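(* Let $N\ge1$ be an integer and let $\theta=\arg\nu$. (i) Suppose $|\theta|<\frac{\pi}{2}$. Put $c(\theta)=|\csc(2\theta)|$ if $\frac{\pi}{4}<|\theta|<\frac{\pi}{2}$ and $c(\theta)=1$ if $|\theta|\le\frac{\pi}{4}$; put $c_0(\theta)=|\csc(2\theta)|$ if $\frac{\pi}{4}<|\theta|<\frac{\pi}{2}$ and $c_0(\theta)=0$ if $|\theta|\le\frac{\pi}{4}$. Then $$\left|R_N^{(J')}(\nu)\right|\le\frac{d_N(\nu)+d_{N+1}(\nu)}{2\sqrt3\pi}c(\theta)\ \text{ if }N\equiv0\bmod3;\qquad\left|R_N^{(J')}(\nu)\right|\le\frac{d_N(\nu)}{2\sqrt3\pi}c(\theta)+\frac{d_{N+2}(\nu)}{2\sqrt3\pi}c_0(\theta)\ \text{ if }N\equiv1\bmod3;$$ $$\left|R_N^{(J')}(\nu)\right|\le\frac{d_{N+1}(\nu)+d_{N+2}(\nu)}{2\sqrt3\pi}c(\theta)\ \text{ if }N\equiv2\bmod3.$$ (ii) Suppose $\nu>0$. Then there are numbers $0<\Theta_1,\Theta_2,\Theta_3<1$ depending on $\nu$ and $N$ such that $$(-1)^{N+1}R_N^{(J')}(\nu)=\frac{d_N(\nu)}{2\sqrt3\pi}\Theta_1+\frac{d_{N+1}(\nu)}{2\sqrt3\pi}\Theta_2\ \text{ if }N\equiv0\bmod3;\qquad(-1)^NR_N^{(J')}(\nu)=\frac{d_N(\nu)}{2\sqrt3\pi}\Theta_1-\frac{d_{N+2}(\nu)}{2\sqrt3\pi}\Theta_3\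 \text{ if }N\equiv1\bmod3;$$ $$(-1)^NR_N^{(J')}(\nu)=\frac{d_{N+1}(\nu)}{2\sqrt3\pi}\Theta_2+\frac{d_{N+2}(\nu)}{2\sqrt3\pi}\Theta_3\ \text{ if }N\equiv2\bmod3.$$ (iii) Suppose $\frac{\pi}{4}<|\theta|<\pi$. Let $\varphi^\ast,\varphi^{\ast\ast},\varphi^{\ast\ast\ast}$ be the unique solutions in the interval $I_\theta$ of $$(2N+8)\cos(3\varphi^\ast-2\theta)=(2N-4)\cos(\varphi^\ast-2\theta),$$ $$(2N+10)\cos(3\varphi^{\ast\ast}-2\theta)=(2N-2)\cos(\varphi^{\ast\ast}-2\theta),$$ $$(2N+12)\cos(3\varphi^{\ast\ast\ast}-2\theta)=2N\cos(\varphi^{\ast\ast\ast}-2\theta).$$ Put $$E_1=\frac{|\csc(2(\theta-\varphi^\ast))|}{\cos^{\frac{2N+2}{3}}\varphi^\ast}\frac{d_N(\nu)}{2\sqrt3\pi},\quad E_2=\frac{|\csc(2(\theta-\varphi^{\ast\ast}))|}{\cos^{\frac{2N+4}{3}}\varphi^{\ast\ast}}\frac{d_{N+1}(\nu)}{2\sqrt3\pi},\quad E_3=\frac{|\csc(2(\theta-\varphi^{\ast\ast\ast}))|}{\cos^{\frac{2N+6}{3}}\varphi^{\ast\ast\ast}}\frac{d_{N+2}(\nu)}{2\sqrt3\pi}.$$ Then $|R_N^{(J')}(\nu)|\le E_1+E_2$ if $N\equiv0\bmod3$; $|R_N^{(J')}(\nu)|\le E_1+E_3$ if $N\equiv1\bmod3$;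 and $|R_N^{(J')}(\nu)|\le E_2+E_3$ if $N\equiv2\bmod3$. (iv) Suppose $\frac{\pi}{4}<|\theta|\le\frac{\pi}{2}$ and $N\ge4$. Put $$F_1=\frac12\sqrt{\tfrac e3\left(2N+\tfrac{13}2\right)}\frac{d_N(\nu)}{2\sqrt3\pi},\quad F_2=\frac12\sqrt{\tfrac e3\left(2N+\tfrac{17}2\right)}\frac{d_{N+1}(\nu)}{2\sqrt3\pi},\quad F_3=\frac12\sqrt{\tfrac e3\left(2N+\tfrac{21}2\right)}\frac{d_{N+2}(\nu)}{2\sqrt3\pi}.$$ Then $|R_N^{(J')}(\nu)|\le F_1+F_2$ if $N\equiv0\bmod3$; $|R_N^{(J')}(\nu)|\le F_1+F_3$ if $N\equiv1\bmod3$; and $|R_N^{(J')}(\nu)|\le F_2+F_3$ if $N\equiv2\bmod3$.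
   Context: $\nu\ne0$ is a complex number with $|\arg\nu|<\pi$, powers $\nu^{k/3}$ being principal. $J_\nu'(\nu)$ is the derivative of the Bessel function $J_\nu(z)$ with respect to $z$ evaluated at $z=\nu$. The remainder $R_N^{(J')}(\nu)$ is defined by $$J'_\nu(\nu)=\frac{1}{3\pi}\sum_{n=0}^{N-1}6^{\frac{2n+2}{3}}D_{2n+1}(0)\sin\left(\frac{(2n+2)\pi}{3}\right)\frac{\Gamma\left(\frac{2n+2}{3}\right)}{\nu^{\frac{2n+2}{3}}}+R_N^{(J')}(\nu),$$ where $D_n(0)=\frac{1}{n!}\left[\frac{d^n}{dt^n}\left(\sinh t\left(\frac16\frac{t^3}{\sinh t-t}\right)^{\frac{n+1}{3}}\right)\right]_{t=0}$ (branch of the power equal to $1$ at $t=0$). Notation: $$d_n(\nu)=6^{\frac{2n+2}{3}}|D_{2n+1}(0)|\frac{\Gamma\left(\frac{2n+2}{3}\right)}{|\nu|^{\frac{2n+2}{3}}}.$$ The interval $I_\theta$ is: $\left(-\frac{\pi}{2}+\theta,\frac{\pi}{2}\right)$ if $\frac{3\pi}{4}\le\theta<\pi$; $\left(-\frac{\pi}{2}+\theta,-\frac{\pi}{4}+\theta\right)$ if $\frac{\pi}{2}\le\theta<\frac{3\pi}{4}$; $\left(0,-\frac{\pi}{4}+\theta\right)$ if $\frac{\pi}{4}<\theta<\frac{\pi}{2}$; $\left(-\frac{\pi}{2},\frac{\pi}{2}+\theta\right)$ if $-\pi<\theta\le-\frac{3\pi}{4}$; $\left(\frac{\pi}{4}+\theta,\frac{\pi}{2}+\theta\right)$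 if $-\frac{3\pi}{4}<\theta\le-\frac{\pi}{2}$; $\left(\frac{\pi}{4}+\theta,0\right)$ if $-\frac{\pi}{2}<\theta<-\frac{\pi}{4}$. *)

theory Defs
  imports "HOL-Analysis.Analysis"
begin

(* The library's powr on complex is the principal power; rGamma = 1/Gamma is entire, so the
   ascending series needs no case distinction for integer orders. *)
definition besselJ :: "complex \<Rightarrow> complex \<Rightarrow> complex" where
  "besselJ \<nu> z =
     (z / 2) powr \<nu> * (\<Sum>k. (-1) ^ k * (z / 2) ^ (2 * k) / fact k * rGamma (\<nu> + of_nat k + 1))"

definition besselJ' :: "complex \<Rightarrow> complex \<Rightarrow> complex" where
  "besselJ' \<nu> z = deriv (\<lambda>w. besselJ \<nu> w) z"

(* t^3 / (6 (sinh t - t)), with its removable singularity at 0 filled in; close to t = 0 it is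
   close to 1, so there the principal power is the branch with value 1 at t = 0. *)
definition cubic_ratio :: "complex \<Rightarrow> complex" where
  "cubic_ratio t = (if t = 0 then 1 else 1 / 6 * (t ^ 3 / (sinh t - t)))"

definition D0 :: "nat \<Rightarrow> complex" where
  "D0 n = (deriv ^^ n) (\<lambda>t. sinh t * cubic_ratio t powr ((of_nat n + 1) / 3)) 0 / fact n"

definition R_J' :: "nat \<Rightarrow> complex \<Rightarrow> complex" where
  "R_J' N \<nu> = besselJ' \<nu> \<nu> -
     1 / (3 * of_real pi) *
       (\<Sum>n<N. of_real (6 powr ((2 * real n + 2) / 3)) * D0 (2 * n + 1)
              * of_real (sin ((2 * real n + 2) * pi / 3))
              * (of_real (Gamma ((2 * real n + 2) / 3)) / \<nu> powr of_real ((2 * real n + 2) / 3)))"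

definition d :: "nat \<Rightarrow> complex \<Rightarrow> real" where
  "d n \<nu> = 6 powr ((2 * real n + 2) / 3) * norm (D0 (2 * n + 1))
            * (Gamma ((2 * real n + 2) / 3) / norm \<nu> powr ((2 * real n + 2) / 3))"

definition csc :: "real \<Rightarrow> real" where
  "csc x = 1 / sin x"

(* Only used for pi/4 < |\<theta>| < pi; empty otherwise. *)
definition I_angle :: "real \<Rightarrow> real set" where
  "I_angle \<theta> =
    (if 3 * pi / 4 \<le> \<theta> \<and> \<theta> < pi then {- pi / 2 + \<theta> <..< pi / 2}
     else if pi / 2 \<le> \<theta> \<and> \<theta> < 3 * pi / 4 then {- pi / 2 + \<theta> <..< - pi / 4 + \<theta>}
     else if pi / 4 < \<theta> \<and> \<theta> < pi / 2 then {0 <..< - pi / 4 + \<theta>}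
     else if - pi < \<theta> \<and> \<theta> \<le> - (3 * pi / 4) then {- pi / 2 <..< pi / 2 + \<theta>}
     else if - (3 * pi / 4) < \<theta> \<and> \<theta> \<le> - pi / 2 then {pi / 4 + \<theta> <..< pi / 2 + \<theta>}
     else if - pi / 2 < \<theta> \<and> \<theta> < - pi / 4 then {pi / 4 + \<theta> <..< 0}
     else {})"

end

(* Put w^3 = sinh t - t, with the branch of w that is positive for t > 0.  By Lagrange inversion
   3 sinh t / (cosh t - 1) is an odd series in w whose coefficients are
   q_n = 6^((2n+2)/3) D_{2n+1}(0).  The integrand sinh t / w^(2n+2) of the coefficient q_n has a
   primitive that is real on the positive axis and has imaginary part pi q_n / 2 on the imaginary
   axis.  Following this primitive along the curve from 2 pi i to infinity on which w = i/p with
   0 < p <= 1, where the imaginary part of the integrand has a constant sign, shows that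
   (-1)^(n-1) q_n (n >= 1) is 2/pi times the (2n-2)nd moment of a positive measure M on (0,1].  Hence
     3 sinh t / (cosh t - 1) = q_0 / w + (2/pi) w S(w^2),  S(x) = integral of 1/(1 + p^2 x) dM(p).
   On the path of steepest descent of Schlaefli's integral, w = u^(1/3) e^(i pi/3), so that J'_nu(nu)
   is the Laplace transform in u of a function expressed by S.  Expanding 1/(1 + p^2 w^2)
   geometrically and taking imaginary parts writes R_N, up to sign, as a sum or difference of two of
   the tails T_N, T_{N+1}, T_{N+2}, where T_n is the integral of
   p^(2n-2) v^((2n+2)/3 - 1) e^(-nu v) / (1 + (p^3 v)^2) over v > 0 and M, times a constant; by
   analytic continuation this holds off the cut.  For nu > 0 the tails lie strictly between 0 and
   d_n / (2 sqrt 3 pi); in general, rotating the ray of integration to the angle phi - theta gives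
   |T_n| <= |csc(2(theta - phi))| cos(phi)^(-(2n+2)/3) d_n / (2 sqrt 3 pi), and the angle in (iii) is the
   stationary point of this bound in phi. *)
theory Submission
  imports Defs "HOL-Complex_Analysis.Complex_Analysis" "HOL-Real_Asymp.Real_Asymp"
begin

subsection \<open>Preliminaries\<close>

text \<open>The branch of w is the main obstacle. Far out to the right, sinh t - t winds once around
  0 as Im t grows from 0 to 2*pi, so principal roots jump. Hence w is the exponential of a logarithm
  chosen on a whole strip around the real axis; the strip reaches past 2*pi*i, the nearest nonzero
  critical point of sinh t - t, but contains no zero of it other than 0. The argument of w on each
  curve is then found by continuity, between barrier values that sign conditions on sinh t - t
  exclude. Integrals over infinite contours are never formed: each is a limit of differences of a
  primitive, which turns them into applications of the fundamental theorem of calculus on the real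
  line. Schlaefli's integral is matched with the ascending series through Hankel's integral for
  1/Gamma, and only for 0 < \<nu> < 1, where Hankel's contour can be collapsed onto its two edges;
  as J'_nu(nu) and the tails are holomorphic off the cut, that interval is enough. The measure lives
  on (0,1] because |w| \<ge> 1 along the curve starting at 2*pi*i.\<close>

lemma holomorphic_on_integral:
  fixes f :: "complex \<Rightarrow> 'a \<Rightarrow> complex"
  assumes "open S"
    and meas: "\<And>z. z \<in> S \<Longrightarrow> f z \<in> borel_measurable M"
    and hol: "AE x in M. (\<lambda>z. f z x) holomorphic_on S"
    and bound: "\<And>z0. z0 \<in> S \<Longrightarrow> \<exists>r>0. \<exists>B. integrable M B \<and>
       (AE x in M. \<forall>z\<in>ball z0 r \<inter> S. norm (f z x) \<le> B x)"
  shows "(\<lambda>z. \<integral>x. f z x \<partial>M) holomorphic_on S"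
proof (rule holomorphic_onI)
  fix z0 assume z0: "z0 \<in> S"
  obtain r1 B where r1: "r1 > 0" and B: "integrable M B"
    and AEB: "AE x in M. \<forall>z\<in>ball z0 r1 \<inter> S. norm (f z x) \<le> B x"
    using bound[OF z0] by blast
  obtain r2 where r2: "r2 > 0" "ball z0 r2 \<subseteq> S"
    using \<open>open S\<close> z0 open_contains_ball by blast
  define r where "r = min r1 r2 / 2"
  have r: "r > 0" "ball z0 (2 * r) \<subseteq> S" "ball z0 (2 * r) \<subseteq> ball z0 r1"
    using r1 r2 by (auto simp: r_def)
  define q where "q = (\<lambda>z x. (f z x - f z0 x) / (z - z0))"
  have AEq: "AE x in M. (\<forall>z\<in>ball z0 r - {z0}. norm (q z x) \<le> B x / r)
       \<and> ((\<lambda>z. q z x) \<longlongrightarrow> deriv (\<lambda>z. f z x) z0) (at z0)"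
    using hol AEB
  proof eventually_elim
    case (elim x)
    note h = elim(1) and b = elim(2)
    have db: "norm (deriv (\<lambda>z. f z x) z) \<le> B x / r" if z: "z \<in> ball z0 r" for z
    proof -
      have sub: "ball z r \<subseteq> ball z0 (2*r)"
        using z by (intro subsetI) (auto simp: dist_norm norm_minus_commute,
          smt (verit) norm_triangle_sub norm_minus_commute diff_add_cancel norm_triangle_ineq add_diff_eq)
      have "norm ((deriv ^^ 1) (\<lambda>z. f z x) z) \<le> fact 1 * B x / r ^ 1 + 0"
      proof -
        \<comment> \<open>The domination holds on an open ball only, so Cauchy's inequality is
          applied on circles of radius s < r, followed by s -> r. It converts the bound on f into
          one on the derivative and thereby on the difference quotients.\<close>
        have "norm (deriv (\<lambda>z. f z x) z) \<le> B x / s" if s: "0 < s" "s < r" for s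
        proof -
          have cb: "cball z s \<subseteq> ball z r" using s by auto
          have hb: "(\<lambda>z. f z x) holomorphic_on cball z s"
            using h cb sub r by (meson holomorphic_on_subset subset_trans)
          have "norm ((deriv ^^ 1) (\<lambda>z. f z x) z) \<le> fact 1 * B x / s ^ 1"
          proof (rule Cauchy_inequality)
            show "(\<lambda>z. f z x) holomorphic_on ball z s"
              using hb holomorphic_on_subset ball_subset_cball by blast
            show "continuous_on (cball z s) (\<lambda>z. f z x)"
              using hb by (rule holomorphic_on_imp_continuous_on)
            fix y assume "norm (z - y) = s"
            then have "y \<in> cball z s" by (simp add: dist_norm)
            then have "y \<in> ball z0 r1 \<inter> S" using cb sub r by blast
            then show "norm (f y x) \<le> B x" using b by blast
          qed (use s in auto)
          then show ?thesis by simp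
        qed
        then have "eventually (\<lambda>s. norm (deriv (\<lambda>z. f z x) z) \<le> B x / s) (at_left r)"
          using r by (auto simp: eventually_at_left_field intro!: exI[of _ 0])
        moreover have "((\<lambda>s. B x / s) \<longlongrightarrow> B x / r) (at_left r)"
          using r by (auto intro!: tendsto_intros)
        ultimately have "norm (deriv (\<lambda>z. f z x) z) \<le> B x / r"
          by (intro tendsto_lowerbound[of _ _ "at_left r"]) auto
        then show ?thesis by simp
      qed
      then show ?thesis by simp
    qed
    have fd: "((\<lambda>z. f z x) has_field_derivative deriv (\<lambda>z. f z x) z) (at z)" if "z \<in> ball z0 r" for z
      using h \<open>open S\<close> r that
      by (intro holomorphic_derivI[of _ S]) (auto simp: subset_iff)
    have "norm (q z x) \<le> B x / r" if z: "z \<in> ball z0 r" "z \<noteq> z0" for z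
    proof -
      have "norm (f z x - f z0 x) \<le> B x / r * norm (z - z0)"
      proof (rule field_differentiable_bound[of "ball z0 r" _ "deriv (\<lambda>z. f z x)"])
        show "((\<lambda>z. f z x) has_field_derivative deriv (\<lambda>z. f z x) y) (at y within ball z0 r)"
          if "y \<in> ball z0 r" for y
          using fd[OF that] has_field_derivative_at_within by blast
      qed (use db z r in auto)
      then show ?thesis using z by (simp add: q_def norm_divide field_simps)
    qed
    moreover have "((\<lambda>z. q z x) \<longlongrightarrow> deriv (\<lambda>z. f z x) z0) (at z0)"
      using fd[of z0] r by (simp add: q_def has_field_derivative_iff)
    ultimately show ?case by auto
  qed
  \<comment> \<open>A limit along one fixed sequence is measurable in x by construction; it equals
    the derivative at z0 almost everywhere.\<close>
  define D where "D = (\<lambda>x. lim (\<lambda>n. q (z0 + of_real (r / (real n + 2))) x))"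
  have sq: "z0 + of_real (r / (real n + 2)) \<in> ball z0 r - {z0}" for n
  proof -
    have "z0 + of_real (r / (real n + 2)) \<noteq> z0"
      using r by (simp del: of_real_divide add: of_real_eq_0_iff)
    moreover have "dist z0 (z0 + of_real (r / (real n + 2))) = r / (real n + 2)"
      unfolding dist_norm using r by (simp add: norm_divide del: of_real_divide)
    moreover have "r / (real n + 2) < r" using r by (simp add: field_simps add_pos_nonneg)
    ultimately show ?thesis by simp
  qed
  have sqS: "z \<in> ball z0 r - {z0} \<Longrightarrow> z \<in> S" for z
    using r by (auto simp: subset_iff)
  have qm: "q z \<in> borel_measurable M" if "z \<in> ball z0 r - {z0}" for z
    unfolding q_def using meas[OF sqS[OF that]] meas[OF z0] by measurable
  have Dm: "D \<in> borel_measurable M"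
    unfolding D_def using qm[OF sq] by measurable
  have sqlim: "filterlim (\<lambda>n. z0 + of_real (r / (real n + 2))) (at z0) sequentially"
  proof -
    have "(\<lambda>n. z0 + of_real (r / (real n + 2))) \<longlonglongrightarrow> z0 + of_real 0"
      by (intro tendsto_intros) real_asymp
    then show ?thesis using sq by (auto simp: filterlim_at)
  qed
  have AED: "AE x in M. D x = deriv (\<lambda>z. f z x) z0"
    using AEq
  proof eventually_elim
    case (elim x)
    have "(\<lambda>n. q (z0 + of_real (r / (real n + 2))) x) \<longlonglongrightarrow> deriv (\<lambda>z. f z x) z0"
      using filterlim_compose[OF conjunct2[OF elim] sqlim] by simp
    then show ?case by (simp add: D_def limI)
  qed
  have int: "integrable M (f z)" if z: "z \<in> ball z0 r" for z
  proof (rule Bochner_Integration.integrable_bound[OF B])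
    have zS: "z \<in> ball z0 r1 \<inter> S" using z r by (auto simp: subset_iff)
    then show "f z \<in> borel_measurable M" using meas by auto
    show "AE x in M. norm (f z x) \<le> norm (B x)"
      using AEB by eventually_elim (use zS in force)
  qed
  have "((\<lambda>z. ((\<integral>x. f z x \<partial>M) - (\<integral>x. f z0 x \<partial>M)) / (z - z0)) \<longlongrightarrow> (\<integral>x. D x \<partial>M)) (at z0)"
  proof (subst tendsto_at_iff_sequentially, intro allI impI)
    fix X :: "nat \<Rightarrow> complex" assume X: "\<forall>i. X i \<in> UNIV - {z0}" and Xl: "X \<longlonglongrightarrow> z0"
    have Xat: "filterlim X (at z0) sequentially" using X Xl by (auto simp: filterlim_at)
    obtain n0 where n0: "\<And>n. n \<ge> n0 \<Longrightarrow> X n \<in> ball z0 r"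
      using metric_LIMSEQ_D[OF Xl r(1)] by (auto simp: dist_commute)
    have "(\<lambda>n. \<integral>x. q (X (n + n0)) x \<partial>M) \<longlonglongrightarrow> (\<integral>x. D x \<partial>M)"
    proof (rule integral_dominated_convergence[where w = "\<lambda>x. B x / r"])
      show "q (X (n + n0)) \<in> borel_measurable M" for n
        using n0[of "n + n0"] X by (intro qm) auto
      show "AE x in M. (\<lambda>n. q (X (n + n0)) x) \<longlonglongrightarrow> D x"
        using AEq AED
      proof eventually_elim
        case (elim x)
        have "(\<lambda>n. q (X n) x) \<longlonglongrightarrow> deriv (\<lambda>z. f z x) z0"
          using filterlim_compose[OF conjunct2[OF elim(1)] Xat] by simp
        from LIMSEQ_ignore_initial_segment[OF this, of n0] show ?case using elim(2) by simp
      qed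
      show "AE x in M. norm (q (X (n + n0)) x) \<le> B x / r" for n
        using AEq by eventually_elim (use n0[of "n + n0"] X in auto)
    qed (use Dm B in auto)
    moreover have "(\<integral>x. q (X (n + n0)) x \<partial>M) =
        ((\<integral>x. f (X (n + n0)) x \<partial>M) - (\<integral>x. f z0 x \<partial>M)) / (X (n + n0) - z0)" for n
      unfolding q_def using int[OF n0[of "n + n0"]] int[of z0] r
      by (simp add: Bochner_Integration.integral_diff)
    ultimately have "(\<lambda>n. ((\<integral>x. f (X (n + n0)) x \<partial>M) - (\<integral>x. f z0 x \<partial>M)) / (X (n + n0) - z0))
        \<longlonglongrightarrow> (\<integral>x. D x \<partial>M)" by simp
    then show "((\<lambda>z. ((\<integral>x. f z x \<partial>M) - (\<integral>x. f z0 x \<partial>M)) / (z - z0)) \<circ> X) \<longlonglongrightarrow> (\<integral>x. D x \<partial>M)"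
      by (simp add: o_def LIMSEQ_offset)
  qed
  then have "((\<lambda>z. \<integral>x. f z x \<partial>M) has_field_derivative (\<integral>x. D x \<partial>M)) (at z0)"
    by (simp add: has_field_derivative_iff)
  then show "(\<lambda>z. \<integral>x. f z x \<partial>M) field_differentiable at z0 within S"
    using field_differentiable_def has_field_derivative_at_within by blast
qed

text \<open>This is how branches are pinned down below: an angle that varies continuously and never
  takes either of two critical values stays between them once it starts there.\<close>

lemma connected_between:
  fixes f :: "'a::topological_space \<Rightarrow> real"
  assumes "connected S" "continuous_on S f" "s0 \<in> S" "p < f s0" "f s0 < q"
    and "\<And>s. s \<in> S \<Longrightarrow> f s \<noteq> p \<and> f s \<noteq> q" and "s \<in> S"
  shows "p < f s \<and> f s < q"
proof -
  have c: "connected (f ` S)" by (rule connected_continuous_image[OF assms(2,1)])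
  have "\<not> f s \<le> p"
    using connectedD_interval[OF c, of "f s" "f s0" p] assms by (metis image_iff less_imp_le)
  moreover have "\<not> q \<le> f s"
    using connectedD_interval[OF c, of "f s0" "f s" q] assms by (metis image_iff less_imp_le)
  ultimately show ?thesis by simp
qed

text \<open>Each step divides out one more factor t and fills in the removable singularity, so the
  factor h is holomorphic on all of S and not merely on a disc where the Taylor series
  converges.\<close>

lemma holomorphic_taylor_factor:
  assumes "f holomorphic_on S" "open S" "0 \<in> S"
  shows "\<exists>h. h holomorphic_on S \<and>
     (\<forall>t\<in>S. f t = (\<Sum>k<n. (deriv ^^ k) f 0 / fact k * t ^ k) + t ^ n * h t) \<and>
     h 0 = (deriv ^^ n) f 0 / fact n"
proof (induction n)
  case 0
  show ?case using assms by (intro exI[of _ f]) auto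
next
  case (Suc n)
  then obtain h where h: "h holomorphic_on S"
    "\<And>t. t \<in> S \<Longrightarrow> f t = (\<Sum>k<n. (deriv ^^ k) f 0 / fact k * t ^ k) + t ^ n * h t"
    "h 0 = (deriv ^^ n) f 0 / fact n" by blast
  define h1 where "h1 = (\<lambda>z. if z = 0 then deriv h 0 else (h z - h 0) / (z - 0))"
  have h1: "h1 holomorphic_on S"
    unfolding h1_def by (rule pole_lemma_open[OF h(1) assms(2)])
  have hh: "h t = h 0 + t * h1 t" for t by (simp add: h1_def)
  have eq: "f t = (\<Sum>k<Suc n. (deriv ^^ k) f 0 / fact k * t ^ k) + t ^ Suc n * h1 t" if "t \<in> S" for t
    unfolding sum.lessThan_Suc h(2)[OF that] hh[of t] h(3) by (simp add: algebra_simps)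
  have an: "f analytic_on {0}" "h1 analytic_on {0}"
    using assms h1 by (auto simp: analytic_at)
  \<comment> \<open>The value \<open>h1 0\<close> is identified by comparing coefficients of order n
    + 1 in two power series expansions of f at 0.\<close>
  define F where "F = fps_expansion f 0"
  define H where "H = fps_expansion h1 0"
  have F: "f has_fps_expansion F" and H: "h1 has_fps_expansion H"
    unfolding F_def H_def using an by (auto intro: analytic_at_imp_has_fps_expansion_0)
  have "(\<lambda>t. (\<Sum>k<Suc n. (deriv ^^ k) f 0 / fact k * t ^ k) + t ^ Suc n * h1 t) has_fps_expansion
      (\<Sum>k<Suc n. fps_const ((deriv ^^ k) f 0 / fact k) * fps_X ^ k) + fps_X ^ Suc n * H"
    by (intro fps_expansion_intros H)
  moreover have "eventually (\<lambda>t. (\<Sum>k<Suc n. (deriv ^^ k) f 0 / fact k * t ^ k) + t ^ Suc n * h1 t = f t) (nhds 0)"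
    using eventually_nhds_in_open[OF assms(2,3)] by eventually_elim (metis eq)
  ultimately have "f has_fps_expansion
      (\<Sum>k<Suc n. fps_const ((deriv ^^ k) f 0 / fact k) * fps_X ^ k) + fps_X ^ Suc n * H"
    by (subst (asm) has_fps_expansion_cong) auto
  then have "F = (\<Sum>k<Suc n. fps_const ((deriv ^^ k) f 0 / fact k) * fps_X ^ k) + fps_X ^ Suc n * H"
    using F fps_expansion_unique_complex by blast
  then have "fps_nth F (Suc n) = h1 0"
    using has_fps_expansion_imp_0_eq_fps_nth_0[OF H]
    by (simp add: fps_sum_nth fps_X_power_mult_nth del: power_Suc sum.lessThan_Suc)
  moreover have "fps_nth F (Suc n) = (deriv ^^ Suc n) f 0 / fact (Suc n)"
    by (simp add: F_def fps_expansion_def)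
  ultimately have "h1 0 = (deriv ^^ Suc n) f 0 / fact (Suc n)" by simp
  with h1 eq show ?case by (intro exI[of _ h1]) blast
qed

lemma imaginary_power_even: "(\<i> * complex_of_real x) ^ (2 * j) = of_real ((- (x\<^sup>2)) ^ j)"
proof -
  have "(\<i> * complex_of_real x) ^ 2 = of_real (- (x\<^sup>2))" by (simp add: power_mult_distrib)
  then show ?thesis unfolding power_mult of_real_power by simp
qed

text \<open>Values real on the real axis force real coefficients. On the imaginary axis an even
  power of t is real, so a real coefficient of even order would contribute a real part. Both
  conclusions are read off by dividing f minus its lower Taylor polynomial by t^n and letting t tend
  to 0 along the axis in question.\<close>

lemma taylor_coeff_real_odd:
  assumes f: "f holomorphic_on S" "open S" "0 \<in> S"
    and re: "\<And>x::real. of_real x \<in> S \<Longrightarrow> Im (f (of_real x)) = 0"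
    and im: "\<And>y::real. \<i> * of_real y \<in> S \<Longrightarrow> Re (f (\<i> * of_real y)) = 0"
  shows "Im ((deriv ^^ k) f 0 / fact k) = 0 \<and> (even k \<longrightarrow> (deriv ^^ k) f 0 / fact k = 0)"
proof (induction k rule: less_induct)
  case (less n)
  define c where "c = (\<lambda>k. (deriv ^^ k) f 0 / fact k)"
  have IH: "Im (c k) = 0" "even k \<Longrightarrow> c k = 0" if "k < n" for k
    using less[OF that] by (auto simp: c_def)
  obtain h where h: "h holomorphic_on S"
    "\<And>t. t \<in> S \<Longrightarrow> f t = (\<Sum>k<n. c k * t ^ k) + t ^ n * h t" "h 0 = c n"
    using holomorphic_taylor_factor[OF f, of n] unfolding c_def by blast
  have hc: "isCont h 0"
    using h(1) f(2,3) by (meson continuous_on_eq_continuous_at holomorphic_on_imp_continuous_on)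
  have l1: "((\<lambda>x::real. h (of_real x)) \<longlongrightarrow> h 0) (at 0)"
  proof -
    have "isCont (\<lambda>x::real. h (of_real x)) 0" by (rule isCont_o2[where g = h]) (use hc in auto)
    then show ?thesis by (simp add: isCont_def)
  qed
  have l2: "((\<lambda>x::real. h (\<i> * of_real x)) \<longlongrightarrow> h 0) (at 0)"
  proof -
    have "isCont (\<lambda>x::real. h (\<i> * of_real x)) 0" by (rule isCont_o2[where g = h]) (use hc in auto)
    then show ?thesis by (simp add: isCont_def)
  qed
  have S1: "eventually (\<lambda>x::real. of_real x \<in> S \<and> x \<noteq> 0) (at 0)"
  proof -
    have "((\<lambda>x::real. complex_of_real x) \<longlongrightarrow> of_real 0) (at 0)" by (intro tendsto_intros)
    from topological_tendstoD[OF this f(2)] f(3) show ?thesis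
      by (auto simp: eventually_conj_iff eventually_at_filter)
  qed
  have S2: "eventually (\<lambda>x::real. \<i> * of_real x \<in> S \<and> x \<noteq> 0) (at 0)"
  proof -
    have "((\<lambda>x::real. \<i> * complex_of_real x) \<longlongrightarrow> \<i> * of_real 0) (at 0)" by (intro tendsto_intros)
    from topological_tendstoD[OF this f(2)] f(3) show ?thesis
      by (auto simp: eventually_conj_iff eventually_at_filter)
  qed
  have cr: "c k = of_real (Re (c k))" if "k < n" for k
    using IH(1)[OF that] by (simp add: complex_eq_iff)
  have evI: "eventually (\<lambda>x::real. Im (h (of_real x)) = 0) (at 0)"
    using S1
  proof eventually_elim
    case (elim x)
    have "(\<Sum>k<n. c k * of_real x ^ k) = of_real (\<Sum>k<n. Re (c k) * x ^ k)"
      unfolding of_real_sum of_real_mult of_real_power by (intro sum.cong refl) (metis cr lessThan_iff)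
    with h(2)[of "of_real x"] elim
    have "of_real (x ^ n) * h (of_real x) = f (of_real x) - of_real (\<Sum>k<n. Re (c k) * x ^ k)"
      by (simp add: algebra_simps)
    then have "Im (of_real (x ^ n) * h (of_real x)) = 0" using re[of x] elim by simp
    then show ?case using elim by simp
  qed
  have "Im (h 0) = 0"
    by (rule tendsto_unique[OF trivial_limit_at tendsto_Im[OF l1] tendsto_eventually[OF evI]])
  then have I: "Im (c n) = 0" using h(3) by simp
  moreover have "c n = 0" if ev: "even n"
  proof -
    have evR: "eventually (\<lambda>x::real. Re (h (\<i> * of_real x)) = 0) (at 0)"
      using S2
    proof eventually_elim
      case (elim x)
      have "Re (c k * (\<i> * of_real x) ^ k) = 0" if "k < n" for k
      proof (cases "even k")
        case True then show ?thesis using IH(2)[OF that] by simp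
      next
        case False
        then obtain j where j: "k = 2 * j + 1" by (auto elim: oddE)
        have "(\<i> * of_real x) ^ k = \<i> * of_real ((- (x\<^sup>2)) ^ j * x)"
          unfolding j power_add imaginary_power_even by (simp add: ac_simps)
        then show ?thesis using cr[OF that] by (metis IH(1) Re_i_times Im_complex_of_real mult.left_commute of_real_mult that neg_0_equal_iff_equal)
      qed
      then have "Re (\<Sum>k<n. c k * (\<i> * of_real x) ^ k) = 0" by simp
      with h(2)[of "\<i> * of_real x"] elim im[of x]
      have "Re ((\<i> * of_real x) ^ n * h (\<i> * of_real x)) = 0"
        by simp
      moreover obtain j where j: "n = 2 * j" using ev by auto
      ultimately have "(- (x\<^sup>2)) ^ j * Re (h (\<i> * of_real x)) = 0"
        unfolding j imaginary_power_even by simp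
      then show ?case using elim by simp
    qed
    have "Re (h 0) = 0"
      by (rule tendsto_unique[OF trivial_limit_at tendsto_Re[OF l2] tendsto_eventually[OF evR]])
    then show ?thesis using I h(3) by (simp add: complex_eq_iff)
  qed
  ultimately show ?case unfolding c_def by blast
qed

text \<open>The reciprocal of \<open>cubic_ratio\<close>; unlike that one it is entire, so a
  holomorphic logarithm exists on every convex open set without zeros of it.\<close>

definition cubic_quot :: "complex \<Rightarrow> complex" where
  "cubic_quot t = (if t = 0 then 1 else 6 * (sinh t - t) / t ^ 3)"

lemma cubic_quot_holomorphic: "cubic_quot holomorphic_on S"
proof -
  have ds: "((sinh :: complex \<Rightarrow> complex) has_field_derivative cosh z) (at z)"
       "((cosh :: complex \<Rightarrow> complex) has_field_derivative sinh z) (at z)" for z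
    by (auto intro!: derivative_eq_intros)
  have sh: "(sinh :: complex \<Rightarrow> complex) holomorphic_on UNIV"
    using ds(1) by (meson holomorphic_onI field_differentiable_def has_field_derivative_at_within)
  obtain h where h: "h holomorphic_on UNIV"
    "\<And>t. sinh t = (\<Sum>k<3. (deriv ^^ k) sinh 0 / fact k * t ^ k) + t ^ 3 * h t"
    "h 0 = (deriv ^^ 3) sinh 0 / fact 3"
    using holomorphic_taylor_factor[OF sh, of 3] by blast
  have d: "deriv sinh = (cosh :: complex \<Rightarrow> complex)" "deriv cosh = (sinh :: complex \<Rightarrow> complex)"
    using ds by (auto intro!: ext DERIV_imp_deriv)
  have "(deriv ^^ 3) (sinh :: complex \<Rightarrow> complex) 0 = 1"
    by (simp add: numeral_3_eq_3 d)
  then have h0: "h 0 = 1 / 6" using h(3) by (simp add: fact_numeral)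
  have "sinh t = t + t ^ 3 * h t" for t
    using h(2)[of t] by (simp add: numeral_3_eq_3 d)
  then have "cubic_quot t = 6 * h t" for t
    by (cases "t = 0") (simp_all add: cubic_quot_def h0)
  then have "cubic_quot = (\<lambda>t. 6 * h t)" by auto
  moreover have "(\<lambda>t. 6 * h t) holomorphic_on S"
    by (rule holomorphic_on_mult[OF holomorphic_on_const holomorphic_on_subset[OF h(1) subset_UNIV]])
  ultimately show ?thesis by simp
qed

lemma cubic_quot_eq: "sinh t - t = t ^ 3 * cubic_quot t / 6"
  by (simp add: cubic_quot_def)

lemma Re_sinh: "Re (sinh t) = sinh (Re t) * cos (Im t)"
  and Im_sinh: "Im (sinh t) = cosh (Re t) * sin (Im t)"
  and Re_cosh: "Re (cosh t) = cosh (Re t) * cos (Im t)"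
  and Im_cosh: "Im (cosh t) = sinh (Re t) * sin (Im t)"
  by (simp_all add: sinh_def cosh_def Re_exp Im_exp left_diff_distrib distrib_right right_diff_distrib distrib_left)

subsection \<open>The cube root of \<open>sinh t - t\<close>\<close>

lemma less_sinh_real: "x > 0 \<Longrightarrow> x < sinh (x::real)"
proof -
  assume x: "x > 0"
  have "(\<lambda>x. sinh x - x) 0 < (\<lambda>x. sinh x - x) x"
    by (rule DERIV_pos_imp_increasing_open[OF x])
      (auto intro!: derivative_eq_intros exI continuous_intros simp: less_le cosh_real_ge_1)
  then show ?thesis by simp
qed

lemma sinh_real_cubic_lower: "x \<ge> 0 \<Longrightarrow> x + x ^ 3 / 6 \<le> sinh (x::real)"
proof -
  have c: "1 + x\<^sup>2 / 2 \<le> cosh (x::real)" if x: "x \<ge> 0" for x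
  proof -
    have "(\<lambda>x. cosh x - x\<^sup>2 / 2) 0 \<le> (\<lambda>x. cosh x - x\<^sup>2 / 2) x"
      by (rule DERIV_nonneg_imp_nondecreasing[OF x])
        (auto intro!: derivative_eq_intros exI simp: le_less less_sinh_real)
    then show ?thesis by simp
  qed
  assume x: "x \<ge> 0"
  have "(\<lambda>x. sinh x - x - x ^ 3 / 6) 0 \<le> (\<lambda>x. sinh x - x - x ^ 3 / 6) x"
  proof (rule DERIV_nonneg_imp_nondecreasing[OF x])
    fix y :: real assume "0 \<le> y"
    moreover have "((\<lambda>x. sinh x - x - x ^ 3 / 6) has_real_derivative cosh y - 1 - y\<^sup>2 / 2) (at y)"
      by (auto intro!: derivative_eq_intros)
    ultimately show "\<exists>l. ((\<lambda>x. sinh x - x - x ^ 3 / 6) has_real_derivative l) (at y) \<and> 0 \<le> l"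
      using c[of y] by force
  qed
  then show ?thesis by simp
qed

lemma sinh_less_mult_cosh: "x > 0 \<Longrightarrow> sinh x < x * cosh (x::real)"
proof -
  assume x: "x > 0"
  have "(\<lambda>x. x * cosh x - sinh x) 0 < (\<lambda>x. x * cosh x - sinh x) x"
    by (rule DERIV_pos_imp_increasing_open[OF x])
      (auto intro!: derivative_eq_intros exI continuous_intros)
  then show ?thesis by simp
qed

lemma sin_less_self: "y > 0 \<Longrightarrow> sin y < (y::real)"
proof (cases "y \<le> 1")
  case True
  assume y: "y > 0"
  have "(\<lambda>x. x - sin x) 0 < (\<lambda>x. x - sin x) y"
  proof (rule DERIV_pos_imp_increasing_open[OF y])
    fix x :: real assume x: "0 < x" "x < y"
    then have "cos x < 1" using True cos_monotone_0_pi[of 0 x] pi_gt3 by simp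
    then show "\<exists>l. ((\<lambda>x. x - sin x) has_real_derivative l) (at x) \<and> 0 < l"
      by (auto intro!: derivative_eq_intros exI)
  qed (auto intro!: continuous_intros)
  then show ?thesis by simp
next
  case False then show ?thesis using sin_le_one[of y] by linarith
qed

lemma mult_cos_less_sin: "0 < y \<Longrightarrow> y < pi \<Longrightarrow> y * cos y < sin (y::real)"
proof -
  assume y: "0 < y" "y < pi"
  have "(\<lambda>x. sin x - x * cos x) 0 < (\<lambda>x. sin x - x * cos x) y"
    by (rule DERIV_pos_imp_increasing_open[OF y(1)])
      (use y in \<open>auto intro!: derivative_eq_intros exI continuous_intros sin_gt_zero mult_pos_pos\<close>)
  then show ?thesis by simp
qed

text \<open>For t = x + i y in the half strip: if Re (sinh t - t) \<ge> 0, then Im (sinh t - t) > 0.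
  In particular sinh t - t is never zero or negative imaginary there. The proof multiplies through
  by sinh x and combines sinh x < x cosh x with y cos y < sin y.\<close>

lemma less_cosh_mult_sin:
  assumes "x > 0" "0 < y" "y < pi" "x \<le> sinh x * cos y"
  shows "y < cosh x * sin (y::real)"
proof -
  have s: "sinh x > 0" using assms by simp
  have "y * sinh x \<le> y * (x * cosh x)"
    using assms sinh_less_mult_cosh[of x] by (intro mult_left_mono) auto
  also have "\<dots> \<le> y * ((sinh x * cos y) * cosh x)"
    using assms by (intro mult_left_mono mult_right_mono) auto
  also have "\<dots> = (cosh x * (y * cos y)) * sinh x" by (simp add: ac_simps)
  finally have "y \<le> cosh x * (y * cos y)" using s mult_right_le_imp_le by blast
  also have "\<dots> < cosh x * sin y"
    using mult_cos_less_sin[of y] assms cosh_real_pos by (intro mult_strict_left_mono) auto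
  finally show ?thesis .
qed

text \<open>The half width must exceed 2*pi, since \<open>cut_curve\<close> starts at 2*pi*i, and
  must stay below the next zeros of sinh t - t. With 7*pi/3 one has cos y \<ge> 1/2 for 2*pi < y <
  7*pi/3, which is what rules out zeros in that range.\<close>

definition strip :: "complex set" where
  "strip = {t. \<bar>Im t\<bar> < 7 * pi / 3}"

section \<open>The zeros of sinh t - t in the strip\<close>

lemma open_strip: "open strip" and convex_strip: "convex strip" and zero_in_strip: "0 \<in> strip"
proof -
  have eq: "strip = {t. Im t < 7 * pi / 3} \<inter> {t. Im t > - (7 * pi / 3)}"
    by (auto simp: strip_def)
  show "open strip" unfolding eq by (intro open_Int open_halfspace_Im_lt open_halfspace_Im_gt)
  show "convex strip" unfolding eq by (intro convex_Int convex_halfspace_Im_lt convex_halfspace_Im_gt)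
qed (simp add: strip_def)

lemma sinh_eq_self_strip:
  assumes "x \<ge> 0" "y \<ge> 0" "y < 7 * pi / 3"
    and re: "sinh x * cos y = x" and im: "cosh x * sin y = (y::real)"
  shows "x = 0 \<and> y = 0"
proof -
  have y0: "x = 0" if "y = 0"
    using re that less_sinh_real[of x] assms(1) by (cases "x = 0") auto
  have x0: "y = 0" if "x = 0"
    using im that sin_less_self[of y] assms(2) by (cases "y = 0") auto
  show ?thesis
  proof (rule ccontr)
    assume "\<not> ?thesis"
    then have x: "x > 0" and y: "y > 0" using y0 x0 assms by force+
    have sp: "sin y > 0" using im y cosh_real_pos[of x] by (metis zero_less_mult_pos)
    have cp: "cos y > 0" using re x by (metis sinh_real_pos_iff zero_less_mult_pos)
    \<comment> \<open>Below pi the imaginary part is too large by \<open>less_cosh_mult_sin\<close>;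
      between pi and 2*pi the sine is not positive; beyond 2*pi a numerical estimate is
      needed.\<close>
    consider "y < pi" | "pi \<le> y" "y \<le> 2 * pi" | "2 * pi < y" by linarith
    then show False
    proof cases
      case 1 then show False using less_cosh_mult_sin[OF x y] re im by simp
    next
      case 2
      then have "sin (y - pi) \<ge> 0" by (intro sin_ge_zero) auto
      then show False using sp by simp
    next
      case 3
      \<comment> \<open>Since cos y \<ge> 1/2, sinh x \<le> 2 x, which by the cubic lower bound
        gives x^2 \<le> 6 and (sinh x)^2 \<le> 24. But cosh x \<ge> y > 6 would need (sinh x)^2 >
        35.\<close>
      have "cos y = cos (y - 2 * pi)" by (simp add: cos_diff)
      also have "\<dots> \<ge> cos (pi / 3)" using 3 assms by (intro cos_monotone_0_pi_le) auto
      finally have c: "cos y \<ge> 1 / 2" by (simp add: cos_60)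
      have "x = sinh x * cos y" using re by simp
      also have "\<dots> \<ge> sinh x * (1 / 2)" using x c by (intro mult_left_mono) auto
      finally have s2: "sinh x \<le> 2 * x" by simp
      have "x + x ^ 3 / 6 \<le> 2 * x" using s2 sinh_real_cubic_lower[of x] x by linarith
      then have "x * (x\<^sup>2) \<le> x * 6" by (simp add: power3_eq_cube power2_eq_square)
      then have x6: "x\<^sup>2 \<le> 6" using x by simp
      have "6 < y" using 3 pi_gt3 by linarith
      also have "y = cosh x * sin y" using im by simp
      also have "\<dots> \<le> cosh x * 1" using cosh_real_pos[of x] by (intro mult_left_mono) auto
      finally have "6 < cosh x" by simp
      then have "36 < (cosh x)\<^sup>2" using power_strict_mono[of 6 "cosh x" 2] by simp
      then have "35 < (sinh x)\<^sup>2" by (simp add: cosh_square_eq)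
      also have "(sinh x)\<^sup>2 \<le> (2 * x)\<^sup>2" using s2 x by (intro power_mono) auto
      finally show False using x6 by (simp add: power_mult_distrib)
    qed
  qed
qed

lemma cubic_quot_nonzero: assumes "t \<in> strip" shows "cubic_quot t \<noteq> 0"
proof
  assume "cubic_quot t = 0"
  then have t: "t \<noteq> 0" "sinh t = t" by (auto simp: cubic_quot_def split: if_splits)
  define x y where "x = Re t" and "y = Im t"
  have re: "sinh x * cos y = x" and im: "cosh x * sin y = y"
    using t(2) Re_sinh[of t] Im_sinh[of t] by (simp_all add: x_def y_def)
  have "sinh \<bar>x\<bar> * cos \<bar>y\<bar> = \<bar>x\<bar>" "cosh \<bar>x\<bar> * sin \<bar>y\<bar> = \<bar>y\<bar>"
    using re im by (auto simp: abs_if)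
  from sinh_eq_self_strip[OF _ _ _ this] assms have "x = 0 \<and> y = 0"
    by (simp add: strip_def y_def)
  then show False using t by (simp add: x_def y_def complex_eq_iff)
qed

text \<open>The principal logarithm of \<open>cubic_quot\<close> does not serve: for large Re t the
  argument of \<open>cubic_quot t\<close> passes pi as Im t grows. On the connected strip the value
  0 at t = 0 determines the branch.\<close>

definition log_quot :: "complex \<Rightarrow> complex" where
  "log_quot = (SOME g. g holomorphic_on strip \<and> (\<forall>t\<in>strip. exp (g t) = cubic_quot t) \<and> g 0 = 0)"

lemma log_quot:
  shows log_quot_holomorphic: "log_quot holomorphic_on strip"
    and exp_log_quot: "t \<in> strip \<Longrightarrow> exp (log_quot t) = cubic_quot t"
    and log_quot_0: "log_quot 0 = 0"
proof -
  obtain g where g: "g holomorphic_on strip" "\<forall>t\<in>strip. exp (g t) = cubic_quot t"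
    using holomorphic_logarithm_exists[OF convex_strip open_strip cubic_quot_holomorphic _ zero_in_strip]
      cubic_quot_nonzero by metis
  have "exp (g 0) = 1" using g(2) zero_in_strip by (simp add: cubic_quot_def)
  then have "(\<lambda>t. g t - g 0) holomorphic_on strip \<and> (\<forall>t\<in>strip. exp (g t - g 0) = cubic_quot t) \<and> g 0 - g 0 = 0"
    using g by (auto intro!: holomorphic_intros simp: exp_diff)
  from someI[of "\<lambda>g. g holomorphic_on strip \<and> (\<forall>t\<in>strip. exp (g t) = cubic_quot t) \<and> g 0 = 0", OF this]
  have *: "log_quot holomorphic_on strip \<and> (\<forall>t\<in>strip. exp (log_quot t) = cubic_quot t) \<and> log_quot 0 = 0"
    unfolding log_quot_def .
  show "log_quot holomorphic_on strip" "t \<in> strip \<Longrightarrow> exp (log_quot t) = cubic_quot t" "log_quot 0 = 0"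
    using * by auto
qed

text \<open>Where the exponential is positive, Im g is a multiple of 2*pi; starting from 0 it can
  never cross pi or -pi. This shows that \<open>log_quot\<close> is real on both axes.\<close>

lemma Im_eq_0_if_exp_pos:
  fixes g :: "real \<Rightarrow> complex"
  assumes "connected S" "continuous_on S g" "0 \<in> S" "g 0 = 0"
    and pos: "\<And>x. x \<in> S \<Longrightarrow> \<exists>r>0. exp (g x) = of_real r" and "x \<in> S"
  shows "Im (g x) = 0"
proof -
  have s: "sin (Im (g x)) = 0 \<and> cos (Im (g x)) > 0" if x: "x \<in> S" for x
  proof -
    obtain r where r: "r > 0" "exp (g x) = of_real r" using pos[OF x] by blast
    then have "exp (Re (g x)) * sin (Im (g x)) = 0" "exp (Re (g x)) * cos (Im (g x)) = r"
      using Re_exp[of "g x"] Im_exp[of "g x"] by auto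
    then show ?thesis using r(1) by (auto simp: zero_less_mult_iff)
  qed
  have "-pi < Im (g x) \<and> Im (g x) < pi"
  proof (rule connected_between[OF assms(1) _ assms(3) _ _ _ assms(6)])
    show "continuous_on S (\<lambda>x. Im (g x))" using assms(2) by (intro continuous_intros)
    show "Im (g s) \<noteq> - pi \<and> Im (g s) \<noteq> pi" if "s \<in> S" for s
      using s[OF that] by auto
  qed (use assms in auto)
  moreover have "sin (Im (g x)) = 0" using s assms(6) by blast
  ultimately show ?thesis using sin_eq_0_pi by blast
qed

lemma cubic_quot_real_pos: "\<exists>r>0. cubic_quot (of_real x) = of_real r"
proof (cases "x = 0")
  case False
  have "(sinh x - x) / x ^ 3 > 0"
  proof (cases "x > 0")
    case True then show ?thesis using less_sinh_real by simp
  next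
    case F: False
    have "sinh (-x) > -x" using F False by (intro less_sinh_real) auto
    then show ?thesis using F False by (simp add: divide_neg_neg)
  qed
  moreover have "sinh (complex_of_real x) = of_real (sinh x)"
    by (simp add: complex_eq_iff Re_sinh Im_sinh)
  ultimately show ?thesis using False
    by (intro exI[of _ "6 * ((sinh x - x) / x ^ 3)"] conjI mult_pos_pos) (simp_all add: cubic_quot_def)
qed (auto simp: cubic_quot_def intro: exI[of _ 1])

lemma sinh_ii: "sinh (\<i> * of_real y) = \<i> * of_real (sin y)"
  by (simp add: complex_eq_iff Re_sinh Im_sinh)

lemma cubic_quot_imaginary_pos: "\<exists>r>0. cubic_quot (\<i> * of_real y) = of_real r"
proof (cases "y = 0")
  case False
  have "(y - sin y) / y ^ 3 > 0"
  proof (cases "y > 0")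
    case True then show ?thesis using sin_x_le_x[of y] by (simp add: sin_less_self)
  next
    case F: False
    have "sin (-y) < -y" using F False by (intro sin_less_self) auto
    then show ?thesis using F False by (simp add: divide_neg_neg)
  qed
  then show ?thesis using False
    by (intro exI[of _ "6 * ((y - sin y) / y ^ 3)"] conjI mult_pos_pos)
      (simp_all add: cubic_quot_def sinh_ii power_mult_distrib power3_eq_cube field_simps)
qed (auto simp: cubic_quot_def intro: exI[of _ 1])

lemma isCont_log_quot: "t \<in> strip \<Longrightarrow> isCont log_quot t"
  using log_quot_holomorphic open_strip continuous_on_eq_continuous_at holomorphic_on_imp_continuous_on by blast

lemma Im_log_quot_real: "Im (log_quot (of_real x)) = 0"
proof (rule Im_eq_0_if_exp_pos[of UNIV "\<lambda>x. log_quot (of_real x)"])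
  have "continuous_on UNIV (\<lambda>x::real. complex_of_real x)" by (intro continuous_intros)
  then show "continuous_on UNIV (\<lambda>x::real. log_quot (of_real x))"
    by (rule continuous_on_compose2[OF holomorphic_on_imp_continuous_on[OF log_quot_holomorphic]])
      (auto simp: strip_def)
  show "\<exists>r>0. exp (log_quot (of_real x)) = of_real r" for x
    using cubic_quot_real_pos[of x] exp_log_quot[of "of_real x"] by (auto simp: strip_def)
qed (auto simp: log_quot_0)

lemma Im_log_quot_imaginary: assumes "\<bar>y\<bar> < 7 * pi / 3" shows "Im (log_quot (\<i> * of_real y)) = 0"
proof (rule Im_eq_0_if_exp_pos[of "{- (7 * pi / 3)<..<7 * pi / 3}" "\<lambda>y. log_quot (\<i> * of_real y)"])
  have "continuous_on {- (7 * pi / 3)<..<7 * pi / 3} (\<lambda>y::real. \<i> * complex_of_real y)" by (intro continuous_intros)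
  then show "continuous_on {- (7 * pi / 3)<..<7 * pi / 3} (\<lambda>y::real. log_quot (\<i> * of_real y))"
    by (rule continuous_on_compose2[OF holomorphic_on_imp_continuous_on[OF log_quot_holomorphic]])
      (auto simp: strip_def)
  show "\<exists>r>0. exp (log_quot (\<i> * of_real y)) = of_real r" if "y \<in> {- (7 * pi / 3)<..<7 * pi / 3}" for y
    using cubic_quot_imaginary_pos[of y] exp_log_quot[of "\<i> * of_real y"] that by (auto simp: strip_def)
qed (use assms in \<open>auto simp: log_quot_0\<close>)

text \<open>A logarithm of w. Splitting off \<open>Ln t\<close> confines the cut to the negative
  real axis, where t itself has its cut; the constant comes from sinh t - t = t^3
  \<open>cubic_quot t\<close> / 6.\<close>

definition lam :: "complex \<Rightarrow> complex" where
  "lam t = of_real (- ln 6 / 3) + Ln t + log_quot t / 3"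

definition slit :: "complex set" where "slit = strip - \<real>\<^sub>\<le>\<^sub>0"

lemma DERIV_Im_along_path:
  assumes "(F has_field_derivative D) (at (\<gamma> x))" "(\<gamma> has_vector_derivative \<gamma>') (at x)"
  shows "((\<lambda>x. Im (F (\<gamma> x))) has_real_derivative Im (D * \<gamma>')) (at x)"
proof -
  have "((F \<circ> \<gamma>) has_vector_derivative \<gamma>' * D) (at x)"
    by (rule field_vector_diff_chain_at[OF assms(2,1)])
  from bounded_linear.has_vector_derivative[OF bounded_linear_Im this] show ?thesis
    by (simp add: has_real_derivative_iff_has_vector_derivative o_def mult.commute)
qed

lemma open_slit: "open slit"
  unfolding slit_def by (intro open_Diff open_strip closed_nonpos_Reals_complex)

lemma slitD: "t \<in> slit \<Longrightarrow> t \<in> strip" "t \<in> slit \<Longrightarrow> t \<notin> \<real>\<^sub>\<le>\<^sub>0" "t \<in> slit \<Longrightarrow> t \<noteq> 0"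
  by (auto simp: slit_def)

lemma lam_holomorphic: "lam holomorphic_on slit"
  unfolding lam_def using slitD holomorphic_on_subset[OF log_quot_holomorphic, of slit]
  by (intro holomorphic_intros) auto

lemma isCont_lam: "t \<in> slit \<Longrightarrow> isCont lam t"
  using lam_holomorphic open_slit continuous_on_eq_continuous_at holomorphic_on_imp_continuous_on by blast

lemma exp_3_lam: "t \<in> slit \<Longrightarrow> exp (3 * lam t) = sinh t - t"
proof -
  assume t: "t \<in> slit"
  have "3 * lam t = 3 * Ln t + of_real (- ln 6) + log_quot t"
    by (simp add: lam_def algebra_simps)
  moreover have "exp (3 * Ln t) = t ^ 3"
    using slitD(3)[OF t] exp_of_nat_mult[of 3 "Ln t"] by simp
  moreover have "exp (complex_of_real (- ln 6)) = 1 / 6"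
  proof -
    have "exp (complex_of_real (- ln 6)) = of_real (exp (- ln 6))" by (simp only: exp_of_real)
    also have "exp (- ln 6) = (1 / 6 :: real)" by (simp add: exp_minus)
    finally show ?thesis by simp
  qed
  ultimately show ?thesis
    using exp_log_quot[OF slitD(1)[OF t]] by (simp only: exp_add cubic_quot_eq) simp
qed

text \<open>For c = -(m+1)/3 this extends the function differentiated in \<open>D0 m\<close> to the
  whole strip, with \<open>log_quot\<close> in place of the principal power.\<close>

definition sinh_pow :: "real \<Rightarrow> complex \<Rightarrow> complex" where
  "sinh_pow c t = sinh t * exp (of_real c * log_quot t)"

lemma sinh_pow_holomorphic: "sinh_pow c holomorphic_on strip"
  unfolding sinh_pow_def sinh_field_def by (intro holomorphic_intros log_quot_holomorphic) auto

lemma Im_sinh_pow_real: "Im (sinh_pow c (of_real x)) = 0"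
  by (simp add: sinh_pow_def Im_sinh Re_sinh Im_exp Im_log_quot_real)

lemma Re_sinh_pow_imaginary: "\<bar>y\<bar> < 7 * pi / 3 \<Longrightarrow> Re (sinh_pow c (\<i> * of_real y)) = 0"
  using Im_log_quot_imaginary[of y] by (simp add: sinh_pow_def Im_sinh Re_sinh Im_exp)

text \<open>Exhibits sinh t / w^(m+1) as a function holomorphic near 0 divided by t^(m+1), so that
  its residue at 0 is 6^((m+1)/3) times \<open>D0 m\<close>.\<close>

lemma sinh_mult_exp_lam:
  assumes t: "t \<in> slit"
  shows "sinh t * exp (- of_nat (m + 1) * lam t) =
     of_real (6 powr (real (m + 1) / 3)) * (sinh_pow (- (real (m + 1) / 3)) t / t ^ (m + 1))"
proof -
  have "- of_nat (m + 1) * lam t =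
      of_real (real (m + 1) / 3 * ln 6) + (- (of_nat (m + 1) * Ln t)) + of_real (- (real (m + 1) / 3)) * log_quot t"
    by (simp add: lam_def field_simps)
  moreover have "exp (- (of_nat (m + 1) * Ln t)) = 1 / t ^ (m + 1)"
    using slitD(3)[OF t] exp_of_nat_mult[of "m + 1" "Ln t"] by (simp only: exp_minus) (simp add: divide_inverse)
  ultimately show ?thesis
    unfolding sinh_pow_def by (simp only: exp_add exp_of_real) (simp add: powr_def)
qed

lemma D0_eq: "D0 m = (deriv ^^ m) (sinh_pow (- (real (m + 1) / 3))) 0 / fact m"
proof -
  \<comment> \<open>Near 0 the chosen logarithm has imaginary part below pi in modulus, so there it
    is the principal one and the \<open>powr\<close> in \<open>D0\<close> agrees with the
    exponential of \<open>log_quot\<close>.\<close>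
  have "eventually (\<lambda>t. norm (log_quot t) < 1) (nhds 0)"
  proof -
    have "isCont (\<lambda>t. norm (log_quot t)) 0" by (intro continuous_intros isCont_log_quot zero_in_strip)
    then have "((\<lambda>t. norm (log_quot t)) \<longlongrightarrow> 0) (at 0)" by (simp add: isCont_def log_quot_0)
    from order_tendstoD(2)[OF this, of 1] show ?thesis by (simp add: eventually_nhds_conv_at log_quot_0)
  qed
  then have "eventually (\<lambda>t. sinh t * cubic_ratio t powr ((of_nat m + 1) / 3) =
      sinh_pow (- (real (m + 1) / 3)) t) (nhds 0)"
    using eventually_nhds_in_open[OF open_strip zero_in_strip]
  proof eventually_elim
    case (elim t)
    have "cubic_ratio t = exp (- log_quot t)"
      using exp_log_quot[OF elim(2)] by (simp add: exp_minus cubic_ratio_def cubic_quot_def field_simps)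
    moreover have "Ln (exp (- log_quot t)) = - log_quot t"
      using elim(1) abs_Im_le_cmod[of "log_quot t"] pi_gt3 by (intro Ln_exp) auto
    moreover have "(of_nat m + 1) / 3 * - log_quot t = of_real (- (real (m + 1) / 3)) * log_quot t"
      by (simp add: field_simps)
    ultimately show ?case by (simp add: powr_def sinh_pow_def add.commute)
  qed
  from higher_deriv_cong_ev[OF this refl, of m] show ?thesis
    by (simp add: D0_def)
qed

lemma D0_real: "Im (D0 m) = 0" and D0_even: "even m \<Longrightarrow> D0 m = 0"
  unfolding D0_eq
  using taylor_coeff_real_odd[OF sinh_pow_holomorphic[of "- (real (m + 1) / 3)"] open_strip zero_in_strip, of m]
    Im_sinh_pow_real Re_sinh_pow_imaginary
  by (auto simp: strip_def)

text \<open>\<open>D0\<close> is real, so taking \<open>Re\<close> loses nothing; in contrast to the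
  modulus used in \<open>d\<close> it keeps the sign, which alternates for n \<ge> 1.\<close>

definition q_coeff :: "nat \<Rightarrow> real" where
  "q_coeff n = 6 powr ((2 * real n + 2) / 3) * Re (D0 (2 * n + 1))"

lemma q_coeff_complex: "of_real (q_coeff n) = of_real (6 powr ((2 * real n + 2) / 3)) * D0 (2 * n + 1)"
  using D0_real[of "2 * n + 1"] by (simp add: q_coeff_def complex_eq_iff)

text \<open>Because a has odd coefficients only, a t / t^(2n+2) integrates termwise to even negative
  powers of t, which are real on both axes, to q times \<open>Ln t\<close>, and to a primitive H of
  a holomorphic remainder that is again real on both axes. Between the two axes only the logarithm
  changes its imaginary part, by q*pi/2.\<close>

lemma odd_primitive:
  fixes a :: "complex \<Rightarrow> complex" and n :: nat
  assumes a: "a holomorphic_on strip"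
    and re: "\<And>x::real. Im (a (of_real x)) = 0"
    and im: "\<And>y::real. \<bar>y\<bar> < 7 * pi / 3 \<Longrightarrow> Re (a (\<i> * of_real y)) = 0"
  defines "q \<equiv> (deriv ^^ (2 * n + 1)) a 0 / fact (2 * n + 1)"
  shows "\<exists>\<Psi>. (\<forall>t\<in>slit. (\<Psi> has_field_derivative a t / t ^ (2 * n + 2)) (at t)) \<and>
      (\<forall>x>0. Im (\<Psi> (of_real x)) = 0) \<and> (\<forall>y. 0 < y \<and> y < 7 * pi / 3 \<longrightarrow> Im (\<Psi> (\<i> * of_real y)) = Re q * pi / 2)"
proof -
  define c where "c = (\<lambda>k. (deriv ^^ k) a 0 / fact k)"
  have c: "Im (c k) = 0" "even k \<Longrightarrow> c k = 0" for k
    using taylor_coeff_real_odd[OF a open_strip zero_in_strip re, of k] im by (auto simp: c_def strip_def)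
  obtain h where h: "h holomorphic_on strip"
    "\<And>t. t \<in> strip \<Longrightarrow> a t = (\<Sum>k<2*n+2. c k * t ^ k) + t ^ (2*n+2) * h t"
    using holomorphic_taylor_factor[OF a open_strip zero_in_strip, of "2*n+2"] unfolding c_def by blast
  have cre: "c k = of_real (Re (c k))" for k using c(1)[of k] by (simp add: complex_eq_iff)
  have h_re: "Im (h (of_real x)) = 0" if "x > 0" for x
  proof -
    have "Im (of_real (x ^ (2*n+2)) * h (of_real x)) = Im (a (of_real x)) - Im (of_real (\<Sum>k<2*n+2. Re (c k) * x ^ k))"
      using h(2)[of "of_real x"] cre by (simp add: strip_def)
    then show ?thesis using re[of x] that by (simp del: of_real_sum)
  qed
  have im_sum: "Re (\<Sum>k<2*n+2. c k * (\<i> * of_real y) ^ k) = 0" for y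
  proof -
    have "Re (c k * (\<i> * of_real y) ^ k) = 0" for k
    proof (cases "even k")
      case False
      then obtain j where j: "k = 2 * j + 1" by (auto elim: oddE)
      have "(\<i> * of_real y) ^ k = \<i> * of_real ((- (y\<^sup>2)) ^ j * y)"
        unfolding j power_add imaginary_power_even by (simp add: ac_simps)
      moreover have "c k * (\<i> * of_real r) = \<i> * of_real (Re (c k) * r)" for r by (subst cre) simp
      ultimately show ?thesis by (simp only: Re_i_times Im_complex_of_real)
    qed (use c(2) in simp)
    then show ?thesis unfolding Re_sum by (intro sum.neutral) blast
  qed
  \<comment> \<open>On the imaginary axis t^(2n+2) is real and the odd terms are imaginary, so h is
    imaginary there; integrating along the axis, where dt = i dy, makes H real.\<close>
  have h_im: "Re (h (\<i> * of_real y)) = 0" if "0 < y" "y < 7 * pi / 3" for y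
  proof -
    have "(\<i> * complex_of_real y) ^ (2 * (n + 1)) = of_real ((- (y\<^sup>2)) ^ (n + 1))"
      by (rule imaginary_power_even)
    then have e: "(\<i> * complex_of_real y) ^ (2*n+2) = of_real ((- (y\<^sup>2)) ^ (n + 1))" by (simp add: mult_ac)
    have "Re (of_real ((- (y\<^sup>2)) ^ (n + 1)) * h (\<i> * of_real y)) = 0"
      using h(2)[of "\<i> * of_real y"] im_sum[of y] im[of y] that unfolding e by (simp add: strip_def)
    then show ?thesis using that by simp
  qed
  obtain H0 where H0: "\<And>t. t \<in> strip \<Longrightarrow> (H0 has_field_derivative h t) (at t within strip)"
    using holomorphic_convex_primitive'[OF convex_strip open_strip h(1)] by blast
  define H where "H = (\<lambda>t. H0 t - H0 0)"
  have H: "(H has_field_derivative h t) (at t)" if "t \<in> strip" for t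
    using H0[OF that] at_within_open[OF that open_strip] unfolding H_def
    by (auto intro!: derivative_eq_intros)
  have HR: "Im (H (of_real x)) = 0" if "x > 0" for x
  proof -
    have d: "((\<lambda>x. Im (H (of_real x))) has_real_derivative Im (h (of_real y))) (at y)" for y
    proof -
      have "((\<lambda>x. complex_of_real x) has_vector_derivative 1) (at y)"
        by (auto intro!: derivative_eq_intros)
      from DERIV_Im_along_path[OF H this] show ?thesis by (simp add: strip_def)
    qed
    have "(\<lambda>x. Im (H (of_real x))) x = (\<lambda>x. Im (H (of_real x))) 0"
    proof (rule DERIV_isconst2[OF that])
      show "continuous_on {0..x} (\<lambda>x. Im (H (of_real x)))"
        by (intro continuous_at_imp_continuous_on ballI DERIV_isCont[OF d])
      show "((\<lambda>x. Im (H (of_real x))) has_real_derivative 0) (at y)" if "0 < y" "y < x" for y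
        using d[of y] h_re[OF that(1)] by simp
    qed (use that in auto)
    then show ?thesis by (simp add: H_def)
  qed
  have HI: "Im (H (\<i> * of_real y)) = 0" if "0 < y" "y < 7 * pi / 3" for y
  proof -
    have d: "((\<lambda>x. Im (H (\<i> * of_real x))) has_real_derivative Im (\<i> * h (\<i> * of_real s))) (at s)"
      if "0 \<le> s" "s \<le> y" for s
    proof -
      have "((\<lambda>x. \<i> * of_real x) has_vector_derivative \<i>) (at s)"
        by (auto intro!: derivative_eq_intros)
      from DERIV_Im_along_path[OF H this] show ?thesis
        using that \<open>y < 7 * pi / 3\<close> by (simp add: strip_def mult.commute)
    qed
    have "(\<lambda>x. Im (H (\<i> * of_real x))) y = (\<lambda>x. Im (H (\<i> * of_real x))) 0"
    proof (rule DERIV_isconst2[OF that(1)])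
      show "continuous_on {0..y} (\<lambda>x. Im (H (\<i> * of_real x)))"
        by (intro continuous_at_imp_continuous_on ballI DERIV_isCont[OF d]) auto
      show "((\<lambda>x. Im (H (\<i> * of_real x))) has_real_derivative 0) (at s)" if "0 < s" "s < y" for s
        using d[of s] h_im[OF that(1)] that \<open>y < 7 * pi / 3\<close> by simp
    qed (use that in auto)
    then show ?thesis by (simp add: H_def)
  qed
  define \<Psi> where "\<Psi> = (\<lambda>t. H t + c (2*n+1) * Ln t - (\<Sum>j<n. c (2*j+1) / (2 * of_nat (n - j)) * inverse t ^ (2 * (n - j))))"
  have "(\<Psi> has_field_derivative a t / t ^ (2 * n + 2)) (at t)" if t: "t \<in> slit" for t
  proof -
    have t0: "t \<noteq> 0" "t \<in> strip" "t \<notin> \<real>\<^sub>\<le>\<^sub>0" using slitD t by auto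
    have dj: "((\<lambda>t. c (2*j+1) / (2 * of_nat (n - j)) * inverse t ^ (2 * (n - j))) has_field_derivative
         - (c (2*j+1) * t ^ (2*j+1) / t ^ (2*n+2))) (at t)" if j: "j < n" for j
    proof -
      obtain m where m: "n = j + Suc m" using j less_iff_Suc_add by auto
      have "((\<lambda>t. c (2*j+1) / (2 * of_nat (n - j)) * inverse t ^ (2 * (n - j))) has_field_derivative
         c (2*j+1) / (2 * of_nat (n - j)) * (of_nat (2 * (n - j)) * (- (inverse t * 1 * inverse t)) * inverse t ^ (2 * (n - j) - 1))) (at t)"
        by (rule derivative_eq_intros refl t0 | simp)+
      also have "c (2*j+1) / (2 * of_nat (n - j)) * (of_nat (2 * (n - j)) * (- (inverse t * 1 * inverse t)) * inverse t ^ (2 * (n - j) - 1))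
        = - (c (2*j+1) * (inverse t * inverse t * inverse t ^ (2 * (n - j) - 1)))"
        using j by simp
      also have "inverse t * inverse t * inverse t ^ (2 * (n - j) - 1) = t ^ (2*j+1) / t ^ (2*n+2)"
        using t0(1) by (simp add: m power_add field_simps power2_eq_square power_mult power_inverse)
      finally show ?thesis by (simp only: times_divide_eq_right)
    qed
    have "(\<Psi> has_field_derivative h t + c (2*n+1) * inverse t - (\<Sum>j<n. - (c (2*j+1) * t ^ (2*j+1) / t ^ (2*n+2)))) (at t)"
      unfolding \<Psi>_def
      by (intro DERIV_add DERIV_diff DERIV_sum H t0 DERIV_cmult has_field_derivative_Ln dj) auto
    also have "h t + c (2*n+1) * inverse t - (\<Sum>j<n. - (c (2*j+1) * t ^ (2*j+1) / t ^ (2*n+2)))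
       = ((\<Sum>j<Suc n. c (2*j+1) * t ^ (2*j+1)) + t ^ (2*n+2) * h t) / t ^ (2*n+2)"
      using t0 by (simp add: sum_negf add_divide_distrib sum_divide_distrib inverse_eq_divide)
    also have "(\<Sum>j<Suc n. c (2*j+1) * t ^ (2*j+1)) = (\<Sum>k<2*n+2. c k * t ^ k)"
    proof -
      have "(\<Sum>k<2*m. c k * t ^ k) = (\<Sum>j<m. c (2*j+1) * t ^ (2*j+1))" for m
        by (induction m) (use c(2) in \<open>auto simp: \<close>)
      from this[of "Suc n"] show ?thesis by simp
    qed
    finally show ?thesis using h(2)[OF t0(2)] by simp
  qed
  moreover have "Im (\<Psi> (of_real x)) = 0" if "x > 0" for x
  proof -
    have "(\<Sum>j<n. c (2*j+1) / (2 * of_nat (n - j)) * inverse (of_real x) ^ (2 * (n - j))) =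
      of_real (\<Sum>j<n. Re (c (2*j+1)) / (2 * of_nat (n - j)) * inverse x ^ (2 * (n - j)))"
      using cre by simp
    then show ?thesis using HR[OF that] that c(1)[of "2*n+1"] by (simp add: \<Psi>_def Ln_of_real del: of_real_sum)
  qed
  moreover have "Im (\<Psi> (\<i> * of_real y)) = Re q * pi / 2" if y: "0 < y" "y < 7 * pi / 3" for y
  proof -
    have "inverse (\<i> * complex_of_real y) = \<i> * of_real (- inverse y)"
      by simp
    then have "(\<Sum>j<n. c (2*j+1) / (2 * of_nat (n - j)) * inverse (\<i> * of_real y) ^ (2 * (n - j))) =
      of_real (\<Sum>j<n. Re (c (2*j+1)) / (2 * of_nat (n - j)) * (- ((- inverse y)\<^sup>2)) ^ (n - j))"
      unfolding of_real_sum by (intro sum.cong refl, subst cre, simp only: imaginary_power_even) simp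
    moreover have "Ln (\<i> * of_real y) = of_real (ln y) + \<i> * of_real (pi / 2)"
      using Ln_times_of_real[OF y(1), of \<i>] y(1) by (simp add: mult.commute Ln_of_real)
    moreover have "c (2*n+1) = q" by (simp add: c_def q_def)
    ultimately show ?thesis using HI[OF y] c(1)[of "2*n+1"] by (simp add: \<Psi>_def del: of_real_sum)
  qed
  ultimately show ?thesis by blast
qed

lemma integrand_primitive:
  "\<exists>\<Psi>. (\<forall>t\<in>slit. (\<Psi> has_field_derivative sinh t * exp (- of_nat (2 * n + 2) * lam t)) (at t)) \<and>
      (\<forall>x>0. Im (\<Psi> (of_real x)) = 0) \<and>
      (\<forall>y. 0 < y \<and> y < 7 * pi / 3 \<longrightarrow> Im (\<Psi> (\<i> * of_real y)) = q_coeff n * pi / 2)"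
proof -
  define r where "r = real (2 * n + 1 + 1) / 3"
  from odd_primitive[OF sinh_pow_holomorphic Im_sinh_pow_real Re_sinh_pow_imaginary, of "- r" n]
  obtain \<Psi> where P:
    "\<And>t. t \<in> slit \<Longrightarrow> (\<Psi> has_field_derivative sinh_pow (- r) t / t ^ (2 * n + 2)) (at t)"
    "\<And>x. x > 0 \<Longrightarrow> Im (\<Psi> (of_real x)) = 0"
    "\<And>y. 0 < y \<Longrightarrow> y < 7 * pi / 3 \<Longrightarrow>
       Im (\<Psi> (\<i> * of_real y)) = Re ((deriv ^^ (2 * n + 1)) (sinh_pow (- r)) 0 / fact (2 * n + 1)) * pi / 2"
    by blast
  have D: "(deriv ^^ (2 * n + 1)) (sinh_pow (- r)) 0 / fact (2 * n + 1) = D0 (2 * n + 1)"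
    unfolding D0_eq r_def ..
  have e: "of_real (6 powr r) * (sinh_pow (- r) t / t ^ (2 * n + 2)) = sinh t * exp (- of_nat (2 * n + 2) * lam t)"
    if "t \<in> slit" for t
    using sinh_mult_exp_lam[OF that, of "2 * n + 1"] by (simp add: r_def)
  show ?thesis
  proof (intro exI[of _ "\<lambda>t. of_real (6 powr r) * \<Psi> t"] conjI ballI allI impI)
    fix t assume t: "t \<in> slit"
    show "((\<lambda>t. of_real (6 powr r) * \<Psi> t) has_field_derivative sinh t * exp (- of_nat (2 * n + 2) * lam t)) (at t)"
      using DERIV_cmult[OF P(1)[OF t], of "of_real (6 powr r)"] unfolding e[OF t] .
  next
    fix x :: real assume "x > 0" then show "Im (of_real (6 powr r) * \<Psi> (of_real x)) = 0" using P(2) by simp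
  next
    fix y :: real assume y: "0 < y \<and> y < 7 * pi / 3"
    have "Im (\<Psi> (\<i> * of_real y)) = Re (D0 (2 * n + 1)) * pi / 2" using P(3)[of y] y unfolding D by simp
    then show "Im (of_real (6 powr r) * \<Psi> (\<i> * of_real y)) = q_coeff n * pi / 2"
      by (simp add: q_coeff_def r_def add_ac)
  qed
qed

subsection \<open>The coefficients as moments\<close>

text \<open>The angle in (0, pi/2) with sinh X * cos y = X, the condition Re (sinh t - t) = 0 at t =
  X + i y. It is invariant under y -> 2*pi - y, which moves the point to the branch of the curve
  ending at 2*pi*i.\<close>

definition eta :: "real \<Rightarrow> real" where "eta X = arccos (X / sinh X)"

definition eta' :: "real \<Rightarrow> real" where
  "eta' X = (X * cosh X - sinh X) / ((sinh X)\<^sup>2 * sin (eta X))"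

text \<open>On this curve \<open>sinh t - t\<close> is negative imaginary, so its cube root \<open>exp (lam t)\<close> is positive
  imaginary.\<close>

definition cut_curve :: "real \<Rightarrow> complex" where "cut_curve X = Complex X (2 * pi - eta X)"

text \<open>The negative of Im (sinh t dt) along \<open>cut_curve\<close>. Both summands are
  positive for X > 0; the second arises because \<open>eta\<close> increases.\<close>

definition weight :: "real \<Rightarrow> real" where "weight X = cosh X * sin (eta X) + eta' X * X"

section \<open>The curve on which w is positive imaginary\<close>

lemma eta_props:
  assumes "X > 0"
  shows eta_gt_0: "0 < eta X" and eta_less: "eta X < pi / 2" and sinh_mult_cos_eta: "sinh X * cos (eta X) = X"
    and sin_eta_pos: "sin (eta X) > 0" and eta'_pos: "eta' X > 0"
    and DERIV_eta: "(eta has_real_derivative eta' X) (at X)"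
proof -
  have s: "sinh X > 0" "X < sinh X" using assms less_sinh_real by auto
  have q: "0 < X / sinh X" "X / sinh X < 1" using s assms by auto
  show e0: "0 < eta X" unfolding eta_def using arccos_lt_bounded[of "X / sinh X"] q by auto
  show e1: "eta X < pi / 2" unfolding eta_def using arccos_less_arccos[of 0 "X / sinh X"] q by simp
  have c: "cos (eta X) = X / sinh X" unfolding eta_def using q by (intro cos_arccos) auto
  then show "sinh X * cos (eta X) = X" using s by simp
  show sp: "sin (eta X) > 0" using e0 e1 by (intro sin_gt_zero) auto
  show "eta' X > 0" unfolding eta'_def using s sp sinh_less_mult_cosh[OF assms] by simp
  have sq: "sqrt (1 - (X / sinh X)\<^sup>2) = sin (eta X)"
    unfolding c[symmetric] using sp by (simp add: sin_squared_eq[symmetric])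
  have "((\<lambda>X. X / sinh X) has_real_derivative (1 * sinh X - X * cosh X) / (sinh X * sinh X)) (at X)"
    using s by (auto intro!: derivative_eq_intros)
  from DERIV_chain2[OF DERIV_arccos this] q
  have "((\<lambda>X. arccos (X / sinh X)) has_real_derivative
      inverse (- sqrt (1 - (X / sinh X)\<^sup>2)) * ((1 * sinh X - X * cosh X) / (sinh X * sinh X))) (at X)"
    by auto
  also have "inverse (- sqrt (1 - (X / sinh X)\<^sup>2)) * ((1 * sinh X - X * cosh X) / (sinh X * sinh X)) = eta' X"
    unfolding sq eta'_def using sp s by (simp add: field_simps power2_eq_square)
  finally show "(eta has_real_derivative eta' X) (at X)" unfolding eta_def[abs_def] .
qed

lemma weight_pos: "X > 0 \<Longrightarrow> weight X > 0"
  unfolding weight_def using eta_props[of X] cosh_real_pos[of X]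
  by (intro add_pos_pos mult_pos_pos) auto

lemma isCont_eta: "X > 0 \<Longrightarrow> isCont eta X"
  using DERIV_eta DERIV_isCont by blast

lemma isCont_weight: "X > 0 \<Longrightarrow> isCont weight X"
  unfolding weight_def eta'_def using eta_props[of X]
  by (intro continuous_intros isCont_eta) auto

lemma cut_curve_in_slit: "X > 0 \<Longrightarrow> cut_curve X \<in> slit"
  using eta_props[of X] by (auto simp: slit_def strip_def cut_curve_def complex_nonpos_Reals_iff)

lemma cut_curve_has_vector_derivative:
  assumes "X > 0" shows "(cut_curve has_vector_derivative Complex 1 (- eta' X)) (at X)"
  unfolding cut_curve_def has_vector_derivative_complex_iff
  using DERIV_eta[OF assms] by (auto intro!: derivative_eq_intros)

lemma isCont_cut_curve: "X > 0 \<Longrightarrow> isCont cut_curve X"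
  using cut_curve_has_vector_derivative has_vector_derivative_continuous by blast

lemma tendsto_cut_curve_0: "(cut_curve \<longlongrightarrow> 2 * of_real pi * \<i>) (at_right 0)"
proof -
  have "((\<lambda>X. X / sinh X) \<longlongrightarrow> 1) (at_right (0::real))" by real_asymp
  moreover have "eventually (\<lambda>X. X / sinh X \<in> {-1..1}) (at_right (0::real))"
    using eventually_at_right_less
  proof eventually_elim
    case (elim X)
    then have "0 < X / sinh X" "X / sinh X < 1" using less_sinh_real[of X] by auto
    then show ?case by simp
  qed
  ultimately have "((\<lambda>X. arccos (X / sinh X)) \<longlongrightarrow> arccos 1) (at_right 0)"
    by (intro continuous_on_tendsto_compose[OF continuous_on_arccos']) auto
  then have "(eta \<longlongrightarrow> 0) (at_right 0)" by (simp add: eta_def[abs_def])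
  then have "(cut_curve \<longlongrightarrow> Complex 0 (2 * pi - 0)) (at_right 0)"
    unfolding cut_curve_def by (intro tendsto_Complex tendsto_intros)
  then show ?thesis by (simp add: Complex_eq mult.commute)
qed

lemma two_pi_i_in_slit: "2 * of_real pi * \<i> \<in> slit"
  by (auto simp: slit_def strip_def complex_nonpos_Reals_iff)

text \<open>The modulus of sinh t - t on the curve, that is |w|^3.\<close>

definition cut_height :: "real \<Rightarrow> real" where
  "cut_height X = cosh X * sin (eta X) + 2 * pi - eta X"

text \<open>By \<open>less_cosh_mult_sin\<close> the height even exceeds 2*pi; the bound 1 is what
  puts p = 1/|w| into (0,1].\<close>

lemma cut_height_gt_1: "X > 0 \<Longrightarrow> cut_height X > 1"
  using less_cosh_mult_sin[of X "eta X"] eta_props[of X] pi_gt3 by (simp add: cut_height_def)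

lemma exp_lam_cut_curve: "X > 0 \<Longrightarrow> exp (3 * lam (cut_curve X)) = - \<i> * of_real (cut_height X)"
  using exp_3_lam[OF cut_curve_in_slit[of X]] sinh_mult_cos_eta[of X]
  by (simp add: complex_eq_iff Re_sinh Im_sinh cut_curve_def cut_height_def sin_diff cos_diff)

text \<open>Since exp (3 \<open>lam\<close>) is negative imaginary, 3 Im \<open>lam\<close> equals
  3*pi/2 modulo 2*pi. The limit at 2*pi*i, where \<open>lam\<close> is known explicitly, and
  continuity single out pi/2.\<close>

lemma Im_lam_cut_curve: assumes "X > 0" shows "Im (lam (cut_curve X)) = pi / 2"
proof -
  define f where "f = (\<lambda>X. Im (lam (cut_curve X)))"
  have cs: "cos (3 * f X) = 0 \<and> sin (3 * f X) < 0" if X: "X > 0" for X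
  proof -
    have "exp (3 * Re (lam (cut_curve X))) * cos (3 * f X) = 0"
      "exp (3 * Re (lam (cut_curve X))) * sin (3 * f X) = - cut_height X"
      using exp_lam_cut_curve[OF X] Re_exp[of "3 * lam (cut_curve X)"] Im_exp[of "3 * lam (cut_curve X)"]
      by (simp_all add: f_def)
    then show ?thesis using cut_height_gt_1[OF X]
      by (auto simp: mult_less_0_iff zero_less_mult_iff) (smt (verit) exp_gt_zero mult_nonneg_nonneg)
  qed
  have lim: "(f \<longlongrightarrow> pi / 2) (at_right 0)"
  proof -
    have "((\<lambda>X. lam (cut_curve X)) \<longlongrightarrow> lam (2 * of_real pi * \<i>)) (at_right 0)"
      by (rule isCont_tendsto_compose[OF isCont_lam[OF two_pi_i_in_slit] tendsto_cut_curve_0])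
    moreover have "Im (lam (2 * of_real pi * \<i>)) = pi / 2"
    proof -
      have "Im (log_quot (\<i> * of_real (2 * pi))) = 0"
        by (intro Im_log_quot_imaginary) auto
      then have "Im (log_quot (2 * of_real pi * \<i>)) = 0" by (simp add: mult_ac)
      moreover have "Im (Ln (2 * of_real pi * \<i>)) = pi / 2"
        using Ln_times_of_real[of "2 * pi" \<i>] Ln_of_real[of "2 * pi"] by (simp add: mult_ac)
      ultimately show ?thesis by (simp add: lam_def)
    qed
    ultimately show ?thesis unfolding f_def by (metis tendsto_Im)
  qed
  have "eventually (\<lambda>X. pi / 6 < f X \<and> f X < 5 * pi / 6) (at_right 0)"
    using order_tendstoD(1)[OF lim, of "pi / 6"] order_tendstoD(2)[OF lim, of "5 * pi / 6"]
    by (auto elim: eventually_elim2)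
  from eventually_happens'[OF _ eventually_conj[OF this eventually_at_right_less]]
  obtain X0 where X0: "X0 > 0" "pi / 6 < f X0" "f X0 < 5 * pi / 6" by auto
  have b: "pi / 6 < f X \<and> f X < 5 * pi / 6"
  proof (rule connected_between[of "{0<..}" f X0])
    show "continuous_on {0<..} f"
      unfolding f_def
      by (intro continuous_at_imp_continuous_on ballI continuous_intros isCont_o2[OF isCont_cut_curve isCont_lam] cut_curve_in_slit) auto
    \<comment> \<open>At these barriers 3 f would be pi/2 or 5*pi/2, where the sine is 1; on the
      curve the sine of 3 f is negative.\<close>
    show "f s \<noteq> pi / 6 \<and> f s \<noteq> 5 * pi / 6" if "s \<in> {0<..}" for s
    proof -
      have "sin (3 * f s) < 0" using cs that by auto
      moreover have "sin (5 * pi / 2) = 1"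
      proof -
        have "5 * pi / 2 = pi / 2 + 2 * pi" by simp
        then show ?thesis by (metis sin_periodic sin_pi_half)
      qed
      moreover have "3 * f s = pi / 2" if "f s = pi / 6" using that by simp
      moreover have "3 * f s = 5 * pi / 2" if "f s = 5 * pi / 6" using that by simp
      ultimately show ?thesis by (metis not_one_less_zero sin_pi_half)
    qed
  qed (use X0 assms in auto)
  \<comment> \<open>Between the barriers 3 f - 3*pi/2 lies strictly between -pi and pi, and there
    the sine vanishes only at 0.\<close>
  have "sin (3 * f X - 3 / 2 * pi) = 0"
    unfolding sin_diff using cs[OF assms] cos_3over2_pi by simp
  then have "3 * f X - 3 / 2 * pi = 0" by (rule sin_eq_0_pi[rotated 2]) (use b in auto)
  then show ?thesis by (simp add: f_def)
qed

text \<open>The number p with w = i/p at the point \<open>cut_curve X\<close>.\<close>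

definition cut_inv :: "real \<Rightarrow> real" where "cut_inv X = exp (- Re (lam (cut_curve X)))"

lemma cut_inv_bounds: assumes "X > 0" shows "0 < cut_inv X" "cut_inv X \<le> 1"
proof -
  have "exp (3 * Re (lam (cut_curve X))) = cut_height X"
    using arg_cong[OF exp_lam_cut_curve[OF assms], of norm] cut_height_gt_1[OF assms]
    by (simp add: norm_mult)
  then have "exp (3 * Re (lam (cut_curve X))) > 1" using cut_height_gt_1[OF assms] by simp
  then show "cut_inv X \<le> 1" by (simp add: cut_inv_def)
qed (simp add: cut_inv_def)

lemma isCont_cut_inv: "X > 0 \<Longrightarrow> isCont cut_inv X"
  unfolding cut_inv_def
  by (intro isCont_exp' isCont_minus isCont_Re isCont_o2[OF isCont_cut_curve isCont_lam] cut_curve_in_slit)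

text \<open>Here 1/w = -i p has real even powers, (-1)^(n+1) p^(2n+2), so the imaginary part of the
  integrand is that of sinh t dt times a number of fixed sign.\<close>

lemma integrand_cut_curve:
  assumes X: "X > 0"
  shows "Im (sinh (cut_curve X) * exp (- of_nat (2 * n + 2) * lam (cut_curve X)) * Complex 1 (- eta' X))
     = (-1) ^ n * (weight X * cut_inv X ^ (2 * n + 2))"
proof -
  define p where "p = cut_inv X"
  have l: "exp (- lam (cut_curve X)) = of_real p * (- \<i>)"
    by (simp add: complex_eq_iff Re_exp Im_exp cut_inv_def p_def Im_lam_cut_curve[OF X])
  have "- of_nat (2 * n + 2) * lam (cut_curve X) = of_nat (2 * (n + 1)) * (- lam (cut_curve X))"
    by (simp add: algebra_simps)
  then have "exp (- of_nat (2 * n + 2) * lam (cut_curve X))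
      = ((of_real p * (- \<i>)) ^ 2) ^ (n + 1)"
    by (simp only: exp_of_nat_mult power_mult l)
  also have "(of_real p * (- \<i>)) ^ 2 = of_real (- (p ^ 2))"
    by (simp add: power_mult_distrib)
  also have "complex_of_real (- (p ^ 2)) ^ (n + 1) = of_real ((- (p ^ 2)) ^ (n + 1))"
    by (simp only: of_real_power)
  also have "(- (p ^ 2)) ^ (n + 1) = ((-1) * p ^ 2) ^ (n + 1)" by simp
  also have "\<dots> = - ((-1) ^ n * p ^ (2 * (n + 1)))"
    by (simp only: power_mult_distrib power_mult[symmetric]) simp
  finally have e: "exp (- of_nat (2 * n + 2) * lam (cut_curve X)) = of_real (- ((-1) ^ n * p ^ (2 * (n + 1))))" .
  define z where "z = sinh (cut_curve X) * Complex 1 (- eta' X)"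
  have z: "Im z = - weight X"
    using sinh_mult_cos_eta[OF X] by (simp add: z_def Re_sinh Im_sinh cut_curve_def weight_def sin_diff cos_diff)
  have "sinh (cut_curve X) * exp (- of_nat (2 * n + 2) * lam (cut_curve X)) * Complex 1 (- eta' X) =
     of_real (- ((-1) ^ n * p ^ (2 * (n + 1)))) * z"
    unfolding e z_def by (simp only: ac_simps)
  then have "Im (sinh (cut_curve X) * exp (- of_nat (2 * n + 2) * lam (cut_curve X)) * Complex 1 (- eta' X)) =
     - ((-1) ^ n * p ^ (2 * (n + 1))) * Im z"
    by (simp only: times_complex.sel Re_complex_of_real Im_complex_of_real mult_zero_left add_0_right)
  then show ?thesis by (simp add: z p_def)
qed

lemma norm_sinh_le: "norm (sinh t) \<le> cosh (Re t)" and norm_sinh_ge: "sinh (Re t) \<le> norm (sinh t)"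
proof -
  have "(norm (sinh t))\<^sup>2 = (sinh (Re t))\<^sup>2 * (cos (Im t))\<^sup>2 + (cosh (Re t))\<^sup>2 * (sin (Im t))\<^sup>2"
    by (simp add: cmod_power2 Re_sinh Im_sinh power_mult_distrib)
  then have e: "(norm (sinh t))\<^sup>2 = (sinh (Re t))\<^sup>2 + (sin (Im t))\<^sup>2"
    by (simp add: cosh_square_eq cos_squared_eq algebra_simps)
  have "(sin (Im t))\<^sup>2 \<le> 1" by (simp add: abs_square_le_1)
  then have "(norm (sinh t))\<^sup>2 \<le> (cosh (Re t))\<^sup>2" using e by (simp add: cosh_square_eq)
  then show "norm (sinh t) \<le> cosh (Re t)" by (rule power2_le_imp_le) simp
  show "sinh (Re t) \<le> norm (sinh t)" by (rule power2_le_imp_le) (use e in auto)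
qed

text \<open>The imaginary part of the primitive is pi q_n / 2 at 2*pi*i and tends to 0 at infinity,
  because it vanishes on the positive real axis and the two curves stay within distance 2*pi of each
  other. The condition n \<ge> 1 gives the decay: sinh t grows like e^X, and |w|^(-4) falls like
  e^(-4X/3).\<close>

lemma moment_integral:
  assumes n: "n \<ge> 1"
  shows "set_integrable lborel {0<..} (\<lambda>X. weight X * cut_inv X ^ (2 * n + 2))"
    and "(LBINT X:{0<..}. weight X * cut_inv X ^ (2 * n + 2)) = - ((-1) ^ n * q_coeff n * pi / 2)"
proof -
  obtain \<Psi> where P: "\<And>t. t \<in> slit \<Longrightarrow> (\<Psi> has_field_derivative sinh t * exp (- of_nat (2 * n + 2) * lam t)) (at t)"
    "\<And>x. x > 0 \<Longrightarrow> Im (\<Psi> (of_real x)) = 0"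
    "\<And>y. 0 < y \<Longrightarrow> y < 7 * pi / 3 \<Longrightarrow> Im (\<Psi> (\<i> * of_real y)) = q_coeff n * pi / 2"
    using integrand_primitive[of n] by blast
  define F where "F = (\<lambda>X. (-1) ^ n * Im (\<Psi> (cut_curve X)))"
  have DF: "(F has_real_derivative weight X * cut_inv X ^ (2 * n + 2)) (at X)" if X: "X > 0" for X
  proof -
    have "(F has_real_derivative (-1) ^ n * ((-1) ^ n * (weight X * cut_inv X ^ (2 * n + 2)))) (at X)"
      unfolding F_def integrand_cut_curve[OF X, symmetric]
      by (intro DERIV_cmult DERIV_Im_along_path P cut_curve_in_slit X cut_curve_has_vector_derivative)
    moreover have "(-1) ^ n * ((-1) ^ n * w) = w" for w :: real by (cases "even n") auto
    ultimately show ?thesis by (simp only:)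
  qed
  have l0: "(F \<longlongrightarrow> (-1) ^ n * q_coeff n * pi / 2) (at_right 0)"
  proof -
    have "isCont \<Psi> (2 * of_real pi * \<i>)" using P(1)[OF two_pi_i_in_slit] DERIV_isCont by blast
    then have "(F \<longlongrightarrow> (-1) ^ n * Im (\<Psi> (2 * of_real pi * \<i>))) (at_right 0)"
      unfolding F_def by (intro tendsto_intros isCont_tendsto_compose[OF _ tendsto_cut_curve_0])
    moreover have "Im (\<Psi> (2 * of_real pi * \<i>)) = q_coeff n * pi / 2"
    proof -
      have "2 * of_real pi * \<i> = \<i> * complex_of_real (2 * pi)" by simp
      then show ?thesis using P(3)[of "2 * pi"] by (simp only:) simp
    qed
    ultimately show ?thesis by (simp only: mult.assoc times_divide_eq_right)
  qed
  \<comment> \<open>The exponent -4/3 comes from |w|^(-2n-2) \<le> |w|^(-4), valid for |w| \<ge> 1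
    and n \<ge> 1, together with |w|^3 = |sinh t - t| \<ge> sinh X - X - 2*pi on the vertical
    segment.\<close>
  define B where "B = (\<lambda>X::real. cosh X * (sinh X - X - 2 * pi) powr (- 4 / 3))"
  have B0: "(B \<longlongrightarrow> 0) at_top" unfolding B_def by real_asymp
  have bound: "\<bar>F X\<bar> \<le> 2 * pi * B X" if X: "X > 0" "sinh X - X - 2 * pi \<ge> 1" for X
  proof -
    \<comment> \<open>The vertical segment over X that joins the real axis, where Im \<Psi> = 0, to
      the curve.\<close>
    define S where "S = {t. Re t = X \<and> 0 \<le> Im t \<and> Im t \<le> 2 * pi}"
    have cS: "convex S"
    proof -
      have "S = {t. Re t \<le> X} \<inter> {t. Re t \<ge> X} \<inter> {t. Im t \<ge> 0} \<inter> {t. Im t \<le> 2 * pi}" by (auto simp: S_def)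
      then show ?thesis by (simp add: convex_Int convex_halfspace_Re_le convex_halfspace_Re_ge convex_halfspace_Im_le convex_halfspace_Im_ge)
    qed
    have Ss: "S \<subseteq> slit" using X
    proof (intro subsetI)
      fix t assume "t \<in> S"
      moreover from this have "\<bar>Im t\<bar> < 7 * pi / 3"
        using pi_gt_zero unfolding S_def mem_Collect_eq by linarith
      ultimately show "t \<in> slit" using X
        by (simp add: S_def slit_def strip_def complex_nonpos_Reals_iff)
    qed
    have nb: "norm (sinh t * exp (- of_nat (2 * n + 2) * lam t)) \<le> B X" if t: "t \<in> S" for t
    proof -
      have ts: "t \<in> slit" using Ss t by auto
      have "norm t \<le> X + 2 * pi" using cmod_le[of t] t X by (simp add: S_def)
      then have v: "sinh X - X - 2 * pi \<le> norm (sinh t - t)"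
        using norm_sinh_ge[of t] norm_triangle_ineq2[of "sinh t" t] t by (simp add: S_def)
      have nv: "norm (sinh t - t) = exp (3 * Re (lam t))"
        using exp_3_lam[OF ts] norm_exp_eq_Re[of "3 * lam t"] by simp
      have "exp (3 * Re (lam t)) \<ge> 1" using v X(2) nv by linarith
      then have r0: "Re (lam t) \<ge> 0" by simp
      have "norm (exp (- of_nat (2 * n + 2) * lam t)) = exp (- real (2 * n + 2) * Re (lam t))"
        by (simp add: norm_exp_eq_Re)
      also have "\<dots> \<le> exp (- 4 * Re (lam t))"
      proof -
        have "4 * Re (lam t) \<le> real (2 * n + 2) * Re (lam t)" using r0 n by (intro mult_right_mono) auto
        then show ?thesis by (simp only: exp_le_cancel_iff mult_minus_left neg_le_iff_le)
      qed
      also have "\<dots> = exp (3 * Re (lam t)) powr (- 4 / 3)" by (simp add: powr_def)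
      also have "\<dots> \<le> (sinh X - X - 2 * pi) powr (- 4 / 3)"
        unfolding nv[symmetric] using v X(2) by (intro powr_mono2') auto
      finally show ?thesis unfolding B_def norm_mult
        using norm_sinh_le[of t] t by (intro mult_mono) (auto simp: S_def)
    qed
    have "norm (\<Psi> (cut_curve X) - \<Psi> (of_real X)) \<le> B X * norm (cut_curve X - of_real X)"
    proof (rule field_differentiable_bound[OF cS])
      show "(\<Psi> has_field_derivative sinh t * exp (- of_nat (2 * n + 2) * lam t)) (at t within S)" if "t \<in> S" for t
        using P(1) Ss that has_field_derivative_at_within by blast
    qed (use nb X eta_props[of X] pi_gt_zero in \<open>auto simp: S_def cut_curve_def\<close>)
    also have "norm (cut_curve X - of_real X) \<le> 2 * pi"
      using eta_props[OF X(1)] cmod_le[of "cut_curve X - of_real X"] by (simp add: cut_curve_def)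
    finally have "norm (\<Psi> (cut_curve X) - \<Psi> (of_real X)) \<le> 2 * pi * B X"
      using X by (simp add: B_def mult_left_mono mult.commute)
    moreover have "\<bar>F X\<bar> = \<bar>Im (\<Psi> (cut_curve X) - \<Psi> (of_real X))\<bar>"
      using P(2)[OF X(1)] by (simp add: F_def abs_mult power_abs)
    ultimately show ?thesis
      using abs_Im_le_cmod[of "\<Psi> (cut_curve X) - \<Psi> (of_real X)"] by linarith
  qed
  have l1: "(F \<longlongrightarrow> 0) at_top"
  proof (rule Lim_null_comparison)
    have "filterlim (\<lambda>X::real. sinh X - X - 2 * pi) at_top at_top" by real_asymp
    then have "eventually (\<lambda>X::real. sinh X - X - 2 * pi \<ge> 1) at_top" by (simp add: filterlim_at_top)
    then show "eventually (\<lambda>X. norm (F X) \<le> 2 * pi * B X) at_top"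
      using eventually_gt_at_top[of 0] by eventually_elim (use bound in auto)
    show "((\<lambda>X. 2 * pi * B X) \<longlongrightarrow> 0) at_top" using tendsto_mult_right_zero[OF B0] by simp
  qed
  have ei: "einterval 0 \<infinity> = {0<..}" by (auto simp: einterval_def)
  have c: "isCont (\<lambda>X. weight X * cut_inv X ^ (2 * n + 2)) X" if "X > 0" for X
    by (intro continuous_intros isCont_weight isCont_cut_inv that)
  note FTC = interval_integral_FTC_nonneg[of 0 \<infinity> F "\<lambda>X. weight X * cut_inv X ^ (2 * n + 2)"
     "(-1) ^ n * q_coeff n * pi / 2" 0]
  have l0': "((F \<circ> real_of_ereal) \<longlongrightarrow> (-1) ^ n * q_coeff n * pi / 2) (at_right 0)"
    unfolding zero_ereal_def ereal_tendsto_simps1 by (rule l0)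
  have l1': "((F \<circ> real_of_ereal) \<longlongrightarrow> 0) (at_left \<infinity>)"
    using l1 by (simp add: ereal_tendsto_simps)
  have nn: "AE x in lborel. 0 < ereal x \<longrightarrow> ereal x < \<infinity> \<longrightarrow> 0 \<le> weight x * cut_inv x ^ (2 * n + 2)"
    using weight_pos cut_inv_bounds by (intro AE_I2) (auto intro!: mult_nonneg_nonneg less_imp_le)
  have prem: "(0::ereal) < \<infinity>"
    "\<And>x. 0 < ereal x \<Longrightarrow> ereal x < \<infinity> \<Longrightarrow> (F has_real_derivative weight x * cut_inv x ^ (2 * n + 2)) (at x)"
    "\<And>x. 0 < ereal x \<Longrightarrow> ereal x < \<infinity> \<Longrightarrow> isCont (\<lambda>X. weight X * cut_inv X ^ (2 * n + 2)) x"
    using DF c by simp_all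
  note F1 = FTC(1)[OF prem nn l0' l1'] and F2 = FTC(2)[OF prem nn l0' l1']
  show "set_integrable lborel {0<..} (\<lambda>X. weight X * cut_inv X ^ (2 * n + 2))"
    using F1 unfolding ei .
  show "(LBINT X:{0<..}. weight X * cut_inv X ^ (2 * n + 2)) = - ((-1) ^ n * q_coeff n * pi / 2)"
    using F2 by (simp add: interval_lebesgue_integral_def ei)
qed

lemma moment_measure_exists:
  "\<exists>M :: real measure. finite_measure M \<and> sets M = sets borel \<and> (AE p in M. 0 < p \<and> p \<le> 1) \<and>
     emeasure M (space M) \<noteq> 0 \<and>
     (\<forall>j. integrable M (\<lambda>p. p ^ (2 * j)) \<and> (\<integral>p. p ^ (2 * j) \<partial>M) = (-1) ^ j * (pi / 2) * q_coeff (Suc j))"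
proof -
  \<comment> \<open>The factor p^4 is p^(2n+2) for n = 1, so the measure has total mass proportional
    to q_1 and its moment of order 2j belongs to q_(j+1).\<close>
  define f where "f = (\<lambda>X. if X \<in> {0<..} then weight X * cut_inv X ^ 4 else 0)"
  \<comment> \<open>The value 1 off the half line keeps g within (0,1] everywhere; the density f
    vanishes there.\<close>
  define g where "g = (\<lambda>X. if X \<in> {0<..} then cut_inv X else 1)"
  have fm[measurable]: "f \<in> borel_measurable borel" and gm[measurable]: "g \<in> borel_measurable borel"
    unfolding f_def g_def
    by (rule borel_measurable_continuous_on_if;
        auto intro!: continuous_at_imp_continuous_on continuous_intros isCont_weight isCont_cut_inv)+
  have f0: "f X \<ge> 0" for X using weight_pos[of X] cut_inv_bounds[of X] by (auto simp: f_def intro!: mult_nonneg_nonneg)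
  define D where "D = density lborel (\<lambda>X. ennreal (f X))"
  define M where "M = distr D borel g"
  have gD: "g \<in> measurable D borel" by (simp add: D_def)
  have fg: "f X * g X ^ (2 * j) = indicator {0<..} X *\<^sub>R (weight X * cut_inv X ^ (2 * Suc j + 2))" for X j
    by (auto simp: f_def g_def indicator_def power_add mult_ac power_numeral_reduce)
  have int: "integrable lborel (\<lambda>X. f X * g X ^ (2 * j))"
    and val: "(\<integral>X. f X * g X ^ (2 * j) \<partial>lborel) = (-1) ^ j * (pi / 2) * q_coeff (Suc j)" for j
    using moment_integral[of "Suc j"] unfolding fg set_integrable_def set_lebesgue_integral_def by simp_all
  have "integrable lborel f" using int[of 0] by simp
  then have "(\<integral>\<^sup>+ X. ennreal (f X) \<partial>lborel) < \<infinity>"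
    using f0 by (simp add: nn_integral_eq_integral)
  then have "emeasure M (space M) \<noteq> \<infinity>"
    by (simp add: M_def D_def emeasure_distr emeasure_density)
  then have fin: "finite_measure M" by (rule finite_measureI)
  have AE: "AE p in M. 0 < p \<and> p \<le> 1"
  proof -
    have "AE X in D. 0 < g X \<and> g X \<le> 1"
      using cut_inv_bounds by (intro AE_I2) (auto simp: g_def)
    then show ?thesis unfolding M_def by (subst AE_distr_iff[OF gD]) auto
  qed
  have nz: "emeasure M (space M) \<noteq> 0"
  proof
    assume "emeasure M (space M) = 0"
    then have "(\<integral>\<^sup>+ X. ennreal (f X) \<partial>lborel) = 0"
      by (simp add: M_def D_def emeasure_distr emeasure_density)
    then have "AE X in lborel. ennreal (f X) = 0" by (subst (asm) nn_integral_0_iff_AE) auto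
    then have "AE X in lborel. X \<notin> {0<..<1::real}"
    proof eventually_elim
      case (elim X)
      then have "f X \<le> 0" by (simp add: ennreal_eq_0_iff)
      moreover have "f X > 0" if "X > 0"
        using that weight_pos[of X] cut_inv_bounds[of X] by (simp add: f_def)
      ultimately show ?case by fastforce
    qed
    then have "emeasure lborel {0<..<1::real} = 0"
      by (subst (asm) AE_iff_measurable[of "{0<..<1::real}"]) auto
    then show False by simp
  qed
  have I: "integrable M (\<lambda>p. p ^ (2 * j))" for j
  proof -
    have "integrable D (\<lambda>X. g X ^ (2 * j))"
      unfolding D_def using int[of j] f0 by (subst integrable_density) auto
    then show ?thesis unfolding M_def by (subst integrable_distr_eq[OF gD]) auto
  qed
  have V: "(\<integral>p. p ^ (2 * j) \<partial>M) = (-1) ^ j * (pi / 2) * q_coeff (Suc j)" for j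
  proof -
    have "(\<integral>p. p ^ (2 * j) \<partial>M) = (\<integral>X. g X ^ (2 * j) \<partial>D)"
      unfolding M_def by (subst integral_distr[OF gD]) auto
    also have "\<dots> = (\<integral>X. f X * g X ^ (2 * j) \<partial>lborel)"
      unfolding D_def using f0 by (subst integral_density) auto
    finally show ?thesis using val by simp
  qed
  show ?thesis
    by (intro exI[of _ M]) (use fin AE nz I V in \<open>auto simp: M_def\<close>)
qed

definition moment_measure :: "real measure" where
  "moment_measure = (SOME M. finite_measure M \<and> sets M = sets borel \<and> (AE p in M. 0 < p \<and> p \<le> 1) \<and>
     emeasure M (space M) \<noteq> 0 \<and>
     (\<forall>j. integrable M (\<lambda>p. p ^ (2 * j)) \<and> (\<integral>p. p ^ (2 * j) \<partial>M) = (-1) ^ j * (pi / 2) * q_coeff (Suc j)))"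

lemma finite_moment_measure: "finite_measure moment_measure"
  and sets_moment_measure [measurable_cong, simp]: "sets moment_measure = sets borel"
  and AE_moment_measure: "AE p in moment_measure. 0 < p \<and> p \<le> 1"
  and moment_measure_nonzero: "emeasure moment_measure (space moment_measure) \<noteq> 0"
  and integrable_moment: "integrable moment_measure (\<lambda>p. p ^ (2 * j))"
  and moment_eq: "(\<integral>p. p ^ (2 * j) \<partial>moment_measure) = (-1) ^ j * (pi / 2) * q_coeff (Suc j)"
  using someI_ex[OF moment_measure_exists] unfolding moment_measure_def[symmetric] by blast+

lemma space_moment_measure [simp]: "space moment_measure = UNIV"
  using sets_eq_imp_space_eq[OF sets_moment_measure] by simp

interpretation moment_measure: finite_measure moment_measure
  by (rule finite_moment_measure)

subsection \<open>Stieltjes representation\<close>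

text \<open>The coefficient of G is the contour integral of G(z) / z^(m+1) pulled back along W. No
  image contour is needed: inserting the Taylor polynomial of G with remainder leaves three kinds of
  terms on a circle in the t-plane, of which only the term of order m contributes.\<close>

lemma lagrange_inversion_coeff:
  fixes L G f :: "complex \<Rightarrow> complex"
  defines "W \<equiv> \<lambda>t. t * exp (L t)"
  assumes L: "L holomorphic_on ball 0 r" and "r > 0" and f: "f holomorphic_on ball 0 r"
    and G: "G holomorphic_on V" "open V" and WV: "W ` ball 0 r \<subseteq> V"
    and fG: "\<And>t. t \<in> ball 0 r \<Longrightarrow> f t = G (W t) * deriv W t"
  shows "(deriv ^^ m) G 0 / fact m = (deriv ^^ m) (\<lambda>t. f t * exp (- of_nat (Suc m) * L t)) 0 / fact m"
proof -
  define B where "B = ball (0::complex) r"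
  have V0: "0 \<in> V" using WV \<open>r > 0\<close> by (force simp: W_def)
  define c where "c = (\<lambda>k. (deriv ^^ k) G 0 / fact k)"
  obtain h where h: "h holomorphic_on V" "\<And>\<zeta>. \<zeta> \<in> V \<Longrightarrow> G \<zeta> = (\<Sum>k<Suc m. c k * \<zeta> ^ k) + \<zeta> ^ Suc m * h \<zeta>"
    using holomorphic_taylor_factor[OF G V0, of "Suc m"] unfolding c_def by blast
  define \<gamma> where "\<gamma> = circlepath (0::complex) (r / 2)"
  have g: "valid_path \<gamma>" "pathfinish \<gamma> = pathstart \<gamma>" by (simp_all add: \<gamma>_def)
  have img: "path_image \<gamma> \<subseteq> B - {0}" using \<open>r > 0\<close> by (auto simp: \<gamma>_def B_def)
  have dL: "(L has_field_derivative deriv L t) (at t)" if "t \<in> B" for t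
    using L that by (auto simp: B_def intro!: holomorphic_derivI)
  have dW': "(W has_field_derivative exp (L t) + t * (exp (L t) * deriv L t)) (at t)" if "t \<in> B" for t
    unfolding W_def using dL[OF that] by (auto intro!: derivative_eq_intros)
  have dW: "(W has_field_derivative deriv W t) (at t)" and dWe: "deriv W t = exp (L t) + t * (exp (L t) * deriv L t)"
    if "t \<in> B" for t
    using dW'[OF that] DERIV_imp_deriv[OF dW'[OF that]] by simp_all
  have Whol: "W holomorphic_on B"
    using dW by (meson holomorphic_onI field_differentiable_def has_field_derivative_at_within)
  have W0: "W t \<noteq> 0" if "t \<in> B - {0}" for t using that by (simp add: W_def)
  \<comment> \<open>For k < m the integrand is the derivative of a negative power of W.\<close>
  have I1: "((\<lambda>t. c k * (W t ^ k / W t ^ Suc m * deriv W t)) has_contour_integral 0) \<gamma>" if k: "k < m" for k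
  proof -
    obtain j where j: "m = k + Suc j" using k less_iff_Suc_add by auto
    have "((\<lambda>t. W t ^ k / W t ^ Suc m * deriv W t) has_contour_integral 0) \<gamma>"
    proof (rule Cauchy_theorem_primitive[OF _ g(1) img g(2)])
      fix t assume t: "t \<in> B - {0}"
      have di: "((\<lambda>t. inverse (W t)) has_field_derivative - (inverse (W t) * deriv W t * inverse (W t))) (at t)"
        by (rule DERIV_inverse'[OF dW W0]) (use t in auto)
      have "((\<lambda>t. - (inverse (W t) ^ Suc j / of_nat (Suc j))) has_field_derivative
          - (of_nat (Suc j) * (- (inverse (W t) * deriv W t * inverse (W t)) * inverse (W t) ^ (Suc j - Suc 0)) / of_nat (Suc j))) (at t)"
        by (rule DERIV_minus[OF DERIV_cdivide[OF DERIV_power[OF di]]])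
      also have "- (of_nat (Suc j) * (- (inverse (W t) * deriv W t * inverse (W t)) * inverse (W t) ^ (Suc j - Suc 0)) / of_nat (Suc j))
          = W t ^ k / W t ^ Suc m * deriv W t"
        using W0[OF t] by (simp add: j power_add field_simps del: of_nat_Suc)
      finally show "((\<lambda>t. - (inverse (W t) ^ Suc j / of_nat (Suc j))) has_field_derivative
          W t ^ k / W t ^ Suc m * deriv W t) (at t within B - {0})"
        by (rule has_field_derivative_at_within)
    qed
    from has_contour_integral_lmul[OF this, of "c k"] show ?thesis by simp
  qed
  \<comment> \<open>For k = m the integrand is W'/W = 1/t + L', and L has no singularity inside the
    circle.\<close>
  have I2: "((\<lambda>t. c m * (W t ^ m / W t ^ Suc m * deriv W t)) has_contour_integral c m * (2 * of_real pi * \<i>)) \<gamma>"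
  proof -
    have "((\<lambda>t. 1 / (t - 0) + deriv L t) has_contour_integral (2 * of_real pi * \<i> * 1) + 0) \<gamma>"
    proof (rule has_contour_integral_add)
      show "((\<lambda>t. 1 / (t - 0)) has_contour_integral (2 * of_real pi * \<i> * 1)) \<gamma>"
        unfolding \<gamma>_def using \<open>r > 0\<close> by (intro Cauchy_integral_circlepath_simple) auto
      show "(deriv L has_contour_integral 0) \<gamma>"
        using Cauchy_theorem_primitive[OF _ g(1) _ g(2), of B L "deriv L"] dL img has_field_derivative_at_within by blast
    qed
    moreover have "1 / (t - 0) + deriv L t = W t ^ m / W t ^ Suc m * deriv W t" if "t \<in> path_image \<gamma>" for t
    proof -
      have t: "t \<in> B - {0}" using that img by auto
      then have "deriv W t = exp (L t) + t * (exp (L t) * deriv L t)" by (simp add: dWe)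
      moreover have "W t ^ m / W t ^ Suc m = 1 / (t * exp (L t))" using W0[OF t] by (simp add: W_def field_simps)
      ultimately show ?thesis using t by (simp add: field_simps)
    qed
    ultimately have "((\<lambda>t. W t ^ m / W t ^ Suc m * deriv W t) has_contour_integral (2 * of_real pi * \<i> * 1) + 0) \<gamma>"
      by (rule has_contour_integral_eq)
    from has_contour_integral_lmul[OF this, of "c m"] show ?thesis by simp
  qed
  have I3: "((\<lambda>t. h (W t) * deriv W t) has_contour_integral 0) \<gamma>"
  proof (rule Cauchy_theorem_disc_simple[of _ 0 r])
    show "(\<lambda>t. h (W t) * deriv W t) holomorphic_on ball 0 r"
      using Whol h(1) WV unfolding B_def
      by (intro holomorphic_intros holomorphic_on_compose_gen[of W _ h V, unfolded o_def]) auto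
  qed (use g img in \<open>auto simp: B_def\<close>)
  have "((\<lambda>t. (\<Sum>k<m. c k * (W t ^ k / W t ^ Suc m * deriv W t)) + c m * (W t ^ m / W t ^ Suc m * deriv W t)
       + h (W t) * deriv W t) has_contour_integral ((\<Sum>k<m. 0) + c m * (2 * of_real pi * \<i>) + 0)) \<gamma>"
    by (intro has_contour_integral_add has_contour_integral_sum I1 I2 I3) auto
  then have A: "((\<lambda>t. f t * exp (- of_nat (Suc m) * L t) / (t - 0) ^ Suc m) has_contour_integral ((\<Sum>k<m. 0) + c m * (2 * of_real pi * \<i>) + 0)) \<gamma>"
  proof (rule has_contour_integral_eq)
    fix t assume "t \<in> path_image \<gamma>"
    then have t: "t \<in> B - {0}" using img by auto
    have WtV: "W t \<in> V" using WV t by (auto simp: B_def)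
    have "exp (- of_nat (Suc m) * L t) = 1 / exp (L t) ^ Suc m"
      using exp_of_nat_mult[of "Suc m" "L t"] by (simp only: mult_minus_left exp_minus) (simp add: divide_inverse)
    then have e1: "f t * exp (- of_nat (Suc m) * L t) / (t - 0) ^ Suc m = f t / W t ^ Suc m"
      by (simp add: W_def power_mult_distrib mult.commute)
    have e2: "f t = ((\<Sum>k<Suc m. c k * W t ^ k) + W t ^ Suc m * h (W t)) * deriv W t"
      using fG[of t] h(2)[OF WtV] t by (simp add: B_def)
    have e3: "((\<Sum>k<Suc m. c k * W t ^ k) + W t ^ Suc m * h (W t)) * deriv W t / W t ^ Suc m = (\<Sum>k<m. c k * (W t ^ k / W t ^ Suc m * deriv W t)) + c m * (W t ^ m / W t ^ Suc m * deriv W t)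
       + h (W t) * deriv W t"
      using W0[OF t] by (simp add: add_divide_distrib sum_divide_distrib sum_distrib_right distrib_right mult.assoc)
    show "(\<Sum>k<m. c k * (W t ^ k / W t ^ Suc m * deriv W t)) + c m * (W t ^ m / W t ^ Suc m * deriv W t)
       + h (W t) * deriv W t = f t * exp (- of_nat (Suc m) * L t) / (t - 0) ^ Suc m"
      unfolding e1 by (subst e2) (rule e3[symmetric])
  qed
  have hol: "(\<lambda>t. f t * exp (- of_nat (Suc m) * L t)) holomorphic_on ball 0 r"
    by (intro holomorphic_intros f L)
  have "((\<lambda>t. f t * exp (- of_nat (Suc m) * L t) / (t - 0) ^ Suc m) has_contour_integral
      ((2 * pi * \<i>) / fact m * (deriv ^^ m) (\<lambda>t. f t * exp (- of_nat (Suc m) * L t)) 0)) \<gamma>"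
    unfolding \<gamma>_def
  proof (rule Cauchy_has_contour_integral_higher_derivative_circlepath)
    show "continuous_on (cball 0 (r / 2)) (\<lambda>t. f t * exp (- of_nat (Suc m) * L t))"
      by (rule continuous_on_subset[OF holomorphic_on_imp_continuous_on[OF hol]]) (use \<open>r > 0\<close> in auto)
    show "(\<lambda>t. f t * exp (- of_nat (Suc m) * L t)) holomorphic_on ball 0 (r / 2)"
      by (rule holomorphic_on_subset[OF hol]) (use \<open>r > 0\<close> in auto)
  qed (use \<open>r > 0\<close> in auto)
  from has_contour_integral_unique[OF this A]
  have "(2 * pi * \<i>) * ((deriv ^^ m) (\<lambda>t. f t * exp (- of_nat (Suc m) * L t)) 0 / fact m) = (2 * pi * \<i>) * c m"
    by simp
  then show ?thesis unfolding c_def by simp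
qed

text \<open>Differentiating w^3 = sinh t - t gives 3 w^2 w' = cosh t - 1, so 3 w^2 sinh t / (cosh t
  - 1) is sinh t dt/dw, whose coefficients as a function of w Lagrange inversion supplies. Even
  powers drop out by the parity of \<open>D0\<close>.\<close>

lemma sinh_div_series:
  "\<exists>r>0. \<forall>t\<in>slit. norm t < r \<longrightarrow> cosh t \<noteq> 1 \<and>
     (\<lambda>n. of_real (q_coeff n) * exp (lam t) ^ (2 * n + 1)) sums (3 * exp (lam t) ^ 2 * (sinh t / (cosh t - 1)))"
proof -
  define L where "L = (\<lambda>t. of_real (- ln 6 / 3) + log_quot t / 3)"
  define W where "W = (\<lambda>t. t * exp (L t))"
  have Lh: "L holomorphic_on strip" unfolding L_def by (intro holomorphic_intros log_quot_holomorphic) auto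
  have Wh: "W holomorphic_on strip" unfolding W_def by (intro holomorphic_intros Lh)
  have We: "exp (lam t) = W t" if "t \<noteq> 0" for t
  proof -
    have "lam t = Ln t + L t" by (simp add: lam_def L_def)
    then show ?thesis using that by (simp add: exp_add W_def)
  qed
  have dW: "(W has_field_derivative deriv W t) (at t)" if "t \<in> strip" for t
    by (rule holomorphic_derivI[OF Wh open_strip that])
  have W3: "W t ^ 3 = sinh t - t" if "t \<in> slit" for t
    using exp_3_lam[OF that] We[of t] slitD(3)[OF that] exp_of_nat_mult[of 3 "lam t"] by simp
  have "deriv W 0 = exp (L 0)"
  proof (rule DERIV_imp_deriv)
    have "(L has_field_derivative deriv L 0) (at 0)" by (rule holomorphic_derivI[OF Lh open_strip zero_in_strip])
    then show "(W has_field_derivative exp (L 0)) (at 0)"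
      unfolding W_def by (auto intro!: derivative_eq_intros)
  qed
  then have d0: "deriv W 0 \<noteq> 0" by simp
  obtain r where r: "r > 0" "ball 0 r \<subseteq> strip" "open (W ` ball 0 r)" "inj_on W (ball 0 r)"
    using has_complex_derivative_locally_invertible[OF Wh zero_in_strip open_strip d0] by metis
  have Wb: "W holomorphic_on ball 0 r" using Wh r(2) holomorphic_on_subset by blast
  obtain g where g: "g holomorphic_on (W ` ball 0 r)" "\<And>z. z \<in> ball 0 r \<Longrightarrow> deriv W z * deriv g (W z) = 1"
      "\<And>z. z \<in> ball 0 r \<Longrightarrow> g (W z) = z"
    using holomorphic_has_inverse[OF Wb open_ball r(4)] by metis
  \<comment> \<open>sinh t dt/dw as a function of w, through the local inverse g of W.\<close>
  define G where "G = (\<lambda>\<zeta>. sinh (g \<zeta>) * deriv g \<zeta>)"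
  have Gh: "G holomorphic_on W ` ball 0 r"
    unfolding G_def sinh_field_def by (intro holomorphic_intros g(1) r(3)) auto
  have fG: "sinh t = G (W t) * deriv W t" if "t \<in> ball 0 r" for t
    using g(2,3)[OF that] by (simp add: G_def mult.commute mult.left_commute)
  have sh: "(sinh :: complex \<Rightarrow> complex) holomorphic_on ball 0 r"
    unfolding sinh_field_def[abs_def] by (intro holomorphic_intros) auto
  have co: "(deriv ^^ m) G 0 / fact m = of_real (6 powr (real (m + 1) / 3)) * D0 m" for m
  proof -
    have "(deriv ^^ m) G 0 / fact m = (deriv ^^ m) (\<lambda>t. sinh t * exp (- of_nat (Suc m) * L t)) 0 / fact m"
      by (rule lagrange_inversion_coeff[of L r sinh G "W ` ball 0 r"])
        (use r(1,3) Gh fG sh holomorphic_on_subset[OF Lh r(2)] in \<open>auto simp: W_def\<close>)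
    also have "(\<lambda>t. sinh t * exp (- of_nat (Suc m) * L t)) = (\<lambda>t. of_real (6 powr (real (m + 1) / 3)) * sinh_pow (- (real (m + 1) / 3)) t)"
    proof
      fix t
      have "- of_nat (Suc m) * L t = of_real (real (m + 1) / 3 * ln 6) + of_real (- (real (m + 1) / 3)) * log_quot t"
        by (simp add: L_def field_simps)
      then show "sinh t * exp (- of_nat (Suc m) * L t) = of_real (6 powr (real (m + 1) / 3)) * sinh_pow (- (real (m + 1) / 3)) t"
        unfolding sinh_pow_def by (simp only: exp_add exp_of_real) (simp add: powr_def)
    qed
    also have "(deriv ^^ m) \<dots> 0 = of_real (6 powr (real (m + 1) / 3)) * (deriv ^^ m) (sinh_pow (- (real (m + 1) / 3))) 0"
      by (rule higher_deriv_cmult[OF sinh_pow_holomorphic zero_in_strip open_strip])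
    finally show ?thesis by (simp only: D0_eq times_divide_eq_right)
  qed
  obtain R where R: "R > 0" "ball 0 R \<subseteq> W ` ball 0 r"
  proof -
    have "0 \<in> W ` ball 0 r" using r(1) by (force simp: W_def)
    then show ?thesis using r(3) open_contains_ball that by blast
  qed
  have ser: "(\<lambda>n. of_real (q_coeff n) * \<zeta> ^ (2 * n + 1)) sums G \<zeta>" if z: "\<zeta> \<in> ball 0 R" for \<zeta>
  proof -
    have "(\<lambda>m. (deriv ^^ m) G 0 / fact m * (\<zeta> - 0) ^ m) sums G \<zeta>"
      by (rule holomorphic_power_series[OF holomorphic_on_subset[OF Gh R(2)] z])
    then have "(\<lambda>m. of_real (6 powr (real (m + 1) / 3)) * D0 m * \<zeta> ^ m) sums G \<zeta>" by (simp add: co)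
    moreover have "strict_mono (\<lambda>n. 2 * n + 1 :: nat)" by (auto simp: strict_mono_def)
    moreover have "of_real (6 powr (real (m + 1) / 3)) * D0 m * \<zeta> ^ m = 0" if "m \<notin> range (\<lambda>n. 2 * n + 1)" for m
    proof -
      have "even m"
      proof (rule ccontr)
        assume "odd m"
        then obtain n where "m = 2 * n + 1" by (auto elim: oddE)
        then show False using that by blast
      qed
      then show ?thesis using D0_even by simp
    qed
    ultimately have "(\<lambda>n. of_real (6 powr (real (2 * n + 1 + 1) / 3)) * D0 (2 * n + 1) * \<zeta> ^ (2 * n + 1)) sums G \<zeta>"
      using sums_mono_reindex[of "\<lambda>n. 2 * n + 1" "\<lambda>m. of_real (6 powr (real (m + 1) / 3)) * D0 m * \<zeta> ^ m" "G \<zeta>"] by blast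
    moreover have "real (2 * n + 1 + 1) / 3 = (2 * real n + 2) / 3" for n by simp
    ultimately show ?thesis unfolding q_coeff_complex by (simp only:)
  qed
  have "isCont W 0" using dW[OF zero_in_strip] DERIV_isCont by blast
  then have "eventually (\<lambda>t. W t \<in> ball 0 R) (nhds 0)"
  proof -
    have "(W \<longlongrightarrow> W 0) (at 0)" using \<open>isCont W 0\<close> by (simp add: isCont_def)
    from topological_tendstoD[OF this open_ball, of 0 R] R(1) show ?thesis
      by (simp add: eventually_nhds_conv_at W_def)
  qed
  then obtain r2 where r2: "r2 > 0" "\<And>t. norm t < r2 \<Longrightarrow> W t \<in> ball 0 R"
    unfolding eventually_nhds_metric by auto
  have "cosh t \<noteq> 1 \<and> (\<lambda>n. of_real (q_coeff n) * exp (lam t) ^ (2 * n + 1)) sums (3 * exp (lam t) ^ 2 * (sinh t / (cosh t - 1)))"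
    if t: "t \<in> slit" "norm t < min r r2" for t
  proof -
    have t0: "t \<noteq> 0" and tb: "t \<in> ball 0 r" using t slitD by auto
    have "((\<lambda>t. W t ^ 3) has_field_derivative 3 * W t ^ 2 * deriv W t) (at t)"
      by (auto intro!: derivative_eq_intros dW slitD t)
    moreover have "((\<lambda>t. sinh t - t) has_field_derivative cosh t - 1) (at t)"
      by (auto intro!: derivative_eq_intros)
    then have "((\<lambda>t. W t ^ 3) has_field_derivative cosh t - 1) (at t)"
      by (rule has_field_derivative_transform_within_open[OF _ open_slit t(1)]) (simp add: W3)
    ultimately have e: "3 * W t ^ 2 * deriv W t = cosh t - 1" by (rule DERIV_unique)
    have Wn: "W t \<noteq> 0" using t0 by (simp add: W_def)
    have dn: "deriv W t \<noteq> 0" using g(2)[OF tb] by auto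
    have c: "cosh t \<noteq> 1" using e Wn dn by auto
    have "3 * W t ^ 2 * (sinh t / (cosh t - 1)) = G (W t)"
      unfolding e[symmetric] fG[OF tb] using Wn dn by simp
    then show ?thesis using c ser[OF r2(2)] t(2) We[OF t0] by simp
  qed
  then show ?thesis using r(1) r2(1) by (intro exI[of _ "min r r2"]) auto
qed

definition stieltjes :: "complex \<Rightarrow> complex" where
  "stieltjes x = (\<integral>p. 1 / (1 + of_real (p ^ 2) * x) \<partial>moment_measure)"

section \<open>The Stieltjes transform of the moment measure\<close>

lemma stieltjes_denominator_nonzero:
  fixes x :: complex
  assumes "x \<notin> \<real>\<^sub>\<le>\<^sub>0" shows "1 + of_real (p ^ 2) * x \<noteq> 0"
proof
  assume e: "1 + of_real (p ^ 2) * x = 0"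
  then have p: "p \<noteq> 0" by auto
  have "of_real (p ^ 2) * x = - 1" using e by (metis add.commute add_eq_0_iff)
  then have "x = - 1 / of_real (p ^ 2)" using p by (subst nonzero_eq_divide_eq) (auto simp: mult.commute)
  then have "x = of_real (- (1 / p ^ 2))" by simp
  then have "x \<in> \<real>\<^sub>\<le>\<^sub>0" using p by (simp only: nonpos_Reals_of_real_iff) simp
  then show False using assms by simp
qed

lemma stieltjes_holomorphic: "stieltjes holomorphic_on - \<real>\<^sub>\<le>\<^sub>0"
  unfolding stieltjes_def[abs_def]
proof (rule holomorphic_on_integral)
  show "open (- \<real>\<^sub>\<le>\<^sub>0 :: complex set)" using closed_nonpos_Reals_complex by (simp add: open_Compl)
  show "(\<lambda>p. 1 / (1 + complex_of_real (p ^ 2) * z)) \<in> borel_measurable moment_measure" for z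
    by measurable
  show "AE p in moment_measure. (\<lambda>z. 1 / (1 + complex_of_real (p ^ 2) * z)) holomorphic_on - \<real>\<^sub>\<le>\<^sub>0"
    by (intro AE_I2 holomorphic_intros) (use stieltjes_denominator_nonzero in auto)
  fix z0 :: complex assume z0: "z0 \<in> - \<real>\<^sub>\<le>\<^sub>0"
  obtain r where r: "r > 0" "cball z0 r \<subseteq> - \<real>\<^sub>\<le>\<^sub>0"
    using z0 closed_nonpos_Reals_complex open_contains_cball[of "- \<real>\<^sub>\<le>\<^sub>0 :: complex set"] by (auto simp: open_Compl)
  \<comment> \<open>Since p is confined to the compact interval [0,1], the denominator attains a
    positive minimum over p and over x in a closed disc; its reciprocal is the constant dominating
    function.\<close>
  define g where "g = (\<lambda>(p::real, z::complex). norm (1 + of_real (p ^ 2) * z))"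
  have "compact ({0..1::real} \<times> cball z0 r)" by (intro compact_Times compact_Icc compact_cball)
  moreover have "continuous_on ({0..1} \<times> cball z0 r) g"
    unfolding g_def case_prod_unfold by (intro continuous_intros)
  moreover have "({0..1} :: real set) \<times> cball z0 r \<noteq> {}" using r by auto
  ultimately obtain m where m: "m \<in> {0..1} \<times> cball z0 r" "\<And>y. y \<in> {0..1} \<times> cball z0 r \<Longrightarrow> g m \<le> g y"
    using continuous_attains_inf by metis
  have gm: "g m > 0" using m(1) r(2) stieltjes_denominator_nonzero[of "snd m" "fst m"] by (auto simp: g_def)
  show "\<exists>r>0. \<exists>B. integrable moment_measure B \<and> (AE p in moment_measure.
      \<forall>z\<in>ball z0 r \<inter> - \<real>\<^sub>\<le>\<^sub>0. norm (1 / (1 + complex_of_real (p ^ 2) * z)) \<le> B p)"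
  proof (intro exI conjI)
    show "integrable moment_measure (\<lambda>_. 1 / g m)" by simp
    show "AE p in moment_measure. \<forall>z\<in>ball z0 r \<inter> - \<real>\<^sub>\<le>\<^sub>0. norm (1 / (1 + complex_of_real (p ^ 2) * z)) \<le> 1 / g m"
      using AE_moment_measure
    proof eventually_elim
      case (elim p)
      show ?case
      proof
        fix z assume "z \<in> ball z0 r \<inter> - \<real>\<^sub>\<le>\<^sub>0"
        then have "g m \<le> g (p, z)" using elim by (intro m(2)) auto
        then show "norm (1 / (1 + complex_of_real (p ^ 2) * z)) \<le> 1 / g m"
          using gm by (simp add: g_def norm_divide frac_le)
      qed
    qed
  qed (use r in auto)
qed

text \<open>As p \<le> 1, the geometric series in -p^2 x is dominated by that in |x| and may be
  integrated term by term; its moments are the coefficients q_(j+1).\<close>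

lemma stieltjes_series:
  assumes x: "norm x < 1"
  shows "(\<lambda>j. of_real (pi / 2 * q_coeff (Suc j)) * x ^ j) sums stieltjes x"
proof -
  define f where "f = (\<lambda>j p. of_real ((-1) ^ j * p ^ (2 * j)) * x ^ j)"
  have int: "integrable moment_measure (f j)" for j
    unfolding f_def by (intro integrable_mult_left integrable_of_real integrable_mult_right integrable_moment) 
  have val: "(\<integral>p. f j p \<partial>moment_measure) = of_real (pi / 2 * q_coeff (Suc j)) * x ^ j" for j
  proof -
    have "(\<integral>p. f j p \<partial>moment_measure) = of_real ((-1) ^ j * (\<integral>p. p ^ (2 * j) \<partial>moment_measure)) * x ^ j"
      unfolding f_def by (simp only: integral_mult_left_zero integral_complex_of_real integral_mult_right_zero)
    then show ?thesis unfolding moment_eq by (simp add: mult.assoc[symmetric] power_mult_distrib[symmetric])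
  qed
  have nb: "norm (f j p) \<le> norm x ^ j" if "0 < p" "p \<le> 1" for j p
  proof -
    have "norm (f j p) = p ^ (2 * j) * norm x ^ j"
      unfolding f_def using that by (simp add: norm_mult norm_power abs_mult power_abs)
    also have "\<dots> \<le> 1 * norm x ^ j" using that by (intro mult_right_mono power_le_one) auto
    finally show ?thesis by simp
  qed
  have "(\<lambda>j. \<integral>p. f j p \<partial>moment_measure) sums (\<integral>p. (\<Sum>j. f j p) \<partial>moment_measure)"
  proof (rule sums_integral)
    show "integrable moment_measure (f j)" for j by (rule int)
    show "AE p in moment_measure. summable (\<lambda>j. norm (f j p))"
      using AE_moment_measure
    proof eventually_elim
      case (elim p)
      show ?case
        by (rule summable_comparison_test'[OF summable_geometric[of "norm x"]]) (use nb elim x in auto)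
    qed
    show "summable (\<lambda>j. \<integral>p. norm (f j p) \<partial>moment_measure)"
    proof (rule summable_comparison_test')
      show "summable (\<lambda>j. norm x ^ j * measure moment_measure UNIV)"
        using x by (intro summable_mult2 summable_geometric) auto
      fix j
      have "(\<integral>p. norm (f j p) \<partial>moment_measure) \<le> (\<integral>p. norm x ^ j \<partial>moment_measure)"
        by (rule integral_mono_AE) (use int nb AE_moment_measure in \<open>auto elim: eventually_mono\<close>)
      then show "norm (\<integral>p. norm (f j p) \<partial>moment_measure) \<le> norm x ^ j * measure moment_measure UNIV"
        by (simp add: mult.commute)
    qed
  qed
  moreover have "(\<integral>p. (\<Sum>j. f j p) \<partial>moment_measure) = stieltjes x"
    unfolding stieltjes_def
  proof (rule integral_cong_AE)
    show "(\<lambda>p. \<Sum>j. f j p) \<in> borel_measurable moment_measure"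
      using borel_measurable_integrable[OF int] by measurable
    show "(\<lambda>p. 1 / (1 + complex_of_real (p ^ 2) * x)) \<in> borel_measurable moment_measure" by measurable
    show "AE p in moment_measure. (\<Sum>j. f j p) = 1 / (1 + complex_of_real (p ^ 2) * x)"
      using AE_moment_measure
    proof eventually_elim
      case (elim p)
      have "norm (- (of_real (p ^ 2) * x)) = p\<^sup>2 * norm x" by (simp add: norm_mult norm_power)
      also have "\<dots> \<le> 1 * norm x" using elim by (intro mult_right_mono power_le_one) auto
      finally have "(\<lambda>j. (- (of_real (p ^ 2) * x)) ^ j) sums (1 / (1 - (- (of_real (p ^ 2) * x))))"
        using x by (intro geometric_sums) auto
      moreover have "(- (of_real (p ^ 2) * x)) ^ j = f j p" for j
        using power_mult_distrib[of "-1" "of_real (p ^ 2) * x" j]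
        by (simp add: f_def power_mult_distrib power_mult)
      ultimately have "(\<lambda>j. f j p) sums (1 / (1 - (- (of_real (p ^ 2) * x))))" by (simp only:)
      then show ?case by (simp add: sums_iff)
    qed
  qed
  ultimately show ?thesis by (simp add: val)
qed

text \<open>Contains the path of steepest descent. On it w^2 avoids the cut of
  \<open>stieltjes\<close>, so the identity between power series near 0 can be continued.\<close>

definition quarter_strip :: "complex set" where
  "quarter_strip = {t. 0 < Re t \<and> 0 < Im t \<and> Im t < pi}"

section \<open>Continuation of the expansion to a half strip\<close>

lemma quarter_strip_slit: "quarter_strip \<subseteq> slit"
proof
  fix t assume "t \<in> quarter_strip"
  then have "0 < Im t" "Im t < 7 * pi / 3" by (auto simp: quarter_strip_def intro: order_less_trans)
  then show "t \<in> slit" by (auto simp: slit_def strip_def complex_nonpos_Reals_iff)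
qed

lemma open_quarter_strip: "open quarter_strip" and convex_quarter_strip: "convex quarter_strip"
proof -
  have e: "quarter_strip = {t. Re t > 0} \<inter> {t. Im t > 0} \<inter> {t. Im t < pi}" by (auto simp: quarter_strip_def)
  show "open quarter_strip" "convex quarter_strip" unfolding e
    by (simp_all add: open_Int open_halfspace_Re_gt open_halfspace_Im_gt open_halfspace_Im_lt
       convex_Int convex_halfspace_Re_gt convex_halfspace_Im_gt convex_halfspace_Im_lt)
qed

text \<open>At either end value sinh t - t would be negative imaginary, which
  \<open>less_cosh_mult_sin\<close> excludes in this region.\<close>

lemma Im_lam_quarter_strip:
  assumes t: "t \<in> quarter_strip"
  shows "- pi / 2 < 3 * Im (lam t) \<and> 3 * Im (lam t) < 3 / 2 * pi"
proof -
  \<comment> \<open>The positive real axis is included so that the continuity argument can start at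
    t = 1, where \<open>lam\<close> is real.\<close>
  define S where "S = {t. 0 < Re t \<and> 0 \<le> Im t \<and> Im t < pi}"
  have "S = {t. Re t > 0} \<inter> {t. Im t \<ge> 0} \<inter> {t. Im t < pi}" by (auto simp: S_def)
  then have "convex S"
    by (simp add: convex_Int convex_halfspace_Re_gt convex_halfspace_Im_ge convex_halfspace_Im_lt)
  then have cS: "connected S" by (rule convex_connected)
  have Ss: "S \<subseteq> slit"
  proof
    fix t assume t: "t \<in> S"
    then have "\<bar>Im t\<bar> < 7 * pi / 3" by (auto simp: S_def intro: order_less_trans)
    with t show "t \<in> slit" by (auto simp: slit_def strip_def complex_nonpos_Reals_iff S_def)
  qed
  have ct: "continuous_on S (\<lambda>t. 3 * Im (lam t))"
    using isCont_lam Ss by (intro continuous_intros continuous_at_imp_continuous_on) auto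
  have ne: "3 * Im (lam t) \<noteq> - pi / 2 \<and> 3 * Im (lam t) \<noteq> 3 / 2 * pi" if t: "t \<in> S" for t
  proof (rule ccontr)
    assume "\<not> ?thesis"
    then have "3 * Im (lam t) = - pi / 2 \<or> 3 * Im (lam t) = 3 / 2 * pi" by blast
    then have cs: "cos (3 * Im (lam t)) = 0" "sin (3 * Im (lam t)) = -1"
      by (auto simp only: cos_3over2_pi sin_3over2_pi cos_minus sin_minus cos_pi_half sin_pi_half minus_divide_left[symmetric] minus_zero)
    have v: "sinh t - t = exp (3 * lam t)" using exp_3_lam Ss t by auto
    have re: "sinh (Re t) * cos (Im t) - Re t = 0" and im: "cosh (Re t) * sin (Im t) - Im t < 0"
      using arg_cong[OF v, of Re] arg_cong[OF v, of Im] cs by (simp_all add: Re_exp Im_exp Re_sinh Im_sinh)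
    show False
    proof (cases "Im t = 0")
      case True then show False using im by simp
    next
      case False
      then show False using less_cosh_mult_sin[of "Re t" "Im t"] re im t by (auto simp: S_def)
    qed
  qed
  have "Im (lam 1) = 0" using Im_log_quot_real[of 1] by (simp add: lam_def)
  then show ?thesis
    using connected_between[OF cS ct, of 1 "- pi / 2" "3 / 2 * pi" t] ne t
    by (auto simp: S_def quarter_strip_def)
qed

text \<open>The range of 3 Im \<open>lam\<close> puts the angle 2 Im \<open>lam\<close> of w^2
  strictly between -pi and pi.\<close>

lemma exp_lam_sq_quarter_strip: "t \<in> quarter_strip \<Longrightarrow> exp (lam t) ^ 2 \<notin> \<real>\<^sub>\<le>\<^sub>0"
proof
  assume t: "t \<in> quarter_strip" and n: "exp (lam t) ^ 2 \<in> \<real>\<^sub>\<le>\<^sub>0"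
  have e: "exp (lam t) ^ 2 = exp (2 * lam t)" using exp_of_nat_mult[of 2 "lam t"] by simp
  have b: "- pi < 2 * Im (lam t)" "2 * Im (lam t) < pi"
    using Im_lam_quarter_strip[OF t] pi_gt_zero by linarith+
  have "sin (2 * Im (lam t)) = 0" "cos (2 * Im (lam t)) \<le> 0"
    using n unfolding e by (auto simp: complex_nonpos_Reals_iff Re_exp Im_exp mult_le_0_iff not_le)
  then have "2 * Im (lam t) = 0" using sin_eq_0_pi b by blast
  then show False using \<open>cos (2 * Im (lam t)) \<le> 0\<close> by simp
qed

lemma cosh_neq_1_quarter_strip: "t \<in> quarter_strip \<Longrightarrow> cosh t \<noteq> 1"
proof
  assume t: "t \<in> quarter_strip" and c: "cosh t = 1"
  have "sinh (Re t) * sin (Im t) > 0" using t by (auto simp: quarter_strip_def intro!: mult_pos_pos sin_gt_zero)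
  moreover have "sinh (Re t) * sin (Im t) = 0" using arg_cong[OF c, of Im] by (simp add: Im_cosh)
  ultimately show False by simp
qed

text \<open>Close to 0 one has |w| < 1 and both sides are the same series in w; both are holomorphic
  on the connected half strip, so the identity spreads to all of it, including points where |w| > 1
  and the series diverges.\<close>

lemma sinh_div_stieltjes:
  assumes t: "t \<in> quarter_strip"
  shows "3 * (sinh t / (cosh t - 1)) =
    of_real (q_coeff 0) / exp (lam t) + of_real (2 / pi) * exp (lam t) * stieltjes (exp (lam t) ^ 2)"
proof -
  define w where "w = (\<lambda>t. exp (lam t))"
  define F :: "complex \<Rightarrow> complex" where "F = (\<lambda>t. 3 * (sinh t / (cosh t - 1)))"
  define H :: "complex \<Rightarrow> complex" where "H = (\<lambda>t. of_real (q_coeff 0) / w t + of_real (2 / pi) * w t * stieltjes (w t ^ 2))"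
  obtain r where r: "r > 0" "\<And>t. t \<in> slit \<Longrightarrow> norm t < r \<Longrightarrow>
     (\<lambda>n. of_real (q_coeff n) * exp (lam t) ^ (2 * n + 1)) sums (3 * exp (lam t) ^ 2 * (sinh t / (cosh t - 1)))"
    using sinh_div_series by blast
  have "((\<lambda>t::complex. norm (sinh t - t)) \<longlongrightarrow> norm (sinh 0 - 0 :: complex)) (at 0)"
    unfolding sinh_field_def by (intro tendsto_intros) auto
  from order_tendstoD(2)[OF this, of 1] have "eventually (\<lambda>t::complex. norm (sinh t - t) < 1) (nhds 0)"
    by (simp add: eventually_nhds_conv_at)
  then obtain r2 where r2: "r2 > 0" "\<And>t::complex. norm t < r2 \<Longrightarrow> norm (sinh t - t) < 1"
    unfolding eventually_nhds_metric by auto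
  define U where "U = quarter_strip \<inter> ball 0 (min r r2)"
  have eqU: "F t = H t" if t: "t \<in> U" for t
  proof -
    have ts: "t \<in> slit" and tq: "t \<in> quarter_strip" and tr: "norm t < r" "norm t < r2"
      using t quarter_strip_slit by (auto simp: U_def)
    have "norm (w t) ^ 3 = norm (sinh t - t)"
      using exp_3_lam[OF ts] exp_of_nat_mult[of 3 "lam t"] by (simp add: w_def norm_power[symmetric] del: norm_exp_eq_Re)
    then have "norm (w t) ^ 3 < 1" using r2(2)[OF tr(2)] by simp
    then have nw: "norm (w t) < 1" by (metis one_le_power not_le)
    then have nw2: "norm (w t ^ 2) < 1" by (simp add: norm_power power_less_one_iff)
    have w0: "w t \<noteq> 0" by (simp add: w_def)
    have "(\<lambda>j. of_real (2 / pi) * w t ^ 3 * (of_real (pi / 2 * q_coeff (Suc j)) * (w t ^ 2) ^ j)) sums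
       (of_real (2 / pi) * w t ^ 3 * stieltjes (w t ^ 2))"
      by (intro sums_mult stieltjes_series nw2)
    \<comment> \<open>The shift of index, q_(j+1) next to w^(2j+3), is why q_0 stands apart and why
      w times \<open>stieltjes\<close> of w^2 gives the rest after division by w^2.\<close>
    moreover have "of_real (2 / pi) * w t ^ 3 * (of_real (pi / 2 * q_coeff (Suc j)) * (w t ^ 2) ^ j) =
        of_real (q_coeff (Suc j)) * w t ^ (2 * Suc j + 1)" for j
    proof -
      have "2 * Suc j + 1 = 3 + 2 * j" by simp
      then have "w t ^ (2 * Suc j + 1) = w t ^ 3 * (w t ^ 2) ^ j"
        by (simp only: power_add power_mult)
      moreover have "complex_of_real (2 / pi) * of_real (pi / 2 * q_coeff (Suc j)) = of_real (q_coeff (Suc j))"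
        by simp
      ultimately show ?thesis by (simp only: mult.assoc[symmetric] mult.commute[of _ "w t ^ 3"]) (simp only: ac_simps)
    qed
    ultimately have "(\<lambda>j. of_real (q_coeff (Suc j)) * w t ^ (2 * Suc j + 1)) sums
       (of_real (2 / pi) * w t ^ 3 * stieltjes (w t ^ 2))" by (simp only:)
    then have "(\<lambda>n. of_real (q_coeff n) * w t ^ (2 * n + 1)) sums
       (of_real (2 / pi) * w t ^ 3 * stieltjes (w t ^ 2) + of_real (q_coeff 0) * w t ^ (2 * 0 + 1))"
      by (subst (asm) sums_Suc_iff) simp
    from sums_unique2[OF this] r(2)[OF ts tr(1)] have "(of_real (2 / pi) * w t ^ 3 * stieltjes (w t ^ 2) + of_real (q_coeff 0) * w t ^ (2 * 0 + 1))
        = 3 * w t ^ 2 * (sinh t / (cosh t - 1))"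
      unfolding w_def by blast
    also have "(of_real (2 / pi) * w t ^ 3 * stieltjes (w t ^ 2) + of_real (q_coeff 0) * w t ^ (2 * 0 + 1)) = w t ^ 2 * H t"
      using w0 by (simp add: H_def distrib_left power2_eq_square power3_eq_cube)
    finally have "w t ^ 2 * F t = w t ^ 2 * H t" by (simp add: F_def)
    then show ?thesis using w0 by simp
  qed
  have wh: "w holomorphic_on quarter_strip"
    unfolding w_def by (intro holomorphic_intros holomorphic_on_subset[OF lam_holomorphic quarter_strip_slit])
  have "F t = H t"
  proof (rule analytic_continuation_open[of U quarter_strip F H])
    show "open U" unfolding U_def by (intro open_Int open_quarter_strip open_ball)
    define s where "s = min (min r r2) 1 / 2"
    have s: "0 < s" "s < 1" "2 * s \<le> min r r2" using r(1) r2(1) by (auto simp: s_def)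
    have "norm (Complex (s / 2) (s / 2)) < min r r2"
      using cmod_le[of "Complex (s / 2) (s / 2)"] s by simp
    then have "Complex (s / 2) (s / 2) \<in> U" using s pi_gt3 by (auto simp: U_def quarter_strip_def)
    then show "U \<noteq> {}" by blast
    show "connected quarter_strip" by (rule convex_connected[OF convex_quarter_strip])
    show "F holomorphic_on quarter_strip"
      unfolding F_def sinh_field_def cosh_field_def
      using cosh_neq_1_quarter_strip by (intro holomorphic_intros) (auto simp: cosh_field_def)
    show "H holomorphic_on quarter_strip"
      unfolding H_def
      by (intro holomorphic_intros wh holomorphic_on_compose_gen[of "\<lambda>t. w t ^ 2" _ stieltjes "- \<real>\<^sub>\<le>\<^sub>0", unfolded o_def] stieltjes_holomorphic)
        (use exp_lam_sq_quarter_strip in \<open>auto simp: w_def\<close>)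
  qed (use eqU t open_quarter_strip in \<open>auto simp: U_def\<close>)
  then show ?thesis by (simp add: F_def H_def w_def)
qed

text \<open>w^3 is negative, so 3 Im \<open>lam\<close> is an odd multiple of pi; the only one in
  the range known for the half strip is pi itself.\<close>

lemma exp_lam_steepest:
  assumes t: "t \<in> quarter_strip" and u: "sinh t - t = - of_real u" "u > 0"
  shows "exp (lam t) = of_real (u powr (1 / 3)) * cis (pi / 3)"
proof -
  have e: "exp (3 * lam t) = - of_real u" using exp_3_lam quarter_strip_slit t u by auto
  have "exp (3 * Re (lam t)) = u" using arg_cong[OF e, of norm] u by simp
  then have re: "exp (Re (lam t)) = u powr (1 / 3)" 
  proof -
    have "ln u = 3 * Re (lam t)" using \<open>exp (3 * Re (lam t)) = u\<close> by auto
    then show ?thesis using u by (simp add: powr_def)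
  qed
  have cs: "cos (3 * Im (lam t)) < 0" "sin (3 * Im (lam t)) = 0"
    using arg_cong[OF e, of Re] arg_cong[OF e, of Im] u by (auto simp: Re_exp Im_exp) (metis exp_gt_zero less_le mult_less_0_iff neg_less_0_iff_less not_less_iff_gr_or_eq)
  have "sin (3 * Im (lam t) - pi) = 0" using cs by simp
  have "3 * Im (lam t) = pi"
  proof (rule ccontr)
    assume ne: "3 * Im (lam t) \<noteq> pi"
    have "\<not> (- pi < 3 * Im (lam t) - pi \<and> 3 * Im (lam t) - pi < pi)"
      using sin_eq_0_pi[of "3 * Im (lam t) - pi"] cs ne by auto
    then have "- pi / 2 < 3 * Im (lam t) \<and> 3 * Im (lam t) \<le> 0"
      using Im_lam_quarter_strip[OF t] pi_gt_zero by linarith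
    then have "cos (3 * Im (lam t)) \<ge> 0" by (intro cos_ge_zero) auto
    then show False using cs by simp
  qed
  then have im: "Im (lam t) = pi / 3" by simp
  have "exp (lam t) = of_real (exp (Re (lam t))) * cis (Im (lam t))" by (rule exp_eq_polar)
  then show ?thesis by (simp only: re im)
qed

subsection \<open>Hankel's integral\<close>

lemma gamma_integral_scaled:
  fixes a b :: real
  assumes a: "a > 0" and b: "b > 0"
  shows "set_integrable lborel {0<..} (\<lambda>u. u powr (a - 1) * exp (- b * u))"
    and "(LBINT u:{0<..}. u powr (a - 1) * exp (- b * u)) = Gamma a / b powr a"
proof -
  define f where "f = (\<lambda>t. ennreal (indicator {0..} t * t powr (a - 1) / exp t))"
  have "(\<integral>\<^sup>+ t. f t \<partial>lborel) = ennreal (Gamma a)"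
    unfolding f_def by (rule Gamma_conv_nn_integral_real[OF a, symmetric])
  moreover have "(\<integral>\<^sup>+ t. f t \<partial>lborel) = ennreal \<bar>b\<bar> * (\<integral>\<^sup>+ u. f (0 + b * u) \<partial>lborel)"
    using b unfolding f_def by (intro nn_integral_real_affine) auto
  moreover have "(\<integral>\<^sup>+ u. f (0 + b * u) \<partial>lborel) =
      (\<integral>\<^sup>+ u. ennreal (b powr (a - 1)) * ennreal (indicator {0<..} u * (u powr (a - 1) * exp (- b * u))) \<partial>lborel)"
  proof (rule nn_integral_cong)
    fix u :: real
    show "f (0 + b * u) = ennreal (b powr (a - 1)) * ennreal (indicator {0<..} u * (u powr (a - 1) * exp (- b * u)))"
      using b by (cases "u > 0") (auto simp: f_def indicator_def powr_mult exp_minus divide_inverse ennreal_mult''[symmetric] zero_le_mult_iff mult.assoc)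
  qed
  moreover have "\<dots> = ennreal (b powr (a - 1)) * (\<integral>\<^sup>+ u. ennreal (indicator {0<..} u * (u powr (a - 1) * exp (- b * u))) \<partial>lborel)"
    by (rule nn_integral_cmult) measurable
  ultimately have e: "ennreal (Gamma a) = ennreal b * (ennreal (b powr (a - 1)) * (\<integral>\<^sup>+ u. ennreal (indicator {0<..} u * (u powr (a - 1) * exp (- b * u))) \<partial>lborel))"
    using b by simp
  have bb: "ennreal b * ennreal (b powr (a - 1)) = ennreal (b powr a)"
    using b by (simp add: ennreal_mult''[symmetric] powr_diff)
  have nn: "(\<integral>\<^sup>+ u. ennreal (indicator {0<..} u * (u powr (a - 1) * exp (- b * u))) \<partial>lborel) = ennreal (Gamma a / b powr a)" (is "?I = _")
  proof -
    have "ennreal (b powr a) * ?I = ennreal (Gamma a)" using e bb by (simp add: mult.assoc[symmetric])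
    then have "inverse (ennreal (b powr a)) * (ennreal (b powr a) * ?I) = inverse (ennreal (b powr a)) * ennreal (Gamma a)" by simp
    moreover have "inverse (ennreal (b powr a)) * ennreal (b powr a) = 1"
      using b by (simp add: inverse_ennreal ennreal_mult''[symmetric])
    ultimately have "?I = inverse (ennreal (b powr a)) * ennreal (Gamma a)" by (simp add: mult.assoc[symmetric])
    also have "\<dots> = ennreal (Gamma a / b powr a)"
      using b a by (simp add: inverse_ennreal ennreal_mult''[symmetric] divide_inverse mult.commute)
    finally show ?thesis .
  qed
  have nn0: "AE u in lborel. 0 \<le> indicator {0<..} u * (u powr (a - 1) * exp (- b * u))"
    by (intro AE_I2) (auto simp: indicator_def)
  have pos: "0 \<le> Gamma a / b powr a" using a b by (simp add: Gamma_real_pos less_imp_le)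
  have m: "(\<lambda>u. indicator {0<..} u * (u powr (a - 1) * exp (- b * u))) \<in> borel_measurable lborel" by measurable
  show "set_integrable lborel {0<..} (\<lambda>u. u powr (a - 1) * exp (- b * u))"
    unfolding set_integrable_def using integrableI_nn_integral_finite[OF m nn0 nn] by simp
  show "(LBINT u:{0<..}. u powr (a - 1) * exp (- b * u)) = Gamma a / b powr a"
    unfolding set_lebesgue_integral_def using integral_eq_nn_integral[OF m nn0] nn pos by simp
qed

text \<open>The integrand e^z z^(-s) dz of Hankel's formula for 1/Gamma(s) after the substitution z
  = b e^t, up to the factor b^(1-s). The loop around the negative axis becomes the boundary of a
  half strip of width 2*pi.\<close>

definition hankel_kernel :: "real \<Rightarrow> real \<Rightarrow> complex \<Rightarrow> complex" where
  "hankel_kernel b s t = exp (of_real b * exp t - of_real (s - 1) * t)"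

lemma hankel_kernel_primitive: "\<exists>G. \<forall>t. (G has_field_derivative hankel_kernel b s t) (at t)"
proof -
  have "hankel_kernel b s holomorphic_on UNIV" unfolding hankel_kernel_def by (intro holomorphic_intros)
  from holomorphic_convex_primitive'[OF convex_UNIV open_UNIV this] show ?thesis by auto
qed

text \<open>Integrals along the contour from \<open>\<infinity> - pi * \<i>\<close> to \<open>\<infinity> + pi * \<i>\<close> are limits of differences of
  primitives.\<close>

definition edge_diff :: "(complex \<Rightarrow> complex) \<Rightarrow> real \<Rightarrow> complex" where
  "edge_diff G x = G (Complex x pi) - G (Complex x (- pi))"

lemma edge_diff_unique:
  assumes "\<And>t. (G has_field_derivative f t) (at t)" "\<And>t. (H has_field_derivative f t) (at t)"
  shows "edge_diff G = edge_diff H"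
proof -
  have "\<exists>c. \<forall>x\<in>UNIV. G x - H x = c"
    by (rule has_field_derivative_zero_constant) (use DERIV_diff[OF assms] in auto)
  then obtain c where "\<And>x. G x - H x = c" by auto
  then have "G x = H x + c" for x by (metis diff_add_cancel add.commute)
  then show ?thesis by (simp add: edge_diff_def fun_eq_iff)
qed

lemma edge_diff_derivative:
  assumes "\<And>t. (G has_field_derivative f t) (at t)"
  shows "(edge_diff G has_vector_derivative f (Complex x pi) - f (Complex x (- pi))) (at x)"
proof -
  have "((\<lambda>x. Complex x c) has_vector_derivative 1) (at x)" for c
    unfolding has_vector_derivative_complex_iff by (auto intro!: derivative_eq_intros)
  from field_vector_diff_chain_at[OF this assms]
  have "((G \<circ> (\<lambda>x. Complex x c)) has_vector_derivative 1 * f (Complex x c)) (at x)" for c .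
  then show ?thesis unfolding edge_diff_def[abs_def] o_def
    by (intro has_vector_derivative_diff) auto
qed

lemma edge_diff_norm_bound:
  assumes "\<And>t. (G has_field_derivative f t) (at t)"
    and "\<And>t. Re t = x \<Longrightarrow> \<bar>Im t\<bar> \<le> pi \<Longrightarrow> norm (f t) \<le> B"
  shows "norm (edge_diff G x) \<le> 2 * pi * B"
proof -
  define S where "S = {t. Re t = x \<and> \<bar>Im t\<bar> \<le> pi}"
  have "S = {t. Re t \<le> x} \<inter> {t. Re t \<ge> x} \<inter> {t. Im t \<ge> - pi} \<inter> {t. Im t \<le> pi}" by (auto simp: S_def)
  then have cS: "convex S" by (simp add: convex_Int convex_halfspace_Re_le convex_halfspace_Re_ge convex_halfspace_Im_le convex_halfspace_Im_ge)
  have "norm (G (Complex x pi) - G (Complex x (- pi))) \<le> B * norm (Complex x pi - Complex x (- pi))"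
  proof (rule field_differentiable_bound[OF cS])
    show "(G has_field_derivative f t) (at t within S)" for t
      by (rule has_field_derivative_at_within[OF assms(1)])
  qed (use assms(2) in \<open>auto simp: S_def\<close>)
  also have "Complex x pi - Complex x (- pi) = \<i> * of_real (2 * pi)" by (simp add: complex_eq_iff)
  also have "norm \<dots> = 2 * pi" by (simp add: norm_mult)
  finally show ?thesis by (simp add: edge_diff_def mult.commute)
qed

text \<open>For s < 1 the kernel decays towards Re t = -infinity, so the contour collapses onto the
  two lines Im t = pi and Im t = -pi. Their difference is 2 i sin(pi s) times the integral for
  Gamma(1 - s), and the reflection formula turns this into 1/Gamma(s).\<close>

lemma hankel_base:
  assumes b: "b > 0" and s: "0 < s" "s < 1" and G: "\<And>t. (G has_field_derivative hankel_kernel b s t) (at t)"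
  shows "(edge_diff G \<longlongrightarrow> 2 * of_real pi * \<i> * of_real (b powr (s - 1)) * rGamma (of_real s)) at_top"
proof -
  define c where "c = 2 * \<i> * of_real (sin (pi * s))"
  have sp: "sin (pi * s) > 0" using s by (intro sin_gt_zero) (auto simp: mult_less_cancel_left1)
  have d: "(edge_diff G has_vector_derivative c * of_real (exp ((1 - s) * x - b * exp x))) (at x)" for x
  proof -
    have e: "exp (Complex x pi) = - of_real (exp x)" "exp (Complex x (- pi)) = - of_real (exp x)"
      by (simp_all add: complex_eq_iff Re_exp Im_exp)
    have "hankel_kernel b s (Complex x pi) - hankel_kernel b s (Complex x (- pi)) = c * of_real (exp ((1 - s) * x - b * exp x))"
      unfolding hankel_kernel_def e
      by (simp add: complex_eq_iff Re_exp Im_exp c_def algebra_simps sin_diff)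
    then show ?thesis using edge_diff_derivative[OF G, of x] by simp
  qed
  \<comment> \<open>With q = e^x the difference of the two edges becomes an ordinary Laplace
    integral of a power of q over the positive half line.\<close>
  define F where "F = (\<lambda>q. edge_diff G (ln q) / c)"
  have c0: "c \<noteq> 0" using sp by (simp add: c_def)
  have dF: "(F has_vector_derivative of_real (q powr ((1 - s) - 1) * exp (- b * q))) (at q)" if q: "q > 0" for q
  proof -
    have "((edge_diff G \<circ> ln) has_vector_derivative (1 / q) *\<^sub>R (c * of_real (exp ((1 - s) * ln q - b * exp (ln q))))) (at q)"
      by (rule vector_diff_chain_at[OF _ d])
        (use q in \<open>auto intro!: derivative_eq_intros simp: has_real_derivative_iff_has_vector_derivative[symmetric]\<close>)
    then have "(F has_vector_derivative ((1 / q) *\<^sub>R (c * of_real (exp ((1 - s) * ln q - b * exp (ln q))))) / c) (at q)"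
      unfolding F_def o_def by (intro has_vector_derivative_divide)
    also have "((1 / q) *\<^sub>R (c * of_real (exp ((1 - s) * ln q - b * exp (ln q))))) / c
        = of_real (q powr ((1 - s) - 1) * exp (- b * q))"
    proof -
      have "exp ((1 - s) * ln q - b * exp (ln q)) = q powr (1 - s) * exp (- b * q)"
        using q by (simp add: exp_diff exp_minus powr_def divide_inverse)
      also have "q powr (1 - s) = q * q powr ((1 - s) - 1)"
        using q by (simp add: powr_mult_base)
      finally show ?thesis using c0 q by (simp add: scaleR_conv_of_real)
    qed
    finally show ?thesis .
  qed
  \<comment> \<open>On the segment at abscissa x \<le> 0 the kernel is at most e^b e^((1-s)x); this
    is where s < 1 enters.\<close>
  have lim0: "(edge_diff G \<longlongrightarrow> 0) at_bot"
  proof (rule Lim_null_comparison)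
    show "eventually (\<lambda>x. norm (edge_diff G x) \<le> 2 * pi * (exp b * exp ((1 - s) * x))) at_bot"
      using eventually_le_at_bot[of 0]
    proof eventually_elim
      case (elim x)
      show ?case
      proof (rule edge_diff_norm_bound[OF G])
        fix t assume t: "Re t = x" "\<bar>Im t\<bar> \<le> pi"
        have "norm (hankel_kernel b s t) = exp (b * (exp x * cos (Im t)) + (1 - s) * x)"
          using t by (simp add: hankel_kernel_def Re_exp algebra_simps)
        also have "exp x * cos (Im t) \<le> exp x * 1" by (intro mult_left_mono) auto
        then have "exp x * cos (Im t) \<le> 1" using elim by (simp add: order_trans[of _ "exp x" 1])
        then have "exp (b * (exp x * cos (Im t)) + (1 - s) * x) \<le> exp (b + (1 - s) * x)"
          using b by (simp add: mult_left_le)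
        finally show "norm (hankel_kernel b s t) \<le> exp b * exp ((1 - s) * x)" by (simp add: exp_add)
      qed
    qed
    have "((\<lambda>x. exp ((1 - s) * x)) \<longlongrightarrow> 0) at_bot"
    proof -
      have "filterlim (\<lambda>x. (1 - s) * x) at_bot at_bot"
        using s by (intro filterlim_tendsto_pos_mult_at_bot[OF tendsto_const _ filterlim_ident]) auto
      then show ?thesis by (rule filterlim_compose[OF exp_at_bot])
    qed
    then show "((\<lambda>x. 2 * pi * (exp b * exp ((1 - s) * x))) \<longlongrightarrow> 0) at_bot"
      by (intro tendsto_mult_right_zero)
  qed
  have F0: "(F \<longlongrightarrow> 0) (at_right 0)"
  proof -
    have "((\<lambda>q. edge_diff G (ln q)) \<longlongrightarrow> 0) (at_right 0)"
      by (rule filterlim_compose[OF lim0 ln_at_0])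
    then show ?thesis unfolding F_def by (intro tendsto_divide_zero)
  qed
  define \<phi> where "\<phi> = (\<lambda>q. q powr ((1 - s) - 1) * exp (- b * q))"
  have gi: "set_integrable lborel {0<..} \<phi>" "(LBINT u:{0<..}. \<phi> u) = Gamma (1 - s) / b powr (1 - s)"
    using gamma_integral_scaled[of "1 - s" b] s b unfolding \<phi>_def by auto
  have FX: "F X = of_real (LBINT u:{0<..<X}. \<phi> u)" if X: "X > 0" for X
  proof -
    have ei: "einterval 0 (ereal X) = {0<..<X}" by (auto simp: einterval_def)
    have si: "set_integrable lborel {0<..<X} \<phi>"
      by (rule set_integrable_subset[OF gi(1)]) auto
    have "(LBINT x=0..ereal X. complex_of_real (\<phi> x)) = F X - 0"
    proof (rule interval_integral_FTC_integrable)
      show "set_integrable lborel (einterval 0 (ereal X)) (\<lambda>x. complex_of_real (\<phi> x))"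
      proof -
        have "(\<lambda>x. indicator {0<..<X} x *\<^sub>R complex_of_real (\<phi> x)) = (\<lambda>x. of_real (indicator {0<..<X} x *\<^sub>R \<phi> x))"
          by (simp add: scaleR_conv_of_real)
        then show ?thesis unfolding ei using si unfolding set_integrable_def by (simp only: integrable_of_real)
      qed
      show "((F \<circ> real_of_ereal) \<longlongrightarrow> 0) (at_right 0)"
        unfolding zero_ereal_def ereal_tendsto_simps1 by (rule F0)
      have "isCont F X" using has_vector_derivative_continuous[OF dF[OF X]] .
      then show "((F \<circ> real_of_ereal) \<longlongrightarrow> F X) (at_left (ereal X))"
        unfolding ereal_tendsto_simps1 by (auto simp: isCont_def intro: tendsto_within_subset)
      show "(F has_vector_derivative complex_of_real (\<phi> x)) (at x)" if "0 < ereal x" "ereal x < ereal X" for x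
        using dF that by (simp add: \<phi>_def)
      show "isCont (\<lambda>x. complex_of_real (\<phi> x)) x" if "0 < ereal x" "ereal x < ereal X" for x
        using that unfolding \<phi>_def by (intro continuous_intros) auto
    qed (use X in auto)
    then show ?thesis using X by (simp add: interval_lebesgue_integral_def ei set_integral_complex_of_real)
  qed
  have "((\<lambda>X. LBINT u:{0<..<X}. \<phi> u) \<longlongrightarrow> (LBINT u:{0<..}. \<phi> u)) at_top"
  proof -
    have "((\<lambda>X. \<integral>u. indicator {0<..<X} u *\<^sub>R \<phi> u \<partial>lborel) \<longlongrightarrow> (\<integral>u. indicator {0<..} u *\<^sub>R \<phi> u \<partial>lborel)) at_top"
    proof (rule integral_dominated_convergence_at_top)
      show "integrable lborel (\<lambda>u. norm (indicator {0<..} u *\<^sub>R \<phi> u))"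
        using gi(1) unfolding set_integrable_def by (rule integrable_norm)
      show "AE u in lborel. ((\<lambda>X. indicator {0<..<X} u *\<^sub>R \<phi> u) \<longlongrightarrow> indicator {0<..} u *\<^sub>R \<phi> u) at_top"
      proof (intro AE_I2 tendsto_eventually)
        fix u
        show "eventually (\<lambda>X. indicator {0<..<X} u *\<^sub>R \<phi> u = indicator {0<..} u *\<^sub>R \<phi> u) at_top"
          using eventually_gt_at_top[of u] by eventually_elim (auto simp: indicator_def)
      qed
      show "\<forall>\<^sub>F X in at_top. AE u in lborel. norm (indicator {0<..<X} u *\<^sub>R \<phi> u) \<le> norm (indicator {0<..} u *\<^sub>R \<phi> u)"
        by (intro always_eventually allI AE_I2) (auto simp: indicator_def)
    qed (auto simp: \<phi>_def)
    then show ?thesis by (simp add: set_lebesgue_integral_def)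
  qed
  then have "((\<lambda>X. complex_of_real (LBINT u:{0<..<X}. \<phi> u)) \<longlongrightarrow> of_real (Gamma (1 - s) / b powr (1 - s))) at_top"
    unfolding gi(2) by (intro tendsto_of_real)
  then have "(F \<longlongrightarrow> of_real (Gamma (1 - s) / b powr (1 - s))) at_top"
  proof (rule Lim_transform_eventually)
    show "\<forall>\<^sub>F X in at_top. complex_of_real (LBINT u:{0<..<X}. \<phi> u) = F X"
      using eventually_gt_at_top[of 0] by eventually_elim (simp add: FX)
  qed
  then have "((\<lambda>x. F (exp x)) \<longlongrightarrow> of_real (Gamma (1 - s) / b powr (1 - s))) at_top"
    by (rule filterlim_compose[OF _ exp_at_top])
  then have "((\<lambda>x. F (exp x) * c) \<longlongrightarrow> of_real (Gamma (1 - s) / b powr (1 - s)) * c) at_top"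
    by (intro tendsto_mult_right)
  moreover have "F (exp x) * c = edge_diff G x" for x using c0 by (simp add: F_def)
  moreover have "of_real (Gamma (1 - s) / b powr (1 - s)) * c = 2 * of_real pi * \<i> * of_real (b powr (s - 1)) * rGamma (of_real s)"
  proof -
    have "rGamma s * rGamma (1 - s) = sin (pi * s) / pi"
    proof -
      have "rGamma (complex_of_real s) * rGamma (1 - of_real s) = sin (of_real pi * of_real s) / of_real pi"
        by (rule rGamma_reflection_complex)
      then have "complex_of_real (rGamma s * rGamma (1 - s)) = of_real (sin (pi * s) / pi)"
        by (simp add: rGamma_complex_of_real[symmetric] sin_of_real[symmetric])
      then show ?thesis by (simp only: of_real_eq_iff)
    qed
    moreover have "Gamma (1 - s) > 0" using s by (intro Gamma_real_pos) auto
    ultimately have "sin (pi * s) * Gamma (1 - s) = pi * rGamma s"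
      by (simp add: rGamma_inverse_Gamma[of "1 - s"] field_simps)
    moreover have "b powr (s - 1) = 1 / b powr (1 - s)" using b by (simp add: powr_minus_divide[symmetric])
    ultimately have "Gamma (1 - s) / b powr (1 - s) * (2 * sin (pi * s)) = 2 * pi * b powr (s - 1) * rGamma s"
      by (simp add: field_simps)
    then have "complex_of_real (Gamma (1 - s) / b powr (1 - s) * (2 * sin (pi * s))) = of_real (2 * pi * b powr (s - 1) * rGamma s)"
      by simp
    moreover have "of_real (Gamma (1 - s) / b powr (1 - s)) * c =
        \<i> * complex_of_real (Gamma (1 - s) / b powr (1 - s) * (2 * sin (pi * s)))" by (simp add: c_def)
    ultimately have "of_real (Gamma (1 - s) / b powr (1 - s)) * c = \<i> * of_real (2 * pi * b powr (s - 1) * rGamma s)"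
      by (simp only:)
    then show ?thesis by (simp add: rGamma_complex_of_real)
  qed
  ultimately show ?thesis by simp
qed

text \<open>The derivative of exp(b e^t - r t) is b times the kernel of order r minus r times the
  kernel of order r + 1. The boundary term vanishes at infinity, which reproduces the functional
  equation of 1/Gamma.\<close>

lemma hankel_integral:
  assumes b: "b > 0" and s: "0 < s" "s < 1" and G: "\<And>t. (G has_field_derivative hankel_kernel b (s + real j) t) (at t)"
  shows "(edge_diff G \<longlongrightarrow> 2 * of_real pi * \<i> * of_real (b powr (s + real j - 1)) * rGamma (of_real (s + real j))) at_top"
  using G
proof (induction j arbitrary: G)
  case 0
  then show ?case using hankel_base[OF b s] by simp
next
  case (Suc j)
  define r where "r = s + real j"
  have r: "r > 0" using s by (simp add: r_def)
  obtain G0 where G0: "\<And>t. (G0 has_field_derivative hankel_kernel b r t) (at t)"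
    using hankel_kernel_primitive by blast
  define e :: "complex \<Rightarrow> complex" where "e = (\<lambda>t. exp (of_real b * exp t - of_real r * t))"
  define H where "H = (\<lambda>t. (of_real b * G0 t - e t) / of_real r)"
  have H: "(H has_field_derivative hankel_kernel b (s + real (Suc j)) t) (at t)" for t
  proof -
    have "(e has_field_derivative (of_real b * exp t - of_real r) * e t) (at t)"
      unfolding e_def by (auto intro!: derivative_eq_intros simp: algebra_simps)
    then have "(H has_field_derivative (of_real b * hankel_kernel b r t - (of_real b * exp t - of_real r) * e t) / of_real r) (at t)"
      unfolding H_def by (intro DERIV_cdivide DERIV_diff DERIV_cmult G0)
    moreover have "hankel_kernel b r t = exp t * e t"
      by (simp add: hankel_kernel_def e_def exp_add[symmetric] algebra_simps)
    moreover have "hankel_kernel b (s + real (Suc j)) t = e t"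
      by (simp add: hankel_kernel_def e_def r_def algebra_simps)
    ultimately show ?thesis using r by (simp add: field_simps)
  qed
  have ee: "edge_diff e x = exp (- b * exp x - r * x) * (- 2 * \<i> * of_real (sin (r * pi)))" for x
    by (simp add: edge_diff_def e_def complex_eq_iff Re_exp Im_exp cos_diff sin_diff)
  have "((\<lambda>x. exp (- b * exp x - r * x)) \<longlongrightarrow> 0) at_top"
    using b r by real_asymp
  then have "((\<lambda>x. complex_of_real (exp (- b * exp x - r * x)) * (- 2 * \<i> * of_real (sin (r * pi)))) \<longlongrightarrow> of_real 0 * (- 2 * \<i> * of_real (sin (r * pi)))) at_top"
    by (intro tendsto_intros)
  then have "(edge_diff e \<longlongrightarrow> 0) at_top" by (simp add: ee[abs_def] exp_of_real[symmetric])
  then have "((\<lambda>x. (of_real b * edge_diff G0 x - edge_diff e x) / of_real r) \<longlongrightarrow>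
      (of_real b * (2 * of_real pi * \<i> * of_real (b powr (r - 1)) * rGamma (of_real r)) - 0) / of_real r) at_top"
    using Suc.IH[OF G0[unfolded r_def], folded r_def] r by (intro tendsto_intros) auto
  moreover have "(of_real b * edge_diff G0 x - edge_diff e x) / of_real r = edge_diff H x" for x
    by (simp add: edge_diff_def H_def diff_divide_distrib right_diff_distrib)
  moreover have "edge_diff H = edge_diff G" by (rule edge_diff_unique[OF H Suc.prems])
  moreover have "(of_real b * (2 * of_real pi * \<i> * of_real (b powr (r - 1)) * rGamma (of_real r)) - 0) / of_real r
      = 2 * of_real pi * \<i> * of_real (b powr (s + real (Suc j) - 1)) * rGamma (of_real (s + real (Suc j)))"
  proof -
    have "rGamma (of_real r) = of_real r * rGamma (of_real (s + real (Suc j)) :: complex)"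
      using rGamma_plus1[of "complex_of_real r"] by (simp add: r_def add_ac)
    moreover have "b powr (s + real (Suc j) - 1) = b * b powr (r - 1)"
      using b by (simp add: powr_mult_base r_def algebra_simps)
    ultimately show ?thesis using r by (simp add: field_simps)
  qed
  ultimately show ?case by simp
qed

section \<open>Exchange of sum and limit in Schlaefli's integral\<close>

lemma exp_tail_bound:
  fixes z :: complex assumes "norm z \<le> b"
  shows "norm (exp z - (\<Sum>k<n. z ^ k / fact k)) \<le> exp b - (\<Sum>k<n. b ^ k / fact k)"
proof -
  have s: "(\<lambda>k. z ^ k / fact k) sums exp z" and sb: "(\<lambda>k. b ^ k / fact k) sums exp b"
    using exp_converges[of z] exp_converges[of b] by (simp_all add: scaleR_conv_of_real divide_inverse mult.commute)
  have 1: "(\<lambda>k. z ^ (k + n) / fact (k + n)) sums (exp z - (\<Sum>k<n. z ^ k / fact k))"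
    using s by (subst sums_iff_shift) simp
  have 2: "(\<lambda>k. b ^ (k + n) / fact (k + n)) sums (exp b - (\<Sum>k<n. b ^ k / fact k))"
    using sb by (subst sums_iff_shift) simp
  have 3: "norm (z ^ (k + n) / fact (k + n)) \<le> b ^ (k + n) / fact (k + n)" for k
    using assms by (simp add: norm_divide norm_power power_mono divide_right_mono)
  show ?thesis
    using norm_suminf_le[OF 3 sums_summable[OF 2]] sums_unique[OF 1] sums_unique[OF 2] by simp
qed

text \<open>The bound does not depend on x: it collects the segment at Re t = 0 and the two edges,
  over which e^x exp(-b e^x) has integral at most 1/b. Such uniformity permits the exchange of the
  limit x -> infinity with the summation.\<close>

lemma edge_diff_bound:
  fixes f :: "complex \<Rightarrow> complex"
  assumes G: "\<And>t. (G has_field_derivative f t) (at t)" and b: "b > 0" and e: "e \<ge> 0" and x: "x > 0"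
    and v: "\<And>t. Re t = 0 \<Longrightarrow> \<bar>Im t\<bar> \<le> pi \<Longrightarrow> norm (f t) \<le> e * exp b"
    and h: "\<And>x. x \<ge> 0 \<Longrightarrow> norm (f (Complex x pi)) \<le> e * (exp x * exp (- b * exp x))"
      "\<And>x. x \<ge> 0 \<Longrightarrow> norm (f (Complex x (- pi))) \<le> e * (exp x * exp (- b * exp x))"
  shows "norm (edge_diff G x) \<le> e * (2 * pi * exp b + 2 / b)"
proof -
  define \<phi> where "\<phi> = (\<lambda>x. - 2 * e * exp (- b * exp x) / b)"
  have d\<phi>: "(\<phi> has_real_derivative 2 * e * (exp x * exp (- b * exp x))) (at x)" for x
    unfolding \<phi>_def using b by (auto intro!: derivative_eq_intros simp: field_simps)
  have "norm (edge_diff G x - edge_diff G 0) \<le> \<phi> x - \<phi> 0"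
  proof (rule differentiable_bound_general[OF x])
    show "continuous_on {0..x} (edge_diff G)"
      using edge_diff_derivative[OF G] has_vector_derivative_continuous by (intro continuous_at_imp_continuous_on) blast
    show "continuous_on {0..x} \<phi>" using d\<phi> DERIV_isCont by (intro continuous_at_imp_continuous_on) blast
    show "(\<phi> has_vector_derivative 2 * e * (exp y * exp (- b * exp y))) (at y)" for y
      using d\<phi> by (simp add: has_real_derivative_iff_has_vector_derivative)
    show "(edge_diff G has_vector_derivative f (Complex y pi) - f (Complex y (- pi))) (at y)" for y
      by (rule edge_diff_derivative[OF G])
    show "norm (f (Complex y pi) - f (Complex y (- pi))) \<le> 2 * e * (exp y * exp (- b * exp y))" if "0 < y" for y
      using norm_triangle_ineq4[of "f (Complex y pi)" "f (Complex y (- pi))"] h[of y] that by linarith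
  qed
  moreover have "\<phi> x - \<phi> 0 \<le> e * (2 / b)"
  proof -
    have "\<phi> x \<le> 0" using e b by (simp add: \<phi>_def divide_nonneg_pos)
    moreover have "- \<phi> 0 \<le> e * (2 / b)"
    proof -
      have "e * exp (- b) \<le> e * 1" using e b by (intro mult_left_mono) auto
      then show ?thesis using b by (simp add: \<phi>_def divide_right_mono)
    qed
    ultimately show ?thesis by linarith
  qed
  moreover have "norm (edge_diff G 0) \<le> 2 * pi * (e * exp b)"
    by (rule edge_diff_norm_bound[OF G v])
  ultimately show ?thesis
    using norm_triangle_sub[of "edge_diff G x" "edge_diff G 0"] by (simp add: algebra_simps)
qed

text \<open>The z-derivative of Schlaefli's integrand exp(z sinh t - \<nu> t), taken at z =
  \<nu>.\<close>

definition schlaefli :: "real \<Rightarrow> complex \<Rightarrow> complex" where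
  "schlaefli \<nu> t = sinh t * exp (of_real \<nu> * (sinh t - t))"

text \<open>Write exp(\<nu>(sinh t - t)) as exp(b e^t - \<nu> t) times exp(-b e^(-t)) with b =
  \<nu>/2 and expand the last factor. As sinh t = (e^t - e^(-t))/2, the k-th term is half the
  difference of the Hankel kernels of orders \<nu> + k and \<nu> + k + 2.\<close>

lemma schlaefli_sum_limit:
  assumes \<nu>: "0 < \<nu>" "\<nu> < 1" and F: "\<And>t. (F has_field_derivative schlaefli \<nu> t) (at t)"
  defines "b \<equiv> \<nu> / 2"
  assumes S: "(\<lambda>k. 1 / 2 * ((- of_real b) ^ k / fact k) *
       (of_real (b powr (\<nu> + real k - 1)) * rGamma (of_real (\<nu> + real k)) -
        of_real (b powr (\<nu> + real (k + 2) - 1)) * rGamma (of_real (\<nu> + real (k + 2))))) sums S"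
  shows "(edge_diff F \<longlongrightarrow> 2 * of_real pi * \<i> * S) at_top"
proof -
  have b: "b > 0" using \<nu> by (simp add: b_def)
  define T :: "nat \<Rightarrow> complex" where "T = (\<lambda>k. 1 / 2 * ((- of_real b) ^ k / fact k) *
       (of_real (b powr (\<nu> + real k - 1)) * rGamma (of_real (\<nu> + real k)) -
        of_real (b powr (\<nu> + real (k + 2) - 1)) * rGamma (of_real (\<nu> + real (k + 2)))))"
  define G where "G = (\<lambda>j. SOME G. \<forall>t. (G has_field_derivative hankel_kernel b (\<nu> + real j) t) (at t))"
  have G: "(G j has_field_derivative hankel_kernel b (\<nu> + real j) t) (at t)" for j t
    using someI_ex[OF hankel_kernel_primitive[of b "\<nu> + real j"]] by (simp add: G_def)
  define c :: "nat \<Rightarrow> complex" where "c = (\<lambda>k. 1 / 2 * ((- of_real b) ^ k / fact k))"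
  define P where "P = (\<lambda>n t. \<Sum>k<n. c k * (G k t - G (k + 2) t))"
  define p where "p = (\<lambda>n t. \<Sum>k<n. c k * (hankel_kernel b (\<nu> + real k) t - hankel_kernel b (\<nu> + real (k + 2)) t))"
  have Pd: "(P n has_field_derivative p n t) (at t)" for n t
    unfolding P_def p_def by (intro DERIV_sum DERIV_cmult DERIV_diff G)
  have limP: "(edge_diff (P n) \<longlongrightarrow> 2 * of_real pi * \<i> * (\<Sum>k<n. T k)) at_top" for n
  proof -
    have "((\<lambda>x. \<Sum>k<n. c k * (edge_diff (G k) x - edge_diff (G (k + 2)) x)) \<longlongrightarrow>
      (\<Sum>k<n. c k * (2 * of_real pi * \<i> * of_real (b powr (\<nu> + real k - 1)) * rGamma (of_real (\<nu> + real k)) -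
         2 * of_real pi * \<i> * of_real (b powr (\<nu> + real (k + 2) - 1)) * rGamma (of_real (\<nu> + real (k + 2)))))) at_top"
      by (intro tendsto_intros hankel_integral[OF b \<nu> G])
    moreover have "(\<Sum>k<n. c k * (edge_diff (G k) x - edge_diff (G (k + 2)) x)) = edge_diff (P n) x" for x
      by (simp add: edge_diff_def P_def sum_subtractf[symmetric] right_diff_distrib algebra_simps)
    moreover have "(\<Sum>k<n. c k * (2 * of_real pi * \<i> * of_real (b powr (\<nu> + real k - 1)) * rGamma (of_real (\<nu> + real k)) -
         2 * of_real pi * \<i> * of_real (b powr (\<nu> + real (k + 2) - 1)) * rGamma (of_real (\<nu> + real (k + 2))))) = 2 * of_real pi * \<i> * (\<Sum>k<n. T k)"
      unfolding sum_distrib_left by (intro sum.cong refl) (simp only: T_def c_def right_diff_distrib ac_simps)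
    ultimately show ?thesis by (simp only:)
  qed
  \<comment> \<open>For Re t \<ge> 0 the expanded exponent -b e^(-t) has modulus at most b, so the
    tail of the series for e^b bounds the error on the whole contour.\<close>
  define e where "e = (\<lambda>n. exp b - (\<Sum>k<n. b ^ k / fact k))"
  have e0: "e \<longlonglongrightarrow> 0"
  proof -
    have "(\<lambda>k. b ^ k / fact k) sums exp b"
      using exp_converges[of b] by (simp add: divide_inverse mult.commute)
    then have "(\<lambda>n. exp b - (\<Sum>k<n. b ^ k / fact k)) \<longlonglongrightarrow> exp b - exp b"
      unfolding sums_def by (intro tendsto_intros)
    then show ?thesis by (simp add: e_def)
  qed
  define C where "C = 2 * pi * exp b + 2 / b"
  have C: "C > 0" using b by (simp add: C_def add_pos_pos)
  have res: "norm (schlaefli \<nu> t - p n t) \<le> e n * norm (sinh t * exp (of_real b * exp t - of_real \<nu> * t))" if t: "Re t \<ge> 0" for n t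
  proof -
    define z where "z = - (of_real b * exp (- t))"
    have nz: "norm z \<le> b" using t b by (simp add: z_def norm_mult)
    have h: "hankel_kernel b (\<nu> + real k) t - hankel_kernel b (\<nu> + real (k + 2)) t
        = 2 * sinh t * exp (of_real b * exp t - of_real \<nu> * t) * exp (- t) ^ k" for k
    proof -
      have 1: "hankel_kernel b (\<nu> + real k) t = exp (of_real b * exp t - of_real \<nu> * t) * exp t * exp (- t) ^ k"
        by (simp add: hankel_kernel_def exp_of_nat_mult[symmetric] exp_add[symmetric] algebra_simps)
      have 2: "hankel_kernel b (\<nu> + real (k + 2)) t = exp (of_real b * exp t - of_real \<nu> * t) * exp (- t) * exp (- t) ^ k"
        by (simp add: hankel_kernel_def exp_of_nat_mult[symmetric] exp_add[symmetric] algebra_simps)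
      show ?thesis unfolding 1 2 sinh_field_def by (simp add: algebra_simps)
    qed
    have "p n t = (\<Sum>k<n. sinh t * exp (of_real b * exp t - of_real \<nu> * t) * (z ^ k / fact k))"
      unfolding p_def
    proof (intro sum.cong refl)
      fix k
      have "z ^ k = (- of_real b) ^ k * exp (- t) ^ k"
        unfolding z_def by (simp flip: power_mult_distrib)
      then show "c k * (hankel_kernel b (\<nu> + real k) t - hankel_kernel b (\<nu> + real (k + 2)) t) = sinh t * exp (of_real b * exp t - of_real \<nu> * t) * (z ^ k / fact k)"
        unfolding h c_def by simp
    qed
    also have "\<dots> = sinh t * exp (of_real b * exp t - of_real \<nu> * t) * (\<Sum>k<n. z ^ k / fact k)"
      by (simp add: sum_distrib_left)
    finally have p: "p n t = sinh t * exp (of_real b * exp t - of_real \<nu> * t) * (\<Sum>k<n. z ^ k / fact k)" .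
    have "of_real \<nu> * (sinh t - t) = (of_real b * exp t - of_real \<nu> * t) + z"
      by (simp add: sinh_field_def z_def b_def diff_divide_distrib right_diff_distrib)
    then have "schlaefli \<nu> t = sinh t * exp (of_real b * exp t - of_real \<nu> * t) * exp z"
      by (simp add: schlaefli_def exp_add)
    then have "norm (schlaefli \<nu> t - p n t) = norm (sinh t * exp (of_real b * exp t - of_real \<nu> * t)) * norm (exp z - (\<Sum>k<n. z ^ k / fact k))"
      unfolding p by (simp add: right_diff_distrib[symmetric] norm_mult)
    also have "\<dots> \<le> norm (sinh t * exp (of_real b * exp t - of_real \<nu> * t)) * e n"
      unfolding e_def by (intro mult_left_mono exp_tail_bound nz) auto
    finally show ?thesis by (simp add: mult.commute)
  qed
  have en: "e n \<ge> 0" for n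
    unfolding e_def by (rule order_trans[OF norm_ge_zero exp_tail_bound[of 0]]) (use b in simp)
  have bound: "norm (edge_diff F x - edge_diff (P n) x) \<le> e n * C" if x: "x > 0" for n x
  proof -
    define R where "R = (\<lambda>t. F t - P n t)"
    have Rd: "(R has_field_derivative schlaefli \<nu> t - p n t) (at t)" for t
      unfolding R_def by (intro DERIV_diff F Pd)
    \<comment> \<open>On the edges cos (Im t) = -1, so exp(b e^t) decays doubly exponentially, which
      absorbs the growth of sinh t.\<close>
    have edge: "norm (sinh t * exp (of_real b * exp t - of_real \<nu> * t)) \<le> exp r * exp (- b * exp r)"
      if t: "t = Complex r pi \<or> t = Complex r (- pi)" "r \<ge> 0" for t r
    proof -
      have rt: "Re t = r" and ct: "cos (Im t) = -1" and st: "sin (Im t) = 0" using t by auto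
      have "norm (sinh t) \<le> exp r"
      proof -
        have "sinh t = of_real (- sinh r)" using rt ct st by (simp add: complex_eq_iff Re_sinh Im_sinh)
        then have "norm (sinh t) = sinh r" using t(2) by simp
        also have "\<dots> \<le> exp r"
        proof -
          have "0 < exp r" "0 < exp (- r)" by simp_all
          then have "- exp (- r) \<le> exp r" by linarith
          then show ?thesis by (simp add: sinh_field_def)
        qed
        finally show ?thesis .
      qed
      moreover have "norm (exp (of_real b * exp t - of_real \<nu> * t)) \<le> exp (- b * exp r)"
        using rt ct \<nu> t(2) by (simp add: Re_exp)
      ultimately show ?thesis unfolding norm_mult by (intro mult_mono) auto
    qed
    have "norm (edge_diff R x) \<le> e n * C"
      unfolding C_def
    proof (rule edge_diff_bound[OF Rd b en x])
      fix t :: complex assume t: "Re t = 0" "\<bar>Im t\<bar> \<le> pi"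
      have "sinh t = \<i> * of_real (sin (Im t))" using t by (simp add: complex_eq_iff Re_sinh Im_sinh)
      then have "norm (sinh t) \<le> 1" by (simp add: norm_mult)
      moreover have "norm (exp (of_real b * exp t - of_real \<nu> * t)) \<le> exp b"
        using t b by (simp add: Re_exp mult_left_le)
      ultimately have "norm (sinh t * exp (of_real b * exp t - of_real \<nu> * t)) \<le> 1 * exp b"
        unfolding norm_mult by (intro mult_mono) auto
      from order_trans[OF res[of t n] mult_left_mono[OF this en[of n]]]
      show "norm (schlaefli \<nu> t - p n t) \<le> e n * exp b" using t by simp
    next
      fix r :: real assume r: "r \<ge> 0"
      show "norm (schlaefli \<nu> (Complex r pi) - p n (Complex r pi)) \<le> e n * (exp r * exp (- b * exp r))"
        by (rule order_trans[OF res[of _ n] mult_left_mono[OF edge en]]) (use r in auto)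
      show "norm (schlaefli \<nu> (Complex r (- pi)) - p n (Complex r (- pi))) \<le> e n * (exp r * exp (- b * exp r))"
        by (rule order_trans[OF res[of _ n] mult_left_mono[OF edge en]]) (use r in auto)
    qed
    then show ?thesis by (simp add: R_def edge_diff_def algebra_simps)
  qed
  have uni: "uniform_limit {0<..} (\<lambda>n x. edge_diff (P n) x) (edge_diff F) sequentially"
  proof (rule uniform_limitI)
    fix \<epsilon> :: real assume "\<epsilon> > 0"
    then have "eventually (\<lambda>n. e n < \<epsilon> / C) sequentially"
      using order_tendstoD(2)[OF e0, of "\<epsilon> / C"] C by simp
    then show "\<forall>\<^sub>F n in sequentially. \<forall>x\<in>{0<..}. dist (edge_diff (P n) x) (edge_diff F x) < \<epsilon>"
    proof eventually_elim
      case (elim n)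
      then have "e n * C < \<epsilon>" using C by (simp add: field_simps)
      then show ?case using bound[of _ n] by (auto simp: dist_norm norm_minus_commute intro: le_less_trans)
    qed
  qed
  have "(\<lambda>n. \<Sum>k<n. T k) \<longlonglongrightarrow> S" using S unfolding sums_def T_def .
  then have "(\<lambda>n. 2 * of_real pi * \<i> * (\<Sum>k<n. T k)) \<longlonglongrightarrow> 2 * of_real pi * \<i> * S"
    by (intro tendsto_intros)
  moreover have "eventually (\<lambda>n. (edge_diff (P n) \<longlongrightarrow> 2 * of_real pi * \<i> * (\<Sum>k<n. T k)) at_top) sequentially"
    using limP by simp
  moreover have "eventually (\<lambda>x. x \<in> {0::real<..}) at_top" using eventually_gt_at_top by auto
  ultimately show ?thesis
    by (intro swap_uniform_limit'[OF _ _ uni]) auto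
qed

subsection \<open>The derivative of the Bessel function on the diagonal\<close>

text \<open>From rGamma(u) = u rGamma(u + 1), the modulus does not increase under the shift once |u|
  \<ge> 1; the finitely many earlier shifts are bounded by compactness.\<close>

lemma rGamma_shift_locally_bounded:
  "\<exists>C. \<forall>z\<in>cball z0 1. \<forall>k. norm (rGamma (z + of_nat k :: complex)) \<le> C"
proof -
  \<comment> \<open>This choice makes Re (z + K) \<ge> 1 on the whole ball of radius 1.\<close>
  obtain K where K: "real K \<ge> 2 - Re z0" using real_arch_simple by blast
  have "\<exists>C. \<forall>z\<in>cball z0 1. norm (rGamma (z + of_nat k :: complex)) \<le> C" for k
  proof -
    have "continuous_on (cball z0 1) (\<lambda>z::complex. rGamma (z + of_nat k))"
      by (intro holomorphic_on_imp_continuous_on holomorphic_intros)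
    then have "compact ((\<lambda>z::complex. rGamma (z + of_nat k)) ` cball z0 1)"
      by (intro compact_continuous_image compact_cball)
    then have "bounded ((\<lambda>z::complex. rGamma (z + of_nat k)) ` cball z0 1)" by (rule compact_imp_bounded)
    then show ?thesis by (auto simp: bounded_iff)
  qed
  then obtain C where C: "\<And>k z. z \<in> cball z0 1 \<Longrightarrow> norm (rGamma (z + of_nat k :: complex)) \<le> C k" by metis
  have C0: "C k \<ge> 0" for k using C[of z0 k] norm_ge_zero order_trans by (metis centre_in_cball zero_le_one)
  define D where "D = (\<Sum>k\<le>K. C k)"
  have CD: "C k \<le> D" if "k \<le> K" for k
    unfolding D_def using that C0 by (intro member_le_sum) auto
  have "norm (rGamma (z + of_nat k :: complex)) \<le> D" if z: "z \<in> cball z0 1" for z k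
  proof (cases "k \<le> K")
    case True then show ?thesis using C[OF z] CD order_trans by blast
  next
    case False
    have Rz: "Re z + real K \<ge> 1"
    proof -
      have "\<bar>Re (z0 - z)\<bar> \<le> 1" using z abs_Re_le_cmod[of "z0 - z"] by (simp add: dist_norm)
      then show ?thesis using K by simp
    qed
    have "norm (rGamma (z + of_nat (K + j) :: complex)) \<le> D" for j
    proof (induction j)
      case 0 then show ?case using C[OF z, of K] CD[of K] by simp
    next
      case (Suc j)
      define u where "u = z + of_nat (K + j)"
      have "Re u \<ge> 1" using Rz by (simp add: u_def)
      then have "norm u \<ge> 1" using complex_Re_le_cmod[of u] by linarith
      then have "norm (rGamma (u + 1)) \<le> norm u * norm (rGamma (u + 1))"
        by (simp add: mult_le_cancel_right1)
      also have "\<dots> = norm (rGamma u)" by (simp add: norm_mult[symmetric] rGamma_plus1)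
      finally show ?case using Suc by (simp add: u_def add_ac)
    qed
    from this[of "k - K"] False show ?thesis by simp
  qed
  then show ?thesis by blast
qed

text \<open>Up to a power of \<nu>/2, the terms of J_(nu+m-1)(nu): m = 1 gives the function itself,
  m = 0 and m = 2 its two neighbours in the order. Freed of the power, each series is entire in
  \<nu>.\<close>

definition diag_term :: "nat \<Rightarrow> nat \<Rightarrow> complex \<Rightarrow> complex" where
  "diag_term m n \<nu> = (-1) ^ n / fact n * rGamma (\<nu> + of_nat (n + m)) * ((\<nu> / 2) ^ 2) ^ n"

definition diag_series :: "nat \<Rightarrow> complex \<Rightarrow> complex" where
  "diag_series m \<nu> = (\<Sum>n. diag_term m n \<nu>)"

lemma diag_term_uniform_bound:
  "\<exists>M. summable M \<and> (\<forall>n. \<forall>\<nu>\<in>cball z0 1. norm (diag_term m n \<nu>) \<le> M n)"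
proof -
  obtain C where C: "\<And>z k. z \<in> cball z0 1 \<Longrightarrow> norm (rGamma (z + of_nat k :: complex)) \<le> C"
    using rGamma_shift_locally_bounded by blast
  define R where "R = (norm z0 + 1) ^ 2"
  have "summable (\<lambda>n. inverse (fact n) * R ^ n)" by (rule summable_exp)
  then have "summable (\<lambda>n. C * (inverse (fact n) * R ^ n))" by (rule summable_mult)
  moreover have "norm (diag_term m n \<nu>) \<le> C * (inverse (fact n) * R ^ n)" if \<nu>: "\<nu> \<in> cball z0 1" for n \<nu>
  proof -
    have "norm \<nu> \<le> norm z0 + 1" using \<nu> norm_triangle_sub[of \<nu> z0] by (simp add: dist_norm norm_minus_commute)
    then have "norm \<nu> / 2 \<le> norm z0 + 1" using norm_ge_zero[of z0] norm_ge_zero[of \<nu>] by linarith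
    then have "norm (\<nu> / 2) \<le> norm z0 + 1" by (simp add: norm_divide)
    then have "norm ((\<nu> / 2) ^ 2) \<le> R" unfolding R_def norm_power by (intro power_mono) auto
    then have p: "norm (((\<nu> / 2) ^ 2) ^ n) \<le> R ^ n" unfolding norm_power[of "(\<nu>/2)^2" n] by (intro power_mono) auto
    have "norm (diag_term m n \<nu>) = inverse (fact n) * (norm (rGamma (\<nu> + of_nat (n + m))) * norm (((\<nu> / 2) ^ 2) ^ n))"
      unfolding diag_term_def by (simp only: norm_mult norm_divide norm_power norm_minus_cancel norm_one norm_inverse norm_fact power_one divide_inverse mult.assoc mult_1_left)
    also have "\<dots> \<le> inverse (fact n) * (C * R ^ n)"
      by (intro mult_left_mono mult_mono C \<nu> p order_trans[OF norm_ge_zero C[OF \<nu>]]) auto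
    finally show ?thesis by (simp add: mult_ac)
  qed
  ultimately show ?thesis by blast
qed

lemma diag_series_sums: "(\<lambda>n. diag_term m n \<nu>) sums diag_series m \<nu>"
proof -
  obtain M where "summable M" "\<And>n. norm (diag_term m n \<nu>) \<le> M n"
    using diag_term_uniform_bound[of \<nu> m] by (metis centre_in_cball zero_le_one)
  then have "summable (\<lambda>n. diag_term m n \<nu>)" by (rule summable_comparison_test'[of M 0])
  then show ?thesis unfolding diag_series_def by (rule summable_sums)
qed

lemma diag_series_holomorphic: "diag_series m holomorphic_on UNIV"
proof (rule holomorphic_uniform_sequence)
  show "(\<lambda>\<nu>. \<Sum>i<n. diag_term m i \<nu>) holomorphic_on UNIV" for n
    unfolding diag_term_def by (intro holomorphic_intros) auto
  fix x :: complex
  obtain M where "summable M" "\<And>n \<nu>. \<nu> \<in> cball x 1 \<Longrightarrow> norm (diag_term m n \<nu>) \<le> M n"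
    using diag_term_uniform_bound[of x m] by blast
  then have "uniform_limit (cball x 1) (\<lambda>n \<nu>. \<Sum>i<n. diag_term m i \<nu>) (\<lambda>\<nu>. \<Sum>i. diag_term m i \<nu>) sequentially"
    by (intro Weierstrass_m_test)
  then show "\<exists>d>0. cball x d \<subseteq> UNIV \<and> uniform_limit (cball x d) (\<lambda>n \<nu>. \<Sum>i<n. diag_term m i \<nu>) (diag_series m) sequentially"
    unfolding diag_series_def by (intro exI[of _ 1]) auto
qed auto

text \<open>At z = \<nu> the derivative of (z/2)^\<nu> is again (\<nu>/2)^\<nu>; the derivative of
  the power series raises the order by one and yields the series with m = 2.\<close>

lemma besselJ'_diag:
  assumes \<nu>: "\<nu> \<notin> \<real>\<^sub>\<le>\<^sub>0"
  shows "besselJ' \<nu> \<nu> = (\<nu> / 2) powr \<nu> * (diag_series 1 \<nu> - \<nu> / 2 * diag_series 2 \<nu>)"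
proof -
  define c where "c = (\<lambda>k. (-1) ^ k / fact k * rGamma (\<nu> + of_nat k + 1))"
  have \<nu>0: "\<nu> \<noteq> 0" using \<nu> by auto
  have h\<nu>: "\<nu> / 2 \<notin> \<real>\<^sub>\<le>\<^sub>0" using \<nu> by (auto simp: complex_nonpos_Reals_iff)
  have sm: "summable (\<lambda>k. c k * y ^ k)" for y
  proof -
    obtain C where C: "\<And>k. norm (rGamma (\<nu> + of_nat k :: complex)) \<le> C"
      using rGamma_shift_locally_bounded[of \<nu>] by (metis centre_in_cball zero_le_one)
    have "summable (\<lambda>n. C * (inverse (fact n) * norm y ^ n))" by (intro summable_mult summable_exp)
    then show ?thesis
    proof (rule summable_comparison_test'[of _ 0])
      fix k
      have "norm (c k * y ^ k) = norm (rGamma (\<nu> + of_nat (Suc k))) * (inverse (fact k) * norm y ^ k)"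
        unfolding c_def by (simp add: norm_mult norm_divide norm_power norm_inverse divide_inverse add_ac mult_ac)
      also have "\<dots> \<le> C * (inverse (fact k) * norm y ^ k)" by (intro mult_right_mono C) auto
      finally show "norm (c k * y ^ k) \<le> C * (inverse (fact k) * norm y ^ k)" .
    qed
  qed
  define S where "S = (\<lambda>y. \<Sum>k. c k * y ^ k)"
  have dS: "(S has_field_derivative (\<Sum>k. diffs c k * y ^ k)) (at y)" for y
    unfolding S_def by (rule termdiffs_strong_converges_everywhere[OF sm])
  have J: "besselJ \<nu> z = (z / 2) powr \<nu> * S ((z / 2) ^ 2)" for z
    unfolding besselJ_def S_def c_def power_mult by (simp only: times_divide_eq_left times_divide_eq_right ac_simps)
  have y: "S ((\<nu> / 2) ^ 2) = diag_series 1 \<nu>"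
    unfolding S_def diag_series_def diag_term_def c_def by (simp add: add_ac)
  have dd: "diffs c k * y ^ k = - ((-1) ^ k / fact k * rGamma (\<nu> + of_nat (k + 2)) * y ^ k)" for k y
  proof -
    have a: "\<nu> + of_nat (Suc k) + 1 = \<nu> + of_nat (k + 2)" by simp
    show ?thesis unfolding diffs_def c_def a by (simp add: fact_Suc del: of_nat_Suc of_nat_add)
  qed
  have y2: "(\<Sum>k. diffs c k * ((\<nu> / 2) ^ 2) ^ k) = - diag_series 2 \<nu>"
    unfolding dd diag_series_def diag_term_def
    by (rule suminf_minus[OF sums_summable[OF diag_series_sums[of 2 \<nu>, unfolded diag_term_def]]])
  have "((\<lambda>z. (z / 2) powr \<nu> * S ((z / 2) ^ 2)) has_field_derivative
      (\<nu> * (\<nu> / 2) powr (\<nu> - 1) * (1 / 2)) * S ((\<nu> / 2) ^ 2) + ((\<Sum>k. diffs c k * ((\<nu> / 2) ^ 2) ^ k) * (\<nu> / 2)) * (\<nu> / 2) powr \<nu>) (at \<nu>)"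
  proof (rule DERIV_mult)
    show "((\<lambda>z. (z / 2) powr \<nu>) has_field_derivative \<nu> * (\<nu> / 2) powr (\<nu> - 1) * (1 / 2)) (at \<nu>)"
      by (rule DERIV_chain2[OF has_field_derivative_powr]) (use h\<nu> in \<open>auto intro!: derivative_eq_intros\<close>)
    show "((\<lambda>z. S ((z / 2) ^ 2)) has_field_derivative (\<Sum>k. diffs c k * ((\<nu> / 2) ^ 2) ^ k) * (\<nu> / 2)) (at \<nu>)"
      by (rule DERIV_chain2[OF dS]) (auto intro!: derivative_eq_intros)
  qed
  then have "besselJ' \<nu> \<nu> = (\<nu> * (\<nu> / 2) powr (\<nu> - 1) * (1 / 2)) * S ((\<nu> / 2) ^ 2) + ((\<Sum>k. diffs c k * ((\<nu> / 2) ^ 2) ^ k) * (\<nu> / 2)) * (\<nu> / 2) powr \<nu>"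
    unfolding besselJ'_def J by (rule DERIV_imp_deriv)
  moreover have "\<nu> * (\<nu> / 2) powr (\<nu> - 1) * (1 / 2) = (\<nu> / 2) powr \<nu>"
    using \<nu>0 by (simp add: powr_diff)
  ultimately have "besselJ' \<nu> \<nu> = (\<nu> / 2) powr \<nu> * diag_series 1 \<nu> + (- diag_series 2 \<nu> * (\<nu> / 2)) * (\<nu> / 2) powr \<nu>"
    unfolding y y2 by (simp only:)
  then show ?thesis by (simp add: algebra_simps)
qed

lemma besselJ'_diag_holomorphic: "(\<lambda>\<nu>. besselJ' \<nu> \<nu>) holomorphic_on - \<real>\<^sub>\<le>\<^sub>0"
proof -
  have "(\<lambda>\<nu>. (\<nu> / 2) powr \<nu> * (diag_series 1 \<nu> - \<nu> / 2 * diag_series 2 \<nu>)) holomorphic_on - \<real>\<^sub>\<le>\<^sub>0"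
    by (intro holomorphic_intros holomorphic_on_subset[OF diag_series_holomorphic]) (auto simp: complex_nonpos_Reals_iff)
  then show ?thesis by (rule holomorphic_transform) (simp add: besselJ'_diag)
qed

text \<open>The recurrence J_(nu-1)(z) + J_(nu+1)(z) = (2 nu / z) J_nu(z) at z = \<nu>, freed of
  powers of \<nu>/2; term by term it is the functional equation of 1/Gamma.\<close>

lemma diag_series_recurrence: "diag_series 0 \<nu> = \<nu> * diag_series 1 \<nu> - (\<nu> / 2) ^ 2 * diag_series 2 \<nu>"
proof -
  define y where "y = (\<nu> / 2) ^ 2"
  have e: "diag_term 0 (Suc n) \<nu> = \<nu> * diag_term 1 (Suc n) \<nu> + - (y * diag_term 2 n \<nu>)" for n
  proof -
    define R A where "R = rGamma (\<nu> + of_nat (n + 2))" and "A = (-1) ^ Suc n / (fact (Suc n) :: complex)"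
    have r: "rGamma (\<nu> + of_nat (Suc n + 0)) = (\<nu> + of_nat (Suc n)) * R" "rGamma (\<nu> + of_nat (Suc n + 1)) = R"
      using rGamma_plus1[of "\<nu> + of_nat (Suc n)"] by (simp_all add: R_def add_ac)
    have a: "(-1) ^ n / fact n = - (A * of_nat (Suc n))"
      by (simp add: A_def fact_Suc del: of_nat_Suc)
    show ?thesis
      unfolding diag_term_def y_def[symmetric] r R_def[symmetric] A_def[symmetric] a
      by (simp add: algebra_simps del: of_nat_Suc)
  qed
  have e0: "diag_term 0 0 \<nu> = \<nu> * diag_term 1 0 \<nu>"
    using rGamma_plus1[of \<nu>] by (simp add: diag_term_def)
  have "(\<lambda>n. \<nu> * diag_term 1 (Suc n) \<nu> + - (y * diag_term 2 n \<nu>)) sums (\<nu> * (diag_series 1 \<nu> - diag_term 1 0 \<nu>) + - (y * diag_series 2 \<nu>))"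
    using diag_series_sums[of 1 \<nu>]
    by (intro sums_add sums_mult sums_minus diag_series_sums) (subst sums_Suc_iff[of "\<lambda>n. diag_term 1 n \<nu>"], simp)
  then have "(\<lambda>n. diag_term 0 n \<nu>) sums (\<nu> * (diag_series 1 \<nu> - diag_term 1 0 \<nu>) + - (y * diag_series 2 \<nu>) + diag_term 0 0 \<nu>)"
    unfolding e[symmetric] by (subst (asm) sums_Suc_iff[of "\<lambda>n. diag_term 0 n \<nu>"])
  from sums_unique2[OF diag_series_sums this] show ?thesis
    unfolding e0 y_def by (simp add: algebra_simps)
qed

text \<open>The formula 2 J'_nu = J_(nu-1) - J_(nu+1) at z = \<nu>, arranged as the series to which
  the Hankel integrals lead.\<close>

lemma besselJ'_diag_sums:
  assumes \<nu>: "0 < \<nu>"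
  defines "b \<equiv> \<nu> / 2"
  shows "(\<lambda>k. 1 / 2 * ((- of_real b) ^ k / fact k) *
       (of_real (b powr (\<nu> + real k - 1)) * rGamma (of_real (\<nu> + real k)) -
        of_real (b powr (\<nu> + real (k + 2) - 1)) * rGamma (of_real (\<nu> + real (k + 2))))) sums besselJ' (of_real \<nu>) (of_real \<nu>)"
proof -
  have b: "b > 0" using \<nu> by (simp add: b_def)
  define n where "n = complex_of_real \<nu>"
  have nb: "n / 2 = of_real b" by (simp add: n_def b_def)
  have t: "1 / 2 * ((- of_real b) ^ k / fact k) *
       (of_real (b powr (\<nu> + real k - 1)) * rGamma (of_real (\<nu> + real k)) -
        of_real (b powr (\<nu> + real (k + 2) - 1)) * rGamma (of_real (\<nu> + real (k + 2)))) =
      of_real (b powr \<nu>) * (1 / 2) * (1 / of_real b * diag_term 0 k n - of_real b * diag_term 2 k n)" for k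
  proof -
    have p1: "b powr (\<nu> + real k - 1) = b powr \<nu> * b ^ k / b"
      using b by (simp add: powr_add powr_diff powr_realpow)
    have p2: "b powr (\<nu> + real (k + 2) - 1) = b powr \<nu> * b ^ k * b"
      using b by (simp add: powr_add powr_diff powr_realpow power2_eq_square)
    have m: "(- complex_of_real b) ^ k = (-1) ^ k * of_real b ^ k" by (rule power_minus)
    have bb: "(complex_of_real b ^ 2) ^ k = of_real b ^ k * of_real b ^ k"
      by (simp add: power2_eq_square power_mult_distrib)
    show ?thesis
      unfolding p1 p2 m diag_term_def nb bb using b by (simp add: n_def field_simps)
  qed
  have "(\<lambda>k. of_real (b powr \<nu>) * (1 / 2) * (1 / of_real b * diag_term 0 k n - of_real b * diag_term 2 k n)) sums
     (of_real (b powr \<nu>) * (1 / 2) * (1 / of_real b * diag_series 0 n - of_real b * diag_series 2 n))"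
    by (intro sums_mult sums_diff diag_series_sums)
  moreover have "of_real (b powr \<nu>) * (1 / 2) * (1 / of_real b * diag_series 0 n - of_real b * diag_series 2 n) = besselJ' n n"
  proof -
    have "n \<notin> \<real>\<^sub>\<le>\<^sub>0" using \<nu> by (simp add: n_def)
    then have "besselJ' n n = (n / 2) powr n * (diag_series 1 n - n / 2 * diag_series 2 n)" by (rule besselJ'_diag)
    also have "(n / 2) powr n = of_real (b powr \<nu>)" by (subst nb) (use b in \<open>simp add: n_def powr_of_real\<close>)
    finally have J: "besselJ' n n = of_real (b powr \<nu>) * (diag_series 1 n - of_real b * diag_series 2 n)" by (simp add: nb)
    have "1 / of_real b * diag_series 0 n = 2 * diag_series 1 n - of_real b * diag_series 2 n"
      unfolding diag_series_recurrence[of n] nb using b by (simp add: n_def b_def field_simps power2_eq_square)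
    then show ?thesis unfolding J by (simp only:) (simp add: algebra_simps)
  qed
  ultimately show ?thesis unfolding t n_def by simp
qed

lemma besselJ'_edge_limit:
  assumes "0 < \<nu>" "\<nu> < 1" and "\<And>t. (F has_field_derivative schlaefli \<nu> t) (at t)"
  shows "(edge_diff F \<longlongrightarrow> 2 * of_real pi * \<i> * besselJ' (of_real \<nu>) (of_real \<nu>)) at_top"
  using schlaefli_sum_limit[OF assms besselJ'_diag_sums[OF assms(1)]] .

subsection \<open>The path of steepest descent\<close>

text \<open>Solves cosh x * sin y = y for x > 0, the condition Im (sinh t - t) = 0. The path is
  parametrised by its ordinate y because x is then explicit.\<close>

definition path_re :: "real \<Rightarrow> real" where "path_re y = arcosh (y / sin y)"

definition steepest :: "real \<Rightarrow> complex" where "steepest y = Complex (path_re y) y"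

text \<open>The value of t - sinh t on the path, which becomes the Laplace variable u.\<close>

definition height :: "real \<Rightarrow> real" where "height y = path_re y - sinh (path_re y) * cos y"

definition height' :: "real \<Rightarrow> real" where
  "height' y = (norm (cosh (steepest y) - 1))\<^sup>2 / (sinh (path_re y) * sin y)"

context
  fixes y :: real
  assumes y: "0 < y" "y < pi"
begin

lemma quot_sin_gt_1: "y / sin y > 1"
  using sin_less_self[of y] sin_gt_zero[of y] y by simp

lemma cosh_path_re: "cosh (path_re y) * sin y = y"
proof -
  have "cosh (path_re y) = y / sin y"
    unfolding path_re_def by (rule cosh_arcosh_real[OF less_imp_le[OF quot_sin_gt_1]])
  then show ?thesis using sin_gt_zero[of y] y by simp
qed

lemma path_re_pos: "path_re y > 0"
  unfolding path_re_def by (subst arcosh_real_gt_1_iff) (use quot_sin_gt_1 in linarith)+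

lemma steepest_in_quarter_strip: "steepest y \<in> quarter_strip"
  using path_re_pos y by (simp add: steepest_def quarter_strip_def)

lemma sinh_steepest: "sinh (steepest y) - steepest y = - of_real (height y)"
  using cosh_path_re by (simp add: complex_eq_iff Re_sinh Im_sinh steepest_def height_def)

lemma height_pos: "height y > 0"
proof (rule ccontr)
  assume "\<not> ?thesis"
  then have "path_re y \<le> sinh (path_re y) * cos y" by (simp add: height_def)
  from less_cosh_mult_sin[OF path_re_pos y this] cosh_path_re show False by simp
qed

lemma path_re_differentiable: "\<exists>d. (path_re has_real_derivative d) (at y)"
proof -
  have "sin y \<noteq> 0" using sin_gt_zero[of y] y by simp
  then have "((\<lambda>y. y / sin y) has_real_derivative (1 * sin y - y * cos y) / (sin y * sin y)) (at y)"
    by (auto intro!: derivative_eq_intros)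
  from DERIV_chain2[OF arcosh_real_has_field_derivative this] quot_sin_gt_1
  show ?thesis unfolding path_re_def by blast
qed

lemma height'_pos: "height' y > 0"
proof -
  have "sin y > 0" using y by (intro sin_gt_zero)
  then show ?thesis unfolding height'_def
    using path_re_pos cosh_neq_1_quarter_strip[OF steepest_in_quarter_strip] by simp
qed

end

text \<open>Only the existence of the derivative of \<open>path_re\<close> is used. The tangent D
  has imaginary part 1, and (cosh t - 1) D is real because sinh t - t is real on the path; these two
  conditions determine D.\<close>

lemma DERIV_height:
  assumes y: "0 < y" "y < pi"
  shows "(steepest has_vector_derivative (- of_real (height' y) / (cosh (steepest y) - 1))) (at y)"
    and "(height has_real_derivative height' y) (at y)"
proof -
  obtain d where d: "(path_re has_real_derivative d) (at y)" using path_re_differentiable[OF y] by blast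
  define D where "D = Complex d 1"
  have D: "(steepest has_vector_derivative D) (at y)"
    unfolding steepest_def[abs_def] has_vector_derivative_complex_iff D_def
    using d by (auto intro!: derivative_eq_intros)
  define r where "r = (cosh (steepest y) - 1) * D"
  have "((\<lambda>t. sinh t - t) has_field_derivative (cosh (steepest y) - 1)) (at (steepest y))"
    by (auto intro!: derivative_eq_intros)
  from field_vector_diff_chain_at[OF D this]
  have "((\<lambda>t. sinh (steepest t) - steepest t) has_vector_derivative r) (at y)"
    by (simp add: o_def r_def mult.commute)
  then have hd: "((\<lambda>t. - complex_of_real (height t)) has_vector_derivative r) (at y)"
    by (rule has_vector_derivative_transform_within_open[of _ _ _ "{0<..<pi}"]) (use y sinh_steepest in auto)
  have "Im r = 0" and hr: "(height has_real_derivative - Re r) (at y)"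
  proof -
    have "((\<lambda>t. Re (- complex_of_real (height t))) has_real_derivative Re r) (at y)"
      "((\<lambda>t. Im (- complex_of_real (height t))) has_real_derivative Im r) (at y)"
      using hd unfolding has_vector_derivative_complex_iff by auto
    then have 1: "((\<lambda>t. - height t) has_real_derivative Re r) (at y)" and 2: "((\<lambda>t. 0) has_real_derivative Im r) (at y)"
      by simp_all
    show "Im r = 0" using DERIV_unique[OF 2 DERIV_const] by simp
    show "(height has_real_derivative - Re r) (at y)" using DERIV_minus[OF 1] by simp
  qed
  have sp: "sinh (path_re y) * sin y > 0" using path_re_pos[OF y] sin_gt_zero[OF y] by simp
  define c where "c = cosh (steepest y) - 1"
  have ci: "Im c = sinh (path_re y) * sin y" by (simp add: c_def Im_cosh steepest_def)
  have c0: "c \<noteq> 0" using ci sp by auto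
  have rD: "r = c * D" by (simp add: r_def c_def)
  have rr0: "r = of_real (Re r)" using \<open>Im r = 0\<close> by (simp add: complex_eq_iff)
  have "cnj c * r = of_real ((norm c)\<^sup>2) * D"
    unfolding rD by (simp only: mult.assoc[symmetric] complex_norm_square mult.commute[of "cnj c" c])
  then have "cnj c * of_real (Re r) = of_real ((norm c)\<^sup>2) * D" using rr0 by simp
  \<comment> \<open>Taking imaginary parts uses Im D = 1 and leaves one linear equation for the real
    number Re r.\<close>
  from arg_cong[OF this, of Im] have eq: "(norm c)\<^sup>2 = - Im c * Re r" by (simp add: D_def)
  have "height' y = - Re r"
  proof -
    have "- s * a / s = - a" if "s > 0" for s a :: real using that by simp
    from this[OF sp] show ?thesis unfolding height'_def c_def[symmetric] eq ci .
  qed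
  then have rr: "Re r = - height' y" by simp
  have "D = r / c" using c0 by (simp add: rD)
  then have "D = of_real (Re r) / c" using rr0 by simp
  then show "(steepest has_vector_derivative (- of_real (height' y) / (cosh (steepest y) - 1))) (at y)"
    using D by (simp add: rr c_def)
  show "(height has_real_derivative height' y) (at y)" using hr by (simp add: rr)
qed

section \<open>Regularity and end behaviour of the path\<close>

lemma isCont_path_re: "0 < y \<Longrightarrow> y < pi \<Longrightarrow> isCont path_re y"
  using path_re_differentiable DERIV_isCont by blast

lemma isCont_steepest: "0 < y \<Longrightarrow> y < pi \<Longrightarrow> isCont steepest y"
  using DERIV_height(1) has_vector_derivative_continuous by blast

lemma isCont_height': 
  assumes y: "0 < y" "y < pi" shows "isCont height' y"
proof -
  have "sinh (path_re y) * sin y \<noteq> 0" using path_re_pos[OF y] sin_gt_zero[OF y] by simp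
  moreover have "isCont (\<lambda>y. cosh (steepest y)) y" by (rule isCont_o2[OF isCont_steepest[OF y] isCont_cosh])
  moreover have "isCont (\<lambda>y. sinh (path_re y)) y" by (rule isCont_o2[OF isCont_path_re[OF y] isCont_sinh])
  ultimately show ?thesis unfolding height'_def[abs_def]
    by (intro continuous_intros) (use y in \<open>auto intro: isCont_steepest isCont_path_re\<close>)
qed

lemma path_re_tendsto_0: "(path_re \<longlongrightarrow> 0) (at_right 0)"
proof -
  have lim: "((\<lambda>y. y / sin y) \<longlongrightarrow> 1) (at_right (0::real))" by real_asymp
  have ev: "eventually (\<lambda>y. y / sin y \<in> {1..}) (at_right (0::real))"
    using eventually_at_right_less eventually_at_right_real[OF pi_gt_zero]
    by eventually_elim (use quot_sin_gt_1 less_imp_le in auto)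
  have "continuous_on {1::real..} arcosh" by (rule continuous_on_arcosh) auto
  from continuous_on_tendsto_compose[OF this lim _ ev]
  have "((\<lambda>y. arcosh (y / sin y)) \<longlongrightarrow> arcosh 1) (at_right (0::real))" by simp
  then show ?thesis by (simp add: path_re_def[abs_def])
qed

lemma path_re_at_top: "filterlim path_re at_top (at_left pi)"
proof (rule filterlim_at_top_mono)
  show "filterlim (\<lambda>y. ln (y / sin y)) at_top (at_left pi)"
  proof (rule filterlim_compose[OF ln_at_top])
    have "filterlim sin (at_right 0) (at_left pi)"
    proof -
      have "(sin \<longlongrightarrow> sin pi) (at_left pi)" by (intro tendsto_intros)
      moreover have "eventually (\<lambda>y. sin y > 0) (at_left pi)"
        using eventually_at_left_real[OF pi_gt_zero] by eventually_elim (auto intro: sin_gt_zero)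
      ultimately show ?thesis by (auto simp: filterlim_at elim: eventually_mono)
    qed
    then show "filterlim (\<lambda>y. y / sin y) at_top (at_left pi)"
      unfolding divide_inverse
      by (intro filterlim_tendsto_pos_mult_at_top[of _ pi] filterlim_compose[OF filterlim_inverse_at_top_right] tendsto_ident_at) auto
  qed
  show "eventually (\<lambda>y. ln (y / sin y) \<le> path_re y) (at_left pi)"
    using eventually_at_left_real[OF pi_gt_zero]
  proof eventually_elim
    case (elim y)
    then have q: "y / sin y > 1" using quot_sin_gt_1[of y] by auto
    then have "arcosh (y / sin y) = ln (y / sin y + sqrt ((y / sin y)\<^sup>2 - 1))" by (intro arcosh_real_def) auto
    moreover have "sqrt ((y / sin y)\<^sup>2 - 1) \<ge> 0" using q by (simp add: one_le_power)
    ultimately show ?case using q unfolding path_re_def by (simp only:) (subst ln_le_cancel_iff; linarith)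
  qed
qed

lemma height_tendsto_0: "(height \<longlongrightarrow> 0) (at_right 0)"
proof -
  have "((\<lambda>y. path_re y - sinh (path_re y) * cos y) \<longlongrightarrow> 0 - sinh 0 * cos 0) (at_right 0)"
    by (intro tendsto_intros path_re_tendsto_0 isCont_tendsto_compose[OF isCont_sinh path_re_tendsto_0])
  then show ?thesis by (simp add: height_def[abs_def])
qed

lemma height_at_top: "filterlim height at_top (at_left pi)"
proof (rule filterlim_at_top_mono[OF path_re_at_top])
  have "pi / 2 < pi" by simp
  from eventually_at_left_real[OF this]
  show "eventually (\<lambda>y. path_re y \<le> height y) (at_left pi)"
  proof eventually_elim
    case (elim y)
    then have y: "0 < y" "y < pi" by auto
    have "cos y \<le> 0" using elim cos_monotone_0_pi_le[of "pi / 2" y] by simp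
    then have "sinh (path_re y) * cos y \<le> 0" using path_re_pos[OF y] by (intro mult_nonneg_nonpos) auto
    then show ?case by (simp add: height_def)
  qed
qed

text \<open>The density whose Laplace transform is J'_nu(nu). Of its factor, 1/pi comes from the
  contour integral, 1/3 from the identity for 3 sinh t / (cosh t - 1), and the sign from dt = -du /
  (cosh t - 1). Expressing it through \<open>stieltjes\<close> makes it explicit in u.\<close>

definition borel_density :: "real \<Rightarrow> real" where
  "borel_density u = (let w = of_real (u powr (1 / 3)) * cis (pi / 3) in
     - (1 / (3 * pi)) * Im (of_real (q_coeff 0) / w + of_real (2 / pi) * w * stieltjes (w ^ 2)))"

lemma borel_density_height:
  assumes y: "0 < y" "y < pi"
  shows "borel_density (height y) = - (1 / pi) * Im (sinh (steepest y) / (cosh (steepest y) - 1))"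
proof -
  have "exp (lam (steepest y)) = of_real (height y powr (1 / 3)) * cis (pi / 3)"
    by (rule exp_lam_steepest[OF steepest_in_quarter_strip[OF y] sinh_steepest[OF y] height_pos[OF y]])
  moreover define z where "z = sinh (steepest y) / (cosh (steepest y) - 1)"
  ultimately have "borel_density (height y) = - (1 / (3 * pi)) * Im (3 * z)"
    using sinh_div_stieltjes[OF steepest_in_quarter_strip[OF y]] unfolding borel_density_def Let_def by (simp only:)
  then show ?thesis by (simp add: z_def[symmetric])
qed

lemma isCont_borel_density: assumes "u > 0" shows "isCont borel_density u"
proof -
  define w where "w = (\<lambda>u. complex_of_real (u powr (1 / 3)) * cis (pi / 3))"
  have w: "isCont w u" unfolding w_def using assms by (intro continuous_intros) auto
  have w0: "w u \<noteq> 0" using assms by (simp add: w_def)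
  have "w u ^ 2 = of_real ((u powr (1 / 3)) ^ 2) * cis (2 * pi / 3)"
  proof -
    have "cis (pi / 3) ^ 2 = cis (2 * pi / 3)" by (subst Complex.DeMoivre) simp
    then show ?thesis by (simp add: w_def power_mult_distrib)
  qed
  then have "Im (w u ^ 2) > 0" using assms by (simp add: sin_120)
  then have "w u ^ 2 \<in> - \<real>\<^sub>\<le>\<^sub>0" by (auto simp: complex_nonpos_Reals_iff)
  then have "isCont stieltjes (w u ^ 2)"
    using stieltjes_holomorphic closed_nonpos_Reals_complex
    by (meson continuous_on_eq_continuous_at holomorphic_on_imp_continuous_on open_Compl)
  moreover have "isCont (\<lambda>u. w u ^ 2) u" using w by (intro continuous_intros)
  ultimately have "isCont (\<lambda>u. stieltjes (w u ^ 2)) u" by (rule isCont_o2[rotated])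
  then have "isCont (\<lambda>u. of_real (q_coeff 0) / w u + of_real (2 / pi) * w u * stieltjes (w u ^ 2)) u"
    using w w0 by (intro continuous_intros) auto
  then have "isCont (\<lambda>u. - (1 / (3 * pi)) * Im (of_real (q_coeff 0) / w u + of_real (2 / pi) * w u * stieltjes (w u ^ 2))) u"
    by (intro isCont_mult[OF continuous_const] isCont_Im)
  then show ?thesis unfolding borel_density_def[abs_def] Let_def w_def .
qed

text \<open>The sign follows from Im (sinh t * cnj (cosh t - 1)) = sin y (cos y - cosh x). It makes
  \<open>borel_density\<close> nonnegative along the path, so the versions of the fundamental
  theorem and of substitution for nonnegative integrands apply and deliver integrability as
  well.\<close>

lemma sinh_div_Im_neg:
  assumes y: "0 < y" "y < pi"
  shows "Im (sinh (steepest y) / (cosh (steepest y) - 1)) \<le> 0"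
proof -
  define x where "x = path_re y"
  have x: "x > 0" using path_re_pos[OF y] by (simp add: x_def)
  define c where "c = cosh (steepest y) - 1"
  have "Im (sinh (steepest y) * cnj c) = cosh x * sin y * (cosh x * cos y - 1) - sinh x * cos y * (sinh x * sin y)"
    by (simp add: c_def Im_sinh Re_sinh Re_cosh Im_cosh steepest_def x_def)
  also have "\<dots> = sin y * (((cosh x)\<^sup>2 - (sinh x)\<^sup>2) * cos y - cosh x)"
    by (simp add: power2_eq_square algebra_simps)
  also have "\<dots> = sin y * (cos y - cosh x)" by (simp add: cosh_square_eq)
  also have "\<dots> \<le> 0"
    using sin_gt_zero[OF y] cos_le_one[of y] cosh_real_ge_1[of x] by (intro mult_nonneg_nonpos) linarith+
  finally have "Im (sinh (steepest y) * cnj c) \<le> 0" .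
  moreover have "Im (sinh (steepest y) / c) = Im (sinh (steepest y) * cnj c) / (norm c)\<^sup>2"
    by (subst complex_div_cnj) (simp add: Im_divide_of_real)
  ultimately show ?thesis by (simp add: c_def divide_nonpos_nonneg)
qed

lemma schlaefli_steepest:
  assumes "0 < y" "y < pi"
  shows "schlaefli \<nu> (steepest y) = sinh (steepest y) * of_real (exp (- \<nu> * height y))"
  unfolding schlaefli_def sinh_steepest[OF assms] exp_of_real[symmetric] by simp

text \<open>By conjugation symmetry the contour integral is 2 i times the imaginary part of a
  primitive at the upper end. That end may be approached along the path of steepest descent instead
  of the line Im t = pi, and on the path the substitution u = \<open>height y\<close> gives the
  Laplace integral.\<close>

lemma besselJ'_laplace:
  assumes \<nu>: "0 < \<nu>" "\<nu> < 1"
  shows "set_integrable lborel {0<..} (\<lambda>u. borel_density u * exp (- \<nu> * u))"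
    and "besselJ' (of_real \<nu>) (of_real \<nu>) = of_real (LBINT u:{0<..}. borel_density u * exp (- \<nu> * u))"
proof -
  have "schlaefli \<nu> holomorphic_on UNIV"
    unfolding schlaefli_def sinh_field_def by (intro holomorphic_intros) auto
  then obtain F0 where F0: "\<And>t. (F0 has_field_derivative schlaefli \<nu> t) (at t)"
    using holomorphic_convex_primitive'[OF convex_UNIV open_UNIV] by auto
  define F where "F = (\<lambda>t. F0 t - F0 0)"
  have F: "(F has_field_derivative schlaefli \<nu> t) (at t)" for t
    unfolding F_def using F0 by (auto intro!: derivative_eq_intros)
  have F_0: "F 0 = 0" by (simp add: F_def)
  have Fc: "isCont F t" for t using F DERIV_isCont by blast
  \<comment> \<open>F vanishes at 0 and its derivative commutes with conjugation, hence so does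
    F.\<close>
  have Fcnj: "F (cnj t) = cnj (F t)" for t
  proof -
    have cs: "cnj (schlaefli \<nu> (cnj z)) = schlaefli \<nu> z" for z
      by (simp add: schlaefli_def sinh_field_def exp_cnj)
    have "((\<lambda>z. cnj (F (cnj z))) has_field_derivative schlaefli \<nu> z) (at z)" for z
      using has_field_derivative_cnj_cnj[OF F[of "cnj z"]] by (simp add: o_def cs)
    from DERIV_diff[OF this F]
    have "\<exists>c. \<forall>z\<in>UNIV. cnj (F (cnj z)) - F z = c"
      by (intro has_field_derivative_zero_constant) auto
    then obtain c where c: "\<And>z. cnj (F (cnj z)) - F z = c" by auto
    have "c = 0" using c[of 0] F_0 by simp
    then show ?thesis using c[of "cnj t"] by simp
  qed
  have ed: "edge_diff F x = 2 * \<i> * of_real (Im (F (Complex x pi)))" for x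
  proof -
    have "Complex x (- pi) = cnj (Complex x pi)" by (simp add: complex_eq_iff)
    then have "F (Complex x (- pi)) = cnj (F (Complex x pi))" by (simp only: Fcnj)
    then show ?thesis unfolding edge_diff_def by (simp add: complex_eq_iff)
  qed
  define J where "J = besselJ' (complex_of_real \<nu>) (complex_of_real \<nu>)"
  have "((\<lambda>x. edge_diff F x / (2 * \<i>)) \<longlongrightarrow> 2 * of_real pi * \<i> * J / (2 * \<i>)) at_top"
    unfolding J_def by (intro tendsto_intros besselJ'_edge_limit \<nu> F) auto
  moreover have "2 * of_real pi * \<i> * J / (2 * \<i>) = of_real pi * J" by (simp add: field_simps)
  ultimately have lim: "((\<lambda>x. complex_of_real (Im (F (Complex x pi)))) \<longlongrightarrow> of_real pi * J) at_top"
    by (simp add: ed)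
  from tendsto_Re[OF this] tendsto_Im[OF this]
  have limR: "((\<lambda>x. Im (F (Complex x pi))) \<longlongrightarrow> pi * Re J) at_top"
    and "((\<lambda>x::real. 0::real) \<longlongrightarrow> pi * Im J) at_top" by simp_all
  then have "pi * Im J = 0" using tendsto_unique[OF trivial_limit_at_top_linorder _ tendsto_const] by blast
  then have JR: "J = of_real (Re J)" by (simp add: complex_eq_iff)
  define E where "E = (\<lambda>y. 1 / pi * Im (F (steepest y)))"
  have DE: "(E has_real_derivative borel_density (height y) * exp (- \<nu> * height y) * height' y) (at y)"
    if y: "0 < y" "y < pi" for y
  proof -
    have "(E has_real_derivative 1 / pi * Im (schlaefli \<nu> (steepest y) * (- of_real (height' y) / (cosh (steepest y) - 1)))) (at y)"
      unfolding E_def by (intro DERIV_cmult DERIV_Im_along_path F DERIV_height y)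
    also have "schlaefli \<nu> (steepest y) * (- of_real (height' y) / (cosh (steepest y) - 1)) =
        of_real (- (exp (- \<nu> * height y) * height' y)) * (sinh (steepest y) / (cosh (steepest y) - 1))"
      unfolding schlaefli_steepest[OF y] by simp
    also have "1 / pi * Im \<dots> = borel_density (height y) * exp (- \<nu> * height y) * height' y"
      unfolding borel_density_height[OF y] by (simp only: times_complex.sel Re_complex_of_real Im_complex_of_real) simp
    finally show ?thesis .
  qed
  have E0: "(E \<longlongrightarrow> 0) (at_right 0)"
  proof -
    have "(steepest \<longlongrightarrow> Complex 0 0) (at_right 0)"
      unfolding steepest_def[abs_def] by (intro tendsto_Complex path_re_tendsto_0 tendsto_ident_at)
    then have "((\<lambda>y. F (steepest y)) \<longlongrightarrow> F (Complex 0 0)) (at_right 0)"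
      by (rule isCont_tendsto_compose[OF Fc])
    then have "((\<lambda>y. 1 / pi * Im (F (steepest y))) \<longlongrightarrow> 1 / pi * Im (F (Complex 0 0))) (at_right 0)"
      by (intro tendsto_intros)
    moreover have "Complex 0 0 = 0" by (simp add: complex_eq_iff)
    ultimately show ?thesis using F_0 by (simp add: E_def)
  qed
  define B where "B = (\<lambda>x::real. cosh x * exp (- (\<nu> / 2) * sinh x))"
  have B0: "(B \<longlongrightarrow> 0) at_top" unfolding B_def using \<nu> by real_asymp
  \<comment> \<open>The path and the line Im t = pi are joined by a vertical segment. The
    restriction y > 2*pi/3 makes cos (Im t) \<le> -1/2 on it, so the integrand is at most cosh x *
    exp(-(\<nu>/2) sinh x).\<close>
  have dist: "norm (F (steepest y) - F (Complex (path_re y) pi)) \<le> B (path_re y) * pi"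
    if y: "2 * pi / 3 < y" "y < pi" for y
  proof -
    have y': "0 < y" "y < pi" using y pi_gt_zero by linarith+
    define x where "x = path_re y"
    have x: "x > 0" using path_re_pos[OF y'] by (simp add: x_def)
    define S where "S = {t. Re t = x \<and> y \<le> Im t \<and> Im t \<le> pi}"
    have "S = {t. Re t \<le> x} \<inter> {t. Re t \<ge> x} \<inter> {t. Im t \<ge> y} \<inter> {t. Im t \<le> pi}" by (auto simp: S_def)
    then have cS: "convex S" by (simp add: convex_Int convex_halfspace_Re_le convex_halfspace_Re_ge convex_halfspace_Im_le convex_halfspace_Im_ge)
    have "norm (F (steepest y) - F (Complex x pi)) \<le> B x * norm (steepest y - Complex x pi)"
    proof (rule field_differentiable_bound[OF cS])
      show "(F has_field_derivative schlaefli \<nu> t) (at t within S)" for t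
        by (rule has_field_derivative_at_within[OF F])
      fix t assume t: "t \<in> S"
      have c: "cos (Im t) \<le> - 1 / 2"
        using cos_monotone_0_pi_le[of "2 * pi / 3" "Im t"] t y by (simp add: S_def cos_120)
      have "sinh x * cos (Im t) \<le> sinh x * (- 1 / 2)" using x c by (intro mult_left_mono) auto
      then have "sinh x * cos (Im t) - x \<le> - (1 / 2) * sinh x" using x by linarith
      then have "\<nu> * (sinh x * cos (Im t) - x) \<le> \<nu> * (- (1 / 2) * sinh x)" using \<nu> by (intro mult_left_mono) auto
      then have "norm (exp (of_real \<nu> * (sinh t - t))) \<le> exp (- (\<nu> / 2) * sinh x)"
        using t by (simp add: Re_sinh S_def)
      then show "norm (schlaefli \<nu> t) \<le> B x"
        unfolding schlaefli_def B_def norm_mult using norm_sinh_le[of t] t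
        by (intro mult_mono) (auto simp: S_def)
    qed (use y in \<open>auto simp: S_def steepest_def x_def\<close>)
    also have "norm (steepest y - Complex x pi) \<le> pi"
      using cmod_le[of "steepest y - Complex x pi"] y' by (simp add: steepest_def x_def)
    finally show ?thesis by (simp add: x_def B_def mult_left_mono)
  qed
  have E1: "(E \<longlongrightarrow> Re J) (at_left pi)"
  proof -
    have "((\<lambda>y. F (steepest y) - F (Complex (path_re y) pi)) \<longlongrightarrow> 0) (at_left pi)"
    proof (rule Lim_null_comparison)
      have "2 * pi / 3 < pi" by simp
      from eventually_at_left_real[OF this]
      show "eventually (\<lambda>y. norm (F (steepest y) - F (Complex (path_re y) pi)) \<le> B (path_re y) * pi) (at_left pi)"
        by eventually_elim (use dist in auto)
      show "((\<lambda>y. B (path_re y) * pi) \<longlongrightarrow> 0) (at_left pi)"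
        using tendsto_mult_left_zero[OF filterlim_compose[OF B0 path_re_at_top]] by simp
    qed
    from tendsto_Im[OF this] have "((\<lambda>y. Im (F (steepest y)) - Im (F (Complex (path_re y) pi))) \<longlongrightarrow> 0) (at_left pi)" by simp
    from tendsto_add[OF this filterlim_compose[OF limR path_re_at_top]]
    have "((\<lambda>y. Im (F (steepest y))) \<longlongrightarrow> pi * Re J) (at_left pi)" by simp
    then have "((\<lambda>y. 1 / pi * Im (F (steepest y))) \<longlongrightarrow> 1 / pi * (pi * Re J)) (at_left pi)" by (intro tendsto_intros)
    then show ?thesis by (simp add: E_def)
  qed
  define f where "f = (\<lambda>u. borel_density u * exp (- \<nu> * u))"
  have fn: "f (height y) \<ge> 0" if "0 < y" "y < pi" for y
    unfolding f_def borel_density_height[OF that] using sinh_div_Im_neg[OF that]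
    by (intro mult_nonneg_nonneg mult_nonpos_nonpos) auto
  have fc: "isCont f u" if "u > 0" for u
    unfolding f_def using that by (intro continuous_intros isCont_borel_density)
  have hc: "isCont height y" if "0 < y" "y < pi" for y using DERIV_height(2)[OF that] DERIV_isCont by blast
  have p1: "(0::ereal) < ereal pi" by simp
  have p2: "(E has_real_derivative f (height y) * height' y) (at y)" if "0 < ereal y" "ereal y < ereal pi" for y
    using DE[of y] that by (simp add: f_def)
  have p3: "isCont (\<lambda>y. f (height y) * height' y) y" if "0 < ereal y" "ereal y < ereal pi" for y
    using that by (intro continuous_intros isCont_height' isCont_o2[OF hc fc] height_pos) auto
  have p4: "AE y in lborel. 0 < ereal y \<longrightarrow> ereal y < ereal pi \<longrightarrow> 0 \<le> f (height y) * height' y"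
    by (intro AE_I2 impI mult_nonneg_nonneg fn less_imp_le[OF height'_pos]) auto
  have p5: "((E \<circ> real_of_ereal) \<longlongrightarrow> 0) (at_right 0)"
    unfolding zero_ereal_def ereal_tendsto_simps1 by (rule E0)
  have p6: "((E \<circ> real_of_ereal) \<longlongrightarrow> Re J) (at_left (ereal pi))"
    unfolding ereal_tendsto_simps1 by (rule E1)
  note FTC = interval_integral_FTC_nonneg[OF p1 p2 p3 p4 p5 p6]
  have s1: "(height has_real_derivative height' y) (at y)" if "0 < ereal y" "ereal y < ereal pi" for y
    using DERIV_height(2) that by simp
  have s2: "isCont f (height y)" if "0 < ereal y" "ereal y < ereal pi" for y
    using fc[OF height_pos] that by simp
  have s3: "isCont height' y" if "0 < ereal y" "ereal y < ereal pi" for y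
    using isCont_height' that by simp
  have s4: "0 \<le> f (height y)" if "0 < ereal y" "ereal y < ereal pi" for y
    using fn that by simp
  \<comment> \<open>The substitution rule asks for a nonnegative derivative at the end points too;
    there \<open>height'\<close> is 0, being a quotient with denominator 0.\<close>
  have s5: "0 \<le> height' y" if "0 \<le> ereal y" "ereal y \<le> ereal pi" for y
  proof (cases "y = 0 \<or> y = pi")
    case True then show ?thesis by (auto simp: height'_def)
  next
    case False then show ?thesis using height'_pos[of y] that by (simp add: less_imp_le)
  qed
  have s6: "((ereal \<circ> height \<circ> real_of_ereal) \<longlongrightarrow> ereal 0) (at_right (ereal 0))"
    unfolding ereal_tendsto_simps using height_tendsto_0 by simp
  have s7: "((ereal \<circ> height \<circ> real_of_ereal) \<longlongrightarrow> \<infinity>) (at_left (ereal pi))"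
    unfolding ereal_tendsto_simps using height_at_top by simp
  note sub = interval_integral_substitution_nonneg[OF p1 s1 s2 s3 s4 s5 s6[folded zero_ereal_def] s7 FTC(1)]
  have ei: "einterval 0 \<infinity> = {0<..}" by (auto simp: einterval_def)
  show "set_integrable lborel {0<..} (\<lambda>u. borel_density u * exp (- \<nu> * u))"
    using sub(1) unfolding ei f_def by simp
  have "(LBINT u:{0<..}. f u) = Re J"
    using sub(2) FTC(2) by (simp add: interval_lebesgue_integral_def[of _ 0 \<infinity>] ei)
  then show "besselJ' (of_real \<nu>) (of_real \<nu>) = of_real (LBINT u:{0<..}. borel_density u * exp (- \<nu> * u))"
    using JR unfolding f_def J_def by simp
qed

subsection \<open>Rotated Laplace integrals\<close>

text \<open>The line of all 1 + s c has distance |Im c| / |c| from the origin.\<close>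

lemma norm_mult_line_ge: "\<bar>Im c\<bar> \<le> norm c * norm (1 + of_real s * c)"
proof -
  have "Im (cnj c * (1 + of_real s * c)) = - Im c" by (simp add: algebra_simps)
  then have "\<bar>Im c\<bar> \<le> norm (cnj c * (1 + of_real s * c))" using abs_Im_le_cmod by (metis abs_minus_cancel)
  then show ?thesis by (simp add: norm_mult)
qed

text \<open>Factor 1 + z^2 = (1 + i z)(1 - i z) and bound each factor by the distance of its line
  from the origin. This crude bound holds on the whole right half plane and serves for integrability
  and holomorphy.\<close>

lemma norm_one_plus_square_ge:
  assumes "Re \<zeta> > 0"
  shows "(Re \<zeta> / norm \<zeta>)\<^sup>2 \<le> norm (1 + (of_real s * \<zeta>)\<^sup>2)"
proof -
  have n: "norm \<zeta> > 0" using assms by auto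
  have "Re \<zeta> / norm \<zeta> \<le> norm (1 + of_real s * (\<i> * \<zeta>))" for s
    using norm_mult_line_ge[of "\<i> * \<zeta>" s] assms n by (simp add: norm_mult field_simps)
  from mult_mono[OF this[of s] this[of "- s"]] assms
  have "(Re \<zeta> / norm \<zeta>) * (Re \<zeta> / norm \<zeta>) \<le> norm ((1 + of_real s * (\<i> * \<zeta>)) * (1 + of_real (- s) * (\<i> * \<zeta>)))"
    by (simp add: norm_mult)
  also have "(1 + of_real s * (\<i> * \<zeta>)) * (1 + of_real (- s) * (\<i> * \<zeta>)) = 1 + (of_real s * \<zeta>)\<^sup>2"
    by (simp add: algebra_simps power2_eq_square)
  finally show ?thesis by (simp add: power2_eq_square)
qed

lemma one_plus_square_nonzero: "Re \<zeta> > 0 \<Longrightarrow> 1 + (of_real s * \<zeta>)\<^sup>2 \<noteq> 0"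
  using norm_one_plus_square_ge[of \<zeta> s] by (auto simp: divide_eq_0_iff)

definition lap_kernel :: "real \<Rightarrow> real \<Rightarrow> complex \<Rightarrow> complex \<Rightarrow> real \<Rightarrow> complex" where
  "lap_kernel a q z \<zeta> v = indicator {0<..} v *\<^sub>R
     (of_real (v powr (a - 1)) * exp (- (z * \<zeta> * of_real v)) / (1 + (of_real (q * v) * \<zeta>)\<^sup>2))"

text \<open>The integral of u^(a-1) e^(-z u) / (1 + (q u)^2) along the ray u = \<zeta> v; the power
  of \<zeta> collects u^(a-1) and du.\<close>

definition lap :: "real \<Rightarrow> real \<Rightarrow> complex \<Rightarrow> complex \<Rightarrow> complex" where
  "lap a q z \<zeta> = \<zeta> powr of_real a * (\<integral>v. lap_kernel a q z \<zeta> v \<partial>lborel)"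

text \<open>The first condition keeps the ray away from the poles u = i/q and u = -i/q, the second
  makes the exponential decay.\<close>

definition lap_dom :: "complex \<Rightarrow> complex set" where
  "lap_dom z = {\<zeta>. Re \<zeta> > 0 \<and> Re (z * \<zeta>) > 0}"

lemma lap_kernel_measurable [measurable]:
  assumes [measurable]: "f \<in> borel_measurable M" "g \<in> borel_measurable M"
  shows "(\<lambda>x. lap_kernel a (f x) z \<zeta> (g x)) \<in> borel_measurable M"
  unfolding lap_kernel_def by measurable

lemma lap_kernel_norm_le:
  assumes c: "c > 0" "c \<le> norm (1 + (of_real (q * v) * \<zeta>)\<^sup>2)" and r: "r \<le> Re (z * \<zeta>)"
  shows "norm (lap_kernel a q z \<zeta> v) \<le> indicator {0<..} v *\<^sub>R (v powr (a - 1) * exp (- r * v)) / c"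
proof (cases "v > 0")
  case True
  have "norm (exp (- (z * \<zeta> * of_real v))) \<le> exp (- r * v)"
    using r True by (simp add: mult_right_mono)
  then have "norm (of_real (v powr (a - 1)) * exp (- (z * \<zeta> * of_real v)) / (1 + (of_real (q * v) * \<zeta>)\<^sup>2))
      \<le> v powr (a - 1) * exp (- r * v) / c"
    unfolding norm_mult norm_divide using c by (intro frac_le mult_mono) auto
  then show ?thesis using True by (simp add: lap_kernel_def)
qed (simp add: lap_kernel_def)

lemma gamma_integrable:
  fixes a r c :: real
  assumes "a > 0" "r > 0"
  shows "integrable lborel (\<lambda>v. indicator {0<..} v *\<^sub>R (v powr (a - 1) * exp (- r * v)) / c)"
  using gamma_integral_scaled(1)[OF assms] unfolding set_integrable_def by (rule integrable_divide)

lemma lap_kernel_integrable: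
  assumes a: "a > 0" and \<zeta>: "\<zeta> \<in> lap_dom z"
  shows "integrable lborel (lap_kernel a q z \<zeta>)"
proof (rule Bochner_Integration.integrable_bound)
  have R: "Re \<zeta> > 0" "Re (z * \<zeta>) > 0" using \<zeta> by (auto simp: lap_dom_def)
  then have c: "(Re \<zeta> / norm \<zeta>)\<^sup>2 > 0" by auto
  show "integrable lborel (\<lambda>v. indicator {0<..} v *\<^sub>R (v powr (a - 1) * exp (- Re (z * \<zeta>) * v)) / (Re \<zeta> / norm \<zeta>)\<^sup>2)"
    by (rule gamma_integrable[OF a R(2)])
  show "AE v in lborel. norm (lap_kernel a q z \<zeta> v) \<le> norm (indicator {0<..} v *\<^sub>R (v powr (a - 1) * exp (- Re (z * \<zeta>) * v)) / (Re \<zeta> / norm \<zeta>)\<^sup>2)"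
  proof (rule AE_I2)
    fix v :: real
    show "norm (lap_kernel a q z \<zeta> v) \<le> norm (indicator {0<..} v *\<^sub>R (v powr (a - 1) * exp (- Re (z * \<zeta>) * v)) / (Re \<zeta> / norm \<zeta>)\<^sup>2)"
      unfolding real_norm_def
      by (rule order_trans[OF lap_kernel_norm_le[OF c norm_one_plus_square_ge[OF R(1)] order_refl] abs_ge_self])
  qed
  show "lap_kernel a q z \<zeta> \<in> borel_measurable lborel"
    using lap_kernel_measurable[of "\<lambda>_. q" lborel "\<lambda>v. v"] by simp
qed

lemma norm_lap_le:
  assumes a: "a > 0" and \<zeta>: "\<zeta> \<in> lap_dom z" and c: "c > 0" "\<And>v. v > 0 \<Longrightarrow> c \<le> norm (1 + (of_real (q * v) * \<zeta>)\<^sup>2)"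
  shows "norm (lap a q z \<zeta>) \<le> norm (\<zeta> powr of_real a) * (Gamma a / Re (z * \<zeta>) powr a / c)"
proof -
  have R: "Re (z * \<zeta>) > 0" using \<zeta> by (auto simp: lap_dom_def)
  have "norm (\<integral>v. lap_kernel a q z \<zeta> v \<partial>lborel) \<le> (\<integral>v. norm (lap_kernel a q z \<zeta> v) \<partial>lborel)"
    by (rule integral_norm_bound)
  also have "\<dots> \<le> (\<integral>v. indicator {0<..} v *\<^sub>R (v powr (a - 1) * exp (- Re (z * \<zeta>) * v)) / c \<partial>lborel)"
  proof (rule integral_mono)
    show "integrable lborel (\<lambda>v. norm (lap_kernel a q z \<zeta> v))"
      by (rule integrable_norm[OF lap_kernel_integrable[OF a \<zeta>]])
    show "integrable lborel (\<lambda>v. indicator {0<..} v *\<^sub>R (v powr (a - 1) * exp (- Re (z * \<zeta>) * v)) / c)"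
      by (rule gamma_integrable[OF a R])
    fix v :: real
    show "norm (lap_kernel a q z \<zeta> v) \<le> indicator {0<..} v *\<^sub>R (v powr (a - 1) * exp (- Re (z * \<zeta>) * v)) / c"
    proof (cases "v > 0")
      case True then show ?thesis by (intro lap_kernel_norm_le c) auto
    qed (simp add: lap_kernel_def)
  qed
  also have "\<dots> = Gamma a / Re (z * \<zeta>) powr a / c"
    using gamma_integral_scaled(2)[OF a R] unfolding set_lebesgue_integral_def by simp
  finally show ?thesis unfolding lap_def norm_mult by (intro mult_left_mono) auto
qed

lemma open_lap_dom: "open (lap_dom z)" and convex_lap_dom: "convex (lap_dom z)"
proof -
  have e: "lap_dom z = {\<zeta>. Re \<zeta> > 0} \<inter> {\<zeta>. cnj z \<bullet> \<zeta> > 0}"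
    by (auto simp: lap_dom_def inner_complex_def)
  show "open (lap_dom z)" "convex (lap_dom z)" unfolding e
    by (simp_all add: open_Int open_halfspace_Re_gt open_halfspace_gt convex_Int convex_halfspace_Re_gt convex_halfspace_gt)
qed

lemma lap_holomorphic_in_z:
  assumes a: "a > 0" and \<zeta>: "Re \<zeta> > 0"
  shows "(\<lambda>z. lap a q z \<zeta>) holomorphic_on {z. Re (z * \<zeta>) > 0}"
proof -
  have op: "open {z. Re (z * \<zeta>) > 0}"
  proof -
    have "{z. Re (z * \<zeta>) > 0} = {z. cnj \<zeta> \<bullet> z > 0}" by (auto simp: inner_complex_def mult.commute)
    then show ?thesis by (simp add: open_halfspace_gt)
  qed
  have "(\<lambda>z. \<integral>v. lap_kernel a q z \<zeta> v \<partial>lborel) holomorphic_on {z. Re (z * \<zeta>) > 0}"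
  proof (rule holomorphic_on_integral[OF op])
    show "lap_kernel a q z \<zeta> \<in> borel_measurable lborel" for z
      using lap_kernel_measurable[of "\<lambda>_. q" lborel "\<lambda>v. v"] by simp
    show "AE v in lborel. (\<lambda>z. lap_kernel a q z \<zeta> v) holomorphic_on {z. Re (z * \<zeta>) > 0}"
      unfolding lap_kernel_def scaleR_conv_of_real
      by (intro AE_I2 holomorphic_intros) (use one_plus_square_nonzero[OF \<zeta>] in auto)
    fix z0 assume "z0 \<in> {z. Re (z * \<zeta>) > 0}"
    then have r0: "Re (z0 * \<zeta>) > 0" by simp
    define r where "r = Re (z0 * \<zeta>) / 2"
    have "open {z. Re (z * \<zeta>) > r}"
    proof -
      have "{z. Re (z * \<zeta>) > r} = {z. cnj \<zeta> \<bullet> z > r}" by (auto simp: inner_complex_def mult.commute)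
      then show ?thesis by (simp add: open_halfspace_gt)
    qed
    moreover have "r < Re (z0 * \<zeta>)" unfolding r_def using r0 by linarith
    then have "z0 \<in> {z. Re (z * \<zeta>) > r}" by blast
    ultimately obtain d where d: "d > 0" "ball z0 d \<subseteq> {z. Re (z * \<zeta>) > r}" using open_contains_ball by blast
    have r: "r > 0" using r0 by (simp add: r_def)
    have c: "(Re \<zeta> / norm \<zeta>)\<^sup>2 > 0" using \<zeta> by auto
    show "\<exists>d>0. \<exists>B. integrable lborel B \<and> (AE v in lborel. \<forall>z\<in>ball z0 d \<inter> {z. Re (z * \<zeta>) > 0}. norm (lap_kernel a q z \<zeta> v) \<le> B v)"
    proof (intro exI conjI AE_I2 ballI)
      show "integrable lborel (\<lambda>v. indicator {0<..} v *\<^sub>R (v powr (a - 1) * exp (- r * v)) / (Re \<zeta> / norm \<zeta>)\<^sup>2)"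
        by (rule gamma_integrable[OF a r])
      fix v z assume "z \<in> ball z0 d \<inter> {z. Re (z * \<zeta>) > 0}"
      then have "r \<le> Re (z * \<zeta>)" using d(2) by (auto simp: subset_iff less_imp_le)
      then show "norm (lap_kernel a q z \<zeta> v) \<le> indicator {0<..} v *\<^sub>R (v powr (a - 1) * exp (- r * v)) / (Re \<zeta> / norm \<zeta>)\<^sup>2"
        by (rule lap_kernel_norm_le[OF c norm_one_plus_square_ge[OF \<zeta>]])
    qed (rule d(1))
  qed
  then show ?thesis unfolding lap_def by (intro holomorphic_intros)
qed

lemma lap_holomorphic_in_zeta:
  assumes a: "a > 0"
  shows "(\<lambda>\<zeta>. lap a q z \<zeta>) holomorphic_on lap_dom z"
proof -
  have "(\<lambda>\<zeta>. \<integral>v. lap_kernel a q z \<zeta> v \<partial>lborel) holomorphic_on lap_dom z"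
  proof (rule holomorphic_on_integral[OF open_lap_dom])
    show "lap_kernel a q z \<zeta> \<in> borel_measurable lborel" for \<zeta>
      using lap_kernel_measurable[of "\<lambda>_. q" lborel "\<lambda>v. v"] by simp
    show "AE v in lborel. (\<lambda>\<zeta>. lap_kernel a q z \<zeta> v) holomorphic_on lap_dom z"
      unfolding lap_kernel_def scaleR_conv_of_real
      by (intro AE_I2 holomorphic_intros) (use one_plus_square_nonzero in \<open>auto simp: lap_dom_def simp del: of_real_mult\<close>)
    fix \<zeta>0 assume "\<zeta>0 \<in> lap_dom z"
    then have r0: "Re \<zeta>0 > 0" "Re (z * \<zeta>0) > 0" by (auto simp: lap_dom_def)
    define r where "r = Re (z * \<zeta>0) / 2"
    define c where "c = (Re \<zeta>0 / norm \<zeta>0)\<^sup>2 / 2"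
    have r: "r > 0" using r0 by (simp add: r_def)
    have c: "c > 0" using r0 by (auto simp: c_def)
    have rr: "r < Re (z * \<zeta>0)" unfolding r_def using r0 by linarith
    have "((\<lambda>\<zeta>. Re (z * \<zeta>)) \<longlongrightarrow> Re (z * \<zeta>0)) (at \<zeta>0)" by (intro tendsto_intros)
    then have "eventually (\<lambda>\<zeta>. r < Re (z * \<zeta>)) (at \<zeta>0)" using rr by (rule order_tendstoD(1))
    moreover have "((\<lambda>\<zeta>. (Re \<zeta> / norm \<zeta>)\<^sup>2) \<longlongrightarrow> (Re \<zeta>0 / norm \<zeta>0)\<^sup>2) (at \<zeta>0)"
      using r0 by (intro tendsto_intros) auto
    then have "eventually (\<lambda>\<zeta>. c < (Re \<zeta> / norm \<zeta>)\<^sup>2) (at \<zeta>0)" using c by (intro order_tendstoD) (auto simp: c_def)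
    ultimately have "eventually (\<lambda>\<zeta>. r < Re (z * \<zeta>) \<and> c < (Re \<zeta> / norm \<zeta>)\<^sup>2) (at \<zeta>0)" by (rule eventually_conj)
    moreover have "r < Re (z * \<zeta>0) \<and> c < (Re \<zeta>0 / norm \<zeta>0)\<^sup>2" using rr c unfolding c_def by linarith
    ultimately have "eventually (\<lambda>\<zeta>. r < Re (z * \<zeta>) \<and> c < (Re \<zeta> / norm \<zeta>)\<^sup>2) (nhds \<zeta>0)"
      by (simp add: eventually_nhds_conv_at)
    then obtain d where d: "d > 0" "\<And>\<zeta>. dist \<zeta> \<zeta>0 < d \<Longrightarrow> r < Re (z * \<zeta>) \<and> c < (Re \<zeta> / norm \<zeta>)\<^sup>2"
      unfolding eventually_nhds_metric by blast
    show "\<exists>d>0. \<exists>B. integrable lborel B \<and> (AE v in lborel. \<forall>\<zeta>\<in>ball \<zeta>0 d \<inter> lap_dom z. norm (lap_kernel a q z \<zeta> v) \<le> B v)"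
    proof (intro exI conjI AE_I2 ballI)
      show "integrable lborel (\<lambda>v. indicator {0<..} v *\<^sub>R (v powr (a - 1) * exp (- r * v)) / c)"
        by (rule gamma_integrable[OF a r])
      fix v \<zeta> assume \<zeta>: "\<zeta> \<in> ball \<zeta>0 d \<inter> lap_dom z"
      then have "r < Re (z * \<zeta>) \<and> c < (Re \<zeta> / norm \<zeta>)\<^sup>2" by (intro d(2)) (simp add: dist_commute)
      then show "norm (lap_kernel a q z \<zeta> v) \<le> indicator {0<..} v *\<^sub>R (v powr (a - 1) * exp (- r * v)) / c"
        using norm_one_plus_square_ge[of \<zeta> "q * v"] \<zeta> by (intro lap_kernel_norm_le c) (auto simp: lap_dom_def)
    qed (rule d(1))
  qed
  then show ?thesis unfolding lap_def by (intro holomorphic_intros) (auto simp: lap_dom_def complex_nonpos_Reals_iff)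
qed

lemma lap_scale:
  assumes s: "s > 0" and \<zeta>: "Re \<zeta> > 0"
  shows "lap a q z (of_real s * \<zeta>) = lap a q z \<zeta>"
proof -
  have "(\<integral>v. lap_kernel a q z \<zeta> v \<partial>lborel) = \<bar>s\<bar> *\<^sub>R (\<integral>v. lap_kernel a q z \<zeta> (0 + s * v) \<partial>lborel)"
    using s by (intro lborel_integral_real_affine) auto
  also have "(\<lambda>v. lap_kernel a q z \<zeta> (0 + s * v)) = (\<lambda>v. of_real (s powr (a - 1)) * lap_kernel a q z (of_real s * \<zeta>) v)"
  proof
    fix v :: real
    show "lap_kernel a q z \<zeta> (0 + s * v) = of_real (s powr (a - 1)) * lap_kernel a q z (of_real s * \<zeta>) v"
      using s by (cases "v > 0") (auto simp: lap_kernel_def powr_mult zero_less_mult_iff mult_ac)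
  qed
  finally have e: "(\<integral>v. lap_kernel a q z \<zeta> v \<partial>lborel) = of_real (s * s powr (a - 1)) * (\<integral>v. lap_kernel a q z (of_real s * \<zeta>) v \<partial>lborel)"
    using s by (simp add: scaleR_conv_of_real)
  have "s * s powr (a - 1) = s powr a" using s by (simp add: powr_mult_base)
  moreover have "(of_real s * \<zeta>) powr of_real a = of_real (s powr a) * \<zeta> powr of_real a"
  proof -
    have "Ln (of_real s * \<zeta>) = of_real (ln s) + Ln \<zeta>" 
    proof -
      have "\<zeta> \<noteq> 0" using \<zeta> by auto
      then show ?thesis using Ln_times_of_real[OF s, of \<zeta>] Ln_of_real[OF s] by simp
    qed
    then show ?thesis using s \<zeta> by (auto simp: powr_def exp_add distrib_left exp_of_real[symmetric])
  qed
  ultimately show ?thesis unfolding lap_def e by simp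
qed

text \<open>Rotation of the ray without a contour at infinity: \<open>lap\<close> is holomorphic in
  \<zeta> and unchanged when \<zeta> is multiplied by a positive number, so its radial derivative,
  hence its complex derivative, vanishes. On the convex domain it is then constant.\<close>

lemma lap_independent:
  assumes a: "a > 0" and \<zeta>: "\<zeta> \<in> lap_dom z" "\<zeta>' \<in> lap_dom z"
  shows "lap a q z \<zeta> = lap a q z \<zeta>'"
proof -
  have d: "(lap a q z has_field_derivative deriv (lap a q z) w) (at w)" if "w \<in> lap_dom z" for w
    by (rule holomorphic_derivI[OF lap_holomorphic_in_zeta[OF a] open_lap_dom that])
  have d0: "deriv (lap a q z) w = 0" if w: "w \<in> lap_dom z" for w
  proof -
    have "((\<lambda>s. of_real s * w) has_vector_derivative w) (at (1::real))"
      by (auto intro!: derivative_eq_intros)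
    from field_vector_diff_chain_at[OF this, of "lap a q z"] d[OF w]
    have "((\<lambda>s. lap a q z (of_real s * w)) has_vector_derivative w * deriv (lap a q z) w) (at 1)"
      by (simp add: o_def)
    then have "((\<lambda>s. lap a q z w) has_vector_derivative w * deriv (lap a q z) w) (at (1::real))"
      by (rule has_vector_derivative_transform_within_open[of _ _ _ "{0<..}"])
        (use w in \<open>auto simp: lap_dom_def lap_scale\<close>)
    from vector_derivative_unique_at[OF this has_vector_derivative_const]
    have "w * deriv (lap a q z) w = 0" .
    then show ?thesis using w by (auto simp: lap_dom_def)
  qed
  have "\<exists>c. \<forall>w\<in>lap_dom z. lap a q z w = c"
  proof (rule has_field_derivative_zero_constant[OF convex_lap_dom])
    fix w assume "w \<in> lap_dom z"
    then show "(lap a q z has_field_derivative 0) (at w within lap_dom z)"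
      using has_field_derivative_at_within[OF d, of w] d0[of w] by simp
  qed
  then obtain c where "\<forall>w\<in>lap_dom z. lap a q z w = c" by blast
  then show ?thesis using \<zeta> by simp
qed

text \<open>The ray has angle -\<beta>. With \<beta> = Arg z - \<phi>, the decay rate on it is norm
  z * cos \<phi>.\<close>

lemma lap_dom_cis:
  assumes "z \<noteq> 0" "\<bar>\<beta>\<bar> < pi / 2" "\<bar>Arg z - \<beta>\<bar> < pi / 2"
  shows "cis (- \<beta>) \<in> lap_dom z" "Re (z * cis (- \<beta>)) = norm z * cos (Arg z - \<beta>)"
proof -
  have z: "z = of_real (norm z) * cis (Arg z)" using rcis_cmod_Arg[of z] by (simp add: rcis_def)
  have "z * cis (- \<beta>) = of_real (norm z) * (cis (Arg z) * cis (- \<beta>))"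
    using arg_cong[OF z, of "\<lambda>w. w * cis (- \<beta>)"] by (simp only: mult.assoc)
  then have "z * cis (- \<beta>) = of_real (norm z) * cis (Arg z - \<beta>)"
    by (simp only: cis_mult add_uminus_conv_diff)
  then show R: "Re (z * cis (- \<beta>)) = norm z * cos (Arg z - \<beta>)" by simp
  have "cos (Arg z - \<beta>) > 0" by (rule cos_gt_zero_pi; use assms in linarith)
  moreover have "cos \<beta> > 0" by (rule cos_gt_zero_pi; use assms in linarith)
  ultimately show "cis (- \<beta>) \<in> lap_dom z"
    unfolding lap_dom_def mem_Collect_eq R using assms(1) by simp
qed

lemma norm_one_plus_cis_ge:
  assumes "\<bar>\<beta>\<bar> < pi / 2"
  shows "\<bar>\<beta>\<bar> \<le> pi / 4 \<Longrightarrow> 1 \<le> norm (1 + (of_real s * cis (- \<beta>))\<^sup>2)"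
    and "\<bar>sin (2 * \<beta>)\<bar> \<le> norm (1 + (of_real s * cis (- \<beta>))\<^sup>2)"
proof -
  have e: "(of_real s * cis (- \<beta>))\<^sup>2 = of_real (s\<^sup>2) * cis (- (2 * \<beta>))"
    unfolding power_mult_distrib by (subst Complex.DeMoivre) simp
  show "1 \<le> norm (1 + (of_real s * cis (- \<beta>))\<^sup>2)" if "\<bar>\<beta>\<bar> \<le> pi / 4"
  proof -
    have "cos (2 * \<beta>) \<ge> 0" using that by (intro cos_ge_zero) (auto simp: abs_le_iff)
    then have "1 \<le> Re (1 + (of_real s * cis (- \<beta>))\<^sup>2)" unfolding e by simp
    then show ?thesis using complex_Re_le_cmod order_trans by blast
  qed
  show "\<bar>sin (2 * \<beta>)\<bar> \<le> norm (1 + (of_real s * cis (- \<beta>))\<^sup>2)"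
    unfolding e using norm_mult_line_ge[of "cis (- (2 * \<beta>))" "s\<^sup>2"] by simp
qed

interpretation moment_lborel: pair_sigma_finite moment_measure lborel
  by unfold_locales

definition expo :: "nat \<Rightarrow> real" where "expo n = (2 * real n + 2) / 3"

section \<open>Tails as averages over the moment measure\<close>

lemma expo_pos: "expo n > 0" by (simp add: expo_def)

text \<open>Meaningful for \<open>n \<ge> 1\<close> only, because of the truncated subtraction; the same holds for
  \<open>tail\<close> below.\<close>

definition moment :: "nat \<Rightarrow> real" where
  "moment n = (\<integral>p. p ^ (2 * (n - 1)) \<partial>moment_measure)"

text \<open>Equals (2/pi) / (2 sqrt 3 pi): the 2/pi relates q_n to the moments, and the rest
  normalises the tails so that d_n / (2 sqrt 3 pi) is their natural bound.\<close>

definition tail_const :: real where "tail_const = 1 / (sqrt 3 * pi\<^sup>2)"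

lemma tail_const_pos: "tail_const > 0" by (simp add: tail_const_def)

lemma q_coeff_moment: "n \<ge> 1 \<Longrightarrow> q_coeff n = (-1) ^ (n - 1) * (2 / pi) * moment n"
  using moment_eq[of "n - 1"] by (cases "even (n - 1)") (simp_all add: moment_def field_simps)

lemma moment_pos: "moment n > 0"
proof -
  have "AE p in moment_measure. 0 \<le> p ^ (2 * (n - 1))" by (intro AE_I2) simp
  moreover have "moment n \<noteq> 0"
  proof
    assume "moment n = 0"
    then have "AE p in moment_measure. p ^ (2 * (n - 1)) = 0"
      unfolding moment_def using integral_nonneg_eq_0_iff_AE[OF integrable_moment[of "n - 1"]] by simp
    with AE_moment_measure have "AE p in moment_measure. False" by eventually_elim simp
    then show False using moment_measure_nonzero by (simp add: AE_iff_measurable[OF _ refl] trivial_limit_def[symmetric] ae_filter_eq_bot_iff)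
  qed
  ultimately show ?thesis unfolding moment_def using integral_nonneg_AE by (metis less_le)
qed

lemma d_eq:
  assumes "n \<ge> 1"
  shows "d n \<nu> / (2 * sqrt 3 * pi) = tail_const * moment n * (Gamma (expo n) / norm \<nu> powr expo n)"
proof -
  have "6 powr ((2 * real n + 2) / 3) * norm (D0 (2 * n + 1)) = \<bar>q_coeff n\<bar>"
    using arg_cong[OF q_coeff_complex[of n], of norm] by (simp add: norm_mult)
  also have "\<dots> = 2 / pi * moment n"
    using q_coeff_moment[OF assms] moment_pos[of n] by (simp add: abs_mult power_abs)
  finally show ?thesis
    by (simp add: d_def expo_def tail_const_def power2_eq_square)
qed

text \<open>The ray at angle \<open>- Arg \<nu> / 2\<close> serves every \<open>\<nu>\<close> off the cut; any other ray in the domain of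
  convergence gives the same value.\<close>

definition tail :: "nat \<Rightarrow> complex \<Rightarrow> complex" where
  "tail n \<nu> = of_real tail_const *
     (\<integral>p. of_real (p ^ (2 * (n - 1))) * lap (expo n) (p ^ 3) \<nu> (cis (- (Arg \<nu> / 2))) \<partial>moment_measure)"

lemma lap_measurable [measurable]:
  "(\<lambda>p. lap a (p ^ 3) \<nu> \<zeta>) \<in> borel_measurable moment_measure"
proof -
  have "(\<lambda>x. lap_kernel a (fst x ^ 3) \<nu> \<zeta> (snd x)) \<in> borel_measurable (moment_measure \<Otimes>\<^sub>M lborel)"
    by (intro lap_kernel_measurable) measurable
  then have "(\<lambda>(p, v). lap_kernel a (p ^ 3) \<nu> \<zeta> v) \<in> borel_measurable (moment_measure \<Otimes>\<^sub>M lborel)"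
    by (simp add: case_prod_unfold)
  from lborel.borel_measurable_lebesgue_integral[OF this] show ?thesis
    unfolding lap_def by (intro borel_measurable_times) auto
qed

lemma half_angle_dom:
  assumes "\<nu> \<notin> \<real>\<^sub>\<le>\<^sub>0" shows "cis (- (Arg \<nu> / 2)) \<in> lap_dom \<nu>"
proof (rule lap_dom_cis)
  have a: "\<bar>Arg \<nu>\<bar> < pi"
    using Arg_bounded[of \<nu>] assms Arg_eq_pi[of \<nu>] by (auto simp: complex_nonpos_Reals_iff abs_less_iff less_le)
  show "\<bar>Arg \<nu> / 2\<bar> < pi / 2" "\<bar>Arg \<nu> - Arg \<nu> / 2\<bar> < pi / 2" using a by (auto simp: abs_if)
  show "\<nu> \<noteq> 0" using assms by auto
qed

lemma tail_eq:
  assumes "\<nu> \<notin> \<real>\<^sub>\<le>\<^sub>0" "\<zeta> \<in> lap_dom \<nu>"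
  shows "tail n \<nu> = of_real tail_const * (\<integral>p. of_real (p ^ (2 * (n - 1))) * lap (expo n) (p ^ 3) \<nu> \<zeta> \<partial>moment_measure)"
  unfolding tail_def using lap_independent[OF expo_pos half_angle_dom[OF assms(1)] assms(2)] by simp

lemma cis_powr_norm: "norm (cis \<beta> powr of_real a) = 1"
proof -
  have "norm (cis \<beta> powr of_real a) = exp (Re (of_real a * Ln (cis \<beta>)))" by (simp add: powr_def)
  also have "Re (of_real a * Ln (cis \<beta>)) = 0" by simp
  finally show ?thesis by simp
qed

lemma integrable_moment_lap:
  assumes \<zeta>: "\<zeta> \<in> lap_dom \<nu>" and a: "a > 0"
  shows "integrable moment_measure (\<lambda>p. of_real (p ^ (2 * k)) * lap a (p ^ 3) \<nu> \<zeta>)"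
proof (rule moment_measure.integrable_const_bound)
  have R: "Re \<zeta> > 0" using \<zeta> by (auto simp: lap_dom_def)
  then have c: "(Re \<zeta> / norm \<zeta>)\<^sup>2 > 0" by auto
  show "AE p in moment_measure. norm (of_real (p ^ (2 * k)) * lap a (p ^ 3) \<nu> \<zeta>)
      \<le> 1 * (norm (\<zeta> powr of_real a) * (Gamma a / Re (\<nu> * \<zeta>) powr a / (Re \<zeta> / norm \<zeta>)\<^sup>2))"
    using AE_moment_measure
  proof eventually_elim
    case (elim p)
    show ?case unfolding norm_mult
      by (intro mult_mono norm_lap_le[OF a \<zeta> c norm_one_plus_square_ge[OF R], unfolded norm_mult])
        (use elim in \<open>auto simp: power_le_one norm_power\<close>)
  qed
qed measurable

lemma not_nonpos_Real_if_Arg: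
  assumes "\<nu> \<noteq> 0" "\<bar>Arg \<nu>\<bar> < pi" shows "\<nu> \<notin> \<real>\<^sub>\<le>\<^sub>0"
  using assms Arg_eq_pi[of \<nu>] by (auto simp: complex_nonpos_Reals_iff complex_eq_iff less_le)

text \<open>The lower bound c holds for every s, so the estimate of \<open>lap\<close> is the same
  for all p; integrating p^(2n-2) then yields exactly the moment contained in d_n.\<close>

lemma tail_bound:
  assumes n: "n \<ge> 1" and \<nu>: "\<nu> \<noteq> 0" "\<bar>Arg \<nu>\<bar> < pi" and \<beta>: "\<bar>\<beta>\<bar> < pi / 2" "\<bar>Arg \<nu> - \<beta>\<bar> < pi / 2"
    and c: "c > 0" "\<And>s. c \<le> norm (1 + (of_real s * cis (- \<beta>))\<^sup>2)"
  shows "norm (tail n \<nu>) \<le> d n \<nu> / (2 * sqrt 3 * pi) * (1 / (c * cos (Arg \<nu> - \<beta>) powr expo n))"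
proof -
  define \<zeta> where "\<zeta> = cis (- \<beta>)"
  have \<zeta>: "\<zeta> \<in> lap_dom \<nu>" and R: "Re (\<nu> * \<zeta>) = norm \<nu> * cos (Arg \<nu> - \<beta>)"
    unfolding \<zeta>_def using lap_dom_cis[OF \<nu>(1) \<beta>] by auto
  have cp: "cos (Arg \<nu> - \<beta>) > 0" by (rule cos_gt_zero_pi; use \<beta> in linarith)
  note nr = not_nonpos_Real_if_Arg[OF \<nu>]
  define L where "L = Gamma (expo n) / (norm \<nu> * cos (Arg \<nu> - \<beta>)) powr expo n / c"
  have lb: "norm (lap (expo n) q \<nu> \<zeta>) \<le> L" for q
  proof -
    have "norm (lap (expo n) q \<nu> \<zeta>) \<le> norm (\<zeta> powr of_real (expo n)) * (Gamma (expo n) / Re (\<nu> * \<zeta>) powr expo n / c)"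
      by (rule norm_lap_le[OF expo_pos \<zeta> c(1)]) (unfold \<zeta>_def, rule c(2))
    moreover have "norm (\<zeta> powr of_real (expo n)) = 1" by (simp only: \<zeta>_def cis_powr_norm)
    ultimately show ?thesis by (simp only: R L_def mult_1_left)
  qed
  have "norm (\<integral>p. of_real (p ^ (2 * (n - 1))) * lap (expo n) (p ^ 3) \<nu> \<zeta> \<partial>moment_measure)
      \<le> (\<integral>p. p ^ (2 * (n - 1)) * L \<partial>moment_measure)"
  proof (rule order_trans[OF integral_norm_bound], rule integral_mono)
    show "integrable moment_measure (\<lambda>p. norm (of_real (p ^ (2 * (n - 1))) * lap (expo n) (p ^ 3) \<nu> \<zeta>))"
      by (intro integrable_norm integrable_moment_lap \<zeta> expo_pos)
    show "integrable moment_measure (\<lambda>p. p ^ (2 * (n - 1)) * L)"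
      by (intro integrable_mult_left integrable_moment)
    show "norm (of_real (p ^ (2 * (n - 1))) * lap (expo n) (p ^ 3) \<nu> \<zeta>) \<le> p ^ (2 * (n - 1)) * L" for p :: real
      unfolding norm_mult norm_of_real abs_of_nonneg[OF zero_le_even_power'] by (intro mult_left_mono lb) simp
  qed
  also have "\<dots> = moment n * L" by (simp add: moment_def)
  finally have "norm (tail n \<nu>) \<le> tail_const * (moment n * L)"
    unfolding tail_eq[OF nr \<zeta>] norm_mult using tail_const_pos by (simp add: mult_left_mono)
  also have "\<dots> = d n \<nu> / (2 * sqrt 3 * pi) * (1 / (c * cos (Arg \<nu> - \<beta>) powr expo n))"
    unfolding d_eq[OF n] L_def using cp by (simp add: powr_mult mult_ac)
  finally show ?thesis .
qed

text \<open>The ray in the definition of \<open>tail\<close> turns with \<nu>, which spoils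
  holomorphy under the integral. Near a given point the ray of that point may be kept fixed, by
  independence of the ray.\<close>

lemma tail_holomorphic: "tail n holomorphic_on - \<real>\<^sub>\<le>\<^sub>0"
proof (rule holomorphic_onI)
  fix \<nu>0 :: complex assume "\<nu>0 \<in> - \<real>\<^sub>\<le>\<^sub>0"
  then have \<nu>0: "\<nu>0 \<notin> \<real>\<^sub>\<le>\<^sub>0" by simp
  define \<zeta> where "\<zeta> = cis (- (Arg \<nu>0 / 2))"
  have \<zeta>: "Re \<zeta> > 0" "Re (\<nu>0 * \<zeta>) > 0" using half_angle_dom[OF \<nu>0] by (auto simp: \<zeta>_def lap_dom_def)
  define U where "U = {z. Re (z * \<zeta>) > 0}"
  have op: "open {z. Re (z * \<zeta>) > r}" for r
  proof -
    have "{z. Re (z * \<zeta>) > r} = {z. cnj \<zeta> \<bullet> z > r}" by (auto simp: inner_complex_def mult.commute)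
    then show ?thesis by (simp add: open_halfspace_gt)
  qed
  have c: "(Re \<zeta> / norm \<zeta>)\<^sup>2 > 0" using \<zeta> by auto
  have "(\<lambda>\<nu>. \<integral>p. of_real (p ^ (2 * (n - 1))) * lap (expo n) (p ^ 3) \<nu> \<zeta> \<partial>moment_measure) holomorphic_on U"
  proof (rule holomorphic_on_integral)
    show "open U" unfolding U_def by (rule op)
    show "(\<lambda>p. of_real (p ^ (2 * (n - 1))) * lap (expo n) (p ^ 3) z \<zeta>) \<in> borel_measurable moment_measure" for z
      by measurable
    show "AE p in moment_measure. (\<lambda>z. of_real (p ^ (2 * (n - 1))) * lap (expo n) (p ^ 3) z \<zeta>) holomorphic_on U"
      unfolding U_def by (intro AE_I2 holomorphic_intros lap_holomorphic_in_z expo_pos \<zeta>)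
    fix z0 assume "z0 \<in> U"
    then have z0: "Re (z0 * \<zeta>) > 0" by (simp add: U_def)
    define r where "r = Re (z0 * \<zeta>) / 2"
    have r: "r > 0" "r < Re (z0 * \<zeta>)" unfolding r_def using z0 by linarith+
    obtain e where e: "e > 0" "ball z0 e \<subseteq> {z. Re (z * \<zeta>) > r}"
      using op[of r] r(2) open_contains_ball by blast
    define B where "B = norm (\<zeta> powr of_real (expo n)) * (Gamma (expo n) / r powr expo n / (Re \<zeta> / norm \<zeta>)\<^sup>2)"
    show "\<exists>r>0. \<exists>B. integrable moment_measure B \<and> (AE p in moment_measure. \<forall>z\<in>ball z0 r \<inter> U.
       norm (of_real (p ^ (2 * (n - 1))) * lap (expo n) (p ^ 3) z \<zeta>) \<le> B p)"
    proof (intro exI conjI)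
      show "integrable moment_measure (\<lambda>_. 1 * B)" by simp
      show "AE p in moment_measure. \<forall>z\<in>ball z0 e \<inter> U. norm (of_real (p ^ (2 * (n - 1))) * lap (expo n) (p ^ 3) z \<zeta>) \<le> 1 * B"
        using AE_moment_measure
      proof eventually_elim
        case (elim p)
        show ?case
        proof
          fix z assume z: "z \<in> ball z0 e \<inter> U"
          then have rz: "r < Re (z * \<zeta>)" using e(2) by auto
          have dom: "\<zeta> \<in> lap_dom z" using z \<zeta>(1) by (auto simp: U_def lap_dom_def)
          have "norm (lap (expo n) (p ^ 3) z \<zeta>) \<le> norm (\<zeta> powr of_real (expo n)) * (Gamma (expo n) / Re (z * \<zeta>) powr expo n / (Re \<zeta> / norm \<zeta>)\<^sup>2)"
            by (rule norm_lap_le[OF expo_pos dom c norm_one_plus_square_ge[OF \<zeta>(1)]])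
          also have "\<dots> \<le> B"
            unfolding B_def using r rz expo_pos[of n] Gamma_real_pos[OF expo_pos[of n]]
            by (intro mult_left_mono divide_right_mono divide_left_mono powr_mono2 mult_pos_pos) auto
          finally have "norm (lap (expo n) (p ^ 3) z \<zeta>) \<le> B" .
          then show "norm (of_real (p ^ (2 * (n - 1))) * lap (expo n) (p ^ 3) z \<zeta>) \<le> 1 * B"
            unfolding norm_mult using elim by (intro mult_mono) (auto simp: norm_power power_le_one)
        qed
      qed
    qed (rule e(1))
  qed
  then have "(\<lambda>\<nu>. of_real tail_const * (\<integral>p. of_real (p ^ (2 * (n - 1))) * lap (expo n) (p ^ 3) \<nu> \<zeta> \<partial>moment_measure)) holomorphic_on (U \<inter> - \<real>\<^sub>\<le>\<^sub>0)"
    by (intro holomorphic_intros) (auto intro: holomorphic_on_subset)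
  then have "tail n holomorphic_on (U \<inter> - \<real>\<^sub>\<le>\<^sub>0)"
  proof (rule holomorphic_transform)
    fix \<nu> assume "\<nu> \<in> U \<inter> - \<real>\<^sub>\<le>\<^sub>0"
    then show "of_real tail_const * (\<integral>p. of_real (p ^ (2 * (n - 1))) * lap (expo n) (p ^ 3) \<nu> \<zeta> \<partial>moment_measure) = tail n \<nu>"
      using \<zeta>(1) by (intro tail_eq[symmetric]) (auto simp: U_def lap_dom_def)
  qed
  moreover have "open (U \<inter> - \<real>\<^sub>\<le>\<^sub>0)"
    unfolding U_def using op closed_nonpos_Reals_complex by (intro open_Int open_Compl)
  ultimately have "tail n field_differentiable at \<nu>0"
    using \<nu>0 \<zeta>(2) by (intro holomorphic_on_imp_differentiable_at[of _ "U \<inter> - \<real>\<^sub>\<le>\<^sub>0"]) (auto simp: U_def)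
  then show "tail n field_differentiable at \<nu>0 within - \<real>\<^sub>\<le>\<^sub>0"
    by (rule field_differentiable_at_within)
qed

section \<open>Tails for positive argument\<close>

lemma integral_pos_of_pos_on_half_line:
  fixes f :: "real \<Rightarrow> real"
  assumes f: "integrable lborel f" and nn: "\<And>u. 0 \<le> f u" and pos: "\<And>u. 0 < u \<Longrightarrow> 0 < f u"
  shows "0 < (\<integral>u. f u \<partial>lborel)"
proof -
  have "(\<integral>u. f u \<partial>lborel) \<noteq> 0"
  proof
    assume "(\<integral>u. f u \<partial>lborel) = 0"
    then have "AE u in lborel. f u = 0" using integral_nonneg_eq_0_iff_AE[OF f] nn by simp
    then have "AE u in lborel. u \<notin> {0<..<1::real}"
    proof eventually_elim
      case (elim u) then show ?case using pos[of u] by fastforce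
    qed
    then have "emeasure lborel {0<..<1::real} = 0"
      by (subst (asm) AE_iff_measurable[of "{0<..<1::real}"]) auto
    then show False by simp
  qed
  moreover have "0 \<le> (\<integral>u. f u \<partial>lborel)" using nn by simp
  ultimately show ?thesis by simp
qed

definition tail_density :: "nat \<Rightarrow> real \<Rightarrow> real" where
  "tail_density n u = tail_const * (\<integral>p. p ^ (2 * (n - 1)) * (u powr (expo n - 1) / (1 + (p ^ 3 * u)\<^sup>2)) \<partial>moment_measure)"

context
  fixes \<nu> :: real and n :: nat
  assumes \<nu>: "\<nu> > 0"
begin

private definition g :: "real \<Rightarrow> real \<Rightarrow> real" where
  "g q u = indicator {0<..} u * (u powr (expo n - 1) * exp (- \<nu> * u) / (1 + (q * u)\<^sup>2))"

private definition g0 :: "real \<Rightarrow> real" where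
  "g0 u = indicator {0<..} u * (u powr (expo n - 1) * exp (- \<nu> * u))"

private lemma g0: "integrable lborel g0" "(\<integral>u. g0 u \<partial>lborel) = Gamma (expo n) / \<nu> powr expo n"
  using gamma_integral_scaled[OF expo_pos \<nu>, of n]
  unfolding set_integrable_def set_lebesgue_integral_def g0_def[abs_def] by simp_all

private lemma g_bounds: "0 \<le> g q u" "g q u \<le> g0 u" "0 < u \<Longrightarrow> 0 < g q u" "0 < u \<Longrightarrow> q \<noteq> 0 \<Longrightarrow> g q u < g0 u"
proof -
  have p: "1 \<le> 1 + (q * u)\<^sup>2" by simp
  have d: "x / (1 + (q * u)\<^sup>2) \<le> x" if "0 \<le> x" for x
    using divide_left_mono[OF p that] add_pos_nonneg[OF zero_less_one zero_le_power2[of "q * u"]] by simp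
  show "0 \<le> g q u" by (simp add: g_def add_nonneg_nonneg)
  show "g q u \<le> g0 u" unfolding g_def g0_def by (intro mult_left_mono d) auto
  show "0 < g q u" if "0 < u" using that by (simp add: g_def add_pos_nonneg)
  show "g q u < g0 u" if u: "0 < u" "q \<noteq> 0"
  proof -
    have "1 < 1 + (q * u)\<^sup>2" using u by simp
    moreover have "0 < u powr (expo n - 1) * exp (- \<nu> * u)" using u by simp
    ultimately have "u powr (expo n - 1) * exp (- \<nu> * u) / (1 + (q * u)\<^sup>2) < u powr (expo n - 1) * exp (- \<nu> * u)"
      by (simp only: divide_less_eq) (simp add: mult_less_cancel_left2 add_pos_nonneg)
    then show ?thesis using u by (simp add: g_def g0_def)
  qed
qed

private lemma g_measurable [measurable]:
  assumes [measurable]: "f \<in> borel_measurable M" "h \<in> borel_measurable M"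
  shows "(\<lambda>x. g (f x) (h x)) \<in> borel_measurable M"
  unfolding g_def by measurable

private lemma g_integrable: "integrable lborel (g q)"
proof (rule Bochner_Integration.integrable_bound[OF g0(1)])
  show "g q \<in> borel_measurable lborel" using g_measurable[of "\<lambda>_. q" lborel "\<lambda>u. u"] by simp
  show "AE u in lborel. norm (g q u) \<le> norm (g0 u)"
  proof (rule AE_I2)
    show "norm (g q u) \<le> norm (g0 u)" for u using g_bounds(1,2)[of q u] unfolding real_norm_def by linarith
  qed
qed

private definition L :: "real \<Rightarrow> real" where "L q = (\<integral>u. g q u \<partial>lborel)"

private lemma L_bounds: "0 < L q" "L q \<le> Gamma (expo n) / \<nu> powr expo n" "q \<noteq> 0 \<Longrightarrow> L q < Gamma (expo n) / \<nu> powr expo n"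
proof -
  show "0 < L q"
    unfolding L_def by (rule integral_pos_of_pos_on_half_line[OF g_integrable g_bounds(1) g_bounds(3)])
  show "L q \<le> Gamma (expo n) / \<nu> powr expo n"
    unfolding L_def g0(2)[symmetric] by (intro integral_mono g_integrable g0 g_bounds)
  show "L q < Gamma (expo n) / \<nu> powr expo n" if "q \<noteq> 0"
  proof -
    have "0 < (\<integral>u. g0 u - g q u \<partial>lborel)"
      by (rule integral_pos_of_pos_on_half_line)
        (use g_integrable g0(1) g_bounds(2) g_bounds(4)[OF _ that] in \<open>simp_all\<close>)
    then show ?thesis unfolding L_def g0(2)[symmetric] using g_integrable g0(1) by simp
  qed
qed

private lemma lap_real: "lap (expo n) q (of_real \<nu>) 1 = of_real (L q)"
proof -
  have "lap_kernel (expo n) q (of_real \<nu>) 1 u = of_real (g q u)" for u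
    by (cases "u > 0") (simp_all add: lap_kernel_def g_def flip: exp_of_real)
  then have "lap_kernel (expo n) q (of_real \<nu>) 1 = (\<lambda>u. of_real (g q u))" by (rule ext)
  then show ?thesis unfolding lap_def L_def by (simp only: integral_complex_of_real) simp
qed

private lemma L_measurable: "(\<lambda>p. L (p ^ 3)) \<in> borel_measurable moment_measure"
proof -
  have "(\<lambda>x. g (fst x ^ 3) (snd x)) \<in> borel_measurable (moment_measure \<Otimes>\<^sub>M lborel)" by measurable
  then have "(\<lambda>(p, v). g (p ^ 3) v) \<in> borel_measurable (moment_measure \<Otimes>\<^sub>M lborel)"
    by (simp add: case_prod_unfold)
  from lborel.borel_measurable_lebesgue_integral[OF this] show ?thesis unfolding L_def .
qed

private lemma pL_integrable: "integrable moment_measure (\<lambda>p. p ^ (2 * k) * L (p ^ 3))"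
proof (rule Bochner_Integration.integrable_bound)
  show "integrable moment_measure (\<lambda>p. p ^ (2 * k) * (Gamma (expo n) / \<nu> powr expo n))"
    by (intro integrable_mult_left integrable_moment)
  show "(\<lambda>p. p ^ (2 * k) * L (p ^ 3)) \<in> borel_measurable moment_measure" using L_measurable by measurable
  show "AE p in moment_measure. norm (p ^ (2 * k) * L (p ^ 3)) \<le> norm (p ^ (2 * k) * (Gamma (expo n) / \<nu> powr expo n))"
  proof (rule AE_I2)
    fix p :: real
    have "0 \<le> p ^ (2 * k) * L (p ^ 3)" using L_bounds(1)[of "p ^ 3"] by simp
    moreover have "p ^ (2 * k) * L (p ^ 3) \<le> p ^ (2 * k) * (Gamma (expo n) / \<nu> powr expo n)"
      by (rule mult_left_mono[OF L_bounds(2) zero_le_even_power'])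
    ultimately show "norm (p ^ (2 * k) * L (p ^ 3)) \<le> norm (p ^ (2 * k) * (Gamma (expo n) / \<nu> powr expo n))"
      unfolding real_norm_def by linarith
  qed
qed

private lemma tail_real: "tail n (of_real \<nu>) = of_real (tail_const * (\<integral>p. p ^ (2 * (n - 1)) * L (p ^ 3) \<partial>moment_measure))"
proof -
  have "(1::complex) \<in> lap_dom (of_real \<nu>)" using \<nu> by (simp add: lap_dom_def)
  moreover have "complex_of_real \<nu> \<notin> \<real>\<^sub>\<le>\<^sub>0" using \<nu> by simp
  ultimately have "tail n (of_real \<nu>) = of_real tail_const * (\<integral>p. of_real (p ^ (2 * (n - 1)) * L (p ^ 3)) \<partial>moment_measure)"
    using tail_eq[of "of_real \<nu>" 1 n, unfolded lap_real] by (simp only: of_real_mult not_False_eq_True simp_thms)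
  then show ?thesis unfolding integral_complex_of_real by (simp only: of_real_mult)
qed

text \<open>On the ray \<zeta> = 1 the factor 1 / (1 + (p^3 u)^2) lies strictly between 0 and 1 for
  p > 0 and u > 0. Strictness survives both integrations because almost every p is positive and the
  measure is nonzero.\<close>

lemma tail_strict_bounds:
  assumes n: "n \<ge> 1"
  obtains t where "tail n (of_real \<nu>) = of_real t" "0 < t" "t < d n (of_real \<nu>) / (2 * sqrt 3 * pi)"
proof
  let ?t = "tail_const * (\<integral>p. p ^ (2 * (n - 1)) * L (p ^ 3) \<partial>moment_measure)"
  show "tail n (of_real \<nu>) = of_real ?t" by (rule tail_real)
  have "(\<integral>p. 0 \<partial>moment_measure) < (\<integral>p. p ^ (2 * (n - 1)) * L (p ^ 3) \<partial>moment_measure)"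
  proof (rule moment_measure.integral_less_AE_space)
    show "AE p in moment_measure. 0 < p ^ (2 * (n - 1)) * L (p ^ 3)"
      using AE_moment_measure by eventually_elim (use L_bounds(1) in simp)
  qed (use pL_integrable moment_measure_nonzero in auto)
  then show "0 < ?t" using tail_const_pos by simp
  have "(\<integral>p. p ^ (2 * (n - 1)) * L (p ^ 3) \<partial>moment_measure) < (\<integral>p. p ^ (2 * (n - 1)) * (Gamma (expo n) / \<nu> powr expo n) \<partial>moment_measure)"
  proof (rule moment_measure.integral_less_AE_space)
    show "AE p in moment_measure. p ^ (2 * (n - 1)) * L (p ^ 3) < p ^ (2 * (n - 1)) * (Gamma (expo n) / \<nu> powr expo n)"
      using AE_moment_measure by eventually_elim (use L_bounds(3) in \<open>intro mult_strict_left_mono; simp\<close>)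
    show "integrable moment_measure (\<lambda>p. p ^ (2 * (n - 1)) * (Gamma (expo n) / \<nu> powr expo n))"
      by (intro integrable_mult_left integrable_moment)
  qed (use pL_integrable moment_measure_nonzero in auto)
  also have "\<dots> = moment n * (Gamma (expo n) / \<nu> powr expo n)" by (simp add: moment_def)
  finally show "?t < d n (of_real \<nu>) / (2 * sqrt 3 * pi)"
    unfolding d_eq[OF n] using mult_strict_left_mono[OF _ tail_const_pos]
    by (simp only: mult.assoc norm_of_real abs_of_pos[OF \<nu>])
qed

text \<open>Fubini interchanges p and u, giving the tail as a Laplace transform in u, the form in
  which \<open>borel_density\<close> is expanded.\<close>

lemma tail_laplace:
  shows "set_integrable lborel {0<..} (\<lambda>u. tail_density n u * exp (- \<nu> * u))"
    and "tail n (of_real \<nu>) = of_real (LBINT u:{0<..}. tail_density n u * exp (- \<nu> * u))"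
proof -
  define f where "f = (\<lambda>p u. p ^ (2 * (n - 1)) * g (p ^ 3) u)"
  have fm: "(\<lambda>(p, u). f p u) \<in> borel_measurable (moment_measure \<Otimes>\<^sub>M lborel)"
    unfolding f_def case_prod_unfold by measurable
  have int: "integrable (moment_measure \<Otimes>\<^sub>M lborel) (\<lambda>(p, u). f p u)"
  proof (rule moment_lborel.Fubini_integrable[OF fm])
    have "(\<integral>u. norm (f p u) \<partial>lborel) = p ^ (2 * (n - 1)) * L (p ^ 3)" for p
      using g_bounds(1) by (simp add: f_def L_def abs_mult power_mult)
    then show "integrable moment_measure (\<lambda>p. \<integral>u. norm (case (p, u) of (p, u) \<Rightarrow> f p u) \<partial>lborel)"
      using pL_integrable by simp
    show "AE p in moment_measure. integrable lborel (\<lambda>u. case (p, u) of (p, u) \<Rightarrow> f p u)"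
      by (intro AE_I2) (simp add: f_def g_integrable)
  qed
  have e: "tail_const * (\<integral>p. f p u \<partial>moment_measure) = indicator {0<..} u *\<^sub>R (tail_density n u * exp (- \<nu> * u))" for u
  proof (cases "u > 0")
    case True
    have "(\<integral>p. f p u \<partial>moment_measure) = (\<integral>p. (p ^ (2 * (n - 1)) * (u powr (expo n - 1) / (1 + (p ^ 3 * u)\<^sup>2))) * exp (- \<nu> * u) \<partial>moment_measure)"
      using True by (intro Bochner_Integration.integral_cong refl) (simp add: f_def g_def)
    also have "\<dots> = (\<integral>p. p ^ (2 * (n - 1)) * (u powr (expo n - 1) / (1 + (p ^ 3 * u)\<^sup>2)) \<partial>moment_measure) * exp (- \<nu> * u)"
      by (rule integral_mult_left_zero)
    finally show ?thesis using True by (simp only: tail_density_def) simp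
  qed (simp add: f_def g_def)
  have "integrable lborel (\<lambda>u. tail_const * (\<integral>p. f p u \<partial>moment_measure))"
    by (intro integrable_mult_right moment_lborel.integrable_snd int)
  then show "set_integrable lborel {0<..} (\<lambda>u. tail_density n u * exp (- \<nu> * u))"
    unfolding e set_integrable_def .
  have "(\<integral>u. (\<integral>p. f p u \<partial>moment_measure) \<partial>lborel) = (\<integral>p. (\<integral>u. f p u \<partial>lborel) \<partial>moment_measure)"
    by (rule moment_lborel.Fubini_integral[OF int])
  also have "\<dots> = (\<integral>p. p ^ (2 * (n - 1)) * L (p ^ 3) \<partial>moment_measure)"
    by (simp add: f_def L_def)
  finally have "tail n (of_real \<nu>) = of_real (\<integral>u. tail_const * (\<integral>p. f p u \<partial>moment_measure) \<partial>lborel)"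
    unfolding tail_real by simp
  then show "tail n (of_real \<nu>) = of_real (LBINT u:{0<..}. tail_density n u * exp (- \<nu> * u))"
    unfolding e set_lebesgue_integral_def .
qed

end

subsection \<open>The remainder as a combination of tails\<close>

lemma stieltjes_kernel_integrable:
  assumes x: "Im x \<noteq> 0"
  shows "integrable moment_measure (\<lambda>p. of_real (p ^ (2 * m)) / (1 + of_real (p\<^sup>2) * x))"
proof (rule Bochner_Integration.integrable_bound)
  have nx: "norm x > 0" using x by auto
  show "integrable moment_measure (\<lambda>p. p ^ (2 * m) * (norm x / \<bar>Im x\<bar>))"
    by (intro integrable_mult_left integrable_moment)
  show "AE p in moment_measure. norm (of_real (p ^ (2 * m)) / (1 + of_real (p\<^sup>2) * x)) \<le> norm (p ^ (2 * m) * (norm x / \<bar>Im x\<bar>))"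
  proof (rule AE_I2)
    fix p :: real
    have "\<bar>Im x\<bar> / norm x \<le> norm (1 + of_real (p\<^sup>2) * x)"
      using norm_mult_line_ge[of x "p\<^sup>2"] nx by (simp add: divide_le_eq mult.commute)
    moreover have "0 < \<bar>Im x\<bar> / norm x" using x nx by simp
    ultimately have "1 / norm (1 + of_real (p\<^sup>2) * x) \<le> 1 / (\<bar>Im x\<bar> / norm x)"
      by (intro divide_left_mono mult_pos_pos) linarith+
    from mult_left_mono[OF this zero_le_even_power'[of p m]]
    have "p ^ (2 * m) / norm (1 + of_real (p\<^sup>2) * x) \<le> p ^ (2 * m) * (norm x / \<bar>Im x\<bar>)" by simp
    then show "norm (of_real (p ^ (2 * m)) / (1 + of_real (p\<^sup>2) * x)) \<le> norm (p ^ (2 * m) * (norm x / \<bar>Im x\<bar>))"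
      unfolding norm_divide norm_of_real abs_of_nonneg[OF zero_le_even_power'] real_norm_def by linarith
  qed
qed measurable

text \<open>Each step uses 1/(1 + p^2 x) = 1 - p^2 x / (1 + p^2 x): the new moment supplies the next
  coefficient, and the remaining integral carries two more powers of p.\<close>

lemma stieltjes_remainder:
  assumes x: "Im x \<noteq> 0"
  shows "of_real (q_coeff 0) + of_real (2 / pi) * x * stieltjes x =
    (\<Sum>n<Suc m. of_real (q_coeff n) * x ^ n) +
    of_real ((-1) ^ m * (2 / pi)) * x ^ Suc m * (\<integral>p. of_real (p ^ (2 * m)) / (1 + of_real (p\<^sup>2) * x) \<partial>moment_measure)"
proof (induction m)
  case 0
  then show ?case by (simp add: stieltjes_def)
next
  case (Suc m)
  define I where "I = (\<lambda>m. \<integral>p. of_real (p ^ (2 * m)) / (1 + of_real (p\<^sup>2) * x) \<partial>moment_measure)"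
  have nz: "1 + of_real (p\<^sup>2) * x \<noteq> 0" for p :: real
    using x by (intro stieltjes_denominator_nonzero) (auto simp: complex_nonpos_Reals_iff)
  have "I m = (\<integral>p. of_real (p ^ (2 * m)) - x * (of_real (p ^ (2 * Suc m)) / (1 + of_real (p\<^sup>2) * x)) \<partial>moment_measure)"
    unfolding I_def
  proof (intro Bochner_Integration.integral_cong refl)
    fix p :: real
    have e: "complex_of_real (p ^ (2 * Suc m)) = of_real (p ^ (2 * m)) * of_real (p\<^sup>2)"
      by (simp add: power2_eq_square)
    show "complex_of_real (p ^ (2 * m)) / (1 + of_real (p\<^sup>2) * x) =
        of_real (p ^ (2 * m)) - x * (of_real (p ^ (2 * Suc m)) / (1 + of_real (p\<^sup>2) * x))"
      unfolding e using nz[of p] by (simp add: field_simps del: of_real_power)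
  qed
  also have "\<dots> = of_real (moment (Suc m)) - x * I (Suc m)"
  proof -
    have "integrable moment_measure (\<lambda>p. complex_of_real (p ^ (2 * m)))"
      by (intro integrable_of_real integrable_moment)
    moreover have "integrable moment_measure (\<lambda>p. x * (of_real (p ^ (2 * Suc m)) / (1 + of_real (p\<^sup>2) * x)))"
      by (intro integrable_mult_right stieltjes_kernel_integrable x)
    ultimately show ?thesis
      unfolding I_def moment_def diff_Suc_1 integral_complex_of_real[symmetric] integral_mult_right_zero[symmetric]
      by (rule Bochner_Integration.integral_diff)
  qed
  finally have Im: "I m = of_real (moment (Suc m)) - x * I (Suc m)" .
  have q: "q_coeff (Suc m) = (-1) ^ m * (2 / pi) * moment (Suc m)"
    using q_coeff_moment[of "Suc m"] by simp
  have e: "of_real ((-1) ^ m * (2 / pi)) * x ^ Suc m * I m =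
      of_real (q_coeff (Suc m)) * x ^ Suc m + of_real ((-1) ^ Suc m * (2 / pi)) * x ^ Suc (Suc m) * I (Suc m)"
    unfolding Im q by (simp add: algebra_simps diff_divide_distrib)
  show ?case
    unfolding Suc.IH e[unfolded I_def] sum.lessThan_Suc[of _ "Suc m"] by (simp only: add.assoc)
qed

text \<open>Multiplying by the conjugate of the denominator gives 1 - t + t^2, and a further factor
  1 + t gives 1 + t^3. With t = p^2 u^(2/3) this is the denominator 1 + (p^3 u)^2 of the tails, and
  the three powers of t in the numerator are the source of three consecutive tails.\<close>

lemma cis_quotient_Im:
  fixes a t :: real
  assumes "t \<ge> 0"
  shows "Im (cis a / (1 + of_real t * cis (2 * pi / 3))) =
    (sin a + sin (a - pi / 3) * t + sin (a - 2 * pi / 3) * t\<^sup>2) / (1 + t ^ 3)"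
proof -
  define z where "z = cis (2 * pi / 3)"
  have cs: "cos (2 * pi / 3) = - 1 / 2" "sin (2 * pi / 3) = sqrt 3 / 2"
    using cos_120 sin_120 by simp_all
  have z: "z = Complex (- 1 / 2) (sqrt 3 / 2)" unfolding z_def by (simp only: complex_eq_iff cis.simps cs) simp
  have D: "1 - t + t\<^sup>2 > 0"
  proof -
    have "1 - t + t\<^sup>2 = (t - 1 / 2)\<^sup>2 + 3 / 4" by (simp add: power2_eq_square algebra_simps)
    then show ?thesis using zero_le_power2[of "t - 1 / 2"] by linarith
  qed
  have zz: "(1 + of_real t * z) * (1 + of_real t * cnj z) = of_real (1 - t + t\<^sup>2)"
    unfolding z by (simp add: complex_eq_iff power2_eq_square algebra_simps)
  have "(1 + of_real t * z) \<noteq> 0 \<and> (1 + of_real t * cnj z) \<noteq> 0" using zz D by (metis mult_eq_0_iff of_real_eq_0_iff less_irrefl)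
  then have "cis a / (1 + of_real t * z) = cis a * (1 + of_real t * cnj z) / of_real (1 - t + t\<^sup>2)"
    unfolding zz[symmetric] by (simp only: nonzero_mult_divide_mult_cancel_right not_False_eq_True simp_thms)
  then have "Im (cis a / (1 + of_real t * z)) = Im (cis a * (1 + of_real t * cnj z)) / (1 - t + t\<^sup>2)"
    by (simp only: Im_divide_of_real)
  also have "Im (cis a * (1 + of_real t * cnj z)) = sin a + sin (a - 2 * pi / 3) * t"
    unfolding z_def by (simp add: sin_diff algebra_simps)
  also have "(sin a + sin (a - 2 * pi / 3) * t) / (1 - t + t\<^sup>2) = (sin a + sin (a - 2 * pi / 3) * t) * (1 + t) / (1 + t ^ 3)"
  proof -
    have "1 + t ^ 3 = (1 - t + t\<^sup>2) * (1 + t)" by (simp add: power2_eq_square power3_eq_cube algebra_simps)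
    then show ?thesis using D assms by simp
  qed
  also have "sin (a - 2 * pi / 3) = sin (a - pi / 3) - sin a"
    by (simp add: sin_diff cs sin_60 cos_60)
  then have e: "sin (a - pi / 3) = sin a + sin (a - 2 * pi / 3)" by linarith
  have "(sin a + sin (a - 2 * pi / 3) * t) * (1 + t) = sin a + sin (a - pi / 3) * t + sin (a - 2 * pi / 3) * t\<^sup>2"
    unfolding e by (simp add: distrib_left distrib_right power2_eq_square)
  finally show ?thesis unfolding z_def .
qed


lemma Im_of_real_mult: "Im (of_real a * z) = a * Im z"
  by simp

lemma tail_density_eq:
  "tail_density n u = tail_const * (u powr (expo n - 1) * (\<integral>p. p ^ (2 * (n - 1)) / (1 + (p ^ 3 * u)\<^sup>2) \<partial>moment_measure))"
proof -
  have "(\<integral>p. p ^ (2 * (n - 1)) * (u powr (expo n - 1) / (1 + (p ^ 3 * u)\<^sup>2)) \<partial>moment_measure)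
     = (\<integral>p. u powr (expo n - 1) * (p ^ (2 * (n - 1)) / (1 + (p ^ 3 * u)\<^sup>2)) \<partial>moment_measure)"
    by (simp add: mult_ac)
  then show ?thesis unfolding tail_density_def by (simp only: integral_mult_right_zero)
qed

lemma tail_density_integrable:
  "integrable moment_measure (\<lambda>p. p ^ (2 * k) / (1 + (p ^ 3 * u)\<^sup>2))"
proof (rule Bochner_Integration.integrable_bound[OF integrable_moment[of k]])
  show "AE p in moment_measure. norm (p ^ (2 * k) / (1 + (p ^ 3 * u)\<^sup>2)) \<le> norm (p ^ (2 * k))"
  proof (rule AE_I2)
    fix p :: real
    have "p ^ (2 * k) / (1 + (p ^ 3 * u)\<^sup>2) \<le> p ^ (2 * k) / 1"
      by (intro divide_left_mono) (auto simp: add_pos_nonneg)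
    moreover have "0 \<le> p ^ (2 * k) / (1 + (p ^ 3 * u)\<^sup>2)" by (simp add: add_nonneg_nonneg)
    ultimately show "norm (p ^ (2 * k) / (1 + (p ^ 3 * u)\<^sup>2)) \<le> norm (p ^ (2 * k))" by simp
  qed
qed measurable

definition expansion_term :: "nat \<Rightarrow> real" where
  "expansion_term n = 1 / (3 * pi) * q_coeff n * sin ((2 * real n + 2) * pi / 3)"

text \<open>The leading terms have Laplace transforms equal to the terms of the expansion. In the
  remainder the factors t and t^2 with t = p^2 u^(2/3) raise the power of p by 2 and 4 and that of u
  by 2/3 and 4/3, which turns the density of index N into those of index N + 1 and N + 2.\<close>

lemma borel_density_remainder:
  assumes u: "u > 0" and N: "N = Suc m"
  shows "borel_density u = (\<Sum>n<N. expansion_term n * u powr (expo n - 1)) + (-1) ^ N * (2 / sqrt 3) *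
    (sin ((2 * real N - 1) * pi / 3) * tail_density N u + sin ((2 * real N - 2) * pi / 3) * tail_density (N + 1) u
     + sin ((2 * real N - 3) * pi / 3) * tail_density (N + 2) u)"
proof -
  define r where "r = u powr (1 / 3)"
  define w where "w = of_real r * cis (pi / 3)"
  define x where "x = w\<^sup>2"
  have r: "r > 0" using u by (simp add: r_def)
  have w0: "w \<noteq> 0" using r by (simp add: w_def)
  have rpow: "r ^ k = u powr (real k / 3)" for k
    using r by (simp add: r_def powr_powr flip: powr_realpow)
  have x: "x = of_real (r\<^sup>2) * cis (2 * pi / 3)"
    unfolding x_def w_def power_mult_distrib Complex.DeMoivre by simp
  have ix: "Im x \<noteq> 0" using r by (simp add: x sin_120)
  have xw: "x ^ n / w = of_real (u powr (expo n - 1)) * cis ((2 * real n - 1) * pi / 3)" for n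
  proof -
    have "x ^ n / w = of_real (r ^ (2 * n) / r) * (cis (pi / 3) ^ (2 * n) / cis (pi / 3))"
      unfolding x_def w_def by (simp add: power_mult_distrib flip: power_mult)
    also have "r ^ (2 * n) / r = u powr (expo n - 1)"
      unfolding rpow expo_def using u by (simp add: r_def field_simps flip: powr_diff)
    also have "cis (pi / 3) ^ (2 * n) / cis (pi / 3) = cis ((2 * real n - 1) * pi / 3)"
      unfolding Complex.DeMoivre cis_divide by (simp add: field_simps)
    finally show ?thesis .
  qed
  define K where "K = (\<integral>p. of_real (p ^ (2 * m)) / (1 + of_real (p\<^sup>2) * x) \<partial>moment_measure)"
  define a where "a = (2 * real N - 1) * pi / 3"
  have ImK: "Im (cis a * K) = (\<integral>p. sin a * (p ^ (2 * (N - 1)) / (1 + (p ^ 3 * u)\<^sup>2))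
      + sin (a - pi / 3) * r\<^sup>2 * (p ^ (2 * N) / (1 + (p ^ 3 * u)\<^sup>2))
      + sin (a - 2 * pi / 3) * r ^ 4 * (p ^ (2 * (N + 1)) / (1 + (p ^ 3 * u)\<^sup>2)) \<partial>moment_measure)"
  proof -
    have "Im (cis a * K) = (\<integral>p. Im (cis a * (of_real (p ^ (2 * m)) / (1 + of_real (p\<^sup>2) * x))) \<partial>moment_measure)"
      unfolding K_def integral_mult_right_zero[symmetric]
      by (rule integral_Im[symmetric]) (intro integrable_mult_right stieltjes_kernel_integrable ix)
    also have "\<dots> = (\<integral>p. sin a * (p ^ (2 * (N - 1)) / (1 + (p ^ 3 * u)\<^sup>2))
      + sin (a - pi / 3) * r\<^sup>2 * (p ^ (2 * N) / (1 + (p ^ 3 * u)\<^sup>2))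
      + sin (a - 2 * pi / 3) * r ^ 4 * (p ^ (2 * (N + 1)) / (1 + (p ^ 3 * u)\<^sup>2)) \<partial>moment_measure)"
    proof (intro Bochner_Integration.integral_cong refl)
      fix p :: real
      define t where "t = p\<^sup>2 * r\<^sup>2"
      have t: "t \<ge> 0" by (simp add: t_def)
      have "r ^ 3 = u" using rpow[of 3] u by simp
      then have "u\<^sup>2 = (r ^ 3)\<^sup>2" by simp
      then have t3: "t ^ 3 = (p ^ 3 * u)\<^sup>2" by (simp add: t_def power_mult_distrib flip: power_mult)
      have "cis a * (of_real (p ^ (2 * m)) / (1 + of_real (p\<^sup>2) * x)) = of_real (p ^ (2 * m)) * (cis a / (1 + of_real t * cis (2 * pi / 3)))"
        by (simp add: x t_def mult_ac)
      then have "Im (cis a * (of_real (p ^ (2 * m)) / (1 + of_real (p\<^sup>2) * x))) =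
          p ^ (2 * m) * ((sin a + sin (a - pi / 3) * t + sin (a - 2 * pi / 3) * t\<^sup>2) / (1 + t ^ 3))"
        by (simp only: Im_of_real_mult cis_quotient_Im[OF t])
      also have "\<dots> = sin a * (p ^ (2 * m) / (1 + t ^ 3)) + sin (a - pi / 3) * (p ^ (2 * m) * t / (1 + t ^ 3))
          + sin (a - 2 * pi / 3) * (p ^ (2 * m) * t\<^sup>2 / (1 + t ^ 3))"
        by (simp add: add_divide_distrib algebra_simps)
      also have "p ^ (2 * m) * t = r\<^sup>2 * p ^ (2 * N)"
        unfolding t_def N by (simp add: power2_eq_square)
      also have "p ^ (2 * m) * t\<^sup>2 = r ^ 4 * p ^ (2 * (N + 1))"
        unfolding t_def N by (simp add: power2_eq_square power4_eq_xxxx)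
      finally show "Im (cis a * (of_real (p ^ (2 * m)) / (1 + of_real (p\<^sup>2) * x))) =
        sin a * (p ^ (2 * (N - 1)) / (1 + (p ^ 3 * u)\<^sup>2)) + sin (a - pi / 3) * r\<^sup>2 * (p ^ (2 * N) / (1 + (p ^ 3 * u)\<^sup>2))
        + sin (a - 2 * pi / 3) * r ^ 4 * (p ^ (2 * (N + 1)) / (1 + (p ^ 3 * u)\<^sup>2))"
        unfolding t3 by (simp add: N mult.assoc)
    qed
    finally show ?thesis .
  qed
  define J where "J = (\<lambda>k. \<integral>p. p ^ (2 * k) / (1 + (p ^ 3 * u)\<^sup>2) \<partial>moment_measure)"
  have ImK': "Im (cis a * K) = sin a * J (N - 1) + sin (a - pi / 3) * r\<^sup>2 * J N + sin (a - 2 * pi / 3) * r ^ 4 * J (N + 1)"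
    unfolding ImK J_def using tail_density_integrable
    by (simp only: Bochner_Integration.integral_add integral_mult_right_zero integrable_mult_right Bochner_Integration.integrable_add)
  have D: "u powr (expo N - 1) * J (N - 1) = tail_density N u / tail_const"
    "u powr (expo N - 1) * (r\<^sup>2 * J N) = tail_density (N + 1) u / tail_const"
    "u powr (expo N - 1) * (r ^ 4 * J (N + 1)) = tail_density (N + 2) u / tail_const"
  proof -
    have "u powr (expo N - 1) * r\<^sup>2 = u powr (expo (N + 1) - 1)" "u powr (expo N - 1) * r ^ 4 = u powr (expo (N + 2) - 1)"
      unfolding rpow expo_def powr_add[symmetric] by (simp_all add: field_simps)
    then show "u powr (expo N - 1) * J (N - 1) = tail_density N u / tail_const"
      "u powr (expo N - 1) * (r\<^sup>2 * J N) = tail_density (N + 1) u / tail_const"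
      "u powr (expo N - 1) * (r ^ 4 * J (N + 1)) = tail_density (N + 2) u / tail_const"
      unfolding tail_density_eq using tail_const_pos by (simp_all add: J_def flip: mult.assoc)
  qed
  have "of_real (q_coeff 0) / w + of_real (2 / pi) * w * stieltjes (w\<^sup>2) = (of_real (q_coeff 0) + of_real (2 / pi) * x * stieltjes x) / w"
    using w0 by (simp add: x_def field_simps power2_eq_square)
  also have "\<dots> = (\<Sum>n<N. of_real (q_coeff n) * (x ^ n / w)) + of_real ((-1) ^ m * (2 / pi)) * ((x ^ N / w) * K)"
    unfolding stieltjes_remainder[OF ix, of m, folded K_def N] by (simp add: add_divide_distrib sum_divide_distrib)
  also have "\<dots> = (\<Sum>n<N. of_real (q_coeff n * u powr (expo n - 1)) * cis ((2 * real n - 1) * pi / 3)) +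
      of_real ((-1) ^ m * (2 / pi) * u powr (expo N - 1)) * (cis a * K)"
    unfolding xw a_def by (simp add: mult_ac)
  finally have e: "Im (of_real (q_coeff 0) / w + of_real (2 / pi) * w * stieltjes (w\<^sup>2)) =
     (\<Sum>n<N. q_coeff n * u powr (expo n - 1) * sin ((2 * real n - 1) * pi / 3)) + (-1) ^ m * (2 / pi) * u powr (expo N - 1) * Im (cis a * K)"
    by (simp only: Im_sum Im_of_real_mult plus_complex.sel cis.sel)
  define Q where "Q = Im (cis a * K)"
  \<comment> \<open>The two angles differ by pi. The resulting minus sign cancels the one in front
    of \<open>borel_density\<close>.\<close>
  have sn: "sin ((2 * real n - 1) * pi / 3) = - sin ((2 * real n + 2) * pi / 3)" for n
  proof -
    have "(2 * real n + 2) * pi / 3 = (2 * real n - 1) * pi / 3 + pi" by (simp add: field_simps)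
    then show ?thesis by (simp only: sin_periodic_pi minus_minus)
  qed
  have "borel_density u = - (1 / (3 * pi)) * Im (of_real (q_coeff 0) / w + of_real (2 / pi) * w * stieltjes (w\<^sup>2))"
    unfolding borel_density_def Let_def w_def r_def ..
  also have "\<dots> = (\<Sum>n<N. expansion_term n * u powr (expo n - 1)) + (-1) ^ N * (2 / (3 * pi\<^sup>2)) * (u powr (expo N - 1) * Im (cis a * K))"
  proof -
    have s: "- (1 / (3 * pi)) * (\<Sum>n<N. q_coeff n * u powr (expo n - 1) * - sin ((2 * real n + 2) * pi / 3)) = (\<Sum>n<N. expansion_term n * u powr (expo n - 1))"
      unfolding sum_distrib_left expansion_term_def by (intro sum.cong refl) simp
    show ?thesis unfolding e sn distrib_left s Q_def[symmetric] by (simp add: N power2_eq_square)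
  qed
  also have "u powr (expo N - 1) * Im (cis a * K) = (sin a * tail_density N u + sin (a - pi / 3) * tail_density (N + 1) u
     + sin (a - 2 * pi / 3) * tail_density (N + 2) u) / tail_const"
    unfolding ImK' add_divide_distrib times_divide_eq_right[symmetric] D[symmetric] by (simp add: algebra_simps)
  also have "(-1) ^ N * (2 / (3 * pi\<^sup>2)) * ((sin a * tail_density N u + sin (a - pi / 3) * tail_density (N + 1) u
     + sin (a - 2 * pi / 3) * tail_density (N + 2) u) / tail_const) = (-1) ^ N * (2 / sqrt 3) * (sin a * tail_density N u + sin (a - pi / 3) * tail_density (N + 1) u
     + sin (a - 2 * pi / 3) * tail_density (N + 2) u)"
  proof -
    have c: "2 / (3 * pi\<^sup>2) = 2 / sqrt 3 * tail_const" by (simp add: tail_const_def)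
    show ?thesis unfolding c using tail_const_pos by simp
  qed
  also have "a - pi / 3 = (2 * real N - 2) * pi / 3" by (simp add: a_def field_simps)
  also have "a - 2 * pi / 3 = (2 * real N - 3) * pi / 3" by (simp add: a_def field_simps)
  finally show ?thesis unfolding a_def .
qed

text \<open>The angles descend in steps of pi/3 from a multiple of pi/3, so exactly one of the three
  sines vanishes; which one depends on N modulo 3.\<close>

definition remainder_comb :: "nat \<Rightarrow> (nat \<Rightarrow> 'a) \<Rightarrow> 'a::real_normed_field" where
  "remainder_comb N f = (-1) ^ N * of_real (2 / sqrt 3) *
    (of_real (sin ((2 * real N - 1) * pi / 3)) * f N + of_real (sin ((2 * real N - 2) * pi / 3)) * f (N + 1)
     + of_real (sin ((2 * real N - 3) * pi / 3)) * f (N + 2))"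

lemma R_J'_expansion:
  "R_J' N \<nu> = besselJ' \<nu> \<nu> - (\<Sum>n<N. of_real (expansion_term n * Gamma (expo n)) / \<nu> powr of_real (expo n))"
  unfolding R_J'_def sum_distrib_left
  by (rule arg_cong[where f = "\<lambda>x. besselJ' \<nu> \<nu> - x"], rule sum.cong)
    (simp_all add: expansion_term_def q_coeff_complex expo_def)

lemma R_J'_near_zero:
  assumes \<nu>: "0 < \<nu>" "\<nu> < 1" and N: "N \<ge> 1"
  shows "R_J' N (of_real \<nu>) = remainder_comb N (\<lambda>n. tail n (of_real \<nu>))"
proof -
  let ?I = "\<lambda>f :: real \<Rightarrow> real. LBINT u:{0<..}. f u * exp (- \<nu> * u)"
  let ?S = "\<lambda>f :: real \<Rightarrow> real. set_integrable lborel {0<..} (\<lambda>u. f u * exp (- \<nu> * u))"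
  obtain m where m: "N = Suc m" using N by (cases N) auto
  define s1 s2 s3 where "s1 = sin ((2 * real N - 1) * pi / 3)" and "s2 = sin ((2 * real N - 2) * pi / 3)"
    and "s3 = sin ((2 * real N - 3) * pi / 3)"
  define c where "c = (-1) ^ N * (2 / sqrt 3)"
  define P where "P = (\<lambda>u. \<Sum>n<N. expansion_term n * u powr (expo n - 1))"
  have PI: "?S P" "?I P = (\<Sum>n<N. expansion_term n * (Gamma (expo n) / \<nu> powr expo n))"
  proof -
    have e: "P u * exp (- \<nu> * u) = (\<Sum>n<N. expansion_term n * (u powr (expo n - 1) * exp (- \<nu> * u)))" for u
      by (simp add: P_def sum_distrib_right mult.assoc)
    note g = gamma_integral_scaled[OF expo_pos \<nu>(1)]
    have i: "set_integrable lborel {0<..} (\<lambda>u. expansion_term n * (u powr (expo n - 1) * exp (- \<nu> * u)))" for n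
      by (rule set_integrable_mult_right) (rule g(1))
    show "?S P" unfolding e set_integrable_def scaleR_sum_right
      by (intro Bochner_Integration.integrable_sum i[unfolded set_integrable_def])
    have "?I P = (\<Sum>n<N. LBINT u:{0<..}. expansion_term n * (u powr (expo n - 1) * exp (- \<nu> * u)))"
      unfolding e set_lebesgue_integral_def scaleR_sum_right
      by (intro Bochner_Integration.integral_sum i[unfolded set_integrable_def])
    then show "?I P = (\<Sum>n<N. expansion_term n * (Gamma (expo n) / \<nu> powr expo n))"
      by (simp only: set_integral_mult_right g(2))
  qed
  define T where "T = (\<lambda>n. ?I (tail_density n))"
  note ti = tail_laplace(1)[OF \<nu>(1)]
  have te: "tail n (of_real \<nu>) = of_real (T n)" for n unfolding T_def by (rule tail_laplace(2)[OF \<nu>(1)])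
  define Q where "Q = (\<lambda>u. c * (s1 * tail_density N u + s2 * tail_density (N + 1) u + s3 * tail_density (N + 2) u))"
  have Qe: "Q u * exp (- \<nu> * u) = c * (s1 * (tail_density N u * exp (- \<nu> * u)) + s2 * (tail_density (N + 1) u * exp (- \<nu> * u))
      + s3 * (tail_density (N + 2) u * exp (- \<nu> * u)))" for u
    unfolding Q_def by (simp add: algebra_simps)
  have QI: "?S Q" "?I Q = c * (s1 * T N + s2 * T (N + 1) + s3 * T (N + 2))"
  proof -
    show "?S Q" unfolding Qe by (intro set_integrable_mult_right set_integral_add ti)
    show "?I Q = c * (s1 * T N + s2 * T (N + 1) + s3 * T (N + 2))"
      unfolding Qe T_def
      by (simp only: set_integral_mult_right set_integral_add set_integrable_mult_right ti)
  qed
  have "?I borel_density = ?I (\<lambda>u. P u + Q u)"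
  proof (rule set_lebesgue_integral_cong)
    show "\<forall>u. u \<in> {0<..} \<longrightarrow> borel_density u * exp (- \<nu> * u) = (P u + Q u) * exp (- \<nu> * u)"
      using borel_density_remainder[OF _ m] unfolding P_def Q_def c_def s1_def s2_def s3_def greaterThan_iff by presburger
  qed simp
  also have "\<dots> = ?I P + ?I Q" using PI(1) QI(1) by (simp add: distrib_right set_integral_add)
  finally have e: "?I borel_density = ?I P + ?I Q" .
  have "besselJ' (of_real \<nu>) (of_real \<nu>) = of_real (?I P + ?I Q)"
    using besselJ'_laplace(2)[OF \<nu>] unfolding e .
  moreover have "(\<Sum>n<N. of_real (expansion_term n * Gamma (expo n)) / of_real \<nu> powr of_real (expo n)) = complex_of_real (?I P)"
    unfolding PI(2) using \<nu> by (simp add: powr_of_real)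
  ultimately have "R_J' N (of_real \<nu>) = of_real (?I Q)" unfolding R_J'_expansion by simp
  also have "\<dots> = remainder_comb N (\<lambda>n. tail n (of_real \<nu>))"
    unfolding QI(2) remainder_comb_def te c_def s1_def s2_def s3_def by simp
  finally show ?thesis .
qed

lemma R_J'_eq_tails:
  assumes \<nu>: "\<nu> \<notin> \<real>\<^sub>\<le>\<^sub>0" and N: "N \<ge> 1"
  shows "R_J' N \<nu> = remainder_comb N (\<lambda>n. tail n \<nu>)"
proof -
  define f where "f = (\<lambda>\<nu>. R_J' N \<nu> - remainder_comb N (\<lambda>n. tail n \<nu>))"
  have "f holomorphic_on - \<real>\<^sub>\<le>\<^sub>0"
    unfolding f_def R_J'_expansion remainder_comb_def
    by (intro holomorphic_intros besselJ'_diag_holomorphic tail_holomorphic) (auto simp: powr_def)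
  moreover have "open (- \<real>\<^sub>\<le>\<^sub>0 :: complex set)" using closed_nonpos_Reals_complex by (simp add: open_Compl)
  moreover have "connected (- \<real>\<^sub>\<le>\<^sub>0 :: complex set)"
    using starlike_imp_connected[OF starlike_slotted_complex_plane_left[of 0]] by (simp add: nonpos_Reals_def image_def atMost_def Bex_def conj_commute)
  moreover have "complex_of_real ` {0<..<1} \<subseteq> - \<real>\<^sub>\<le>\<^sub>0" by auto
  moreover have "(1 / 2 :: complex) \<in> - \<real>\<^sub>\<le>\<^sub>0" by (simp add: complex_nonpos_Reals_iff)
  \<comment> \<open>The two sides are known to agree on the real interval (0,1), which accumulates
    at 1/2 inside the slit plane.\<close>
  moreover have "(1 / 2 :: complex) islimpt complex_of_real ` {0<..<1}"
  proof -
    have "(1 / 2 :: real) islimpt {0<..<1}" by (rule open_imp_islimpt) auto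
    then have "complex_of_real (1 / 2) islimpt complex_of_real ` {0<..<1}"
      by (rule islimpt_isCont_image) (use eventually_neq_at_within[of "1 / 2 :: real" "1 / 2" UNIV] in \<open>simp_all only: of_real_eq_iff continuous_of_real isCont_of_real continuous_ident\<close>)
    then show ?thesis by simp
  qed
  moreover have "f z = 0" if "z \<in> complex_of_real ` {0<..<1}" for z
    using that R_J'_near_zero[OF _ _ N] by (auto simp: f_def)
  ultimately have "f \<nu> = 0" using analytic_continuation[of f "- \<real>\<^sub>\<le>\<^sub>0"] \<nu> by blast
  then show ?thesis by (simp add: f_def)
qed

lemma remainder_comb_mod3:
  fixes f :: "nat \<Rightarrow> 'a::real_normed_field"
  shows "N mod 3 = 0 \<Longrightarrow> remainder_comb N f = (-1) ^ (N + 1) * (f N + f (N + 1))"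
    and "N mod 3 = 1 \<Longrightarrow> remainder_comb N f = (-1) ^ N * (f N - f (N + 2))"
    and "N mod 3 = 2 \<Longrightarrow> remainder_comb N f = (-1) ^ N * (f (N + 1) + f (N + 2))"
proof -
  have sp: "sin (x + real k * (2 * pi)) = sin x" for x k
    using sin.plus_of_nat[of x k] by simp
  have red: "sin ((2 * real (3 * k + j) - i) * pi / 3) = sin ((2 * real j - i) * pi / 3)" for k j and i :: real
    using sp[of "(2 * real j - i) * pi / 3" k] by (simp add: field_simps)
  have v: "sin (- pi / 3) = (-1) * (sqrt 3 / 2)" "sin (- 2 * pi / 3) = (-1) * (sqrt 3 / 2)" "sin (- 3 * pi / 3) = 0 * (sqrt 3 / 2)"
    "sin (pi / 3) = 1 * (sqrt 3 / 2)" "sin (2 * pi / 3) = 1 * (sqrt 3 / 2)" "sin (pi * 2 / 3) = sqrt 3 / 2"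
    using sin_60 sin_120 by (simp_all add: mult.commute)
  have comb: "remainder_comb N f = (-1) ^ N * (of_real a * f N + of_real b * f (N + 1) + of_real c * f (N + 2))"
    if "sin ((2 * real N - 1) * pi / 3) = a * (sqrt 3 / 2)" "sin ((2 * real N - 2) * pi / 3) = b * (sqrt 3 / 2)"
      "sin ((2 * real N - 3) * pi / 3) = c * (sqrt 3 / 2)" for a b c
  proof -
    have "(of_real (2 / sqrt 3) :: 'a) * (of_real (x * (sqrt 3 / 2)) * y) = of_real x * y" for x y
      unfolding mult.assoc[symmetric] of_real_mult[symmetric] by simp
    then show ?thesis unfolding remainder_comb_def that mult.assoc distrib_left by (simp only:)
  qed
  note mod = mult_div_mod_eq[of 3 N]
  show "remainder_comb N f = (-1) ^ (N + 1) * (f N + f (N + 1))" if "N mod 3 = 0"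
  proof -
    have N: "N = 3 * (N div 3) + 0" using mod that by simp
    show ?thesis by (subst comb[of "-1" "-1" 0]; (subst N, subst red)?) (simp_all add: v algebra_simps)
  qed
  show "remainder_comb N f = (-1) ^ N * (f N - f (N + 2))" if "N mod 3 = 1"
  proof -
    have N: "N = 3 * (N div 3) + 1" using mod that by simp
    show ?thesis by (subst comb[of 1 0 "-1"]; (subst N, subst red)?) (simp_all add: v algebra_simps)
  qed
  show "remainder_comb N f = (-1) ^ N * (f (N + 1) + f (N + 2))" if "N mod 3 = 2"
  proof -
    have N: "N = 3 * (N div 3) + 2" using mod that by simp
    show ?thesis by (subst comb[of 0 1 1]; (subst N, subst red)?) (simp_all add: v algebra_simps)
  qed
qed

subsection \<open>Estimates of the tails\<close>

lemma tail_bound_csc: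
  assumes n: "n \<ge> 1" and \<nu>: "\<nu> \<noteq> 0" "\<bar>Arg \<nu>\<bar> < pi" and \<beta>: "pi / 4 \<le> \<bar>\<beta>\<bar>" "\<bar>\<beta>\<bar> < pi / 2" "\<bar>Arg \<nu> - \<beta>\<bar> < pi / 2"
  shows "norm (tail n \<nu>) \<le> \<bar>csc (2 * \<beta>)\<bar> / cos (Arg \<nu> - \<beta>) powr expo n * (d n \<nu> / (2 * sqrt 3 * pi))"
proof -
  have "sin (2 * \<bar>\<beta>\<bar>) > 0" using \<beta> by (intro sin_gt_zero) auto
  then have "\<bar>sin (2 * \<beta>)\<bar> > 0" by (auto simp: abs_if split: if_splits)
  from tail_bound[OF n \<nu> \<beta>(2,3) this norm_one_plus_cis_ge(2)[OF \<beta>(2)]]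
  show ?thesis by (simp add: csc_def mult_ac)
qed

lemma tail_bound_narrow:
  assumes n: "n \<ge> 1" and \<nu>: "\<nu> \<noteq> 0" "\<bar>Arg \<nu>\<bar> \<le> pi / 4"
  shows "norm (tail n \<nu>) \<le> d n \<nu> / (2 * sqrt 3 * pi)"
proof -
  have b: "\<bar>Arg \<nu>\<bar> < pi / 2" "\<bar>Arg \<nu> - Arg \<nu>\<bar> < pi / 2" "\<bar>Arg \<nu>\<bar> < pi" using \<nu>(2) pi_gt_zero by linarith+
  from tail_bound[OF n \<nu>(1) b(3,1,2) zero_less_one norm_one_plus_cis_ge(1)[OF b(1) \<nu>(2)]]
  show ?thesis by simp
qed

lemma norm_R_J'_le:
  assumes \<nu>: "\<nu> \<noteq> 0" "\<bar>Arg \<nu>\<bar> < pi" and N: "N \<ge> 1"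
    and le: "norm (tail N \<nu>) \<le> a" "norm (tail (N + 1) \<nu>) \<le> b" "norm (tail (N + 2) \<nu>) \<le> c"
  shows "N mod 3 = 0 \<Longrightarrow> norm (R_J' N \<nu>) \<le> a + b"
    and "N mod 3 = 1 \<Longrightarrow> norm (R_J' N \<nu>) \<le> a + c"
    and "N mod 3 = 2 \<Longrightarrow> norm (R_J' N \<nu>) \<le> b + c"
proof -
  note R = R_J'_eq_tails[OF not_nonpos_Real_if_Arg[OF \<nu>] N]
  show "norm (R_J' N \<nu>) \<le> a + b" if "N mod 3 = 0"
    unfolding R remainder_comb_mod3(1)[OF that] norm_mult norm_power using le(1,2)
    by (simp add: norm_triangle_mono)
  show "norm (R_J' N \<nu>) \<le> a + c" if "N mod 3 = 1"
    unfolding R remainder_comb_mod3(2)[OF that] norm_mult norm_power using le(1,3) norm_triangle_ineq4[of "tail N \<nu>" "tail (N + 2) \<nu>"]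
    by simp
  show "norm (R_J' N \<nu>) \<le> b + c" if "N mod 3 = 2"
    unfolding R remainder_comb_mod3(3)[OF that] norm_mult norm_power using le(2,3)
    by (simp add: norm_triangle_mono)
qed

text \<open>The derivative of the difference is ln(1 + t/2) + t/(2 + t) - ln(1 + t), nonnegative
  because 1 + t = (1 + t/2)(1 + t/(2 + t)) and ln(1 + s) \<le> s. With x = 1/(a+1) it produces the
  shift 3/2 in the constants near the edge.\<close>

lemma entropy_difference_bound:
  fixes x :: real
  assumes x: "x \<ge> 0"
  shows "(1 + x) * ln (1 + x) \<le> x + x * ln (1 + x / 2)"
proof -
  let ?f = "\<lambda>x::real. x + x * ln (1 + x / 2) - (1 + x) * ln (1 + x)"
  have "?f 0 \<le> ?f x"
  proof (rule DERIV_nonneg_imp_nondecreasing[OF x])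
    fix t :: real assume t: "0 \<le> t" "t \<le> x"
    have "1 + t = (1 + t / 2) * (1 + t / (2 + t))" using t by (simp add: field_simps)
    then have "ln (1 + t) = ln (1 + t / 2) + ln (1 + t / (2 + t))"
      using t by (simp only: ln_mult_pos add_pos_nonneg zero_less_one divide_nonneg_nonneg add_nonneg_nonneg zero_le_numeral)
    moreover have "ln (1 + t / (2 + t)) \<le> t / (2 + t)" using t by (intro ln_add_one_self_le_self) simp
    ultimately have "0 \<le> ln (1 + t / 2) + t / (2 + t) - ln (1 + t)" by linarith
    moreover have "(?f has_real_derivative 1 + (1 * ln (1 + t / 2) + t * (1 / (1 + t / 2) * (1 / 2))) - (1 * ln (1 + t) + (1 + t) * (1 / (1 + t)))) (at t)"
      using t by (auto intro!: derivative_eq_intros)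
    moreover have "t * (1 / (1 + t / 2) * (1 / 2)) = t / (2 + t)" "(1 + t) * (1 / (1 + t)) = 1"
      using t by (simp_all add: divide_simps)
    ultimately show "\<exists>y. (?f has_real_derivative y) (at t) \<and> 0 \<le> y" by (intro exI[of _ "ln (1 + t / 2) + t / (2 + t) - ln (1 + t)"]) (simp only: mult_1_left diff_diff_eq2, simp add: algebra_simps)
  qed
  then show ?thesis by simp
qed

text \<open>This angle maximises \<open>sin \<phi> * cos \<phi> powr (a + 1)\<close>.\<close>

lemma near_edge_constant:
  fixes a :: real
  assumes a: "a > 0" and \<phi>: "\<phi> = arcsin (1 / sqrt (a + 2))"
  shows "0 < \<phi>" "\<phi> < pi / 4" "1 / (sin (2 * \<phi>) * cos \<phi> powr a) \<le> 1 / 2 * sqrt (exp 1 * (a + 3 / 2))"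
proof -
  define s where "s = 1 / sqrt (a + 2)"
  have s: "0 < s" "s < sqrt 2 / 2"
  proof -
    have "sqrt 2 < sqrt (a + 2)" using a by simp
    then have "1 / sqrt (a + 2) < 1 / sqrt 2" by (intro divide_strict_left_mono) auto
    also have "1 / sqrt 2 = sqrt 2 / 2" by (simp add: field_simps)
    finally show "s < sqrt 2 / 2" by (simp add: s_def)
    show "0 < s" using a by (simp add: s_def)
  qed
  have "sqrt 2 / 2 \<le> 1" using real_sqrt_le_mono[of 2 4] by simp
  then have s1: "s < 1" using s by linarith
  show p0: "0 < \<phi>" unfolding \<phi> s_def[symmetric] using arcsin_less_arcsin[of 0 s] s s1 by simp
  have "arcsin s < arcsin (sin (pi / 4))" using s s1 \<open>sqrt 2 / 2 \<le> 1\<close> by (intro arcsin_less_arcsin) (auto simp: sin_45)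
  then show p1: "\<phi> < pi / 4" unfolding \<phi> s_def[symmetric] by (simp add: arcsin_sin)
  have sn: "sin \<phi> = s" unfolding \<phi> s_def[symmetric] using s s1 by simp
  have c: "cos \<phi> > 0" using p0 p1 by (intro cos_gt_zero) auto
  have ss: "s\<^sup>2 = 1 / (a + 2)" using a by (simp add: s_def power_divide)
  have cc: "(cos \<phi>)\<^sup>2 = (a + 1) / (a + 2)" using a unfolding cos_squared_eq sn ss by (simp add: field_simps)
  have lc: "ln (cos \<phi>) = (ln (a + 1) - ln (a + 2)) / 2"
  proof -
    have "2 * ln (cos \<phi>) = ln ((cos \<phi>)\<^sup>2)" using c by (simp add: ln_realpow)
    then show ?thesis unfolding cc using a by (simp add: ln_div)
  qed
  have ls: "ln s = - ln (a + 2) / 2" using a by (simp add: s_def ln_div ln_sqrt)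
  \<comment> \<open>\<open>entropy_difference_bound\<close> for x = 1/(a+1), multiplied by a + 1.
    Half of the right side, exponentiated, is the constant sqrt(e (a + 3/2)); the e comes from the
    summand 1.\<close>
  have key: "(a + 2) * ln (a + 2) - (a + 1) * ln (a + 1) \<le> 1 + ln (a + 3 / 2)"
  proof -
    have x: "1 / (a + 1) > 0" using a by simp
    have l1: "ln (1 + 1 / (a + 1)) = ln (a + 2) - ln (a + 1)"
    proof -
      have "1 + 1 / (a + 1) = (a + 2) / (a + 1)" using a by (simp add: field_simps)
      then show ?thesis using a by (simp add: ln_div)
    qed
    have l2: "ln (1 + 1 / (a + 1) / 2) = ln (a + 3 / 2) - ln (a + 1)"
    proof -
      have "1 + 1 / (a + 1) / 2 = (a + 3 / 2) / (a + 1)" using a by (simp add: field_simps)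
      then show ?thesis using a by (simp add: ln_div)
    qed
    have "(a + 1) * ((1 + 1 / (a + 1)) * (ln (a + 2) - ln (a + 1))) \<le> (a + 1) * (1 / (a + 1) + 1 / (a + 1) * (ln (a + 3 / 2) - ln (a + 1)))"
      using entropy_difference_bound[of "1 / (a + 1)"] a unfolding l1 l2 by (intro mult_left_mono) auto
    also have "(a + 1) * ((1 + 1 / (a + 1)) * (ln (a + 2) - ln (a + 1))) = (a + 2) * (ln (a + 2) - ln (a + 1))"
      using a by (simp add: field_simps)
    also have "(a + 1) * (1 / (a + 1) + 1 / (a + 1) * (ln (a + 3 / 2) - ln (a + 1))) = 1 + (ln (a + 3 / 2) - ln (a + 1))"
      using a by (simp add: field_simps)
    finally show ?thesis by (simp add: algebra_simps)
  qed
  have "exp (- ln s - (a + 1) * ln (cos \<phi>)) = 1 / (s * (cos \<phi> powr a * cos \<phi>))"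
  proof -
    have e: "- ln s - (a + 1) * ln (cos \<phi>) = - (ln s + (a * ln (cos \<phi>) + ln (cos \<phi>)))" by (simp add: algebra_simps)
    have "cos \<phi> powr a = exp (a * ln (cos \<phi>))" using c by (simp add: powr_def)
    then show ?thesis unfolding e exp_minus exp_add inverse_eq_divide using s(1) c by (simp only: exp_ln)
  qed
  then have "1 / (sin (2 * \<phi>) * cos \<phi> powr a) = 1 / 2 * exp (- ln s - (a + 1) * ln (cos \<phi>))"
    unfolding sin_double sn by (simp add: mult_ac)
  also have "\<dots> \<le> 1 / 2 * exp (ln (exp 1 * (a + 3 / 2)) / 2)"
  proof -
    have "- ln s - (a + 1) * ln (cos \<phi>) = ((a + 2) * ln (a + 2) - (a + 1) * ln (a + 1)) / 2"
      unfolding lc ls by (simp add: algebra_simps diff_divide_distrib add_divide_distrib)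
    moreover have "ln (exp 1 * (a + 3 / 2)) = 1 + ln (a + 3 / 2)" using a by (subst ln_mult_pos) auto
    ultimately show ?thesis using key by simp
  qed
  also have "exp (ln (exp 1 * (a + 3 / 2)) / 2) = sqrt (exp 1 * (a + 3 / 2))"
  proof -
    have "exp (ln (sqrt (exp 1 * (a + 3 / 2)))) = sqrt (exp 1 * (a + 3 / 2))" using a by simp
    then show ?thesis using a by (simp add: ln_sqrt)
  qed
  finally show "1 / (sin (2 * \<phi>) * cos \<phi> powr a) \<le> 1 / 2 * sqrt (exp 1 * (a + 3 / 2))" by simp
qed

lemma tail_bound_near_edge:
  assumes n: "n \<ge> 1" and \<nu>: "\<nu> \<noteq> 0" "pi / 4 < \<bar>Arg \<nu>\<bar>" "\<bar>Arg \<nu>\<bar> \<le> pi / 2"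
  shows "norm (tail n \<nu>) \<le> 1 / 2 * sqrt (exp 1 * (expo n + 3 / 2)) * (d n \<nu> / (2 * sqrt 3 * pi))"
proof -
  define a where "a = expo n"
  have a: "a > 0" by (simp add: a_def expo_pos)
  define \<phi> where "\<phi> = arcsin (1 / sqrt (a + 2))"
  note E = near_edge_constant[OF a \<phi>_def]
  \<comment> \<open>Up to pi/2 - \<phi> the full rotation \<beta> = Arg \<nu> is taken; beyond that
    \<beta> is frozen to keep the ray away from the poles. In both cases |sin 2\<beta>| \<ge> sin
    2\<phi> and cos (Arg \<nu> - \<beta>) \<ge> cos \<phi>.\<close>
  define \<beta> where "\<beta> = (if \<bar>Arg \<nu>\<bar> \<le> pi / 2 - \<phi> then Arg \<nu> else sgn (Arg \<nu>) * (pi / 2 - \<phi>))"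
  have \<beta>: "pi / 4 \<le> \<bar>\<beta>\<bar>" "\<bar>\<beta>\<bar> \<le> pi / 2 - \<phi>" "\<bar>Arg \<nu> - \<beta>\<bar> \<le> \<phi>"
    using E(1,2) \<nu>(2,3) pi_gt_zero by (auto simp: \<beta>_def sgn_if abs_if split: if_splits)
  have c: "cos (Arg \<nu> - \<beta>) \<ge> cos \<phi>" "cos \<phi> > 0"
  proof -
    have "cos \<phi> \<le> cos \<bar>Arg \<nu> - \<beta>\<bar>" using \<beta>(3) E(2) pi_gt_zero by (intro cos_monotone_0_pi_le) linarith+
    then show "cos (Arg \<nu> - \<beta>) \<ge> cos \<phi>" by simp
    show "cos \<phi> > 0" using E(1,2) by (intro cos_gt_zero) auto
  qed
  have s: "sin (2 * \<phi>) \<le> \<bar>sin (2 * \<beta>)\<bar>" "sin (2 * \<phi>) > 0"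
  proof -
    have "sin (2 * \<phi>) = cos (pi / 2 - 2 * \<phi>)" by (simp add: cos_diff)
    also have "\<dots> \<le> cos (2 * \<bar>\<beta>\<bar> - pi / 2)" using \<beta>(1,2) E(1) by (intro cos_monotone_0_pi_le) linarith+
    also have "\<dots> = sin (2 * \<bar>\<beta>\<bar>)" by (simp add: cos_diff)
    also have "\<dots> \<le> \<bar>sin (2 * \<beta>)\<bar>" by (auto simp: abs_if)
    finally show "sin (2 * \<phi>) \<le> \<bar>sin (2 * \<beta>)\<bar>" .
    show "sin (2 * \<phi>) > 0" using E(1,2) by (intro sin_gt_zero) auto
  qed
  have dn: "0 \<le> d n \<nu> / (2 * sqrt 3 * pi)"
    unfolding d_eq[OF n] using tail_const_pos moment_pos Gamma_real_pos[OF expo_pos[of n]]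
    by (intro mult_nonneg_nonneg divide_nonneg_nonneg) (auto intro: less_imp_le)
  have "norm (tail n \<nu>) \<le> \<bar>csc (2 * \<beta>)\<bar> / cos (Arg \<nu> - \<beta>) powr a * (d n \<nu> / (2 * sqrt 3 * pi))"
    unfolding a_def using \<beta> \<nu> E(1,2) pi_gt_zero by (intro tail_bound_csc n) linarith+
  also have "\<dots> \<le> 1 / (sin (2 * \<phi>) * cos \<phi> powr a) * (d n \<nu> / (2 * sqrt 3 * pi))"
  proof (rule mult_right_mono[OF _ dn])
    have "\<bar>csc (2 * \<beta>)\<bar> / cos (Arg \<nu> - \<beta>) powr a = 1 / (\<bar>sin (2 * \<beta>)\<bar> * cos (Arg \<nu> - \<beta>) powr a)"
      by (simp add: csc_def)
    also have "\<dots> \<le> 1 / (sin (2 * \<phi>) * cos \<phi> powr a)"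
      using c s a by (intro divide_left_mono mult_mono powr_mono2 mult_pos_pos) auto
    finally show "\<bar>csc (2 * \<beta>)\<bar> / cos (Arg \<nu> - \<beta>) powr a \<le> 1 / (sin (2 * \<phi>) * cos \<phi> powr a)" .
  qed
  also have "\<dots> \<le> 1 / 2 * sqrt (exp 1 * (a + 3 / 2)) * (d n \<nu> / (2 * sqrt 3 * pi))"
    by (rule mult_right_mono[OF E(3) dn])
  finally show ?thesis unfolding a_def .
qed

section \<open>The stationary angle\<close>

lemma I_angle_pos:
  assumes "pi / 4 < \<theta>" "\<theta> < pi"
  shows "I_angle \<theta> = {max 0 (\<theta> - pi / 2) <..< min (pi / 2) (\<theta> - pi / 4)}"
  using assms by (auto simp: I_angle_def)

lemma I_angle_minus:
  assumes "pi / 4 < \<theta>" "\<theta> < pi"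
  shows "\<phi> \<in> I_angle (- \<theta>) \<longleftrightarrow> - \<phi> \<in> I_angle \<theta>"
  using assms by (auto simp: I_angle_def)

lemma I_angle_bounds:
  assumes "pi / 4 < \<bar>\<theta>\<bar>" "\<bar>\<theta>\<bar> < pi" "\<phi> \<in> I_angle \<theta>"
  shows "\<bar>\<phi>\<bar> < pi / 2" "pi / 4 < \<bar>\<theta> - \<phi>\<bar>" "\<bar>\<theta> - \<phi>\<bar> < pi / 2"
  using assms by (auto simp: I_angle_def split: if_splits)

text \<open>The equation says that 2 cot 2(\<theta> - \<phi>) + a tan \<phi> = 0, the vanishing of
  the logarithmic derivative of csc(2(\<theta> - \<phi>)) cos(\<phi>)^(-a). Existence is a change of
  sign across the interval, uniqueness a monotonicity argument.\<close>

lemma optimal_angle_pos: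
  fixes a :: real
  assumes a: "a > 0" and \<theta>: "pi / 4 < \<theta>" "\<theta> < pi"
  shows "\<exists>!\<phi>. \<phi> \<in> I_angle \<theta> \<and> (a + 2) * cos (3 * \<phi> - 2 * \<theta>) = (a - 2) * cos (\<phi> - 2 * \<theta>)"
proof -
  \<comment> \<open>That logarithmic derivative multiplied by sin 2(\<theta> - \<phi>) cos \<phi>,
    which removes the singularities at the ends of the interval and allows the intermediate value
    theorem.\<close>
  define h where "h = (\<lambda>\<phi>. 2 * cos (2 * (\<theta> - \<phi>)) * cos \<phi> + a * sin (2 * (\<theta> - \<phi>)) * sin \<phi>)"
  have eq: "(a + 2) * cos (3 * \<phi> - 2 * \<theta>) = (a - 2) * cos (\<phi> - 2 * \<theta>) \<longleftrightarrow> h \<phi> = 0" for \<phi>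
  proof -
    have "3 * \<phi> - 2 * \<theta> = \<phi> - 2 * (\<theta> - \<phi>)" "\<phi> - 2 * \<theta> = - (\<phi> + 2 * (\<theta> - \<phi>))" by simp_all
    then have "cos (3 * \<phi> - 2 * \<theta>) = cos (\<phi> - 2 * (\<theta> - \<phi>))" "cos (\<phi> - 2 * \<theta>) = cos (\<phi> + 2 * (\<theta> - \<phi>))"
      by (simp_all only: cos_minus)
    then have "(a + 2) * cos (3 * \<phi> - 2 * \<theta>) - (a - 2) * cos (\<phi> - 2 * \<theta>) = 2 * h \<phi>"
      unfolding h_def cos_add cos_diff by (simp only:) (simp add: algebra_simps)
    then show ?thesis by linarith
  qed
  define l r where "l = max 0 (\<theta> - pi / 2)" and "r = min (pi / 2) (\<theta> - pi / 4)"
  have I: "I_angle \<theta> = {l <..< r}" unfolding l_def r_def by (rule I_angle_pos[OF \<theta>])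
  have lr: "l < r" "0 \<le> l" "r \<le> pi / 2" using \<theta> pi_gt_zero unfolding l_def r_def by linarith+
  have hl: "h l < 0"
  proof (cases "\<theta> \<ge> pi / 2")
    case True
    then have "l = \<theta> - pi / 2" by (simp add: l_def)
    then have "h l = - 2 * cos l" by (simp add: h_def)
    moreover have "cos l > 0" using lr pi_gt_zero by (intro cos_gt_zero_pi) linarith+
    ultimately show ?thesis by simp
  next
    case False
    then have "h l = 2 * cos (2 * \<theta>)" by (simp add: h_def l_def)
    moreover have "cos (2 * \<theta>) < 0"
    proof -
      have "cos (2 * \<theta>) < cos (pi / 2)" using False \<theta> by (intro cos_monotone_0_pi) linarith+
      then show ?thesis by simp
    qed
    ultimately show ?thesis by simp
  qed
  have hr: "h r > 0"
  proof (cases "\<theta> \<ge> 3 * pi / 4")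
    case True
    then have r: "r = pi / 2" by (simp add: r_def)
    have "0 < \<theta> - pi / 2" "\<theta> - pi / 2 < pi / 2" using True \<theta> pi_gt_zero by (simp_all add: field_simps)
    then have "sin (2 * (\<theta> - pi / 2)) > 0" by (intro sin_gt_zero) simp_all
    moreover have "h r = a * sin (2 * (\<theta> - pi / 2))" unfolding r h_def by simp
    ultimately show ?thesis using a by (simp only: mult_pos_pos)
  next
    case False
    then have "r = \<theta> - pi / 4" by (simp add: r_def)
    moreover have "sin r > 0" using lr pi_gt_zero by (intro sin_gt_zero) linarith+
    ultimately show ?thesis using a by (simp add: h_def)
  qed
  have "\<exists>x\<ge>l. x \<le> r \<and> h x = 0"
    using lr hl hr by (intro IVT') (auto simp: h_def intro!: continuous_intros)
  then obtain x where x: "l \<le> x" "x \<le> r" "h x = 0" by blast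
  then have xI: "x \<in> {l <..< r}" using hl hr by (auto simp: less_le)
  have uniq: False if xy: "x \<in> {l <..< r}" "h x = 0" "y \<in> {l <..< r}" "h y = 0" "x < y" for x y
  proof -
    have b: "0 < t" "t < pi / 2" "pi / 2 < 2 * (\<theta> - t)" "2 * (\<theta> - t) < pi" if "t \<in> {l <..< r}" for t
      using that by (auto simp: l_def r_def)
    have root: "a * tan t = 2 * tan (2 * (\<theta> - t) - pi / 2)" if t: "t \<in> {l <..< r}" "h t = 0" for t
    proof -
      have s: "sin (2 * (\<theta> - t)) > 0" "cos t > 0" using b[OF t(1)] by (auto intro!: sin_gt_zero cos_gt_zero)
      define B where "B = 2 * (\<theta> - t)"
      have tB: "tan (B - pi / 2) = - cos B / sin B"
        unfolding tan_def by (simp only: sin_diff cos_diff) simp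
      have "2 * cos B * cos t = - (a * sin B * sin t)" using t(2) unfolding h_def B_def by linarith
      then have "a * sin t * sin B = - 2 * cos B * cos t" by (simp only: mult_ac minus_mult_right mult_minus_left)
      then have "a * sin t / cos t = - 2 * cos B / sin B" using s unfolding B_def[symmetric] by (subst frac_eq_eq) auto
      then show ?thesis using tB unfolding B_def[symmetric] by (simp add: tan_def)
    qed
    \<comment> \<open>At a root a tan \<phi> equals 2 tan(2(\<theta> - \<phi>) - pi/2); the left
      side increases with \<phi> and the right side decreases, so two roots are impossible.\<close>
    have "tan x < tan y" using b[OF xy(1)] b[OF xy(3)] xy(5) by (intro tan_monotone) auto
    then have "a * tan x < a * tan y" using a by simp
    moreover have "tan (2 * (\<theta> - y) - pi / 2) < tan (2 * (\<theta> - x) - pi / 2)"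
      using b[OF xy(1)] b[OF xy(3)] xy(5) by (intro tan_monotone) auto
    ultimately show False using root[OF xy(1,2)] root[OF xy(3,4)] by linarith
  qed
  show ?thesis unfolding eq I
  proof (rule ex1I[of _ x])
    show "x \<in> {l<..<r} \<and> h x = 0" using xI x by blast
    show "y = x" if "y \<in> {l<..<r} \<and> h y = 0" for y
      using uniq[of x y] uniq[of y x] that xI x(3) by (metis linorder_neqE_linordered_idom)
  qed
qed

lemma optimal_angle:
  fixes a :: real
  assumes a: "a > 0" and \<theta>: "pi / 4 < \<bar>\<theta>\<bar>" "\<bar>\<theta>\<bar> < pi"
  shows "\<exists>!\<phi>. \<phi> \<in> I_angle \<theta> \<and> (a + 2) * cos (3 * \<phi> - 2 * \<theta>) = (a - 2) * cos (\<phi> - 2 * \<theta>)"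
proof (cases "\<theta> > 0")
  case True then show ?thesis using optimal_angle_pos[OF a] \<theta> by simp
next
  case False
  then have t: "pi / 4 < - \<theta>" "- \<theta> < pi" using \<theta> by auto
  have sym: "cos (3 * (- \<phi>) - 2 * (- \<theta>)) = cos (3 * \<phi> - 2 * \<theta>)" "cos (- \<phi> - 2 * (- \<theta>)) = cos (\<phi> - 2 * \<theta>)" for \<phi>
    using cos_minus[of "3 * \<phi> - 2 * \<theta>"] cos_minus[of "\<phi> - 2 * \<theta>"] by (simp_all add: algebra_simps)
  from optimal_angle_pos[OF a t] obtain x where
    x: "x \<in> I_angle (- \<theta>)" "(a + 2) * cos (3 * x - 2 * (- \<theta>)) = (a - 2) * cos (x - 2 * (- \<theta>))" and
    u: "\<And>y. y \<in> I_angle (- \<theta>) \<Longrightarrow> (a + 2) * cos (3 * y - 2 * (- \<theta>)) = (a - 2) * cos (y - 2 * (- \<theta>)) \<Longrightarrow> y = x"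
    by blast
  have m: "\<phi> \<in> I_angle \<theta> \<longleftrightarrow> - \<phi> \<in> I_angle (- \<theta>)" for \<phi> using I_angle_minus[OF t, of \<phi>] by simp
  show ?thesis
  proof (rule ex1I[of _ "- x"])
    show "- x \<in> I_angle \<theta> \<and> (a + 2) * cos (3 * (- x) - 2 * \<theta>) = (a - 2) * cos (- x - 2 * \<theta>)"
      using x m[of "- x"] sym[of "- x"] by simp
    show "y = - x" if "y \<in> I_angle \<theta> \<and> (a + 2) * cos (3 * y - 2 * \<theta>) = (a - 2) * cos (y - 2 * \<theta>)" for y
      using u[of "- y"] that m[of y] sym[of y] by fastforce
  qed
qed

text \<open>After cancelling |1 + z| the claim is |1 - z| \<le> |1 - z + z^2|. With c = cos \<alpha>
  the squares differ by \<rho>^2 ((\<rho> - c)^2 + 3 c^2 - 2), and |\<alpha>| \<le> pi/6 gives 3 c^2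
  \<ge> 9/4.\<close>

lemma norm_one_minus_square_le:
  fixes \<rho> \<alpha> :: real
  assumes \<alpha>: "\<bar>\<alpha>\<bar> \<le> pi / 6"
  shows "norm (1 - (of_real \<rho> * cis \<alpha>)\<^sup>2) \<le> norm (1 + (of_real \<rho> * cis \<alpha>) ^ 3)"
proof -
  define c s where "c = cos \<alpha>" and "s = sin \<alpha>"
  have cs: "s\<^sup>2 = 1 - c\<^sup>2" unfolding c_def s_def by (simp add: sin_squared_eq)
  have "cos (pi / 6) \<le> cos \<bar>\<alpha>\<bar>" using \<alpha> pi_gt_zero by (intro cos_monotone_0_pi_le) linarith+
  then have "sqrt 3 / 2 \<le> c" unfolding c_def cos_abs_real cos_30 .
  then have "(sqrt 3 / 2)\<^sup>2 \<le> c\<^sup>2" by (intro power_mono) auto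
  then have c2: "3 / 4 \<le> c\<^sup>2" by (simp add: power_divide)
  define z where "z = of_real \<rho> * cis \<alpha>"
  have z: "z = Complex (\<rho> * c) (\<rho> * s)" by (simp add: z_def c_def s_def complex_eq_iff)
  have n1: "(norm (1 - z))\<^sup>2 = 1 - 2 * \<rho> * c + \<rho>\<^sup>2"
  proof -
    have "(norm (1 - z))\<^sup>2 = (1 - \<rho> * c)\<^sup>2 + \<rho>\<^sup>2 * s\<^sup>2" unfolding cmod_power2 z by (simp add: power_mult_distrib)
    then show ?thesis unfolding cs by (simp add: power2_eq_square algebra_simps)
  qed
  have n2: "(norm (1 - z + z\<^sup>2))\<^sup>2 = (norm (1 - z))\<^sup>2 + \<rho>\<^sup>2 * ((\<rho> - c)\<^sup>2 + (3 * c\<^sup>2 - 2))"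
  proof -
    have "(norm (1 - z + z\<^sup>2))\<^sup>2 = (1 - \<rho> * c + \<rho>\<^sup>2 * (c\<^sup>2 - s\<^sup>2))\<^sup>2 + \<rho>\<^sup>2 * s\<^sup>2 * (2 * \<rho> * c - 1)\<^sup>2"
      unfolding cmod_power2 z by (simp add: power2_eq_square algebra_simps)
    then show ?thesis unfolding n1 cs by (simp add: power2_eq_square algebra_simps)
  qed
  have "0 \<le> \<rho>\<^sup>2 * ((\<rho> - c)\<^sup>2 + (3 * c\<^sup>2 - 2))" using c2 by (intro mult_nonneg_nonneg add_nonneg_nonneg) auto
  then have "norm (1 - z) \<le> norm (1 - z + z\<^sup>2)" using n2 by (intro power2_le_imp_le[of "norm (1 - z)"]) auto
  then have "norm (1 - z) * norm (1 + z) \<le> norm (1 - z + z\<^sup>2) * norm (1 + z)" by (intro mult_right_mono) auto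
  also have "norm (1 - z) * norm (1 + z) = norm (1 - z\<^sup>2)"
    unfolding norm_mult[symmetric] by (simp add: power2_eq_square algebra_simps)
  also have "norm (1 - z + z\<^sup>2) * norm (1 + z) = norm (1 + z ^ 3)"
    unfolding norm_mult[symmetric] by (simp add: power2_eq_square power3_eq_cube algebra_simps)
  finally show ?thesis unfolding z_def .
qed

text \<open>Bounding the two tails separately would lose the cancellation
  \<open>\<bar>1 - z\<^sup>2\<bar> \<le> \<bar>1 + z ^ 3\<bar>\<close>, so they are put under one integral; here
  \<open>z ^ 3 = (p ^ 3 * v * \<zeta>)\<^sup>2\<close>.\<close>

lemma tail_difference_bound:
  assumes n: "n \<ge> 1" and \<nu>: "\<nu> \<noteq> 0" "\<bar>Arg \<nu>\<bar> \<le> pi / 4"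
  shows "norm (tail n \<nu> - tail (n + 2) \<nu>) \<le> d n \<nu> / (2 * sqrt 3 * pi)"
proof -
  define e where "e = expo n"
  have e: "e > 0" "expo (n + 2) = e + 4 / 3" by (simp_all add: e_def expo_def field_simps)
  define \<theta> where "\<theta> = Arg \<nu>"
  define \<zeta> where "\<zeta> = cis (- \<theta>)"
  have b: "\<bar>\<theta>\<bar> < pi / 2" "\<bar>Arg \<nu> - \<theta>\<bar> < pi / 2" "\<bar>Arg \<nu>\<bar> < pi" using \<nu>(2) pi_gt_zero unfolding \<theta>_def by linarith+
  have \<zeta>: "\<zeta> \<in> lap_dom \<nu>" "Re (\<nu> * \<zeta>) = norm \<nu>"
    unfolding \<zeta>_def using lap_dom_cis[OF \<nu>(1) b(1,2)] by (simp_all add: \<theta>_def)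
  note nr = not_nonpos_Real_if_Arg[OF \<nu>(1) b(3)]
  define L where "L = Gamma e / norm \<nu> powr e"
  have \<zeta>43: "\<zeta> powr of_real (4 / 3) = cis (- (2 * \<theta> / 3)) ^ 2"
  proof -
    have "Ln (exp (\<i> * of_real (- \<theta>))) = \<i> * of_real (- \<theta>)" using b by (intro Ln_exp) (auto simp: \<theta>_def)
    then have "Ln \<zeta> = \<i> * of_real (- \<theta>)" unfolding \<zeta>_def cis_conv_exp .
    then have "\<zeta> powr of_real (4 / 3) = exp (\<i> * of_real (- (4 * \<theta> / 3)))"
      by (simp add: powr_def \<zeta>_def mult_ac)
    also have "\<dots> = cis (- (4 * \<theta> / 3))" by (simp only: cis_conv_exp)
    also have "\<dots> = cis (- (2 * \<theta> / 3)) ^ 2" unfolding Complex.DeMoivre by (simp add: mult_ac)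
    finally show ?thesis .
  qed
  have lap_le: "norm (lap e (p ^ 3) \<nu> \<zeta> - of_real (p ^ 4) * lap (e + 4 / 3) (p ^ 3) \<nu> \<zeta>) \<le> L" for p :: real
  proof -
    define k where "k = (\<lambda>a. lap_kernel a (p ^ 3) \<nu> \<zeta>)"
    have ki: "integrable lborel (k a)" if "a > 0" for a unfolding k_def by (rule lap_kernel_integrable[OF that \<zeta>(1)])
    have e43: "e + 4 / 3 > 0" using e by simp
    let ?c = "of_real (p ^ 4) * \<zeta> powr of_real (4 / 3)"
    have "lap e (p ^ 3) \<nu> \<zeta> - of_real (p ^ 4) * lap (e + 4 / 3) (p ^ 3) \<nu> \<zeta>
        = \<zeta> powr of_real e * ((\<integral>v. k e v \<partial>lborel) - ?c * (\<integral>v. k (e + 4 / 3) v \<partial>lborel))"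
    proof -
      have l: "lap a (p ^ 3) \<nu> \<zeta> = \<zeta> powr of_real a * (\<integral>v. k a v \<partial>lborel)" for a by (simp only: lap_def k_def)
      show ?thesis unfolding l of_real_add powr_add right_diff_distrib by (simp only: mult_ac)
    qed
    also have "(\<integral>v. k e v \<partial>lborel) - ?c * (\<integral>v. k (e + 4 / 3) v \<partial>lborel) = (\<integral>v. k e v - ?c * k (e + 4 / 3) v \<partial>lborel)"
      using ki[OF e(1)] ki[OF e43] by simp
    finally have "norm (lap e (p ^ 3) \<nu> \<zeta> - of_real (p ^ 4) * lap (e + 4 / 3) (p ^ 3) \<nu> \<zeta>) = norm (\<integral>v. k e v - ?c * k (e + 4 / 3) v \<partial>lborel)"
      by (simp only: norm_mult cis_powr_norm[of "- \<theta>", folded \<zeta>_def] mult_1_left)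
    also have "\<dots> \<le> (\<integral>v. norm (k e v - ?c * k (e + 4 / 3) v) \<partial>lborel)" by (rule integral_norm_bound)
    also have "\<dots> \<le> (\<integral>v. indicator {0<..} v *\<^sub>R (v powr (e - 1) * exp (- norm \<nu> * v)) \<partial>lborel)"
    proof (rule integral_mono)
      show "integrable lborel (\<lambda>v. norm (k e v - ?c * k (e + 4 / 3) v))"
        by (intro integrable_norm Bochner_Integration.integrable_diff integrable_mult_right ki e e43)
      show "integrable lborel (\<lambda>v. indicator {0<..} v *\<^sub>R (v powr (e - 1) * exp (- norm \<nu> * v)))"
        using gamma_integral_scaled(1)[OF e(1), of "norm \<nu>"] \<nu>(1) by (simp add: set_integrable_def)
      fix v :: real
      show "norm (k e v - ?c * k (e + 4 / 3) v) \<le> indicator {0<..} v *\<^sub>R (v powr (e - 1) * exp (- norm \<nu> * v))"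
      proof (cases "v > 0")
        case True
        define \<rho> where "\<rho> = p\<^sup>2 * v powr (2 / 3)"
        define z where "z = of_real \<rho> * cis (- (2 * \<theta> / 3))"
        define E where "E = exp (- (\<nu> * \<zeta> * of_real v))"
        have vp: "(v powr (2 / 3)) ^ m = v powr (2 / 3 * real m)" for m
          unfolding powr_powr[symmetric] using True by (intro powr_realpow[symmetric]) simp
        have z2: "?c * of_real (v powr (4 / 3)) = z\<^sup>2"
        proof -
          have "\<rho>\<^sup>2 = p ^ 4 * v powr (4 / 3)"
            unfolding \<rho>_def power_mult_distrib vp power_mult[symmetric] by simp
          then show ?thesis unfolding \<zeta>43 z_def power_mult_distrib of_real_power[symmetric] by simp
        qed
        have z3: "(of_real (p ^ 3 * v) * \<zeta>)\<^sup>2 = z ^ 3"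
        proof -
          have "\<rho> ^ 3 = (p ^ 3 * v)\<^sup>2"
            unfolding \<rho>_def power_mult_distrib vp power_mult[symmetric] using True powr_realpow[of v 2] by simp
          moreover have "cis (- (2 * \<theta> / 3)) ^ 3 = \<zeta>\<^sup>2" unfolding \<zeta>_def Complex.DeMoivre by simp
          ultimately show ?thesis unfolding z_def power_mult_distrib of_real_power[symmetric] by simp
        qed
        have vv: "v powr (e + 4 / 3 - 1) = v powr (e - 1) * v powr (4 / 3)"
          unfolding powr_add[symmetric] by (simp add: algebra_simps)
        have "k e v - ?c * k (e + 4 / 3) v = of_real (v powr (e - 1)) * E * (1 - ?c * of_real (v powr (4 / 3))) / (1 + z ^ 3)"
        proof -
          have l: "k a v = of_real (v powr (a - 1)) * E / (1 + z ^ 3)" for a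
            unfolding k_def lap_kernel_def E_def[symmetric] z3 using True by simp
          have "x * E / y - C * (x * t * E / y) = x * E * (1 - C * t) / y" for x y C t
            by (simp add: diff_divide_distrib algebra_simps)
          then show ?thesis unfolding l vv of_real_mult .
        qed
        also have "norm \<dots> = v powr (e - 1) * norm E * (norm (1 - z\<^sup>2) / norm (1 + z ^ 3))"
          unfolding z2 norm_divide norm_mult by simp
        also have "\<dots> \<le> v powr (e - 1) * norm E * 1"
        proof (rule mult_left_mono)
          \<comment> \<open>The sector |\<theta>| \<le> pi/4 is exactly what bounds the phase of z
            by pi/6.\<close>
          have "\<bar>- (2 * \<theta> / 3)\<bar> \<le> pi / 6" using \<nu>(2) by (simp add: \<theta>_def)
          then have "norm (1 - z\<^sup>2) \<le> norm (1 + z ^ 3)" unfolding z_def by (rule norm_one_minus_square_le)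
          then show "norm (1 - z\<^sup>2) / norm (1 + z ^ 3) \<le> 1" by (simp add: divide_le_eq_1)
        qed simp
        also have "norm E = exp (- norm \<nu> * v)"
        proof -
          have "Re (- (\<nu> * \<zeta> * of_real v)) = - norm \<nu> * v" unfolding \<zeta>(2)[symmetric] by (simp add: algebra_simps)
          then show ?thesis unfolding E_def norm_exp_eq_Re by (simp only:)
        qed
        finally show ?thesis using True by simp
      qed (simp add: k_def lap_kernel_def)
    qed
    also have "\<dots> = L"
      using gamma_integral_scaled(2)[OF e(1), of "norm \<nu>"] \<nu>(1) by (simp add: set_lebesgue_integral_def L_def)
    finally show ?thesis .
  qed
  define f where "f = (\<lambda>p. of_real (p ^ (2 * (n - 1))) * (lap e (p ^ 3) \<nu> \<zeta> - of_real (p ^ 4) * lap (e + 4 / 3) (p ^ 3) \<nu> \<zeta>))"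
  have fe: "f p = of_real (p ^ (2 * (n - 1))) * lap e (p ^ 3) \<nu> \<zeta> - of_real (p ^ (2 * (n + 2 - 1))) * lap (e + 4 / 3) (p ^ 3) \<nu> \<zeta>" for p
  proof -
    have "2 * (n + 2 - 1) = 2 * (n - 1) + 4" using n by simp
    then have "complex_of_real (p ^ (2 * (n + 2 - 1))) = of_real (p ^ (2 * (n - 1))) * of_real (p ^ 4)"
      by (simp only: power_add of_real_mult)
    then show ?thesis unfolding f_def right_diff_distrib by (simp only: mult.assoc)
  qed
  have e43: "e + 4 / 3 > 0" using e by simp
  have fi: "integrable moment_measure f"
    unfolding fe by (intro Bochner_Integration.integrable_diff integrable_moment_lap \<zeta>(1) e e43)
  have "(\<integral>p. f p \<partial>moment_measure) = (\<integral>p. of_real (p ^ (2 * (n - 1))) * lap e (p ^ 3) \<nu> \<zeta> \<partial>moment_measure)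
      - (\<integral>p. of_real (p ^ (2 * (n + 2 - 1))) * lap (e + 4 / 3) (p ^ 3) \<nu> \<zeta> \<partial>moment_measure)"
    unfolding fe by (rule Bochner_Integration.integral_diff) (intro integrable_moment_lap \<zeta>(1) e e43)+
  then have "tail n \<nu> - tail (n + 2) \<nu> = of_real tail_const * (\<integral>p. f p \<partial>moment_measure)"
    unfolding tail_eq[OF nr \<zeta>(1)] e(2) unfolding e_def[symmetric] by (simp only: right_diff_distrib)
  also have "norm \<dots> \<le> tail_const * (moment n * L)"
  proof -
    have "norm (\<integral>p. f p \<partial>moment_measure) \<le> (\<integral>p. norm (f p) \<partial>moment_measure)" by (rule integral_norm_bound)
    also have "\<dots> \<le> (\<integral>p. p ^ (2 * (n - 1)) * L \<partial>moment_measure)"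
    proof (rule integral_mono)
      show "integrable moment_measure (\<lambda>p. p ^ (2 * (n - 1)) * L)" by (intro integrable_mult_left integrable_moment)
      show "norm (f p) \<le> p ^ (2 * (n - 1)) * L" for p
        unfolding f_def norm_mult[of "of_real (p ^ (2 * (n - 1)))"] norm_of_real abs_of_nonneg[OF zero_le_even_power']
        by (intro mult_left_mono lap_le) simp
    qed (intro integrable_norm fi)
    also have "\<dots> = moment n * L" by (simp add: moment_def)
    finally show ?thesis unfolding norm_mult using tail_const_pos by (simp add: mult_left_mono)
  qed
  also have "\<dots> = d n \<nu> / (2 * sqrt 3 * pi)"
    unfolding d_eq[OF n] L_def e_def by simp
  finally show ?thesis .
qed

section \<open>The four remainder estimates\<close>

theorem mainTheorem11:
  fixes \<nu> :: complex and N :: nat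
  assumes "\<nu> \<noteq> 0" and "\<bar>Arg \<nu>\<bar> < pi" and "N \<ge> 1"
  shows
    "let \<theta> = Arg \<nu>; K = 2 * sqrt 3 * pi; R = R_J' N \<nu> in
     (\<bar>\<theta>\<bar> < pi / 2 \<longrightarrow>
       (let c = (if pi / 4 < \<bar>\<theta>\<bar> then \<bar>csc (2 * \<theta>)\<bar> else 1);
            c0 = (if pi / 4 < \<bar>\<theta>\<bar> then \<bar>csc (2 * \<theta>)\<bar> else 0)
        in (N mod 3 = 0 \<longrightarrow> norm R \<le> (d N \<nu> + d (N + 1) \<nu>) / K * c) \<and>
           (N mod 3 = 1 \<longrightarrow> norm R \<le> d N \<nu> / K * c + d (N + 2) \<nu> / K * c0) \<and>
           (N mod 3 = 2 \<longrightarrow> norm R \<le> (d (N + 1) \<nu> + d (N + 2) \<nu>) / K * c)))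
     \<and>
     (\<nu> \<in> \<real> \<and> Re \<nu> > 0 \<longrightarrow>
       (\<exists>\<Theta>1 \<Theta>2 \<Theta>3 :: real.
          0 < \<Theta>1 \<and> \<Theta>1 < 1 \<and> 0 < \<Theta>2 \<and> \<Theta>2 < 1 \<and> 0 < \<Theta>3 \<and> \<Theta>3 < 1 \<and>
          (N mod 3 = 0 \<longrightarrow>
             (-1) ^ (N + 1) * R = of_real (d N \<nu> / K * \<Theta>1 + d (N + 1) \<nu> / K * \<Theta>2)) \<and>
          (N mod 3 = 1 \<longrightarrow>
             (-1) ^ N * R = of_real (d N \<nu> / K * \<Theta>1 - d (N + 2) \<nu> / K * \<Theta>3)) \<and>
          (N mod 3 = 2 \<longrightarrow>
             (-1) ^ N * R = of_real (d (N + 1) \<nu> / K * \<Theta>2 + d (N + 2) \<nu> / K * \<Theta>3))))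
     \<and>
     (pi / 4 < \<bar>\<theta>\<bar> \<longrightarrow>
       (let sol1 = (\<lambda>\<phi>. \<phi> \<in> I_angle \<theta> \<and>
              (2 * real N + 8) * cos (3 * \<phi> - 2 * \<theta>) = (2 * real N - 4) * cos (\<phi> - 2 * \<theta>));
            sol2 = (\<lambda>\<phi>. \<phi> \<in> I_angle \<theta> \<and>
              (2 * real N + 10) * cos (3 * \<phi> - 2 * \<theta>) = (2 * real N - 2) * cos (\<phi> - 2 * \<theta>));
            sol3 = (\<lambda>\<phi>. \<phi> \<in> I_angle \<theta> \<and>
              (2 * real N + 12) * cos (3 * \<phi> - 2 * \<theta>) = 2 * real N * cos (\<phi> - 2 * \<theta>))
        in (\<exists>!\<phi>. sol1 \<phi>) \<and> (\<exists>!\<phi>. sol2 \<phi>) \<and> (\<exists>!\<phi>. sol3 \<phi>) \<and>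
           (\<forall>\<phi>1 \<phi>2 \<phi>3. sol1 \<phi>1 \<and> sol2 \<phi>2 \<and> sol3 \<phi>3 \<longrightarrow>
             (let E1 = \<bar>csc (2 * (\<theta> - \<phi>1))\<bar> / cos \<phi>1 powr ((2 * real N + 2) / 3) * (d N \<nu> / K);
                  E2 = \<bar>csc (2 * (\<theta> - \<phi>2))\<bar> / cos \<phi>2 powr ((2 * real N + 4) / 3) * (d (N + 1) \<nu> / K);
                  E3 = \<bar>csc (2 * (\<theta> - \<phi>3))\<bar> / cos \<phi>3 powr ((2 * real N + 6) / 3) * (d (N + 2) \<nu> / K)
              in (N mod 3 = 0 \<longrightarrow> norm R \<le> E1 + E2) \<and>
                 (N mod 3 = 1 \<longrightarrow> norm R \<le> E1 + E3) \<and>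
                 (N mod 3 = 2 \<longrightarrow> norm R \<le> E2 + E3)))))
     \<and>
     (pi / 4 < \<bar>\<theta>\<bar> \<and> \<bar>\<theta>\<bar> \<le> pi / 2 \<and> N \<ge> 4 \<longrightarrow>
       (let F1 = 1 / 2 * sqrt (exp 1 / 3 * (2 * real N + 13 / 2)) * (d N \<nu> / K);
            F2 = 1 / 2 * sqrt (exp 1 / 3 * (2 * real N + 17 / 2)) * (d (N + 1) \<nu> / K);
            F3 = 1 / 2 * sqrt (exp 1 / 3 * (2 * real N + 21 / 2)) * (d (N + 2) \<nu> / K)
        in (N mod 3 = 0 \<longrightarrow> norm R \<le> F1 + F2) \<and>
           (N mod 3 = 1 \<longrightarrow> norm R \<le> F1 + F3) \<and>
           (N mod 3 = 2 \<longrightarrow> norm R \<le> F2 + F3)))"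
  unfolding Let_def
proof (intro conjI)
  let ?\<theta> = "Arg \<nu>" and ?K = "2 * sqrt 3 * pi"
  have N: "N \<ge> 1" "N + 1 \<ge> 1" "N + 2 \<ge> 1" using assms(3) by simp_all
  note R_le = norm_R_J'_le[OF assms]
  show "\<bar>?\<theta>\<bar> < pi / 2 \<longrightarrow>
      (N mod 3 = 0 \<longrightarrow> norm (R_J' N \<nu>) \<le> (d N \<nu> + d (N + 1) \<nu>) / ?K * (if pi / 4 < \<bar>?\<theta>\<bar> then \<bar>csc (2 * ?\<theta>)\<bar> else 1)) \<and>
      (N mod 3 = 1 \<longrightarrow> norm (R_J' N \<nu>) \<le> d N \<nu> / ?K * (if pi / 4 < \<bar>?\<theta>\<bar> then \<bar>csc (2 * ?\<theta>)\<bar> else 1)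
          + d (N + 2) \<nu> / ?K * (if pi / 4 < \<bar>?\<theta>\<bar> then \<bar>csc (2 * ?\<theta>)\<bar> else 0)) \<and>
      (N mod 3 = 2 \<longrightarrow> norm (R_J' N \<nu>) \<le> (d (N + 1) \<nu> + d (N + 2) \<nu>) / ?K * (if pi / 4 < \<bar>?\<theta>\<bar> then \<bar>csc (2 * ?\<theta>)\<bar> else 1))"
  proof
    assume \<theta>: "\<bar>?\<theta>\<bar> < pi / 2"
    show "(N mod 3 = 0 \<longrightarrow> norm (R_J' N \<nu>) \<le> (d N \<nu> + d (N + 1) \<nu>) / ?K * (if pi / 4 < \<bar>?\<theta>\<bar> then \<bar>csc (2 * ?\<theta>)\<bar> else 1)) \<and>
      (N mod 3 = 1 \<longrightarrow> norm (R_J' N \<nu>) \<le> d N \<nu> / ?K * (if pi / 4 < \<bar>?\<theta>\<bar> then \<bar>csc (2 * ?\<theta>)\<bar> else 1)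
          + d (N + 2) \<nu> / ?K * (if pi / 4 < \<bar>?\<theta>\<bar> then \<bar>csc (2 * ?\<theta>)\<bar> else 0)) \<and>
      (N mod 3 = 2 \<longrightarrow> norm (R_J' N \<nu>) \<le> (d (N + 1) \<nu> + d (N + 2) \<nu>) / ?K * (if pi / 4 < \<bar>?\<theta>\<bar> then \<bar>csc (2 * ?\<theta>)\<bar> else 1))"
    proof (cases "pi / 4 < \<bar>?\<theta>\<bar>")
      case True
      have t: "norm (tail n \<nu>) \<le> d n \<nu> / ?K * \<bar>csc (2 * ?\<theta>)\<bar>" if "n \<ge> 1" for n
        using tail_bound_csc[OF that assms(1,2) less_imp_le[OF True] \<theta>] by (simp add: mult.commute)
      show ?thesis
        using R_le[OF t[OF N(1)] t[OF N(2)] t[OF N(3)]] True by (simp only: if_True add_divide_distrib distrib_right simp_thms) blast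
    next
      case False
      then have th: "\<bar>?\<theta>\<bar> \<le> pi / 4" by simp
      have t: "norm (tail n \<nu>) \<le> d n \<nu> / ?K" if "n \<ge> 1" for n by (rule tail_bound_narrow[OF that assms(1) th])
      \<comment> \<open>Here \<open>c0\<close> is 0, so the second tail must not cost anything; the
        joint estimate of the difference replaces the sum of two separate bounds.\<close>
      have "norm (R_J' N \<nu>) \<le> d N \<nu> / ?K" if "N mod 3 = 1"
        unfolding R_J'_eq_tails[OF not_nonpos_Real_if_Arg[OF assms(1,2)] N(1)] remainder_comb_mod3(2)[OF that] norm_mult norm_power
        using tail_difference_bound[OF N(1) assms(1) th] by simp
      then show ?thesis
        using R_le(1,3)[OF t[OF N(1)] t[OF N(2)] t[OF N(3)]] False
        by (simp only: if_False add_divide_distrib mult_1_right mult_zero_right add_0_right simp_thms) blast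
    qed
  qed
next
  let ?K = "2 * sqrt 3 * pi"
  show "\<nu> \<in> \<real> \<and> 0 < Re \<nu> \<longrightarrow>
      (\<exists>\<Theta>1 \<Theta>2 \<Theta>3 :: real.
          0 < \<Theta>1 \<and> \<Theta>1 < 1 \<and> 0 < \<Theta>2 \<and> \<Theta>2 < 1 \<and> 0 < \<Theta>3 \<and> \<Theta>3 < 1 \<and>
          (N mod 3 = 0 \<longrightarrow> (-1) ^ (N + 1) * R_J' N \<nu> = of_real (d N \<nu> / ?K * \<Theta>1 + d (N + 1) \<nu> / ?K * \<Theta>2)) \<and>
          (N mod 3 = 1 \<longrightarrow> (-1) ^ N * R_J' N \<nu> = of_real (d N \<nu> / ?K * \<Theta>1 - d (N + 2) \<nu> / ?K * \<Theta>3)) \<and>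
          (N mod 3 = 2 \<longrightarrow> (-1) ^ N * R_J' N \<nu> = of_real (d (N + 1) \<nu> / ?K * \<Theta>2 + d (N + 2) \<nu> / ?K * \<Theta>3)))"
  proof
    assume "\<nu> \<in> \<real> \<and> 0 < Re \<nu>"
    then obtain x where x: "\<nu> = of_real x" "x > 0" by (auto elim: Reals_cases)
    have "\<exists>t. tail n \<nu> = of_real (d n \<nu> / ?K * t) \<and> 0 < t \<and> t < 1" if n: "n \<ge> 1" for n
    proof -
      obtain s where s: "tail n \<nu> = of_real s" "0 < s" "s < d n \<nu> / ?K"
        using tail_strict_bounds[OF x(2) n] unfolding x(1) by blast
      then have "d n \<nu> / ?K > 0" by linarith
      then show ?thesis using s by (intro exI[of _ "s / (d n \<nu> / ?K)"]) (simp only: divide_less_eq_1 zero_less_divide_iff nonzero_mult_div_cancel_left times_divide_eq_right, simp)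
    qed
    then obtain t where t: "\<And>n. n \<ge> 1 \<Longrightarrow> tail n \<nu> = of_real (d n \<nu> / ?K * t n) \<and> 0 < t n \<and> t n < 1" by metis
    have sgn: "(-1) ^ k * ((-1) ^ k * z) = (z :: complex)" for k z by (simp flip: mult.assoc power_add)
    note R = R_J'_eq_tails[OF not_nonpos_Real_if_Arg[OF assms(1,2)] assms(3)]
    note tt = t[OF assms(3)] t[of "N + 1"] t[of "N + 2"]
    show "\<exists>\<Theta>1 \<Theta>2 \<Theta>3 :: real.
          0 < \<Theta>1 \<and> \<Theta>1 < 1 \<and> 0 < \<Theta>2 \<and> \<Theta>2 < 1 \<and> 0 < \<Theta>3 \<and> \<Theta>3 < 1 \<and>
          (N mod 3 = 0 \<longrightarrow> (-1) ^ (N + 1) * R_J' N \<nu> = of_real (d N \<nu> / ?K * \<Theta>1 + d (N + 1) \<nu> / ?K * \<Theta>2)) \<and>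
          (N mod 3 = 1 \<longrightarrow> (-1) ^ N * R_J' N \<nu> = of_real (d N \<nu> / ?K * \<Theta>1 - d (N + 2) \<nu> / ?K * \<Theta>3)) \<and>
          (N mod 3 = 2 \<longrightarrow> (-1) ^ N * R_J' N \<nu> = of_real (d (N + 1) \<nu> / ?K * \<Theta>2 + d (N + 2) \<nu> / ?K * \<Theta>3))"
    proof (intro exI conjI impI)
      show "(-1) ^ (N + 1) * R_J' N \<nu> = of_real (d N \<nu> / ?K * t N + d (N + 1) \<nu> / ?K * t (N + 1))" if "N mod 3 = 0"
        unfolding R remainder_comb_mod3(1)[OF that] sgn using tt by (simp only: of_real_add le_add2)
      show "(-1) ^ N * R_J' N \<nu> = of_real (d N \<nu> / ?K * t N - d (N + 2) \<nu> / ?K * t (N + 2))" if "N mod 3 = 1"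
        unfolding R remainder_comb_mod3(2)[OF that] sgn using tt assms(3) by (simp only: of_real_diff trans_le_add1)
      show "(-1) ^ N * R_J' N \<nu> = of_real (d (N + 1) \<nu> / ?K * t (N + 1) + d (N + 2) \<nu> / ?K * t (N + 2))" if "N mod 3 = 2"
        unfolding R remainder_comb_mod3(3)[OF that] sgn using tt assms(3) by (simp only: of_real_add trans_le_add1)
    qed (use tt in simp_all)
  qed
next
  let ?\<theta> = "Arg \<nu>" and ?K = "2 * sqrt 3 * pi"
  have e: "expo N = (2 * real N + 2) / 3" "expo (N + 1) = (2 * real N + 4) / 3" "expo (N + 2) = (2 * real N + 6) / 3"
    by (simp_all add: expo_def)
  have eq: "(2 * real N + 8) * x = (2 * real N - 4) * y \<longleftrightarrow> (expo N + 2) * x = (expo N - 2) * y"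
    "(2 * real N + 10) * x = (2 * real N - 2) * y \<longleftrightarrow> (expo (N + 1) + 2) * x = (expo (N + 1) - 2) * y"
    "(2 * real N + 12) * x = 2 * real N * y \<longleftrightarrow> (expo (N + 2) + 2) * x = (expo (N + 2) - 2) * y" for x y
  proof -
    \<comment> \<open>The stated equations are those for the exponents \<open>expo\<close>,
      multiplied by 3 to clear denominators.\<close>
    have three: "a * x = b * y \<longleftrightarrow> a' * x = b' * y" if "a = 3 * a'" "b = 3 * b'" for a b a' b' :: real
      unfolding that mult.assoc by simp
    show "(2 * real N + 8) * x = (2 * real N - 4) * y \<longleftrightarrow> (expo N + 2) * x = (expo N - 2) * y"
      "(2 * real N + 10) * x = (2 * real N - 2) * y \<longleftrightarrow> (expo (N + 1) + 2) * x = (expo (N + 1) - 2) * y"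
      "(2 * real N + 12) * x = 2 * real N * y \<longleftrightarrow> (expo (N + 2) + 2) * x = (expo (N + 2) - 2) * y"
      by (rule three; simp only: e; simp add: field_simps)+
  qed
  show "pi / 4 < \<bar>?\<theta>\<bar> \<longrightarrow>
      (\<exists>!\<phi>. \<phi> \<in> I_angle ?\<theta> \<and> (2 * real N + 8) * cos (3 * \<phi> - 2 * ?\<theta>) = (2 * real N - 4) * cos (\<phi> - 2 * ?\<theta>)) \<and>
      (\<exists>!\<phi>. \<phi> \<in> I_angle ?\<theta> \<and> (2 * real N + 10) * cos (3 * \<phi> - 2 * ?\<theta>) = (2 * real N - 2) * cos (\<phi> - 2 * ?\<theta>)) \<and>
      (\<exists>!\<phi>. \<phi> \<in> I_angle ?\<theta> \<and> (2 * real N + 12) * cos (3 * \<phi> - 2 * ?\<theta>) = 2 * real N * cos (\<phi> - 2 * ?\<theta>)) \<and>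
      (\<forall>\<phi>1 \<phi>2 \<phi>3.
        (\<phi>1 \<in> I_angle ?\<theta> \<and> (2 * real N + 8) * cos (3 * \<phi>1 - 2 * ?\<theta>) = (2 * real N - 4) * cos (\<phi>1 - 2 * ?\<theta>)) \<and>
        (\<phi>2 \<in> I_angle ?\<theta> \<and> (2 * real N + 10) * cos (3 * \<phi>2 - 2 * ?\<theta>) = (2 * real N - 2) * cos (\<phi>2 - 2 * ?\<theta>)) \<and>
        (\<phi>3 \<in> I_angle ?\<theta> \<and> (2 * real N + 12) * cos (3 * \<phi>3 - 2 * ?\<theta>) = 2 * real N * cos (\<phi>3 - 2 * ?\<theta>)) \<longrightarrow>
        (N mod 3 = 0 \<longrightarrow> norm (R_J' N \<nu>) \<le>
           \<bar>csc (2 * (?\<theta> - \<phi>1))\<bar> / cos \<phi>1 powr ((2 * real N + 2) / 3) * (d N \<nu> / ?K) +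
           \<bar>csc (2 * (?\<theta> - \<phi>2))\<bar> / cos \<phi>2 powr ((2 * real N + 4) / 3) * (d (N + 1) \<nu> / ?K)) \<and>
        (N mod 3 = 1 \<longrightarrow> norm (R_J' N \<nu>) \<le>
           \<bar>csc (2 * (?\<theta> - \<phi>1))\<bar> / cos \<phi>1 powr ((2 * real N + 2) / 3) * (d N \<nu> / ?K) +
           \<bar>csc (2 * (?\<theta> - \<phi>3))\<bar> / cos \<phi>3 powr ((2 * real N + 6) / 3) * (d (N + 2) \<nu> / ?K)) \<and>
        (N mod 3 = 2 \<longrightarrow> norm (R_J' N \<nu>) \<le>
           \<bar>csc (2 * (?\<theta> - \<phi>2))\<bar> / cos \<phi>2 powr ((2 * real N + 4) / 3) * (d (N + 1) \<nu> / ?K) +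
           \<bar>csc (2 * (?\<theta> - \<phi>3))\<bar> / cos \<phi>3 powr ((2 * real N + 6) / 3) * (d (N + 2) \<nu> / ?K)))"
  proof (rule impI, unfold eq e[symmetric], intro conjI allI)
    assume \<theta>: "pi / 4 < \<bar>?\<theta>\<bar>"
    note opt = optimal_angle[OF expo_pos \<theta> assms(2)]
    show "\<exists>!\<phi>. \<phi> \<in> I_angle ?\<theta> \<and> (expo N + 2) * cos (3 * \<phi> - 2 * ?\<theta>) = (expo N - 2) * cos (\<phi> - 2 * ?\<theta>)"
      by (rule opt)
    show "\<exists>!\<phi>. \<phi> \<in> I_angle ?\<theta> \<and> (expo (N + 1) + 2) * cos (3 * \<phi> - 2 * ?\<theta>) = (expo (N + 1) - 2) * cos (\<phi> - 2 * ?\<theta>)"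
      by (rule opt)
    show "\<exists>!\<phi>. \<phi> \<in> I_angle ?\<theta> \<and> (expo (N + 2) + 2) * cos (3 * \<phi> - 2 * ?\<theta>) = (expo (N + 2) - 2) * cos (\<phi> - 2 * ?\<theta>)"
      by (rule opt)
    \<comment> \<open>The ray of angle \<phi> - \<theta> corresponds to \<beta> = \<theta> - \<phi>,
      and every \<phi> in the interval satisfies pi/4 < |\<beta>| < pi/2 and |\<phi>| <
      pi/2.\<close>
    have t: "norm (tail n \<nu>) \<le> \<bar>csc (2 * (?\<theta> - \<phi>))\<bar> / cos \<phi> powr expo n * (d n \<nu> / ?K)" if "\<phi> \<in> I_angle ?\<theta>" "n \<ge> 1" for n \<phi>
      using tail_bound_csc[OF that(2) assms(1,2), of "?\<theta> - \<phi>"] I_angle_bounds[OF \<theta> assms(2) that(1)] by simp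
    fix \<phi>1 \<phi>2 \<phi>3
    let ?E = "\<lambda>n \<phi>. \<bar>csc (2 * (?\<theta> - \<phi>))\<bar> / cos \<phi> powr expo n * (d n \<nu> / ?K)"
    show "(\<phi>1 \<in> I_angle ?\<theta> \<and> (expo N + 2) * cos (3 * \<phi>1 - 2 * ?\<theta>) = (expo N - 2) * cos (\<phi>1 - 2 * ?\<theta>)) \<and>
        (\<phi>2 \<in> I_angle ?\<theta> \<and> (expo (N + 1) + 2) * cos (3 * \<phi>2 - 2 * ?\<theta>) = (expo (N + 1) - 2) * cos (\<phi>2 - 2 * ?\<theta>)) \<and>
        (\<phi>3 \<in> I_angle ?\<theta> \<and> (expo (N + 2) + 2) * cos (3 * \<phi>3 - 2 * ?\<theta>) = (expo (N + 2) - 2) * cos (\<phi>3 - 2 * ?\<theta>)) \<longrightarrow>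
        (N mod 3 = 0 \<longrightarrow> norm (R_J' N \<nu>) \<le> ?E N \<phi>1 + ?E (N + 1) \<phi>2) \<and>
        (N mod 3 = 1 \<longrightarrow> norm (R_J' N \<nu>) \<le> ?E N \<phi>1 + ?E (N + 2) \<phi>3) \<and>
        (N mod 3 = 2 \<longrightarrow> norm (R_J' N \<nu>) \<le> ?E (N + 1) \<phi>2 + ?E (N + 2) \<phi>3)"
    proof
      assume sol: "(\<phi>1 \<in> I_angle ?\<theta> \<and> (expo N + 2) * cos (3 * \<phi>1 - 2 * ?\<theta>) = (expo N - 2) * cos (\<phi>1 - 2 * ?\<theta>)) \<and>
        (\<phi>2 \<in> I_angle ?\<theta> \<and> (expo (N + 1) + 2) * cos (3 * \<phi>2 - 2 * ?\<theta>) = (expo (N + 1) - 2) * cos (\<phi>2 - 2 * ?\<theta>)) \<and>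
        (\<phi>3 \<in> I_angle ?\<theta> \<and> (expo (N + 2) + 2) * cos (3 * \<phi>3 - 2 * ?\<theta>) = (expo (N + 2) - 2) * cos (\<phi>3 - 2 * ?\<theta>))"
      then have \<phi>: "\<phi>1 \<in> I_angle ?\<theta>" "\<phi>2 \<in> I_angle ?\<theta>" "\<phi>3 \<in> I_angle ?\<theta>" by blast+
      have N': "N + 1 \<ge> 1" "N + 2 \<ge> 1" by simp_all
      note le = norm_R_J'_le[OF assms t[OF \<phi>(1) assms(3)] t[OF \<phi>(2) N'(1)] t[OF \<phi>(3) N'(2)]]
      show "(N mod 3 = 0 \<longrightarrow> norm (R_J' N \<nu>) \<le> ?E N \<phi>1 + ?E (N + 1) \<phi>2) \<and>
        (N mod 3 = 1 \<longrightarrow> norm (R_J' N \<nu>) \<le> ?E N \<phi>1 + ?E (N + 2) \<phi>3) \<and>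
        (N mod 3 = 2 \<longrightarrow> norm (R_J' N \<nu>) \<le> ?E (N + 1) \<phi>2 + ?E (N + 2) \<phi>3)"
        by (intro conjI impI le)
    qed
  qed
next
  let ?\<theta> = "Arg \<nu>" and ?K = "2 * sqrt 3 * pi"
  let ?F = "\<lambda>n c. 1 / 2 * sqrt (exp 1 / 3 * (2 * real N + c / 2)) * (d n \<nu> / ?K)"
  have F: "exp 1 * (expo N + 3 / 2) = exp 1 / 3 * (2 * real N + 13 / 2)"
    "exp 1 * (expo (N + 1) + 3 / 2) = exp 1 / 3 * (2 * real N + 17 / 2)"
    "exp 1 * (expo (N + 2) + 3 / 2) = exp 1 / 3 * (2 * real N + 21 / 2)"
    by (simp_all add: expo_def field_simps)
  show "pi / 4 < \<bar>?\<theta>\<bar> \<and> \<bar>?\<theta>\<bar> \<le> pi / 2 \<and> N \<ge> 4 \<longrightarrow>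
      (N mod 3 = 0 \<longrightarrow> norm (R_J' N \<nu>) \<le> ?F N 13 + ?F (N + 1) 17) \<and>
      (N mod 3 = 1 \<longrightarrow> norm (R_J' N \<nu>) \<le> ?F N 13 + ?F (N + 2) 21) \<and>
      (N mod 3 = 2 \<longrightarrow> norm (R_J' N \<nu>) \<le> ?F (N + 1) 17 + ?F (N + 2) 21)"
  proof
    assume \<theta>: "pi / 4 < \<bar>?\<theta>\<bar> \<and> \<bar>?\<theta>\<bar> \<le> pi / 2 \<and> N \<ge> 4"
    note t = tail_bound_near_edge[OF _ assms(1) conjunct1[OF \<theta>] conjunct1[OF conjunct2[OF \<theta>]]]
    have "N + 1 \<ge> 1" "N + 2 \<ge> 1" by simp_all
    from norm_R_J'_le[OF assms t[OF assms(3), unfolded F] t[OF this(1), unfolded F] t[OF this(2), unfolded F]]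
    show "(N mod 3 = 0 \<longrightarrow> norm (R_J' N \<nu>) \<le> ?F N 13 + ?F (N + 1) 17) \<and>
      (N mod 3 = 1 \<longrightarrow> norm (R_J' N \<nu>) \<le> ?F N 13 + ?F (N + 2) 21) \<and>
      (N mod 3 = 2 \<longrightarrow> norm (R_J' N \<nu>) \<le> ?F (N + 1) 17 + ?F (N + 2) 21)" by blast
  qed
qed


end
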